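(* Let $n\ge 3$. The map $\Phi=\phi\circ f$ is a homomorphism $PB_n\to G_{n(n-1)}^2$, where $f\colon PB_n\to {}'G_n^3$ is the map reading off collinear triples of points of a pure braid and $\phi\colon {}'G_n^3\to G_{n(n-1)}^2$ is the map given on generators by $\phi(a'_{ijk})=a_{ij,ik}\,a_{kj,ki}$.
   Context: Definition of ${}'G_n^3$ ($n\ge 3$): the group with generators $a'_{ijk}$, where $i,j,k\in\{1,\dots,n\}$ are pairwise distinct and ordered triples are taken up to order reversal only, i.e. $a'_{ijk}=a'_{kji}$ (so there are $3\binom{n}{3}$ generators), and relations: (1) $(a'_{ijk})^2=1$ for all pairwise distinct $i,j,k$; (2) $a'_{ijk}a'_{pqr}=a'_{pqr}a'_{ijk}$ whenever $|\{i,j,k\}|=|\{p,q,r\}|=3$ and $|\{i,j,k\}\cap\{p,q,r\}|\le 1$; (3) $a'_{ijk}a'_{ijl}a'_{ikl}a'_{jkl}=a'_{jkl}a'_{ikl}a'_{ijl}a'_{ijk}$ for all pairwise distinct $i,j,k,l$. Definition of $G_{n(n-1)}^2$: let $P$ be the set of the $n(n-1)$ ordered pairs $ij$ of distinct elements $i\neq j$ of $\{1,\dots,n\}$ (so $ij\ne ji$ as elements of $P$). $G_{n(n-1)}^2$ is the group with generators $a_{p,q}$ for distinct $p,q\in P$, with $a_{p,q}=a_{q,p}$, and relations: $a_{p,q}^2=1$; $a_{p,q}a_{r,s}=a_{r,s}a_{p,q}$ for pairwise distinct $p,q,r,s\in P$; $(a_{p,q}a_{p,r}a_{q,r})^2=1$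 for pairwise distinct $p,q,r\in P$. Pure braids: an $n$-strand pure braid is represented by smooth functions $\beta(t)=(z_1(t),\dots,z_n(t))$, $t\in[0,1]$, $z_j(t)\in\mathbb{C}=\mathbb{R}^2$, pairwise distinct for every $t$, with $z_j(0)=z_j(1)=\exp(2\pi \sqrt{-1}\,j/n)$. $PB_n$ is the group of isotopy classes (homotopy classes with fixed endpoints, through such families) with product given by concatenation in time (first factor first). Critical moments: a value $t$ is critical if there are three distinct indices $i,j,k$ such that $z_i(t),z_j(t),z_k(t)$ are collinear. A braid $\beta$ is good and stable if: the number of its critical moments is finite; at each critical moment there is exactly one triple of indices whose points are collinear; and the number of critical moments does not change after any sufficiently small perturbation of the braid (small in the $C^1$ sense). Every braid can be made good and stable by an arbitrarily small perturbation. Definition of $f$: let $\beta$ be a good and stable pure braid with critical moments $t_1<t_2<\dots<t_m$. At $t_l$ let the three collinear points have indices $i_l,j_l,k_l$, with the point with index $j_l$ lying between the other two. Set $f(\beta)=a'_{i_1j_1k_1}a'_{i_2j_2k_2}\cdots a'_{i_mj_mk_m}\in {}'G_n^3$. The value of $f$ on an element of $PB_n$ is its value on any good and stable representative. *)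

theory Defs
  imports "HOL-Analysis.Analysis" "HOL-Algebra.Group"
begin

section \<open>Groups given by generators and relations\<close>

text \<open>
  A letter \<open>(s, True)\<close> stands for the generator \<open>s\<close> and \<open>(s, False)\<close> for its formal inverse.
  A relation is a pair of words that become equal in the group.
\<close>

type_synonym 'g gword = "('g \<times> bool) list"

definition gwords :: "'g set \<Rightarrow> 'g gword set" where
  "gwords S = lists (S \<times> UNIV)"

inductive pres_eq :: "'g set \<Rightarrow> ('g gword \<times> 'g gword) set \<Rightarrow> 'g gword \<Rightarrow> 'g gword \<Rightarrow> bool"
  for S R where
    refl: "u \<in> gwords S \<Longrightarrow> pres_eq S R u u"
  | sym: "pres_eq S R u v \<Longrightarrow> pres_eq S R v u"
  | trans: "pres_eq S R u v \<Longrightarrow> pres_eq S R v w \<Longrightarrow> pres_eq S R u w"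
  | append: "pres_eq S R u u' \<Longrightarrow> pres_eq S R v v' \<Longrightarrow> pres_eq S R (u @ v) (u' @ v')"
  | cancel: "s \<in> S \<Longrightarrow> pres_eq S R [(s, b), (s, \<not> b)] []"
  | rel: "(u, v) \<in> R \<Longrightarrow> u \<in> gwords S \<Longrightarrow> v \<in> gwords S \<Longrightarrow> pres_eq S R u v"

definition pres_class :: "'g set \<Rightarrow> ('g gword \<times> 'g gword) set \<Rightarrow> 'g gword \<Rightarrow> 'g gword set" where
  "pres_class S R u = {v. pres_eq S R u v}"

definition pres_group :: "'g set \<Rightarrow> ('g gword \<times> 'g gword) set \<Rightarrow> 'g gword set monoid" where
  "pres_group S R =
    \<lparr>carrier = pres_class S R ` gwords S,
     monoid.mult = (\<lambda>X Y. {w. \<exists>u\<in>X. \<exists>v\<in>Y. pres_eq S R (u @ v) w}),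
     one = pres_class S R []\<rparr>"

abbreviation pos_word :: "'g list \<Rightarrow> 'g gword" where
  "pos_word gs \<equiv> map (\<lambda>g. (g, True)) gs"

section \<open>The group \<open>'G_n^3\<close>\<close>

text \<open>The index of \<open>a'_{ijk}\<close>: an ordered triple up to order reversal, so that
  \<open>a'_{ijk} = a'_{kji}\<close> holds by construction.\<close>

type_synonym triple_index = "(nat \<times> nat \<times> nat) set"

definition rev_triple :: "nat \<Rightarrow> nat \<Rightarrow> nat \<Rightarrow> triple_index" where
  "rev_triple i j k = {(i, j, k), (k, j, i)}"

definition G3'_gens :: "nat \<Rightarrow> triple_index set" where
  "G3'_gens n = {rev_triple i j k | i j k. {i, j, k} \<subseteq> {1..n} \<and> distinct [i, j, k]}"

definition G3'_rels :: "nat \<Rightarrow> (triple_index gword \<times> triple_index gword) set" where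
  "G3'_rels n =
    {(pos_word [rev_triple i j k, rev_triple i j k], []) | i j k.
       {i, j, k} \<subseteq> {1..n} \<and> distinct [i, j, k]} \<union>
    {(pos_word [rev_triple i j k, rev_triple p q r],
      pos_word [rev_triple p q r, rev_triple i j k]) | i j k p q r.
       {i, j, k, p, q, r} \<subseteq> {1..n} \<and> distinct [i, j, k] \<and> distinct [p, q, r] \<and>
       card ({i, j, k} \<inter> {p, q, r}) \<le> 1} \<union>
    {(pos_word [rev_triple i j k, rev_triple i j l, rev_triple i k l, rev_triple j k l],
      pos_word [rev_triple j k l, rev_triple i k l, rev_triple i j l, rev_triple i j k]) | i j k l.
       {i, j, k, l} \<subseteq> {1..n} \<and> distinct [i, j, k, l]}"

definition G3' :: "nat \<Rightarrow> triple_index gword set monoid" where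
  "G3' n = pres_group (G3'_gens n) (G3'_rels n)"

definition a' :: "nat \<Rightarrow> nat \<Rightarrow> nat \<Rightarrow> nat \<Rightarrow> triple_index gword set" where
  "a' n i j k = pres_class (G3'_gens n) (G3'_rels n) (pos_word [rev_triple i j k])"

section \<open>The group \<open>G^2\<close> on an index set \<open>P\<close>\<close>

text \<open>The index of \<open>a_{p,q}\<close> is the unordered pair \<open>{p, q}\<close>, so that \<open>a_{p,q} = a_{q,p}\<close>
  holds by construction.\<close>

definition G2_gens :: "'p set \<Rightarrow> 'p set set" where
  "G2_gens P = {{p, q} | p q. {p, q} \<subseteq> P \<and> p \<noteq> q}"

definition G2_rels :: "'p set \<Rightarrow> ('p set gword \<times> 'p set gword) set" where
  "G2_rels P =
    {(pos_word [{p, q}, {p, q}], []) | p q. {p, q} \<subseteq> P \<and> p \<noteq> q} \<union>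
    {(pos_word [{p, q}, {r, s}], pos_word [{r, s}, {p, q}]) | p q r s.
       {p, q, r, s} \<subseteq> P \<and> distinct [p, q, r, s]} \<union>
    {(pos_word [{p, q}, {p, r}, {q, r}, {p, q}, {p, r}, {q, r}], []) | p q r.
       {p, q, r} \<subseteq> P \<and> distinct [p, q, r]}"

definition G2 :: "'p set \<Rightarrow> 'p set gword set monoid" where
  "G2 P = pres_group (G2_gens P) (G2_rels P)"

definition a2 :: "'p set \<Rightarrow> 'p \<Rightarrow> 'p \<Rightarrow> 'p set gword set" where
  "a2 P p q = pres_class (G2_gens P) (G2_rels P) (pos_word [{p, q}])"

definition ordered_pairs :: "nat \<Rightarrow> (nat \<times> nat) set" where
  "ordered_pairs n = {(i, j). i \<in> {1..n} \<and> j \<in> {1..n} \<and> i \<noteq> j}"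

abbreviation G2_pairs :: "nat \<Rightarrow> (nat \<times> nat) set gword set monoid" where
  "G2_pairs n \<equiv> G2 (ordered_pairs n)"

section \<open>The map \<open>\<phi>\<close>\<close>

definition phi_on_gens :: "nat \<Rightarrow> (triple_index gword set \<Rightarrow> (nat \<times> nat) set gword set) \<Rightarrow> bool" where
  "phi_on_gens n h \<longleftrightarrow>
    (\<forall>i j k. {i, j, k} \<subseteq> {1..n} \<and> distinct [i, j, k] \<longrightarrow>
       h (a' n i j k) =
         a2 (ordered_pairs n) (i, j) (i, k) \<otimes>\<^bsub>G2_pairs n\<^esub> a2 (ordered_pairs n) (k, j) (k, i))"

definition phi :: "nat \<Rightarrow> triple_index gword set \<Rightarrow> (nat \<times> nat) set gword set" where
  "phi n = (THE h. h \<in> hom (G3' n) (G2_pairs n) \<and> h \<in> extensional (carrier (G3' n)) \<and>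
                   phi_on_gens n h)"

section \<open>Pure braids\<close>

text \<open>\<open>C\<^sup>\<infinity>\<close> on the closed unit interval, with one-sided derivatives at the end points.\<close>

definition smooth_on_unit :: "(real \<Rightarrow> complex) \<Rightarrow> bool" where
  "smooth_on_unit f \<longleftrightarrow>
    (\<exists>D :: nat \<Rightarrow> real \<Rightarrow> complex.
       (\<forall>t\<in>{0..1}. D 0 t = f t) \<and>
       (\<forall>m. \<forall>t\<in>{0..1}. (D m has_vector_derivative D (Suc m) t) (at t within {0..1})))"

definition base_point :: "nat \<Rightarrow> nat \<Rightarrow> complex" where
  "base_point n j = exp (2 * complex_of_real pi * \<i> * of_nat j / of_nat n)"

text \<open>\<open>z j t\<close> is the position of strand \<open>j\<close> at time \<open>t\<close>; only the values for \<open>j \<in> {1..n}\<close> and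
  \<open>t \<in> {0..1}\<close> matter.\<close>

type_synonym strands = "nat \<Rightarrow> real \<Rightarrow> complex"

definition pure_braid :: "nat \<Rightarrow> strands \<Rightarrow> bool" where
  "pure_braid n z \<longleftrightarrow>
    (\<forall>j\<in>{1..n}. smooth_on_unit (z j) \<and> z j 0 = base_point n j \<and> z j 1 = base_point n j) \<and>
    (\<forall>t\<in>{0..1}. inj_on (\<lambda>j. z j t) {1..n})"

definition isotopic :: "nat \<Rightarrow> strands \<Rightarrow> strands \<Rightarrow> bool" where
  "isotopic n z w \<longleftrightarrow>
    (\<exists>H :: real \<Rightarrow> strands.
       (\<forall>s\<in>{0..1}. pure_braid n (H s)) \<and>
       (\<forall>j\<in>{1..n}. continuous_on ({0..1} \<times> {0..1}) (\<lambda>(s, t). H s j t)) \<and>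
       (\<forall>j\<in>{1..n}. \<forall>t\<in>{0..1}. H 0 j t = z j t \<and> H 1 j t = w j t))"

definition braid_class :: "nat \<Rightarrow> strands \<Rightarrow> strands set" where
  "braid_class n z = {w. pure_braid n w \<and> isotopic n z w}"

definition braid_concat :: "strands \<Rightarrow> strands \<Rightarrow> strands" where
  "braid_concat z w = (\<lambda>j. z j +++ w j)"

text \<open>
  The concatenation of two smooth braids need not be smooth at the junction. The product of two
  classes is therefore the class of the concatenation of representatives whose concatenation is
  again a smooth pure braid (for example, representatives that are constant near both ends, which
  exist in every class).
\<close>

definition PB :: "nat \<Rightarrow> strands set monoid" where
  "PB n =
    \<lparr>carrier = braid_class n ` {z. pure_braid n z},
     monoid.mult = (\<lambda>X Y. {v. \<exists>z\<in>X. \<exists>w\<in>Y. pure_braid n (braid_concat z w) \<and>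
                                  v \<in> braid_class n (braid_concat z w)}),
     one = braid_class n (\<lambda>j t. base_point n j)\<rparr>"

section \<open>Critical moments and the map \<open>f\<close>\<close>

definition collinear_triples :: "nat \<Rightarrow> strands \<Rightarrow> real \<Rightarrow> nat set set" where
  "collinear_triples n z t = {T. T \<subseteq> {1..n} \<and> card T = 3 \<and> collinear ((\<lambda>i. z i t) ` T)}"

definition critical_moments :: "nat \<Rightarrow> strands \<Rightarrow> real set" where
  "critical_moments n z = {t \<in> {0..1}. collinear_triples n z t \<noteq> {}}"

definition C1_close :: "nat \<Rightarrow> real \<Rightarrow> strands \<Rightarrow> strands \<Rightarrow> bool" where
  "C1_close n \<epsilon> z w \<longleftrightarrow>
    (\<forall>j\<in>{1..n}. \<forall>t\<in>{0..1}.
       dist (z j t) (w j t) < \<epsilon> \<and>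
       dist (vector_derivative (z j) (at t within {0..1}))
            (vector_derivative (w j) (at t within {0..1})) < \<epsilon>)"

definition good_stable :: "nat \<Rightarrow> strands \<Rightarrow> bool" where
  "good_stable n z \<longleftrightarrow>
    pure_braid n z \<and>
    finite (critical_moments n z) \<and>
    (\<forall>t\<in>critical_moments n z. \<exists>!T. T \<in> collinear_triples n z t) \<and>
    (\<exists>\<epsilon>>0. \<forall>w. pure_braid n w \<and> C1_close n \<epsilon> z w \<longrightarrow>
       finite (critical_moments n w) \<and>
       card (critical_moments n w) = card (critical_moments n z))"

definition moment_index :: "nat \<Rightarrow> strands \<Rightarrow> real \<Rightarrow> triple_index" where
  "moment_index n z t =
    (THE g. \<exists>i j k. {i, j, k} \<in> collinear_triples n z t \<and>
                    between (z i t, z k t) (z j t) \<and> g = rev_triple i j k)"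

definition read_off :: "nat \<Rightarrow> strands \<Rightarrow> triple_index gword set" where
  "read_off n z =
    pres_class (G3'_gens n) (G3'_rels n)
      (pos_word (map (moment_index n z) (sorted_list_of_set (critical_moments n z))))"

definition f_map :: "nat \<Rightarrow> strands set \<Rightarrow> triple_index gword set" where
  "f_map n X = (THE g. \<exists>z\<in>X. good_stable n z \<and> g = read_off n z)"

definition Phi :: "nat \<Rightarrow> strands set \<Rightarrow> (nat \<times> nat) set gword set" where
  "Phi n = phi n \<circ> f_map n"

end

(*
  For n points in general position the signs of the areas of all triangles are locally constant, and
  a group-valued potential depending only on these signs records the letters a'_{ijk} met along a
  path. The relations of 'G_n^3 make the potential well defined on each chart in which the points
  are sorted by a linear functional, so the word of a regular path depends only on its homotopy
  class; applying this to the right regular representation of 'G_n^3 shows that f is well defined.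
  The pure braid group is identified with the fundamental group of the configuration space by
  polynomial approximation, which yields good and stable representatives and, after halving time,
  multiplicativity of f. For phi, the tetrahedron relation follows from the triangle relations
  at three of the vertices, since letters attached to different vertices commute.
*)
theory Submission
  imports Defs
begin

text \<open>A direct proof of invariance would put a homotopy in general position and inspect every
  stratum of codimension two. The potential avoids this: it only has to be followed across one wall
  at a time, along paths. With the points numbered by increasing real part and b_pqr for the
  letters, it is the product over m of the letters b_pqm of those lines pq, p < q < m, that pass
  above point m, taken from the highest line over m downward. When j < k < l become collinear, point
  l crosses the line jk, so b_jkl appears or disappears as the last factor of level l. Over a later
  point m the lines jk, jl, kl reverse their order, and the tetrahedron relation says exactly that
  this reversal is conjugation by b_jkl. Every other factor of a later level shares at most one
  index with jkl and commutes with b_jkl. The signs do not fix the order of lines without a common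
  point, but the letters of such lines commute. Stability is what excludes tangential
  collinearities, at which a letter would be read although no wall is crossed.\<close>

section \<open>A potential on configurations with increasing real parts\<close>

text \<open>Two orderings compatible with the same constraints differ by swaps of unconstrained
  letters, as in a partially commutative monoid; \<open>Q a b\<close> reads "a may come before b".
  For the head \<open>a\<close> of \<open>L\<close>, each letter in front of \<open>a\<close> in
  \<open>L'\<close> is related to \<open>a\<close> both ways, so it commutes with \<open>a\<close>,
  and \<open>a\<close> can be pulled to the front of \<open>L'\<close>.\<close>

lemma sum_list_commuting_rearrangement:
  fixes f :: "'a \<Rightarrow> 'g::monoid_add"
  assumes "distinct L" "distinct L'" "set L = set L'" "sorted_wrt Q L" "sorted_wrt Q L'"
    and "\<And>a b. a \<in> set L \<Longrightarrow> b \<in> set L \<Longrightarrow> a \<noteq> b \<Longrightarrow> Q a b \<Longrightarrow> Q b a \<Longrightarrow> f a + f b = f b + f a"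
  shows "sum_list (map f L) = sum_list (map f L')"
  using assms
proof (induction L arbitrary: L')
  case Nil
  then show ?case by simp
next
  case (Cons a L)
  obtain B C where L': "L' = B @ a # C"
    using Cons.prems(3) split_list[of a L'] by auto
  have comm: "sum_list (map f D) + f a = f a + sum_list (map f D)" if "set D \<subseteq> set B" for D
    using that
  proof (induction D)
    case (Cons d D)
    have d: "d \<in> set B" using Cons.prems by auto
    have "Q d a" using Cons.prems(1) \<open>sorted_wrt Q L'\<close> L' by (auto simp: sorted_wrt_append)
    moreover have "d \<in> set (a # L)" "d \<noteq> a"
      using d \<open>distinct L'\<close> L' \<open>set (a # L) = set L'\<close> by auto
    moreover from this have "Q a d" using \<open>sorted_wrt Q (a # L)\<close> by auto
    ultimately have "f d + f a = f a + f d"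
      using Cons.prems \<open>\<And>a' b. a' \<in> set (a # L) \<Longrightarrow> b \<in> set (a # L) \<Longrightarrow> a' \<noteq> b \<Longrightarrow> Q a' b \<Longrightarrow> Q b a' \<Longrightarrow> f a' + f b = f b + f a'\<close>
      by auto
    then show ?case using Cons.IH Cons.prems by (simp add: add.assoc) (simp flip: add.assoc)
  qed simp
  have "sum_list (map f L) = sum_list (map f (B @ C))"
  proof (rule Cons.IH)
    show "set L = set (B @ C)"
      using Cons.prems(1-3) L' by auto
    show "sorted_wrt Q (B @ C)" using Cons.prems(5) L' by (auto simp: sorted_wrt_append)
    show "f a + f b = f b + f a" if "a \<in> set L" "b \<in> set L" "a \<noteq> b" "Q a b" "Q b a" for a b
      by (rule Cons.prems(6)) (use that in auto)
  qed (use Cons.prems(1-5) L' in auto)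
  then show ?case
    using comm[of B] L' by (simp add: add.assoc) (simp flip: add.assoc)
qed

lemma sorted_wrt_distinct_mono:
  assumes "distinct L" "sorted_wrt P L"
    and "\<And>a b. a \<in> set L \<Longrightarrow> b \<in> set L \<Longrightarrow> a \<noteq> b \<Longrightarrow> P a b \<Longrightarrow> Q a b"
  shows "sorted_wrt Q L"
  using assms by (induction L) auto

section \<open>Orientation of triples and heights of lines\<close>

definition turn :: "(nat \<Rightarrow> complex) \<Rightarrow> nat \<Rightarrow> nat \<Rightarrow> nat \<Rightarrow> real" where
  "turn c i j k = (Re (c j) - Re (c i)) * (Im (c k) - Im (c i))
                - (Re (c k) - Re (c i)) * (Im (c j) - Im (c i))"

text \<open>The height at which the line through the two points of \<open>a\<close> meets the
  vertical line through point \<open>m\<close>.\<close>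

definition ht :: "(nat \<Rightarrow> complex) \<Rightarrow> nat \<Rightarrow> nat \<times> nat \<Rightarrow> real" where
  "ht c m a = Im (c (fst a)) + (Im (c (snd a)) - Im (c (fst a))) / (Re (c (snd a)) - Re (c (fst a)))
              * (Re (c m) - Re (c (fst a)))"

definition incr :: "nat \<Rightarrow> (nat \<Rightarrow> complex) \<Rightarrow> bool" where
  "incr n c \<longleftrightarrow> (\<forall>i j. i < j \<longrightarrow> j < n \<longrightarrow> Re (c i) < Re (c j))"

lemma incrD: "incr n c \<Longrightarrow> i < j \<Longrightarrow> j < n \<Longrightarrow> Re (c i) < Re (c j)"
  by (auto simp: incr_def)

text \<open>Both differences are twice the signed area of pqr times a factor whose sign depends only
  on where \<open>m\<close> lies horizontally.\<close>

lemma ht_diff: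
  assumes "Re (c p) < Re (c q)" "Re (c q) < Re (c r)"
  shows "ht c m (p, r) - ht c m (p, q) =
           turn c p q r * ((Re (c m) - Re (c p)) / ((Re (c q) - Re (c p)) * (Re (c r) - Re (c p))))"
    and "ht c m (q, r) - ht c m (p, r) =
           turn c p q r * ((Re (c m) - Re (c r)) / ((Re (c r) - Re (c q)) * (Re (c r) - Re (c p))))"
proof -
  have *: "Re (c q) - Re (c p) \<noteq> 0" "Re (c r) - Re (c p) \<noteq> 0" "Re (c r) - Re (c q) \<noteq> 0"
    using assms by auto
  show "ht c m (p, r) - ht c m (p, q) =
           turn c p q r * ((Re (c m) - Re (c p)) / ((Re (c q) - Re (c p)) * (Re (c r) - Re (c p))))"
    using * by (simp add: ht_def turn_def divide_simps) (simp add: algebra_simps)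
  show "ht c m (q, r) - ht c m (p, r) =
           turn c p q r * ((Re (c m) - Re (c r)) / ((Re (c r) - Re (c q)) * (Re (c r) - Re (c p))))"
    using * by (simp add: ht_def turn_def divide_simps) (simp add: algebra_simps)
qed

lemma turn_ht:
  assumes "Re (c p) < Re (c q)"
  shows "turn c p q m = (Re (c q) - Re (c p)) * (Im (c m) - ht c m (p, q))"
  using assms by (simp add: ht_def turn_def divide_simps) (simp add: algebra_simps)

text \<open>To the right of \<open>r\<close> both factors of \<open>ht_diff\<close> are positive. So
  the sides of the triangle are stacked as pq, pr, qr from below when it is positively oriented, and
  in the opposite order when it is negatively oriented; a flat triangle gives ties.\<close>

lemma ht_order:
  assumes "incr n c" "p < q" "q < r" "r < m" "m < n"
  shows "ht c m (p, q) < ht c m (p, r) \<longleftrightarrow> turn c p q r > 0"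
    and "ht c m (p, r) < ht c m (p, q) \<longleftrightarrow> turn c p q r < 0"
    and "ht c m (p, r) < ht c m (q, r) \<longleftrightarrow> turn c p q r > 0"
    and "ht c m (q, r) < ht c m (p, r) \<longleftrightarrow> turn c p q r < 0"
    and "ht c m (p, q) < ht c m (q, r) \<longleftrightarrow> turn c p q r > 0"
    and "ht c m (q, r) < ht c m (p, q) \<longleftrightarrow> turn c p q r < 0"
proof -
  have x: "Re (c p) < Re (c q)" "Re (c q) < Re (c r)" "Re (c r) < Re (c m)"
    using assms by (auto intro: incrD)
  define u where "u = (Re (c m) - Re (c p)) / ((Re (c q) - Re (c p)) * (Re (c r) - Re (c p)))"
  define v where "v = (Re (c m) - Re (c r)) / ((Re (c r) - Re (c q)) * (Re (c r) - Re (c p)))"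
  have "u > 0" "v > 0" using x by (auto simp: u_def v_def intro!: divide_pos_pos mult_pos_pos)
  moreover have "ht c m (p, r) - ht c m (p, q) = turn c p q r * u"
    "ht c m (q, r) - ht c m (p, r) = turn c p q r * v"
    using ht_diff[OF x(1,2)] by (auto simp: u_def v_def)
  moreover have "turn c p q r * u > 0 \<longleftrightarrow> turn c p q r > 0" "turn c p q r * u < 0 \<longleftrightarrow> turn c p q r < 0"
    "turn c p q r * v > 0 \<longleftrightarrow> turn c p q r > 0" "turn c p q r * v < 0 \<longleftrightarrow> turn c p q r < 0"
    using \<open>u > 0\<close> \<open>v > 0\<close> by (auto simp: zero_less_mult_iff mult_less_0_iff)
  ultimately show "ht c m (p, q) < ht c m (p, r) \<longleftrightarrow> turn c p q r > 0"
    and "ht c m (p, r) < ht c m (p, q) \<longleftrightarrow> turn c p q r < 0"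
    and "ht c m (p, r) < ht c m (q, r) \<longleftrightarrow> turn c p q r > 0"
    and "ht c m (q, r) < ht c m (p, r) \<longleftrightarrow> turn c p q r < 0"
    and "ht c m (p, q) < ht c m (q, r) \<longleftrightarrow> turn c p q r > 0"
    and "ht c m (q, r) < ht c m (p, q) \<longleftrightarrow> turn c p q r < 0"
    by linarith+
qed

definition pair_disj :: "nat \<times> nat \<Rightarrow> nat \<times> nat \<Rightarrow> bool" where
  "pair_disj a b \<longleftrightarrow> {fst a, snd a} \<inter> {fst b, snd b} = {}"

lemma pair_disj_sym: "pair_disj a b \<longleftrightarrow> pair_disj b a"
  by (auto simp: pair_disj_def)

text \<open>Two lines with a common point are two sides of a triangle, so \<open>ht_order\<close>
  compares them to the right of it. All six ordered choices of two sides occur because it is not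
  known which of the lines is the higher one.\<close>

lemma sharing_pairs_cases:
  assumes "\<not> pair_disj a b" "a \<noteq> b" "fst a < snd a" "fst b < snd b" "snd a < m" "snd b < m"
  obtains p q r where "p < q" "q < r" "r < (m::nat)"
    "(a, b) \<in> {((p,q),(p,r)), ((p,r),(p,q)), ((p,q),(q,r)), ((q,r),(p,q)), ((p,r),(q,r)), ((q,r),(p,r))}"
proof -
  obtain j k where a: "a = (j, k)" by (cases a)
  obtain i l where b: "b = (i, l)" by (cases b)
  have *: "j < k" "i < l" "k < m" "l < m" "j = i \<or> j = l \<or> k = i \<or> k = l" "\<not> (j = i \<and> k = l)"
    using assms by (auto simp: a b pair_disj_def)
  consider "j = i" "k < l" | "j = i" "l < k" | "j = l" | "k = i" | "k = l" "i < j" | "k = l" "j < i"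
    using * by linarith
  then show ?thesis
  proof cases
    case 1 then show ?thesis using * that[of j k l] by (auto simp: a b)
  next
    case 2 then show ?thesis using * that[of j l k] by (auto simp: a b)
  next
    case 3 then show ?thesis using * that[of i j k] by (auto simp: a b)
  next
    case 4 then show ?thesis using * that[of j k l] by (auto simp: a b)
  next
    case 5 then show ?thesis using * that[of i j k] by (auto simp: a b)
  next
    case 6 then show ?thesis using * that[of j i k] by (auto simp: a b)
  qed
qed

text \<open>A nonzero orientation leaves no ties between sides, so even a weak inequality at
  \<open>c\<close> becomes a strict one at every configuration with the same sign.\<close>

lemma sharing_pairs_order:
  assumes "incr n c" "incr n c'" "p < q" "q < r" "r < m" "m < n"
    and "(a, b) \<in> {((p,q),(p,r)), ((p,r),(p,q)), ((p,q),(q,r)), ((q,r),(p,q)), ((p,r),(q,r)), ((q,r),(p,r))}"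
    and "turn c' p q r \<noteq> 0" "sgn (turn c p q r) = sgn (turn c' p q r)" "ht c m b \<le> ht c m a"
  shows "ht c' m b < ht c' m a"
proof -
  have *: "turn c p q r < 0 \<longleftrightarrow> turn c' p q r < 0" "turn c p q r > 0 \<longleftrightarrow> turn c' p q r > 0"
    using assms(9) by (auto simp: sgn_if split: if_splits)
  then show ?thesis
    using assms(7,8,10) ht_order[OF assms(1,3-6)] ht_order[OF assms(2,3-6)]
    by (auto simp: not_less[symmetric])
qed

section \<open>Levels and the potential\<close>

definition pairs_below :: "nat \<Rightarrow> (nat \<times> nat) list" where
  "pairs_below m = concat (map (\<lambda>k. map (\<lambda>j. (j, k)) [0..<k]) [0..<m])"

lemma set_pairs_below: "set (pairs_below m) = {a. fst a < snd a \<and> snd a < m}"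
  by (force simp: pairs_below_def)

lemma distinct_pairs_below: "distinct (pairs_below m)"
proof (induction m)
  case (Suc m)
  then show ?case
    by (auto simp: pairs_below_def distinct_map inj_on_def)
qed (simp add: pairs_below_def)

text \<open>By \<open>turn_ht\<close> the negative sign says that the line passes above point
  \<open>m\<close>. The negated key makes the ascending \<open>sort_key\<close> list the lines from
  the highest down.\<close>

definition above_list :: "(nat \<Rightarrow> complex) \<Rightarrow> nat \<Rightarrow> (nat \<times> nat) list" where
  "above_list c m = sort_key (\<lambda>a. - ht c m a) (filter (\<lambda>a. turn c (fst a) (snd a) m < 0) (pairs_below m))"

definition level :: "(nat \<Rightarrow> nat \<Rightarrow> nat \<Rightarrow> 'g::group_add) \<Rightarrow> (nat \<Rightarrow> complex) \<Rightarrow> nat \<Rightarrow> 'g" where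
  "level \<beta> c m = sum_list (map (\<lambda>a. \<beta> (fst a) (snd a) m) (above_list c m))"

definition pot :: "(nat \<Rightarrow> nat \<Rightarrow> nat \<Rightarrow> 'g::group_add) \<Rightarrow> nat \<Rightarrow> (nat \<Rightarrow> complex) \<Rightarrow> 'g" where
  "pot \<beta> n c = sum_list (map (level \<beta> c) [0..<n])"

lemma set_above_list:
  "set (above_list c m) = {a. fst a < snd a \<and> snd a < m \<and> turn c (fst a) (snd a) m < 0}"
  by (auto simp: above_list_def set_pairs_below)

lemma distinct_above_list: "distinct (above_list c m)"
  by (simp add: above_list_def distinct_pairs_below)

lemma sorted_above_list: "sorted_wrt (\<lambda>a b. ht c m b \<le> ht c m a) (above_list c m)"
proof -
  have "sorted (map (\<lambda>a. - ht c m a) (above_list c m))"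
    unfolding above_list_def by (rule sorted_sort_key)
  then show ?thesis by (simp add: sorted_map)
qed

text \<open>The relations of the triple group for increasing triples only, as they appear once the
  points are sorted. The class \<open>group_add\<close> is additive in notation but does not assume
  commutativity, so sums stand for words.\<close>

locale tetrahedral =
  fixes \<beta> :: "nat \<Rightarrow> nat \<Rightarrow> nat \<Rightarrow> 'g::group_add" and n :: nat
  assumes invol: "i < j \<Longrightarrow> j < k \<Longrightarrow> k < n \<Longrightarrow> \<beta> i j k + \<beta> i j k = 0"
    and far_comm: "i < j \<Longrightarrow> j < k \<Longrightarrow> k < n \<Longrightarrow> p < q \<Longrightarrow> q < r \<Longrightarrow> r < n \<Longrightarrow>
      card ({i, j, k} \<inter> {p, q, r}) \<le> 1 \<Longrightarrow> \<beta> i j k + \<beta> p q r = \<beta> p q r + \<beta> i j k"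
    and tetra: "i < j \<Longrightarrow> j < k \<Longrightarrow> k < l \<Longrightarrow> l < n \<Longrightarrow>
      \<beta> i j k + \<beta> i j l + \<beta> i k l + \<beta> j k l = \<beta> j k l + \<beta> i k l + \<beta> i j l + \<beta> i j k"
begin

abbreviation b3 :: "nat \<Rightarrow> nat \<times> nat \<Rightarrow> 'g" where
  "b3 m a \<equiv> \<beta> (fst a) (snd a) m"

lemma b3_comm:
  assumes "pair_disj a b" "fst a < snd a" "snd a < m" "fst b < snd b" "snd b < m" "m < n"
  shows "b3 m a + b3 m b = b3 m b + b3 m a"
proof (rule far_comm)
  have "{fst a, snd a, m} \<inter> {fst b, snd b, m} = {m}"
    using assms by (auto simp: pair_disj_def)
  then show "card ({fst a, snd a, m} \<inter> {fst b, snd b, m}) \<le> 1" by simp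
qed (use assms in auto)

text \<open>The signs determine which lines pass above point \<open>m\<close> and how two lines with
  a common point are stacked there. They do not determine the order of disjoint lines, but the
  letters of those commute by \<open>b3_comm\<close>.\<close>

lemma level_cong:
  assumes "incr n c" "incr n c'" "m < n"
    and sgn: "\<And>p q r. p < q \<Longrightarrow> q < r \<Longrightarrow> r \<le> m \<Longrightarrow> turn c p q r \<noteq> 0 \<and> sgn (turn c p q r) = sgn (turn c' p q r)"
  shows "level \<beta> c m = level \<beta> c' m"
  unfolding level_def
proof (rule sum_list_commuting_rearrangement)
  have sgn': "turn c p q r < 0 \<longleftrightarrow> turn c' p q r < 0" "turn c p q r > 0 \<longleftrightarrow> turn c' p q r > 0"
    "turn c p q r \<noteq> 0"
    if "p < q" "q < r" "r \<le> m" for p q r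
    using sgn[OF that] by (auto simp: sgn_if split: if_splits)
  \<comment> \<open>Disjoint pairs are related in both directions, pairs with a common point in one
    direction only; hence \<open>Q\<close> both ways means disjoint and gives commuting
    letters.\<close>
  define Q where "Q = (\<lambda>a b. pair_disj a b \<or> ht c m b < ht c m a)"
  show "set (above_list c m) = set (above_list c' m)"
    using sgn' by (auto simp: set_above_list)
  have *: "ht c m b < ht c m a"
    if "a \<in> set (above_list c m)" "b \<in> set (above_list c m)" "a \<noteq> b" "\<not> pair_disj a b"
       "ht c m b \<le> ht c m a \<or> ht c' m b \<le> ht c' m a" for a b
  proof -
    from that obtain p q r where pqr: "p < q" "q < r" "r < m" and
      ab: "(a, b) \<in> {((p,q),(p,r)), ((p,r),(p,q)), ((p,q),(q,r)), ((q,r),(p,q)), ((p,r),(q,r)), ((q,r),(p,r))}"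
      by (elim sharing_pairs_cases[of a b m]) (auto simp: set_above_list)
    have "turn c p q r \<noteq> 0" using sgn' pqr by auto
    moreover have "turn c p q r < 0 \<longleftrightarrow> turn c' p q r < 0" "turn c p q r > 0 \<longleftrightarrow> turn c' p q r > 0"
      using sgn' pqr by auto
    ultimately show ?thesis
      using ab that(5) ht_order[OF assms(1) pqr assms(3)] ht_order[OF assms(2) pqr assms(3)]
      by (auto simp: not_less[symmetric])
  qed
  show "sorted_wrt Q (above_list c m)"
    by (rule sorted_wrt_distinct_mono[OF distinct_above_list sorted_above_list]) (auto simp: Q_def dest: *)
  show "sorted_wrt Q (above_list c' m)"
    by (rule sorted_wrt_distinct_mono[OF distinct_above_list sorted_above_list])
      (use * \<open>set (above_list c m) = set (above_list c' m)\<close> in \<open>auto simp: Q_def\<close>)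
  show "b3 m a + b3 m b = b3 m b + b3 m a"
    if "a \<in> set (above_list c m)" "b \<in> set (above_list c m)" "Q a b" "Q b a" for a b
    using that assms(3) by (intro b3_comm) (auto simp: Q_def set_above_list pair_disj_sym)
qed (auto simp: distinct_above_list)


section \<open>Crossing a wall on which exactly one triple degenerates\<close>

context
  fixes c0 :: "nat \<Rightarrow> complex" and j k l :: nat
  assumes incr0: "incr n c0" and jkl: "j < k" "k < l" "l < n" and turn0: "turn c0 j k l = 0"
    and nondeg: "\<And>p q r. p < q \<Longrightarrow> q < r \<Longrightarrow> r < n \<Longrightarrow> (p, q, r) \<noteq> (j, k, l) \<Longrightarrow> turn c0 p q r \<noteq> 0"
begin

abbreviation tri :: "(nat \<times> nat) list" where
  "tri \<equiv> [(j, k), (j, l), (k, l)]"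

lemma ht0_tri: "l < m \<Longrightarrow> m < n \<Longrightarrow> a \<in> set tri \<Longrightarrow> ht c0 m a = ht c0 m (j, k)"
  using ht_order[OF incr0 jkl(1,2), of m] turn0 by auto

lemma turn0_tri: 
  assumes "l < m" "m < n" "a \<in> set tri" 
  shows "turn c0 (fst a) (snd a) m < 0 \<longleftrightarrow> turn c0 j k m < 0"
proof -
  have *: "turn c0 (fst a) (snd a) m < 0 \<longleftrightarrow> Im (c0 m) < ht c0 m a" 
    if "fst a < snd a" "snd a < n" for a
    using turn_ht[of c0 "fst a" "snd a" m] incrD[OF incr0 that] by (simp add: mult_less_0_iff)
  show ?thesis
    using *[of a] *[of "(j, k)"] ht0_tri[OF assms] assms(3) jkl by auto
qed

text \<open>Two sides of a triangle have equal heights to its right only if the triangle is flat,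
  and jkl is the only flat one. All other ties are between disjoint lines, whose order is
  irrelevant.\<close>

lemma ht0_sharing:
  assumes "fst a < snd a" "snd a < m" "fst b < snd b" "snd b < m" "m < n" "a \<noteq> b" "\<not> pair_disj a b"
    "ht c0 m a = ht c0 m b"
  shows "l < m \<and> a \<in> set tri \<and> b \<in> set tri"
proof -
  obtain p q r where pqr: "p < q" "q < r" "r < m" and
      ab: "(a, b) \<in> {((p,q),(p,r)), ((p,r),(p,q)), ((p,q),(q,r)), ((q,r),(p,q)), ((p,r),(q,r)), ((q,r),(p,r))}"
    using assms by (elim sharing_pairs_cases[of a b m])
  have "turn c0 p q r = 0"
    using ab assms(8) ht_order[OF incr0 pqr assms(5)] by (auto simp: not_less[symmetric])
  then have "(p, q, r) = (j, k, l)" using nondeg[of p q r] pqr assms(5) by auto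
  then show ?thesis using ab pqr by auto
qed

text \<open>Lines tied with the degenerate line jkl are counted as high. Either side would do: over
  a point beyond \<open>l\<close>, such a line shares no point with jk, jl or kl by
  \<open>ht0_sharing\<close>.\<close>

definition high :: "nat \<Rightarrow> (nat \<times> nat) list" where
  "high m = sort_key (\<lambda>a. - ht c0 m a) (filter (\<lambda>a. a \<notin> set tri \<and> turn c0 (fst a) (snd a) m < 0 \<and>
     ht c0 m (j, k) \<le> ht c0 m a) (pairs_below m))"

definition low :: "nat \<Rightarrow> (nat \<times> nat) list" where
  "low m = sort_key (\<lambda>a. - ht c0 m a) (filter (\<lambda>a. a \<notin> set tri \<and> turn c0 (fst a) (snd a) m < 0 \<and>
     ht c0 m a < ht c0 m (j, k)) (pairs_below m))"

lemma set_high: "set (high m) = {a. fst a < snd a \<and> snd a < m \<and> a \<notin> set tri \<and>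
    turn c0 (fst a) (snd a) m < 0 \<and> ht c0 m (j, k) \<le> ht c0 m a}"
  and set_low: "set (low m) = {a. fst a < snd a \<and> snd a < m \<and> a \<notin> set tri \<and>
    turn c0 (fst a) (snd a) m < 0 \<and> ht c0 m a < ht c0 m (j, k)}"
  by (auto simp: high_def low_def set_pairs_below)

lemma sorted_high_low:
  "sorted_wrt (\<lambda>a b. ht c0 m b \<le> ht c0 m a) (high m)" "distinct (high m)"
  "sorted_wrt (\<lambda>a b. ht c0 m b \<le> ht c0 m a) (low m)" "distinct (low m)"
proof -
  have "sorted (map (\<lambda>a. - ht c0 m a) (high m))" "sorted (map (\<lambda>a. - ht c0 m a) (low m))"
    unfolding high_def low_def by (rule sorted_sort_key)+
  then show "sorted_wrt (\<lambda>a b. ht c0 m b \<le> ht c0 m a) (high m)" 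
     "sorted_wrt (\<lambda>a b. ht c0 m b \<le> ht c0 m a) (low m)"
    by (simp_all add: sorted_map)
qed (simp_all add: high_def low_def distinct_pairs_below)

text \<open>Near the wall the lines over point \<open>m\<close> are stacked as at \<open>c0\<close>,
  except that the coincident lines jk, jl, kl fan out in one of two opposite orders. At
  \<open>c0\<close> they are one line, so either all three or none of them pass above point
  \<open>m\<close>.\<close>

lemma level_near_crossing:
  assumes c: "incr n c" "turn c j k l \<noteq> 0"
    and sgn: "\<And>p q r. p < q \<Longrightarrow> q < r \<Longrightarrow> r < n \<Longrightarrow> (p, q, r) \<noteq> (j, k, l) \<Longrightarrow> sgn (turn c p q r) = sgn (turn c0 p q r)"
    and m: "l < m" "m < n"
  shows "level \<beta> c m = sum_list (map (b3 m) (high m)) +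
    sum_list (map (b3 m) (if turn c0 j k m < 0 then if turn c j k l < 0 then tri else rev tri else [])) +
    sum_list (map (b3 m) (low m))"
proof -
  define M where "M = (if turn c0 j k m < 0 then if turn c j k l < 0 then tri else rev tri else [])"
  define N where "N = high m @ M @ low m"
  have sgn': "turn c p q r < 0 \<longleftrightarrow> turn c0 p q r < 0" "turn c p q r > 0 \<longleftrightarrow> turn c0 p q r > 0"
    "turn c p q r \<noteq> 0"
    if "p < q" "q < r" "r < n" "(p, q, r) \<noteq> (j, k, l)" for p q r
    using sgn[OF that] nondeg[OF that] by (auto simp: sgn_if split: if_splits)
  define O3 where "O3 = (\<lambda>a b. ht c m b < ht c m a \<and> a \<in> set tri \<and> b \<in> set tri)"
  \<comment> \<open>The order inside the fan is taken from \<open>c\<close>, every other order from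
    \<open>c0\<close>.\<close>
  define Q where "Q = (\<lambda>a b. pair_disj a b \<or> ht c0 m b < ht c0 m a \<or> O3 a b)"
  have setM: "set M = (if turn c0 j k m < 0 then set tri else {})" by (auto simp: M_def)
  have triD: "fst a < snd a \<and> snd a < m" if "a \<in> set tri" for a
    using that jkl m by auto
  have set0: "set N = {a. fst a < snd a \<and> snd a < m \<and> turn c0 (fst a) (snd a) m < 0}"
    using turn0_tri[OF m] triD unfolding N_def set_append setM set_high set_low by (auto simp del: set_simps)
  have "sum_list (map (b3 m) (above_list c m)) = sum_list (map (b3 m) N)"
  proof (rule sum_list_commuting_rearrangement[OF distinct_above_list])
    show "set (above_list c m) = set N"
      unfolding set0 set_above_list using sgn' m by auto
    have "distinct M" using jkl by (auto simp: M_def)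
    then show "distinct N"
      using sorted_high_low unfolding N_def by (auto simp: setM set_high set_low)
    show "sorted_wrt Q (above_list c m)"
    proof (rule sorted_wrt_distinct_mono[OF distinct_above_list sorted_above_list])
      fix a b assume ab: "a \<in> set (above_list c m)" "b \<in> set (above_list c m)" "a \<noteq> b" "ht c m b \<le> ht c m a"
      show "Q a b"
      proof (cases "pair_disj a b")
        case False
        from ab have in': "fst a < snd a" "snd a < m" "fst b < snd b" "snd b < m"
          by (auto simp: set_above_list)
        obtain p q r where pqr: "p < q" "q < r" "r < m" and
            opts: "(a, b) \<in> {((p,q),(p,r)), ((p,r),(p,q)), ((p,q),(q,r)), ((q,r),(p,q)), ((p,r),(q,r)), ((q,r),(p,r))}"
          using False ab(3) in' by (elim sharing_pairs_cases[of a b m])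
        show ?thesis
        proof (cases "(p, q, r) = (j, k, l)")
          case True
          then have "a \<in> set tri" "b \<in> set tri" using opts by auto
          moreover have "ht c m b < ht c m a"
            using opts True c(2) ab(4) ht_order[OF c(1) pqr m(2)] by (auto simp: not_less[symmetric])
          ultimately show ?thesis by (simp add: Q_def O3_def)
        next
          case False
          then have "turn c p q r < 0 \<longleftrightarrow> turn c0 p q r < 0" "turn c p q r > 0 \<longleftrightarrow> turn c0 p q r > 0"
            "turn c p q r \<noteq> 0" using sgn'[of p q r] pqr m by auto
          then have "ht c0 m b < ht c0 m a"
            using opts ab(4) ht_order[OF c(1) pqr m(2)] ht_order[OF incr0 pqr m(2)]
            by (auto simp: not_less[symmetric])
          then show ?thesis by (simp add: Q_def)
        qed
      qed (simp add: Q_def)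
    qed
    \<comment> \<open>A weak inequality at \<open>c0\<close> is enough outside the fan: a tie there
      can only be between disjoint lines.\<close>
    have Q1: "Q a b" if "fst a < snd a" "snd a < m" "fst b < snd b" "snd b < m" "a \<noteq> b" 
       "ht c0 m b \<le> ht c0 m a" "a \<notin> set tri \<or> b \<notin> set tri" for a b
      using ht0_sharing[of a m b] that m(2) unfolding Q_def by (cases "ht c0 m a = ht c0 m b") auto
    have 1: "sorted_wrt Q (high m)" "sorted_wrt Q (low m)"
      by (rule sorted_wrt_distinct_mono[OF sorted_high_low(2,1)] sorted_wrt_distinct_mono[OF sorted_high_low(4,3)],
          rule Q1, auto simp: set_high set_low)+
    have "sorted_wrt O3 M"
      unfolding M_def O3_def using c(2) ht_order[OF c(1) jkl(1,2) m] by auto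
    then have 2: "sorted_wrt Q M" by (rule sorted_wrt_mono_rel[rotated]) (auto simp: Q_def)
    have 3: "Q a b" if "a \<in> set M" "b \<in> set (low m)" for a b
    proof -
      have "a \<in> set tri" using that(1) by (auto simp: setM split: if_splits)
      then have "ht c0 m a = ht c0 m (j, k)" using ht0_tri m by blast
      then show ?thesis using that by (auto simp: set_low Q_def)
    qed
    have 4: "Q a b" if "a \<in> set (high m)" "b \<in> set M" for a b
    proof -
      have "b \<in> set tri" using that(2) by (auto simp: setM split: if_splits)
      moreover from this have "ht c0 m b = ht c0 m (j, k)" using ht0_tri m by blast
      ultimately show ?thesis 
        using that triD[of b] by (intro Q1) (auto simp: set_high simp del: set_simps)
    qed
    have 5: "Q a b" if "a \<in> set (high m)" "b \<in> set (low m)" for a b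
      using that by (auto simp: set_high set_low Q_def)
    show "sorted_wrt Q N"
      unfolding N_def sorted_wrt_append set_append using 1 2 3 4 5 by blast
    show "b3 m a + b3 m b = b3 m b + b3 m a"
      if "a \<in> set (above_list c m)" "b \<in> set (above_list c m)" "Q a b" "Q b a" for a b
    proof (rule b3_comm)
      show "pair_disj a b"
        using that(3,4) ht0_tri[OF m, of a] ht0_tri[OF m, of b] by (auto simp: Q_def O3_def pair_disj_sym)
    qed (use that m in \<open>auto simp: set_above_list\<close>)
  qed
  then show ?thesis by (simp add: level_def N_def M_def add.assoc)
qed

text \<open>Conjugation by \<open>\<beta> j k l\<close> carries level \<open>m\<close> on one side
  of the wall to level \<open>m\<close> on the other. A line outside \<open>tri\<close>, together
  with \<open>m\<close>, meets {j, k, l} in at most one index, so its letter commutes; the fan is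
  reversed by the tetrahedron relation.\<close>

lemma crossing_commutes_past_level:
  assumes c: "incr n c" "turn c j k l < 0" and c': "incr n c'" "turn c' j k l > 0"
    and sgn: "\<And>p q r. p < q \<Longrightarrow> q < r \<Longrightarrow> r < n \<Longrightarrow> (p, q, r) \<noteq> (j, k, l) \<Longrightarrow>
       sgn (turn c p q r) = sgn (turn c0 p q r) \<and> sgn (turn c' p q r) = sgn (turn c0 p q r)"
    and m: "l < m" "m < n"
  shows "level \<beta> c m + \<beta> j k l = \<beta> j k l + level \<beta> c' m"
proof -
  let ?b = "\<beta> j k l"
  have far: "b3 m a + ?b = ?b + b3 m a" if "fst a < snd a" "snd a < m" "a \<notin> set tri" for a
  proof (rule far_comm)
    have "m \<notin> {j, k, l}" using m jkl by auto
    have "\<not> (fst a \<in> {j, k, l} \<and> snd a \<in> {j, k, l})" using that jkl by (cases a) auto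
    then have "{fst a, snd a, m} \<inter> {j, k, l} \<subseteq> {fst a} \<or> {fst a, snd a, m} \<inter> {j, k, l} \<subseteq> {snd a}"
      using \<open>m \<notin> {j, k, l}\<close> by blast
    then show "card ({fst a, snd a, m} \<inter> {j, k, l}) \<le> 1"
      by (metis card_mono finite.emptyI finite.insertI is_singletonI is_singleton_altdef)
  qed (use that m jkl in auto)
  have far_list: "sum_list (map (b3 m) L) + ?b = ?b + sum_list (map (b3 m) L)"
    if "\<And>a. a \<in> set L \<Longrightarrow> fst a < snd a \<and> snd a < m \<and> a \<notin> set tri" for L
    using that
  proof (induction L)
    case (Cons a L)
    then have "b3 m a + ?b = ?b + b3 m a" by (intro far) auto
    then show ?case using Cons by (simp add: add.assoc) (simp flip: add.assoc)
  qed simp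
  have hl: "sum_list (map (b3 m) (high m)) + ?b = ?b + sum_list (map (b3 m) (high m))"
    "sum_list (map (b3 m) (low m)) + ?b = ?b + sum_list (map (b3 m) (low m))"
    by (rule far_list; auto simp: set_high set_low)+
  define M where "M s = (if turn c0 j k m < 0 then if s then tri else rev tri else [])" for s
  \<comment> \<open>The relation for j, k, l, m moves the letter from left to right of the fan while
    reversing it. Multiplying by the involution \<open>?b\<close> on both sides yields the opposite
    passage, which is the one needed.\<close>
  have tet: "?b + (\<beta> j k m + \<beta> j l m + \<beta> k l m) = (\<beta> k l m + \<beta> j l m + \<beta> j k m) + ?b"
    using tetra[OF jkl(1,2) m] by (simp add: add.assoc)
  have bb: "?b + (?b + x) = x" for x
    using invol[OF jkl] by (simp flip: add.assoc)
  have "(\<beta> j k m + \<beta> j l m + \<beta> k l m) + ?b = ?b + ((?b + (\<beta> j k m + \<beta> j l m + \<beta> k l m)) + ?b)"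
    by (simp add: add.assoc bb)
  also have "\<dots> = ?b + (\<beta> k l m + \<beta> j l m + \<beta> j k m)"
    unfolding tet by (simp add: add.assoc invol[OF jkl])
  finally have mid: "sum_list (map (b3 m) (M True)) + ?b = ?b + sum_list (map (b3 m) (M False))"
    by (simp add: M_def add.assoc)
  have "level \<beta> c m = sum_list (map (b3 m) (high m)) + sum_list (map (b3 m) (M True)) + sum_list (map (b3 m) (low m))"
    using level_near_crossing[OF c(1) _ _ m] c(2) sgn by (simp add: M_def)
  moreover have "level \<beta> c' m = sum_list (map (b3 m) (high m)) + sum_list (map (b3 m) (M False)) + sum_list (map (b3 m) (low m))"
    using level_near_crossing[OF c'(1) _ _ m] c'(2) sgn by (simp add: M_def)
  moreover have "(h + M1 + lo) + ?b = ?b + (h + M2 + lo)"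
    if "h + ?b = ?b + h" "M1 + ?b = ?b + M2" "lo + ?b = ?b + lo" for h lo M1 M2 :: 'g
  proof -
    have "(h + M1 + lo) + ?b = h + (M1 + ?b) + lo" by (simp only: add.assoc that(3))
    also have "\<dots> = (h + ?b) + M2 + lo" by (simp only: that(2)) (simp only: add.assoc)
    also have "\<dots> = ?b + (h + M2 + lo)" by (simp only: that(1)) (simp only: add.assoc)
    finally show ?thesis .
  qed
  ultimately show ?thesis using hl mid by simp
qed

text \<open>At the wall point \<open>l\<close> lies on the line jk, and every other line above it is
  strictly higher. So jk is the lowest line above point \<open>l\<close> just before it disappears,
  and its letter is the last one of the level.\<close>

lemma level_crossing:
  assumes c: "incr n c" "turn c j k l < 0" and c': "incr n c'" "turn c' j k l > 0"
    and sgn: "\<And>p q r. p < q \<Longrightarrow> q < r \<Longrightarrow> r < n \<Longrightarrow> (p, q, r) \<noteq> (j, k, l) \<Longrightarrow>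
       sgn (turn c p q r) = sgn (turn c0 p q r) \<and> sgn (turn c' p q r) = sgn (turn c0 p q r)"
  shows "level \<beta> c l = level \<beta> c' l + \<beta> j k l"
proof -
  have sgn': "turn c p q r < 0 \<longleftrightarrow> turn c0 p q r < 0" "turn c p q r > 0 \<longleftrightarrow> turn c0 p q r > 0"
     "turn c' p q r < 0 \<longleftrightarrow> turn c0 p q r < 0" "turn c' p q r > 0 \<longleftrightarrow> turn c0 p q r > 0"
    if "p < q" "q < r" "r < n" "(p, q, r) \<noteq> (j, k, l)" for p q r
    using sgn[OF that] nondeg[OF that] by (auto simp: sgn_if split: if_splits)
  define Q where "Q = (\<lambda>a b. pair_disj a b \<or> ht c0 l b < ht c0 l a)"
  have Q1: "Q a b" if asm: "fst a < snd a" "snd a < l" "fst b < snd b" "snd b < l" "a \<noteq> b" 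
     "ht c l b \<le> ht c l a \<or> ht c' l b \<le> ht c' l a" for a b
  proof (cases "pair_disj a b")
    case False
    obtain p q r where pqr: "p < q" "q < r" "r < l" and
        opts: "(a, b) \<in> {((p,q),(p,r)), ((p,r),(p,q)), ((p,q),(q,r)), ((q,r),(p,q)), ((p,r),(q,r)), ((q,r),(p,r))}"
      by (rule sharing_pairs_cases[OF False asm(5,1,3,2,4)])
    have "turn c0 p q r \<noteq> 0" "sgn (turn c p q r) = sgn (turn c0 p q r)" "sgn (turn c' p q r) = sgn (turn c0 p q r)"
      using nondeg[of p q r] sgn[of p q r] pqr jkl by auto
    then have "ht c0 l b < ht c0 l a"
      using sharing_pairs_order[OF c(1) incr0 pqr jkl(3) opts] sharing_pairs_order[OF c'(1) incr0 pqr jkl(3) opts]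
        asm(6) by auto
    then show ?thesis by (simp add: Q_def)
  qed (simp add: Q_def)
  have "sum_list (map (b3 l) (above_list c l)) = sum_list (map (b3 l) (above_list c' l @ [(j, k)]))"
  proof (rule sum_list_commuting_rearrangement[OF distinct_above_list])
    show "distinct (above_list c' l @ [(j, k)])"
      using c' by (auto simp: distinct_above_list set_above_list)
    show "set (above_list c l) = set (above_list c' l @ [(j, k)])"
    proof (rule Set.set_eqI)
      fix a
      show "a \<in> set (above_list c l) \<longleftrightarrow> a \<in> set (above_list c' l @ [(j, k)])"
      proof (cases "a = (j, k)")
        case False
        then show ?thesis
          using sgn'(1)[of "fst a" "snd a" l] sgn'(3)[of "fst a" "snd a" l] jkl
          by (cases a) (auto simp: set_above_list)
      qed (use c jkl in \<open>auto simp: set_above_list\<close>)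
    qed
    show "sorted_wrt Q (above_list c l)"
      by (rule sorted_wrt_distinct_mono[OF distinct_above_list sorted_above_list], rule Q1) (auto simp: set_above_list)
    have "sorted_wrt Q (above_list c' l)"
      by (rule sorted_wrt_distinct_mono[OF distinct_above_list sorted_above_list], rule Q1) (auto simp: set_above_list)
    moreover have "Q a (j, k)" if "a \<in> set (above_list c' l)" for a
    proof -
      from that have a: "fst a < snd a" "snd a < l" "turn c' (fst a) (snd a) l < 0" "a \<noteq> (j, k)"
        using c' by (auto simp: set_above_list)
      then have "turn c0 (fst a) (snd a) l < 0" using sgn'(3)[of "fst a" "snd a" l] jkl by (auto simp: prod_eq_iff)
      then have "Im (c0 l) < ht c0 l a"
        using turn_ht[of c0 "fst a" "snd a" l] incrD[OF incr0, of "fst a" "snd a"] a jkl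
        by (simp add: mult_less_0_iff)
      moreover have "ht c0 l (j, k) = Im (c0 l)"
        using turn_ht[of c0 j k l] incrD[OF incr0, of j k] jkl turn0 by auto
      ultimately show ?thesis by (simp add: Q_def)
    qed
    ultimately show "sorted_wrt Q (above_list c' l @ [(j, k)])" by (simp add: sorted_wrt_append)
    show "b3 l a + b3 l b = b3 l b + b3 l a"
      if "a \<in> set (above_list c l)" "b \<in> set (above_list c l)" "Q a b" "Q b a" for a b
      by (rule b3_comm) (use that jkl in \<open>auto simp: set_above_list Q_def pair_disj_sym\<close>)
  qed
  then show ?thesis by (simp add: level_def)
qed

text \<open>A letter appended to the potential moves leftward through all levels beyond
  \<open>l\<close>, conjugating them into those of \<open>c'\<close>. It then meets the copy at the
  end of level \<open>l\<close>, and the two copies cancel.\<close>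

lemma pot_crossing:
  assumes c: "incr n c" "turn c j k l < 0" and c': "incr n c'" "turn c' j k l > 0"
    and sgn: "\<And>p q r. p < q \<Longrightarrow> q < r \<Longrightarrow> r < n \<Longrightarrow> (p, q, r) \<noteq> (j, k, l) \<Longrightarrow>
       sgn (turn c p q r) = sgn (turn c0 p q r) \<and> sgn (turn c' p q r) = sgn (turn c0 p q r)"
  shows "pot \<beta> n c' = pot \<beta> n c + \<beta> j k l"
proof -
  let ?b = "\<beta> j k l"
  have low_levels: "level \<beta> c m = level \<beta> c' m" if "m < l" for m
  proof (rule level_cong[OF c(1) c'(1)])
    fix p q r assume "p < q" "q < r" "r \<le> m"
    then have "turn c0 p q r \<noteq> 0" "sgn (turn c p q r) = sgn (turn c0 p q r)" "sgn (turn c' p q r) = sgn (turn c0 p q r)"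
      using sgn[of p q r] nondeg[of p q r] that jkl by auto
    then show "turn c p q r \<noteq> 0 \<and> sgn (turn c p q r) = sgn (turn c' p q r)"
      by (metis sgn_0_0)
  qed (use that jkl in auto)
  have high_levels: "sum_list (map (level \<beta> c) [Suc l..<N]) + ?b = ?b + sum_list (map (level \<beta> c') [Suc l..<N])"
    if "N \<le> n" for N
    using that
  proof (induction N)
    case (Suc N)
    show ?case
    proof (cases "Suc l \<le> N")
      case True
      then have "level \<beta> c N + ?b = ?b + level \<beta> c' N"
        using Suc.prems by (intro crossing_commutes_past_level[OF c c' sgn]) auto
      then have "sum_list (map (level \<beta> c) [Suc l..<N]) + (level \<beta> c N + ?b) 
          = (sum_list (map (level \<beta> c) [Suc l..<N]) + ?b) + level \<beta> c' N"
        by (simp only: add.assoc)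
      then show ?thesis using True Suc.IH Suc.prems by (simp add: add.assoc)
    qed simp
  qed simp
  have bb: "?b + (?b + x) = x" for x
    using invol[OF jkl] by (simp flip: add.assoc)
  have lc: "level \<beta> c l = level \<beta> c' l + ?b" by (rule level_crossing[OF c c' sgn])
  have split: "[0..<n] = [0..<l] @ l # [Suc l..<n]"
    using jkl upt_add_eq_append[of 0 l "n - l"] upt_conv_Cons[of l n] by simp
  let ?S = "sum_list (map (level \<beta> c) [0..<l])" and ?S' = "sum_list (map (level \<beta> c') [0..<l])"
  let ?T = "sum_list (map (level \<beta> c) [Suc l..<n])" and ?T' = "sum_list (map (level \<beta> c') [Suc l..<n])"
  have "?S = ?S'" using low_levels by (auto intro!: arg_cong[of _ _ sum_list])
  have "pot \<beta> n c + ?b = ?S + (level \<beta> c l + (?T + ?b))" by (simp add: pot_def split add.assoc)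
  also have "\<dots> = ?S + (level \<beta> c l + (?b + ?T'))" by (simp only: high_levels[of n])
  also have "\<dots> = ?S' + ((level \<beta> c' l + ?b) + (?b + ?T'))"
    by (simp only: lc \<open>?S = ?S'\<close>)
  also have "\<dots> = pot \<beta> n c'" by (simp add: pot_def split add.assoc bb)
  finally show ?thesis ..
qed

end

lemma pot_cong:
  assumes "incr n c" "incr n c'"
    and "\<And>p q r. p < q \<Longrightarrow> q < r \<Longrightarrow> r < n \<Longrightarrow> turn c p q r \<noteq> 0 \<and> sgn (turn c p q r) = sgn (turn c' p q r)"
  shows "pot \<beta> n c = pot \<beta> n c'"
  unfolding pot_def
  by (rule arg_cong[of _ _ sum_list], rule map_cong[OF HOL.refl], rule level_cong[OF assms(1,2)])
     (use assms(3) in auto)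

end

section \<open>Transverse polynomial paths\<close>

lemma Wronskian_zero_imp_proportional:
  fixes D E :: "real poly"
  assumes "D * pderiv E = pderiv D * E" "E \<noteq> 0"
  shows "\<exists>s. D = smult s E"
proof -
  obtain t where t: "poly E t \<noteq> 0" using assms(2) poly_all_0_iff_0 by blast
  \<comment> \<open>This difference vanishes at \<open>t\<close> while \<open>E\<close> does not. If
    it were nonzero, differentiation would lower its order of vanishing at \<open>t\<close> by one,
    but the identity bounds that order by the order of \<open>pderiv F\<close>.\<close>
  define F where "F = D - smult (poly D t / poly E t) E"
  have W: "F * pderiv E = pderiv F * E"
    using assms(1) by (simp add: F_def pderiv_diff pderiv_smult algebra_simps)
  have "F = 0"
  proof (rule ccontr)
    assume F: "F \<noteq> 0"
    have root: "poly F t = 0" using t by (simp add: F_def)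
    have F': "pderiv F \<noteq> 0" using F root pderiv_eq_0_iff[of F] by (auto elim: degree_eq_zeroE)
    have "order t (pderiv F * E) = order t (pderiv F)"
      using F' assms(2) t by (simp add: order_mult order_0I)
    moreover have "order t F \<le> order t (F * pderiv E)"
      using order_mult[of F "pderiv E" t] F' assms(2) W by simp
    ultimately show False using order_pderiv[OF F root] W by simp
  qed
  then show ?thesis by (auto simp: F_def)
qed

lemma finite_imp_MOST: "finite S \<Longrightarrow> (\<And>x. x \<notin> S \<Longrightarrow> P x) \<Longrightarrow> MOST x. P x"
  by (metis (mono_tags, lifting) MOST_iff_cofinite finite_subset mem_Collect_eq subsetI)

text \<open>A multiple root of D + rE away from the zeros of \<open>E\<close> is a zero of the
  Wronskian \<open>W\<close>, and there r = -D/E. So finitely many r are bad unless W = 0; in that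
  case D is a multiple of E and a single r is bad.\<close>

lemma MOST_simple_roots:
  fixes D E :: "real poly"
  shows "MOST r. \<forall>t. poly (D + smult r E) t = 0 \<longrightarrow> poly E t \<noteq> 0 \<longrightarrow> poly (pderiv (D + smult r E)) t \<noteq> 0"
proof (cases "E = 0")
  case False
  define W where "W = D * pderiv E - pderiv D * E"
  show ?thesis
  proof (cases "W = 0")
    case True
    then obtain s where s: "D = smult s E"
      using Wronskian_zero_imp_proportional[OF _ False] by (auto simp: W_def)
    show ?thesis
    proof (rule finite_imp_MOST[of "{- s}"])
      fix r assume "r \<notin> {- s}"
      then have "s + r \<noteq> 0" by auto
      moreover have "poly (D + smult r E) t = (s + r) * poly E t" for t
        by (simp add: s distrib_right)
      ultimately show "\<forall>t. poly (D + smult r E) t = 0 \<longrightarrow> poly E t \<noteq> 0 \<longrightarrow> poly (pderiv (D + smult r E)) t \<noteq> 0"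
        by simp
    qed simp
  next
    case W: False
    show ?thesis
    proof (rule finite_imp_MOST)
      show "finite ((\<lambda>t. - poly D t / poly E t) ` {t. poly W t = 0})"
        using W poly_roots_finite by blast
      fix r assume r: "r \<notin> (\<lambda>t. - poly D t / poly E t) ` {t. poly W t = 0}"
      show "\<forall>t. poly (D + smult r E) t = 0 \<longrightarrow> poly E t \<noteq> 0 \<longrightarrow> poly (pderiv (D + smult r E)) t \<noteq> 0"
      proof (intro allI impI notI)
        fix t assume *: "poly (D + smult r E) t = 0" "poly E t \<noteq> 0" "poly (pderiv (D + smult r E)) t = 0"
        then have 1: "poly D t = - r * poly E t" "poly (pderiv D) t = - r * poly (pderiv E) t"
          by (auto simp: pderiv_add pderiv_smult)
        then have "poly W t = 0" by (simp add: W_def)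
        moreover have "r = - poly D t / poly E t" using 1(1) *(2) by simp
        ultimately show False using r by blast
      qed
    qed
  qed
qed simp

text \<open>For fixed r, the parameter s deals with the roots at which \<open>E2\<close> is nonzero.
  A root at which \<open>E2\<close> vanishes but \<open>E1\<close> does not is already a root of D +
  rE1, one of finitely many; there s affects only the derivative, and at most one value of s is
  bad.\<close>

lemma MOST_MOST_simple_roots:
  fixes D E1 E2 :: "real poly"
  shows "MOST r. MOST s. \<forall>t. poly (D + smult r E1 + smult s E2) t = 0 \<longrightarrow> poly E1 t \<noteq> 0 \<or> poly E2 t \<noteq> 0 \<longrightarrow>
    poly (pderiv (D + smult r E1 + smult s E2)) t \<noteq> 0"
  using MOST_simple_roots[of D E1]
proof (rule MOST_mono)
  fix r 
  assume r: "\<forall>t. poly (D + smult r E1) t = 0 \<longrightarrow> poly E1 t \<noteq> 0 \<longrightarrow> poly (pderiv (D + smult r E1)) t \<noteq> 0"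
  define G where "G = D + smult r E1"
  define Z where "Z = {t. poly G t = 0 \<and> poly E1 t \<noteq> 0}"
  have "finite Z"
  proof (cases "G = 0")
    case True
    then have "Z = {}" using r by (auto simp: Z_def G_def)
    then show ?thesis by simp
  next
    case False
    then show ?thesis using poly_roots_finite[of G] by (auto simp: Z_def intro: finite_subset[rotated])
  qed
  then have "finite ((\<lambda>t. - poly (pderiv G) t / poly (pderiv E2) t) ` Z)" by simp
  then have "MOST s. s \<notin> (\<lambda>t. - poly (pderiv G) t / poly (pderiv E2) t) ` Z"
    by (rule finite_imp_MOST)
  then show "MOST s. \<forall>t. poly (D + smult r E1 + smult s E2) t = 0 \<longrightarrow> poly E1 t \<noteq> 0 \<or> poly E2 t \<noteq> 0 \<longrightarrow>
    poly (pderiv (D + smult r E1 + smult s E2)) t \<noteq> 0"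
    using MOST_simple_roots[of G E2]
  proof (rule MOST_rev_mp[OF MOST_conjI], intro ALL_MOST allI impI)
    fix s t
    assume s: "s \<notin> (\<lambda>t. - poly (pderiv G) t / poly (pderiv E2) t) ` Z \<and>
         (\<forall>t. poly (G + smult s E2) t = 0 \<longrightarrow> poly E2 t \<noteq> 0 \<longrightarrow> poly (pderiv (G + smult s E2)) t \<noteq> 0)"
      and t: "poly (D + smult r E1 + smult s E2) t = 0" "poly E1 t \<noteq> 0 \<or> poly E2 t \<noteq> 0"
    show "poly (pderiv (D + smult r E1 + smult s E2)) t \<noteq> 0"
    proof (cases "poly E2 t = 0")
      case True
      then have "t \<in> Z" "poly (pderiv G) t \<noteq> 0" using t r by (auto simp: Z_def G_def)
      moreover have "s \<noteq> - poly (pderiv G) t / poly (pderiv E2) t" using s \<open>t \<in> Z\<close> by blast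
      ultimately show ?thesis
        by (cases "poly (pderiv E2) t = 0")
          (auto simp: G_def[symmetric] pderiv_add pderiv_smult field_simps add_eq_0_iff)
    next
      case False
      then show ?thesis using s t(1) by (simp add: G_def)
    qed
  qed
qed

lemma MOST_MOST_avoid_point:
  fixes d e1 e2 :: real
  assumes "e1 \<noteq> 0 \<or> e2 \<noteq> 0"
  shows "MOST r. MOST s. d + r * e1 + s * e2 \<noteq> 0"
proof (cases "e2 = 0")
  case True
  then have "e1 \<noteq> 0" using assms by simp
  show ?thesis
  proof (rule finite_imp_MOST[of "{- d / e1}"])
    fix r assume "r \<notin> {- d / e1}"
    then have "d + r * e1 \<noteq> 0" using \<open>e1 \<noteq> 0\<close> by (auto simp: field_simps add_eq_0_iff)
    then show "MOST s. d + r * e1 + s * e2 \<noteq> 0" using True by simp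
  qed simp
next
  case False
  have "MOST s. d + r * e1 + s * e2 \<noteq> 0" for r
    by (rule finite_imp_MOST[of "{- (d + r * e1) / e2}"]) (use False in \<open>auto simp: field_simps add_eq_0_iff\<close>)
  then show ?thesis by simp
qed

text \<open>A common root at time t is a linear system for (r, s) with determinant \<Delta>(t), and
  Cramer's rule gives r = N1/\<Delta> and s = N2/\<Delta> there. If \<open>smult r \<Delta>\<close>
  differs from \<open>N1\<close>, this leaves finitely many times, and s avoids the value
  N2/\<Delta> at each of them.\<close>

lemma MOST_MOST_common_root:
  fixes D1 D2 A1 A2 B1 B2 :: "real poly"
  defines "\<Delta> \<equiv> A1 * B2 - A2 * B1"
  shows "MOST r. MOST s. \<forall>t. poly (D1 + smult r A1 + smult s A2) t = 0 \<longrightarrow>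
     poly (D2 + smult r B1 + smult s B2) t = 0 \<longrightarrow> poly \<Delta> t = 0"
proof (cases "\<Delta> = 0")
  case False
  define N1 N2 where "N1 = D2 * A2 - D1 * B2" and "N2 = D1 * B1 - D2 * A1"
  have "MOST r. N1 \<noteq> smult r \<Delta>"
  proof (cases "\<exists>r. N1 = smult r \<Delta>")
    case True
    then obtain r0 where r0: "N1 = smult r0 \<Delta>" by blast
    have "r = r0" if "N1 = smult r \<Delta>" for r
    proof -
      have "smult (r - r0) \<Delta> = 0" using that r0 by (simp add: smult_diff_left)
      then show ?thesis using False by simp
    qed
    then show ?thesis by (intro finite_imp_MOST[of "{r0}"]) auto
  qed simp
  then show ?thesis
  proof (rule MOST_mono)
    fix r assume "N1 \<noteq> smult r \<Delta>"
    then have "smult r \<Delta> - N1 \<noteq> 0" by auto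
    then have "finite {t. poly (smult r \<Delta> - N1) t = 0}" by (rule poly_roots_finite)
    then show "MOST s. \<forall>t. poly (D1 + smult r A1 + smult s A2) t = 0 \<longrightarrow>
       poly (D2 + smult r B1 + smult s B2) t = 0 \<longrightarrow> poly \<Delta> t = 0"
    proof (intro finite_imp_MOST[of "(\<lambda>t. poly N2 t / poly \<Delta> t) ` {t. poly (smult r \<Delta> - N1) t = 0}"] allI impI)
      fix s t
      assume s: "s \<notin> (\<lambda>t. poly N2 t / poly \<Delta> t) ` {t. poly (smult r \<Delta> - N1) t = 0}"
        and 0: "poly (D1 + smult r A1 + smult s A2) t = 0" "poly (D2 + smult r B1 + smult s B2) t = 0"
      have d1: "poly D1 t = - r * poly A1 t - s * poly A2 t" and d2: "poly D2 t = - r * poly B1 t - s * poly B2 t"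
        using 0 by auto
      have 1: "poly (smult r \<Delta> - N1) t = 0" 
        by (simp add: \<Delta>_def N1_def d1 d2 algebra_simps)
      have 2: "s * poly \<Delta> t = poly N2 t"
        by (simp add: \<Delta>_def N2_def d1 d2 algebra_simps)
      show "poly \<Delta> t = 0"
      proof (rule ccontr)
        assume "poly \<Delta> t \<noteq> 0"
        then have "s = poly N2 t / poly \<Delta> t" using 2 by (simp add: field_simps)
        then show False using s 1 by blast
      qed
    qed simp
  qed
qed simp

section \<open>Transversality by moving one strand at a time\<close>

definition turn_poly :: "(nat \<Rightarrow> real poly) \<Rightarrow> (nat \<Rightarrow> real poly) \<Rightarrow> nat \<Rightarrow> nat \<Rightarrow> nat \<Rightarrow> real poly" where
  "turn_poly X Y i j k = (X j - X i) * (Y k - Y i) - (X k - X i) * (Y j - Y i)"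

definition poly_strands :: "(nat \<Rightarrow> real poly) \<Rightarrow> (nat \<Rightarrow> real poly) \<Rightarrow> strands" where
  "poly_strands X Y = (\<lambda>j t. Complex (poly (X j) t) (poly (Y j) t))"

lemma turn_poly_strands: "turn (\<lambda>j. poly_strands X Y j t) i j k = poly (turn_poly X Y i j k) t"
  by (simp add: turn_def turn_poly_def poly_strands_def)

text \<open>Uniqueness is stated for sets of indices because all orderings of a collinear triple
  vanish together.\<close>

definition transverse :: "nat set \<Rightarrow> (nat \<Rightarrow> real poly) \<Rightarrow> (nat \<Rightarrow> real poly) \<Rightarrow> bool" where
  "transverse J X Y \<longleftrightarrow> (\<forall>t\<in>{0..1}. \<forall>i j k. {i, j, k} \<subseteq> J \<longrightarrow> distinct [i, j, k] \<longrightarrow>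
     poly (turn_poly X Y i j k) t = 0 \<longrightarrow>
     poly (pderiv (turn_poly X Y i j k)) t \<noteq> 0 \<and>
     (\<forall>p q r. {p, q, r} \<subseteq> J \<longrightarrow> distinct [p, q, r] \<longrightarrow> poly (turn_poly X Y p q r) t = 0 \<longrightarrow>
        {p, q, r} = {i, j, k}))"

lemma transverse_cong:
  assumes "transverse J X Y" "\<And>j. j \<in> J \<Longrightarrow> X' j = X j" "\<And>j. j \<in> J \<Longrightarrow> Y' j = Y j"
  shows "transverse J X' Y'"
proof -
  have eq: "turn_poly X' Y' i j k = turn_poly X Y i j k" if "{i, j, k} \<subseteq> J" for i j k
    using that assms(2,3) by (simp add: turn_poly_def)
  show ?thesis
    unfolding transverse_def
  proof (intro ballI allI impI conjI)
    fix t i j k p q r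
    assume *: "t \<in> {0..1::real}" "{i, j, k} \<subseteq> J" "distinct [i, j, k]" "poly (turn_poly X' Y' i j k) t = 0"
    note 1 = assms(1)[unfolded transverse_def, rule_format, OF *(1-3) *(4)[unfolded eq[OF *(2)]]]
    show "poly (pderiv (turn_poly X' Y' i j k)) t \<noteq> 0"
      unfolding eq[OF *(2)] by (rule 1[THEN conjunct1])
    assume **: "{p, q, r} \<subseteq> J" "distinct [p, q, r]" "poly (turn_poly X' Y' p q r) t = 0"
    show "{p, q, r} = {i, j, k}"
      using 1[THEN conjunct2, rule_format, OF **(1,2) **(3)[unfolded eq[OF **(1)]]] .
  qed
qed

lemma turn_poly_rotate: "turn_poly X Y j k i = turn_poly X Y i j k"
  by (simp add: turn_poly_def algebra_simps)

text \<open>Rotating a triple preserves the signed area, so a triple through the moved strand may be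
  written with that strand first.\<close>

lemma turn_poly_start:
  assumes "distinct [i, j, k]" "x \<in> {i, j, k}"
  obtains k' l' where "{x, k', l'} = {i, j, k}" "distinct [x, k', l']" "turn_poly X Y i j k = turn_poly X Y x k' l'"
proof -
  consider "x = i" | "x = j" | "x = k" using assms by auto
  then show ?thesis
  proof cases
    case 1 show ?thesis by (rule that[of j k]) (use 1 assms in auto)
  next
    case 2 show ?thesis by (rule that[of k i]) (use 2 assms turn_poly_rotate[of X Y j k i] in auto)
  next
    case 3 show ?thesis by (rule that[of i j])
      (use 3 assms turn_poly_rotate[of X Y j k i] turn_poly_rotate[of X Y k i j] in auto)
  qed
qed

lemma cross_zero_trans:
  fixes u1 :: real
  assumes "v1 \<noteq> 0 \<or> v2 \<noteq> 0" "u1 * v2 = u2 * v1" "v1 * x2 = v2 * x1"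
  shows "u1 * x2 = u2 * x1"
proof -
  have "v1 * (u1 * x2 - u2 * x1) = 0" "v2 * (u1 * x2 - u2 * x1) = 0"
    using assms(2,3) by algebra+
  then show ?thesis using assms(1) by auto
qed

text \<open>The lines kl and pq are parallel and both pass through point \<open>j\<close>, hence are
  equal. The signs in \<open>par\<close> are those in which the determinant of
  \<open>MOST_MOST_common_root\<close> delivers parallelism.\<close>

lemma turn_zero_if_lines_coincide:
  assumes "c p \<noteq> c q" "c k \<noteq> c l"
    and par: "(Im (c k) - Im (c l)) * (Re (c q) - Re (c p)) = (Re (c l) - Re (c k)) * (Im (c p) - Im (c q))"
    and "turn c j k l = 0" "turn c j p q = 0"
  shows "turn c k l p = 0" "turn c k l q = 0"
proof -
  let ?u1 = "Re (c k) - Re (c l)" and ?u2 = "Im (c k) - Im (c l)"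
  let ?v1 = "Re (c p) - Re (c q)" and ?v2 = "Im (c p) - Im (c q)"
  have uv: "?u1 * ?v2 = ?u2 * ?v1" using par by (simp add: algebra_simps)
  have "?v1 * (Im (c j) - Im (c q)) = ?v2 * (Re (c j) - Re (c q))"
    using assms(5) by (simp add: turn_def algebra_simps)
  moreover have "?v1 \<noteq> 0 \<or> ?v2 \<noteq> 0" using assms(1) by (auto simp: complex_eq_iff)
  ultimately have 1: "?u1 * (Im (c j) - Im (c q)) = ?u2 * (Re (c j) - Re (c q))"
    using cross_zero_trans uv by blast
  have 2: "?u1 * (Im (c j) - Im (c l)) = ?u2 * (Re (c j) - Re (c l))"
    using assms(4) by (simp add: turn_def algebra_simps)
  show "turn c k l q = 0" "turn c k l p = 0" unfolding turn_def using 1 2 uv by algebra+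
qed

text \<open>This is t (1 - t): it moves a strand at all inner times and fixes both ends.\<close>

abbreviation bump_poly :: "real poly" where
  "bump_poly \<equiv> [:0, 1, -1:]"

lemma poly_bump: "poly bump_poly t \<noteq> 0 \<longleftrightarrow> t \<noteq> 0 \<and> t \<noteq> 1"
  by (auto simp: algebra_simps)

lemma MOST_MOST_conj:
  "(MOST r. MOST s. P r s) \<Longrightarrow> (MOST r. MOST s. Q r s) \<Longrightarrow> MOST r. MOST s. P r s \<and> Q r s"
  by (simp add: MOST_conj_distrib)

lemma MOST_MOST_ball:
  "finite A \<Longrightarrow> (\<And>x. x \<in> A \<Longrightarrow> MOST r. MOST s. P x r s) \<Longrightarrow> MOST r. MOST s. \<forall>x\<in>A. P x r s"
  by (simp add: MOST_finite_Ball_distrib)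

lemma transverse_finite:
  assumes "finite J" "transverse J X Y"
  shows "finite {t \<in> {0..1}. \<exists>i j k. {i, j, k} \<subseteq> J \<and> distinct [i, j, k] \<and> poly (turn_poly X Y i j k) t = 0}"
proof -
  have "finite {t \<in> {0..1}. distinct [i, j, k] \<and> poly (turn_poly X Y i j k) t = 0}" if "{i, j, k} \<subseteq> J" for i j k
  proof (cases "turn_poly X Y i j k = 0 \<and> distinct [i, j, k]")
    case True
    \<comment> \<open>The zero polynomial would vanish at time 0 together with its
      derivative.\<close>
    then have False using assms(2)[unfolded transverse_def, rule_format, of 0 i j k] that by simp
    then show ?thesis ..
  next
    case False
    then show ?thesis using poly_roots_finite[of "turn_poly X Y i j k"]
      by (auto intro: finite_subset[rotated])
  qed
  then have "finite (\<Union>i\<in>J. \<Union>j\<in>J. \<Union>k\<in>J. {t \<in> {0..1}. distinct [i, j, k] \<and> poly (turn_poly X Y i j k) t = 0})"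
    using assms(1) by auto
  then show ?thesis by (rule finite_subset[rotated]) auto
qed

text \<open>The signed area is affine in the position of a single vertex, so moving strand
  \<open>j0\<close> alone changes the polynomial of a triple j0, k, l exactly by
  \<open>smult r (E1 k l) + smult s (E2 k l)\<close>, where \<open>E1\<close> and \<open>E2\<close>
  are the bump times the gradient. This makes the one-strand step a question about linear
  families.\<close>

lemma MOST_transverse_insert:
  assumes J: "finite J" "j0 \<notin> J" "transverse J X Y"
    and dist: "\<And>t k l. t \<in> {0<..<1} \<Longrightarrow> k \<in> J \<Longrightarrow> l \<in> J \<Longrightarrow> k \<noteq> l \<Longrightarrow> poly_strands X Y k t \<noteq> poly_strands X Y l t"
    and ends: "\<And>t i j k. t \<in> {0, 1} \<Longrightarrow> {i, j, k} \<subseteq> insert j0 J \<Longrightarrow> distinct [i, j, k] \<Longrightarrow> 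
       poly (turn_poly X Y i j k) t \<noteq> 0"
  shows "MOST r. MOST s. transverse (insert j0 J)
     (X(j0 := X j0 + smult r bump_poly)) (Y(j0 := Y j0 + smult s bump_poly))"
proof -
  define E1 where "E1 k l = bump_poly * (Y k - Y l)" for k l
  define E2 where "E2 k l = bump_poly * (X l - X k)" for k l
  define D where "D = turn_poly X Y j0"
  define F where "F = {t \<in> {0..1}. \<exists>i j k. {i, j, k} \<subseteq> J \<and> distinct [i, j, k] \<and> poly (turn_poly X Y i j k) t = 0}"
  have "finite F" unfolding F_def using J transverse_finite by blast
  have FI: "t \<in> F" if "t \<in> {0..1}" "{i, j, k} \<subseteq> J" "distinct [i, j, k]" "poly (turn_poly X Y i j k) t = 0" for t i j k
    unfolding F_def using that by blast
  have A: "MOST r. MOST s. \<forall>k\<in>J. \<forall>l\<in>J. \<forall>t. poly (D k l + smult r (E1 k l) + smult s (E2 k l)) t = 0 \<longrightarrow> 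
     poly (E1 k l) t \<noteq> 0 \<or> poly (E2 k l) t \<noteq> 0 \<longrightarrow>
     poly (pderiv (D k l + smult r (E1 k l) + smult s (E2 k l))) t \<noteq> 0"
    by (intro MOST_MOST_ball J(1) MOST_MOST_simple_roots)
  have B: "MOST r. MOST s. \<forall>k\<in>J. \<forall>l\<in>J. \<forall>t\<in>F. poly (E1 k l) t \<noteq> 0 \<or> poly (E2 k l) t \<noteq> 0 \<longrightarrow>
     poly (D k l) t + r * poly (E1 k l) t + s * poly (E2 k l) t \<noteq> 0"
  proof (intro MOST_MOST_ball J(1) \<open>finite F\<close>)
    fix k l t 
    show "MOST r. MOST s. poly (E1 k l) t \<noteq> 0 \<or> poly (E2 k l) t \<noteq> 0 \<longrightarrow>
     poly (D k l) t + r * poly (E1 k l) t + s * poly (E2 k l) t \<noteq> 0"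
      using MOST_MOST_avoid_point[of "poly (E1 k l) t" "poly (E2 k l) t" "poly (D k l) t"]
      by (cases "poly (E1 k l) t \<noteq> 0 \<or> poly (E2 k l) t \<noteq> 0") auto
  qed
  have C: "MOST r. MOST s. \<forall>k\<in>J. \<forall>l\<in>J. \<forall>p\<in>J. \<forall>q\<in>J. \<forall>t.
     poly (D k l + smult r (E1 k l) + smult s (E2 k l)) t = 0 \<longrightarrow>
     poly (D p q + smult r (E1 p q) + smult s (E2 p q)) t = 0 \<longrightarrow>
     poly (E1 k l * E2 p q - E2 k l * E1 p q) t = 0"
    by (intro MOST_MOST_ball J(1) MOST_MOST_common_root)
  from MOST_MOST_conj[OF A MOST_MOST_conj[OF B C]]
  show ?thesis
  proof (rule MOST_mono)
    fix r
    assume "MOST s. (\<forall>k\<in>J. \<forall>l\<in>J. \<forall>t. poly (D k l + smult r (E1 k l) + smult s (E2 k l)) t = 0 \<longrightarrow> 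
     poly (E1 k l) t \<noteq> 0 \<or> poly (E2 k l) t \<noteq> 0 \<longrightarrow>
     poly (pderiv (D k l + smult r (E1 k l) + smult s (E2 k l))) t \<noteq> 0) \<and>
     (\<forall>k\<in>J. \<forall>l\<in>J. \<forall>t\<in>F. poly (E1 k l) t \<noteq> 0 \<or> poly (E2 k l) t \<noteq> 0 \<longrightarrow>
     poly (D k l) t + r * poly (E1 k l) t + s * poly (E2 k l) t \<noteq> 0) \<and>
     (\<forall>k\<in>J. \<forall>l\<in>J. \<forall>p\<in>J. \<forall>q\<in>J. \<forall>t.
     poly (D k l + smult r (E1 k l) + smult s (E2 k l)) t = 0 \<longrightarrow>
     poly (D p q + smult r (E1 p q) + smult s (E2 p q)) t = 0 \<longrightarrow>
     poly (E1 k l * E2 p q - E2 k l * E1 p q) t = 0)"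
    then show "MOST s. transverse (insert j0 J)
     (X(j0 := X j0 + smult r bump_poly)) (Y(j0 := Y j0 + smult s bump_poly))"
    proof (rule MOST_mono, elim conjE)
      fix s
      define X' Y' where "X' = X(j0 := X j0 + smult r bump_poly)" and "Y' = Y(j0 := Y j0 + smult s bump_poly)"
      assume simple: "\<forall>k\<in>J. \<forall>l\<in>J. \<forall>t. poly (D k l + smult r (E1 k l) + smult s (E2 k l)) t = 0 \<longrightarrow> 
           poly (E1 k l) t \<noteq> 0 \<or> poly (E2 k l) t \<noteq> 0 \<longrightarrow>
           poly (pderiv (D k l + smult r (E1 k l) + smult s (E2 k l))) t \<noteq> 0"
        and avoid: "\<forall>k\<in>J. \<forall>l\<in>J. \<forall>t\<in>F. poly (E1 k l) t \<noteq> 0 \<or> poly (E2 k l) t \<noteq> 0 \<longrightarrow>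
           poly (D k l) t + r * poly (E1 k l) t + s * poly (E2 k l) t \<noteq> 0"
        and common: "\<forall>k\<in>J. \<forall>l\<in>J. \<forall>p\<in>J. \<forall>q\<in>J. \<forall>t.
           poly (D k l + smult r (E1 k l) + smult s (E2 k l)) t = 0 \<longrightarrow>
           poly (D p q + smult r (E1 p q) + smult s (E2 p q)) t = 0 \<longrightarrow>
           poly (E1 k l * E2 p q - E2 k l * E1 p q) t = 0"
      have new: "turn_poly X' Y' j0 k l = D k l + smult r (E1 k l) + smult s (E2 k l)" if "k \<in> J" "l \<in> J" for k l
      proof -
        have "k \<noteq> j0" "l \<noteq> j0" using that J by auto
        then show ?thesis
          by (simp add: turn_poly_def X'_def Y'_def D_def E1_def E2_def smult_diff_right smult_add_right algebra_simps)
      qed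
      have old: "turn_poly X' Y' i j k = turn_poly X Y i j k" if "{i, j, k} \<subseteq> J" for i j k
      proof -
        have "i \<noteq> j0" "j \<noteq> j0" "k \<noteq> j0" using that J by auto
        then show ?thesis by (simp add: turn_poly_def X'_def Y'_def)
      qed
      have ends': "poly (turn_poly X' Y' i j k) t \<noteq> 0" if "t \<in> {0, 1}" "{i, j, k} \<subseteq> insert j0 J" "distinct [i, j, k]" for t i j k
      proof -
        have "poly (X' i) t = poly (X i) t" "poly (Y' i) t = poly (Y i) t" for i
          using that(1) by (auto simp: X'_def Y'_def)
        then have "poly (turn_poly X' Y' i j k) t = poly (turn_poly X Y i j k) t" by (simp add: turn_poly_def)
        then show ?thesis using ends that by metis
      qed
      have E1_val: "poly (E1 k l) t = poly bump_poly t * (poly (Y k) t - poly (Y l) t)"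
        and E2_val: "poly (E2 k l) t = poly bump_poly t * (poly (X l) t - poly (X k) t)" for k l t
        by (simp_all only: E1_def E2_def poly_mult poly_diff)
      have E_nz: "poly (E1 k l) t \<noteq> 0 \<or> poly (E2 k l) t \<noteq> 0" if "t \<in> {0<..<1}" "k \<in> J" "l \<in> J" "k \<noteq> l" for t k l
      proof -
        have "poly bump_poly t \<noteq> 0" unfolding poly_bump using that(1) by auto
        then show ?thesis using dist[OF that] unfolding E1_val E2_val by (auto simp: poly_strands_def)
      qed
      \<comment> \<open>A triple through \<open>j0\<close> shares its critical moment with no other triple: the case of a
        triple in \<open>J\<close> is avoided directly, and two triples through \<open>j0\<close> would force one in \<open>J\<close>.\<close>
      have avoid': "poly (turn_poly X' Y' j0 k l) t \<noteq> 0" if "t \<in> F" "t \<in> {0<..<1}" "k \<in> J" "l \<in> J" "k \<noteq> l" for t k l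
        using avoid that E_nz[OF that(2-5)] new[OF that(3,4)] by auto
      have uniq: "{p, q} = {k, l}" if t: "t \<in> {0<..<1}" and kl: "k \<in> J" "l \<in> J" "k \<noteq> l" and pq: "p \<in> J" "q \<in> J" "p \<noteq> q"
        and 0: "poly (turn_poly X' Y' j0 k l) t = 0" "poly (turn_poly X' Y' j0 p q) t = 0" for t k l p q
      proof (rule ccontr)
        assume ne: "{p, q} \<noteq> {k, l}"
        define c where "c = (\<lambda>j. poly_strands X' Y' j t)"
        have c_eq: "c i = poly_strands X Y i t" if "i \<in> J" for i
          using that J by (auto simp: c_def poly_strands_def X'_def Y'_def)
        have nz: "poly bump_poly t \<noteq> 0" unfolding poly_bump using t by auto
        \<comment> \<open>The determinant is the square of the bump times the cross product of the
          directions of kl and pq. At an inner time it vanishes only if these lines are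
          parallel.\<close>
        have "poly (E1 k l * E2 p q - E2 k l * E1 p q) t = 0" using common 0 new kl pq by metis
        then have "poly bump_poly t * poly bump_poly t * ((poly (Y k) t - poly (Y l) t) * (poly (X q) t - poly (X p) t)
           - (poly (X l) t - poly (X k) t) * (poly (Y p) t - poly (Y q) t)) = 0"
          unfolding poly_diff poly_mult E1_val E2_val by algebra
        then have par: "(Im (c k) - Im (c l)) * (Re (c q) - Re (c p)) = (Re (c l) - Re (c k)) * (Im (c p) - Im (c q))"
          using nz kl pq unfolding mult_eq_0_iff by (simp add: c_eq poly_strands_def)
        have "turn c j0 k l = 0" "turn c j0 p q = 0" using 0 by (simp_all add: c_def turn_poly_strands)
        moreover have "c p \<noteq> c q" "c k \<noteq> c l" using dist[OF t] kl pq by (auto simp: c_eq)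
        ultimately have "turn c k l p = 0" "turn c k l q = 0" using turn_zero_if_lines_coincide par by blast+
        then have z: "poly (turn_poly X Y k l p) t = 0" "poly (turn_poly X Y k l q) t = 0"
          unfolding c_def turn_poly_strands using old kl pq by auto
        have "t \<in> F"
        proof (cases "p \<in> {k, l}")
          case True
          then have "distinct [k, l, q]" using ne kl pq by auto
          then show ?thesis using z(2) t kl pq by (intro FI[of t k l q]) auto
        next
          case False
          then have "distinct [k, l, p]" using ne kl pq by auto
          then show ?thesis using z(1) t kl pq by (intro FI[of t k l p]) auto
        qed
        then show False using avoid'[OF _ t kl] 0 by blast
      qed
      have main: "poly (pderiv (turn_poly X' Y' i j k)) t \<noteq> 0 \<and> {p, q, r} = {i, j, k}"
        if t: "t \<in> {0..1}" and ijk: "{i, j, k} \<subseteq> insert j0 J" "distinct [i, j, k]" "poly (turn_poly X' Y' i j k) t = 0"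
          and pqr: "{p, q, r} \<subseteq> insert j0 J" "distinct [p, q, r]" "poly (turn_poly X' Y' p q r) t = 0" for t i j k p q r
      proof -
        have "t \<noteq> 0" "t \<noteq> 1" using ends' ijk by auto
        then have t': "t \<in> {0<..<1}" using t by auto
        have inF: "t \<in> F" if "{i, j, k} \<subseteq> J" "distinct [i, j, k]" "poly (turn_poly X' Y' i j k) t = 0" for i j k
          using that t old FI[of t i j k] by simp
        consider "j0 \<in> {i, j, k}" "j0 \<in> {p, q, r}" | "j0 \<notin> {i, j, k}" "j0 \<notin> {p, q, r}" 
          | "j0 \<in> {i, j, k} \<longleftrightarrow> j0 \<notin> {p, q, r}" by blast
        then show ?thesis
        proof cases
          case 1
          obtain k' l' where kl: "{j0, k', l'} = {i, j, k}" "distinct [j0, k', l']" "turn_poly X' Y' i j k = turn_poly X' Y' j0 k' l'"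
            by (rule turn_poly_start[OF ijk(2) 1(1)])
          obtain p' q' where pq: "{j0, p', q'} = {p, q, r}" "distinct [j0, p', q']" "turn_poly X' Y' p q r = turn_poly X' Y' j0 p' q'"
            by (rule turn_poly_start[OF pqr(2) 1(2)])
          have in': "k' \<in> J" "l' \<in> J" "k' \<noteq> l'" "p' \<in> J" "q' \<in> J" "p' \<noteq> q'"
            using kl(2) pq(2) ijk(1) pqr(1) unfolding kl(1)[symmetric] pq(1)[symmetric] by auto
          have "{p', q'} = {k', l'}" by (rule uniq[OF t' in']) (use ijk(3) pqr(3) kl(3) pq(3) in simp_all)
          moreover have "poly (pderiv (turn_poly X' Y' i j k)) t \<noteq> 0"
            using simple in' E_nz[OF t' in'(1-3)] ijk(3) unfolding kl(3) new[OF in'(1,2)] by blast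
          ultimately show ?thesis unfolding kl(1)[symmetric] pq(1)[symmetric] by simp
        next
          case 2
          then have "{i, j, k} \<subseteq> J" "{p, q, r} \<subseteq> J" using ijk pqr by auto
          then show ?thesis
            using J(3)[unfolded transverse_def, rule_format, of t i j k] ijk(2,3) pqr(2,3) t
            by (simp only: old) blast
        next
          case 3
          have contra: False
            if abc: "{a, b, c} \<subseteq> insert j0 J" "j0 \<in> {a, b, c}" "distinct [a, b, c]" "poly (turn_poly X' Y' a b c) t = 0"
              and abc': "{a', b', c'} \<subseteq> J" "distinct [a', b', c']" "poly (turn_poly X' Y' a' b' c') t = 0" for a b c a' b' c'
          proof -
            obtain k' l' where kl: "{j0, k', l'} = {a, b, c}" "distinct [j0, k', l']" "turn_poly X' Y' a b c = turn_poly X' Y' j0 k' l'"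
              by (rule turn_poly_start[OF abc(3,2)])
            have "k' \<in> J" "l' \<in> J" "k' \<noteq> l'" using kl(2) abc(1) unfolding kl(1)[symmetric] by auto
            then have "poly (turn_poly X' Y' j0 k' l') t \<noteq> 0" by (rule avoid'[OF inF[OF abc'] t'])
            then show False using abc(4) kl(3) by simp
          qed
          show ?thesis
          proof (cases "j0 \<in> {i, j, k}")
            case True
            then have "{p, q, r} \<subseteq> J" using 3 pqr(1) by blast
            then show ?thesis using contra[OF ijk(1) True ijk(2,3) _ pqr(2,3)] by blast
          next
            case False
            then have "{i, j, k} \<subseteq> J" "j0 \<in> {p, q, r}" using 3 ijk(1) by blast+
            then show ?thesis using contra[OF pqr(1) _ pqr(2,3) _ ijk(2,3)] by blast
          qed
        qed
      qed
      show "transverse (insert j0 J) X' Y'"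
        unfolding transverse_def
      proof (intro ballI allI impI conjI)
        fix t i j k p q r
        assume t: "t \<in> {0..1::real}" and ijk: "{i, j, k} \<subseteq> insert j0 J" "distinct [i, j, k]" "poly (turn_poly X' Y' i j k) t = 0"
        show "poly (pderiv (turn_poly X' Y' i j k)) t \<noteq> 0" by (rule conjunct1[OF main[OF t ijk ijk]])
        assume "{p, q, r} \<subseteq> insert j0 J" "distinct [p, q, r]" "poly (turn_poly X' Y' p q r) t = 0"
        then show "{p, q, r} = {i, j, k}" by (rule conjunct2[OF main[OF t ijk]])
      qed
    qed
  qed
qed

text \<open>The minimum of finitely many bounds serves for all, as each condition persists when its
  bound shrinks.\<close>

lemma finite_uniform_positive:
  assumes "finite A" "\<And>x. x \<in> A \<Longrightarrow> \<exists>d>0::real. P x d" "\<And>x d e. P x d \<Longrightarrow> 0 < e \<Longrightarrow> e \<le> d \<Longrightarrow> P x e"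
  shows "\<exists>d>0. \<forall>x\<in>A. P x d"
  using assms(1,2)
proof (induction A)
  case (insert x A)
  then obtain d e where "d > 0" "\<forall>y\<in>A. P y d" "e > 0" "P x e" by (metis insertCI)
  then show ?case using assms(3) by (intro exI[of _ "min d e"]) (auto simp: min_def)
qed (auto intro: exI[of _ 1])

lemma strands_separated:
  fixes z :: strands
  assumes "\<And>j. j \<in> {1..n} \<Longrightarrow> continuous_on {0..1} (z j)" "\<And>t. t \<in> {0..1} \<Longrightarrow> inj_on (\<lambda>j. z j t) {1..n}"
  obtains d where "d > 0" "\<And>t j k. t \<in> {0..1} \<Longrightarrow> j \<in> {1..n} \<Longrightarrow> k \<in> {1..n} \<Longrightarrow> j \<noteq> k \<Longrightarrow> d \<le> dist (z j t) (z k t)"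
proof -
  have "\<exists>d>0. \<forall>x\<in>{1..n} \<times> {1..n}. fst x \<noteq> snd x \<longrightarrow> (\<forall>t\<in>{0..1}. d \<le> dist (z (fst x) t) (z (snd x) t))"
  proof (rule finite_uniform_positive)
    fix x assume x: "x \<in> {1..n} \<times> {1..n}"
    have "continuous_on {0..1} (\<lambda>t. dist (z (fst x) t) (z (snd x) t))"
      using x by (intro continuous_intros assms) auto
    then obtain t0 where t0: "t0 \<in> {0..1}" "\<And>t. t \<in> {0..1} \<Longrightarrow> dist (z (fst x) t0) (z (snd x) t0) \<le> dist (z (fst x) t) (z (snd x) t)"
      using continuous_attains_inf[of "{0..1::real}" "\<lambda>t. dist (z (fst x) t) (z (snd x) t)"] by auto
    show "\<exists>d>0. fst x \<noteq> snd x \<longrightarrow> (\<forall>t\<in>{0..1}. d \<le> dist (z (fst x) t) (z (snd x) t))"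
    proof (cases "fst x = snd x")
      case False
      then have "z (fst x) t0 \<noteq> z (snd x) t0"
        using assms(2)[OF t0(1)] x by (auto dest: inj_onD)
      then show ?thesis using t0 by (intro exI[of _ "dist (z (fst x) t0) (z (snd x) t0)"]) auto
    qed (auto intro: exI[of _ 1])
  qed force+
  then show ?thesis using that by force
qed

definition generic :: "nat \<Rightarrow> (nat \<Rightarrow> complex) \<Rightarrow> bool" where
  "generic n c \<longleftrightarrow> (\<forall>i j k. {i, j, k} \<subseteq> {1..n} \<longrightarrow> distinct [i, j, k] \<longrightarrow> turn c i j k \<noteq> 0)"

lemma real_polynomial_function_poly:
  assumes "real_polynomial_function f"
  obtains p where "f = poly p"
proof -
  obtain a N where "f = (\<lambda>x. \<Sum>i\<le>N. a i * x ^ i)" using real_polynomial_function_imp_sum[OF assms] by blast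
  then have "f = poly (\<Sum>i\<le>N. monom (a i) i)" by (simp add: fun_eq_iff poly_sum poly_monom)
  then show ?thesis using that by blast
qed

lemma polynomial_function_poly_strand:
  fixes g :: "real \<Rightarrow> complex"
  assumes "polynomial_function g"
  obtains p q where "g = (\<lambda>t. Complex (poly p t) (poly q t))"
proof -
  have "real_polynomial_function (Re \<circ> g)" "real_polynomial_function (Im \<circ> g)"
    using assms bounded_linear_Re bounded_linear_Im unfolding polynomial_function_def by blast+
  then obtain p q where "Re \<circ> g = poly p" "Im \<circ> g = poly q"
    using real_polynomial_function_poly by metis
  then have "g = (\<lambda>t. Complex (poly p t) (poly q t))"
    by (auto simp: fun_eq_iff complex_eq_iff)
  then show ?thesis using that by blast
qed

text \<open>The bump is at most 1/4, so the displacement is at most a quarter of |r j| + |s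
  j|.\<close>

lemma bump_perturbation_close:
  assumes "\<bar>r j\<bar> < \<eta>" "\<bar>s j\<bar> < \<eta>" "t \<in> {0..1}"
  shows "dist (poly_strands (\<lambda>j. X j + smult (r j) bump_poly) (\<lambda>j. Y j + smult (s j) bump_poly) j t) (poly_strands X Y j t) < \<eta>"
    (is "dist ?w ?z < \<eta>")
proof -
  define b where "b = poly bump_poly t"
  have "b = t * (1 - t)" by (simp add: b_def algebra_simps)
  moreover have "0 \<le> t * (1 - t)" using assms by simp
  moreover have "t * (1 - t) \<le> 1 / 4"
    using sum_power2_ge_zero[of "t - 1/2" 0] by (simp add: power2_eq_square algebra_simps)
  ultimately have b: "\<bar>b\<bar> \<le> 1 / 4" by simp
  have "?w - ?z = Complex (r j * b) (s j * b)"
    by (simp only: poly_strands_def complex_eq_iff minus_complex.simps complex.sel poly_add poly_smult b_def) simp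
  then have "cmod (?w - ?z) \<le> \<bar>r j\<bar> * \<bar>b\<bar> + \<bar>s j\<bar> * \<bar>b\<bar>"
    using cmod_le[of "?w - ?z"] by (simp add: abs_mult)
  also have "\<dots> \<le> \<bar>r j\<bar> * (1 / 4) + \<bar>s j\<bar> * (1 / 4)" using b by (intro add_mono mult_left_mono) auto
  also have "\<dots> < \<eta>" using assms by auto
  finally show ?thesis by (simp add: dist_norm)
qed

lemma MOST_imp_ex_interval:
  fixes \<eta> :: real
  assumes "MOST x. P x" "\<eta> > 0"
  shows "\<exists>x\<in>{-\<eta><..<\<eta>}. P x"
proof (rule ccontr)
  assume "\<not> ?thesis"
  then have "{-\<eta><..<\<eta>} \<subseteq> {x. \<not> P x}" by auto
  then have "finite {-\<eta><..<\<eta>}" using assms(1) unfolding MOST_iff_cofinite by (rule finite_subset)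
  then show False using infinite_Ioo[of "-\<eta>" \<eta>] assms(2) by simp
qed

text \<open>Separation 2\<eta> and displacements below \<eta> keep the points distinct at every
  stage. That is what makes the gradients in \<open>MOST_transverse_insert\<close> nonzero at inner
  times.\<close>

lemma transverse_small_perturbation:
  assumes dist: "\<And>t j k. t \<in> {0..1} \<Longrightarrow> j \<in> {1..n} \<Longrightarrow> k \<in> {1..n} \<Longrightarrow> j \<noteq> k \<Longrightarrow> 
       2 * \<eta> \<le> dist (poly_strands X Y j t) (poly_strands X Y k t)"
    and ends: "generic n (\<lambda>j. poly_strands X Y j 0)" "generic n (\<lambda>j. poly_strands X Y j 1)" and "\<eta> > 0" "m \<le> n"
  shows "\<exists>r s. (\<forall>j. \<bar>r j\<bar> < \<eta> \<and> \<bar>s j\<bar> < \<eta>) \<and>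
     transverse {1..m} (\<lambda>j. X j + smult (r j) bump_poly) (\<lambda>j. Y j + smult (s j) bump_poly)"
  using \<open>m \<le> n\<close>
proof (induction m)
  case 0
  show ?case using \<open>\<eta> > 0\<close> by (intro exI[of _ "\<lambda>_. 0"]) (auto simp: transverse_def)
next
  case (Suc m)
  from Suc.IH[OF Suc_leD[OF Suc.prems]]
  obtain r s where rs: "\<And>j. \<bar>r j\<bar> < \<eta> \<and> \<bar>s j\<bar> < \<eta>" and
    tr: "transverse {1..m} (\<lambda>j. X j + smult (r j) bump_poly) (\<lambda>j. Y j + smult (s j) bump_poly)"
    by blast
  \<comment> \<open>Strand \<open>Suc m\<close> is put back to its original position: the
    coefficients that the induction hypothesis returned for it are arbitrary and are replaced by the
    new ones.\<close>
  define X' where "X' = (\<lambda>j. if j = Suc m then X j else X j + smult (r j) bump_poly)"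
  define Y' where "Y' = (\<lambda>j. if j = Suc m then Y j else Y j + smult (s j) bump_poly)"
  have close: "dist (poly_strands X Y j t) (poly_strands X' Y' j t) < \<eta>" if t: "t \<in> {0..1}" for j t
  proof (cases "j = Suc m")
    case False
    then have "poly_strands X' Y' j t = poly_strands (\<lambda>j. X j + smult (r j) bump_poly) (\<lambda>j. Y j + smult (s j) bump_poly) j t"
      by (simp add: poly_strands_def X'_def Y'_def)
    then show ?thesis using bump_perturbation_close[OF _ _ t, of r j \<eta> s X Y] rs[of j] by (simp add: dist_commute)
  qed (use \<open>\<eta> > 0\<close> in \<open>simp add: poly_strands_def X'_def Y'_def\<close>)
  have "MOST a. MOST b. transverse (insert (Suc m) {1..m}) (X'(Suc m := X' (Suc m) + smult a bump_poly)) (Y'(Suc m := Y' (Suc m) + smult b bump_poly))"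
  proof (rule MOST_transverse_insert)
    have "X' j = X j + smult (r j) bump_poly" "Y' j = Y j + smult (s j) bump_poly" if "j \<in> {1..m}" for j
      using that by (auto simp: X'_def Y'_def)
    then show "transverse {1..m} X' Y'" by (intro transverse_cong[OF tr])
    fix t k l assume t: "t \<in> {0<..<1::real}" and kl: "k \<in> {1..m}" "l \<in> {1..m}" "k \<noteq> l"
    have "2 * \<eta> \<le> dist (poly_strands X Y k t) (poly_strands X Y l t)" using dist t kl Suc.prems by auto
    then show "poly_strands X' Y' k t \<noteq> poly_strands X' Y' l t"
      using close[of t k] close[of t l] t dist_triangle2[of "poly_strands X Y k t" "poly_strands X Y l t" "poly_strands X' Y' k t"] 
      by fastforce
  next
    fix t i j k assume *: "t \<in> {0, 1::real}" "{i, j, k} \<subseteq> insert (Suc m) {1..m}" "distinct [i, j, k]"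
    have "poly (turn_poly X' Y' i j k) t = turn (\<lambda>j. poly_strands X Y j t) i j k"
      using *(1) by (auto simp: turn_poly_def turn_def poly_strands_def X'_def Y'_def)
    moreover have "{i, j, k} \<subseteq> {1..n}" using *(2) Suc.prems by auto
    ultimately show "poly (turn_poly X' Y' i j k) t \<noteq> 0" using ends *(1,3) by (auto simp: generic_def)
  qed auto
  then have "\<exists>a\<in>{-\<eta><..<\<eta>}. MOST b. transverse (insert (Suc m) {1..m}) (X'(Suc m := X' (Suc m) + smult a bump_poly)) (Y'(Suc m := Y' (Suc m) + smult b bump_poly))"
    by (rule MOST_imp_ex_interval[OF _ \<open>\<eta> > 0\<close>])
  then obtain a where a: "a \<in> {-\<eta><..<\<eta>}" and "MOST b. transverse (insert (Suc m) {1..m}) (X'(Suc m := X' (Suc m) + smult a bump_poly)) (Y'(Suc m := Y' (Suc m) + smult b bump_poly))"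
    by blast
  then have "\<exists>b\<in>{-\<eta><..<\<eta>}. transverse (insert (Suc m) {1..m}) (X'(Suc m := X' (Suc m) + smult a bump_poly)) (Y'(Suc m := Y' (Suc m) + smult b bump_poly))"
    by (intro MOST_imp_ex_interval[OF _ \<open>\<eta> > 0\<close>])
  then obtain b where b: "b \<in> {-\<eta><..<\<eta>}" and tr': "transverse (insert (Suc m) {1..m}) (X'(Suc m := X' (Suc m) + smult a bump_poly)) (Y'(Suc m := Y' (Suc m) + smult b bump_poly))"
    by blast
  have "X'(Suc m := X' (Suc m) + smult a bump_poly) = (\<lambda>j. X j + smult ((r(Suc m := a)) j) bump_poly)"
       "Y'(Suc m := Y' (Suc m) + smult b bump_poly) = (\<lambda>j. Y j + smult ((s(Suc m := b)) j) bump_poly)"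
    by (auto simp: X'_def Y'_def fun_eq_iff)
  moreover have "insert (Suc m) {1..m} = {1..Suc m}" by auto
  ultimately show ?case
    using tr' rs a b by (intro exI[of _ "r(Suc m := a)"] exI[of _ "s(Suc m := b)"]) (auto simp: abs_less_iff)
qed

theorem transverse_approximation:
  fixes z :: strands
  assumes cont: "\<And>j. j \<in> {1..n} \<Longrightarrow> continuous_on {0..1} (z j)" and inj: "\<And>t. t \<in> {0..1} \<Longrightarrow> inj_on (\<lambda>j. z j t) {1..n}"
    and ends: "generic n (\<lambda>j. z j 0)" "generic n (\<lambda>j. z j 1)" and "\<epsilon> > 0"
  obtains X Y where "transverse {1..n} X Y"
    "\<And>j. j \<in> {1..n} \<Longrightarrow> poly_strands X Y j 0 = z j 0 \<and> poly_strands X Y j 1 = z j 1"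
    "\<And>j t. j \<in> {1..n} \<Longrightarrow> t \<in> {0..1} \<Longrightarrow> dist (poly_strands X Y j t) (z j t) < \<epsilon>"
proof -
  obtain d where d: "d > 0" "\<And>t j k. t \<in> {0..1} \<Longrightarrow> j \<in> {1..n} \<Longrightarrow> k \<in> {1..n} \<Longrightarrow> j \<noteq> k \<Longrightarrow> d \<le> dist (z j t) (z k t)"
    using strands_separated[of n z] cont inj by auto
  \<comment> \<open>After approximation within \<eta> the strands are at least d - 2\<eta> \<ge>
    2\<eta> apart. Approximation and perturbation together cost less than 2\<eta> \<le>
    \<epsilon>.\<close>
  define \<eta> where "\<eta> = min (\<epsilon> / 2) (d / 4)"
  have \<eta>: "\<eta> > 0" "\<eta> \<le> \<epsilon> / 2" "\<eta> \<le> d / 4" using d(1) \<open>\<epsilon> > 0\<close> by (auto simp: \<eta>_def)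
  have "\<exists>p q. \<forall>t. t \<in> {0..1} \<longrightarrow> cmod (Complex (poly p t) (poly q t) - z j t) < \<eta> \<and> Complex (poly p 0) (poly q 0) = z j 0
      \<and> Complex (poly p 1) (poly q 1) = z j 1" if "j \<in> {1..n}" for j
  proof -
    have "path (z j)" using cont that by (simp add: path_def)
    then obtain g where g: "polynomial_function g" "pathstart g = pathstart (z j)" "pathfinish g = pathfinish (z j)"
      "\<And>t. t \<in> {0..1} \<Longrightarrow> norm (g t - z j t) < \<eta>"
      using path_approx_polynomial_function[of "z j" \<eta>] \<eta>(1) by metis
    obtain p q where "g = (\<lambda>t. Complex (poly p t) (poly q t))" using polynomial_function_poly_strand[OF g(1)] by blast
    then show ?thesis using g by (intro exI[of _ p] exI[of _ q]) (auto simp: pathstart_def pathfinish_def)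
  qed
  then obtain X Y where XY: "\<And>j t. j \<in> {1..n} \<Longrightarrow> t \<in> {0..1} \<Longrightarrow> cmod (Complex (poly (X j) t) (poly (Y j) t) - z j t) < \<eta> \<and>
      Complex (poly (X j) 0) (poly (Y j) 0) = z j 0 \<and> Complex (poly (X j) 1) (poly (Y j) 1) = z j 1"
    by metis
  have close: "dist (poly_strands X Y j t) (z j t) < \<eta>" if "j \<in> {1..n}" "t \<in> {0..1}" for j t
    using XY[OF that] by (simp add: poly_strands_def dist_norm)
  have ends': "poly_strands X Y j 0 = z j 0" "poly_strands X Y j 1 = z j 1" if "j \<in> {1..n}" for j
    using XY[OF that, of 0] by (auto simp: poly_strands_def)
  have "\<exists>r s. (\<forall>j. \<bar>r j\<bar> < \<eta> \<and> \<bar>s j\<bar> < \<eta>) \<and>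
     transverse {1..n} (\<lambda>j. X j + smult (r j) bump_poly) (\<lambda>j. Y j + smult (s j) bump_poly)"
  proof (rule transverse_small_perturbation[OF _ _ _ \<eta>(1) order.refl])
    fix t :: real and j k assume *: "t \<in> {0..1}" "j \<in> {1..n}" "k \<in> {1..n}" "j \<noteq> k"
    have "d \<le> dist (z j t) (z k t)" using d(2)[OF *] .
    then show "2 * \<eta> \<le> dist (poly_strands X Y j t) (poly_strands X Y k t)"
      using close[OF *(2,1)] close[OF *(3,1)] \<eta>(3) 
        dist_triangle[of "z j t" "z k t" "poly_strands X Y j t"] dist_triangle[of "poly_strands X Y j t" "z k t" "poly_strands X Y k t"]
      by (simp add: dist_commute)
  next
    have "turn (\<lambda>j. poly_strands X Y j t) i j k = turn (\<lambda>j. z j t) i j k" if "t \<in> {0, 1}" "{i, j, k} \<subseteq> {1..n}" for t i j k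
      using that ends' by (auto simp: turn_def)
    then show "generic n (\<lambda>j. poly_strands X Y j 0)" "generic n (\<lambda>j. poly_strands X Y j 1)"
      using ends unfolding generic_def by simp_all
  qed
  then obtain r s where rs: "\<And>j. \<bar>r j\<bar> < \<eta> \<and> \<bar>s j\<bar> < \<eta>" and
     tr: "transverse {1..n} (\<lambda>j. X j + smult (r j) bump_poly) (\<lambda>j. Y j + smult (s j) bump_poly)"
    by blast
  show thesis
  proof (rule that[OF tr])
    fix j assume j: "j \<in> {1..n}"
    show "poly_strands (\<lambda>j. X j + smult (r j) bump_poly) (\<lambda>j. Y j + smult (s j) bump_poly) j 0 = z j 0 \<and>
       poly_strands (\<lambda>j. X j + smult (r j) bump_poly) (\<lambda>j. Y j + smult (s j) bump_poly) j 1 = z j 1"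
      using ends'[OF j] by (simp add: poly_strands_def)
    fix t :: real assume t: "t \<in> {0..1}"
    have "dist (poly_strands (\<lambda>j. X j + smult (r j) bump_poly) (\<lambda>j. Y j + smult (s j) bump_poly) j t) (poly_strands X Y j t) < \<eta>"
      by (rule bump_perturbation_close) (use rs[of j] t in auto)
    then show "dist (poly_strands (\<lambda>j. X j + smult (r j) bump_poly) (\<lambda>j. Y j + smult (s j) bump_poly) j t) (z j t) < \<epsilon>"
      using close[OF j t] \<eta>(2) dist_triangle[of "poly_strands (\<lambda>j. X j + smult (r j) bump_poly) (\<lambda>j. Y j + smult (s j) bump_poly) j t" "z j t" "poly_strands X Y j t"]
      by simp
  qed
qed

section \<open>Charts and paths inside a chart\<close>

lemma sorted_list_of_set_append:
  fixes A B :: "'a::linorder set"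
  assumes "finite A" "finite B" "\<And>x y. x \<in> A \<Longrightarrow> y \<in> B \<Longrightarrow> x < y"
  shows "sorted_list_of_set (A \<union> B) = sorted_list_of_set A @ sorted_list_of_set B"
proof (rule sorted_distinct_set_unique)
  show "sorted (sorted_list_of_set A @ sorted_list_of_set B)"
    using assms by (auto simp: sorted_append intro: less_imp_le)
  show "distinct (sorted_list_of_set A @ sorted_list_of_set B)"
    using assms by fastforce
qed (use assms in auto)

lemma sgn_eq_of_nonzero_on_interval:
  fixes f :: "real \<Rightarrow> real"
  assumes "continuous_on {a..b} f" "\<And>t. t \<in> {a..b} \<Longrightarrow> f t \<noteq> 0" "a \<le> b"
  shows "sgn (f a) = sgn (f b)"
proof (rule ccontr)
  assume *: "sgn (f a) \<noteq> sgn (f b)"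
  have "f a \<noteq> 0" "f b \<noteq> 0" using assms by auto
  then consider "f a < 0" "f b > 0" | "f a > 0" "f b < 0" using * by (auto simp: sgn_if split: if_splits)
  then have "\<exists>x\<ge>a. x \<le> b \<and> f x = 0"
  proof cases
    case 1 then show ?thesis using IVT'[of f a 0 b] assms by auto
  next
    case 2 then show ?thesis using IVT2'[of f b 0 a] assms by auto
  qed
  then show False using assms(2) by auto
qed

lemma continuous_on_turn:
  assumes "continuous_on S (z i)" "continuous_on S (z j)" "continuous_on S (z k)"
  shows "continuous_on S (\<lambda>t. turn (\<lambda>j. z j t) i j k)"
  unfolding turn_def using assms by (intro continuous_intros)

section \<open>Collinearity as vanishing of the signed area\<close>

lemma turn_perm_zero:
  assumes "{i, j, k} = {p, q, r}" "distinct [p, q, r]" "turn c p q r = 0"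
  shows "turn c i j k = 0"
proof -
  have "i \<in> {p, q, r}" "j \<in> {p, q, r}" "k \<in> {p, q, r}" using assms(1) by auto
  moreover have "p \<in> {i, j, k}" "q \<in> {i, j, k}" "r \<in> {i, j, k}" using assms(1) by auto
  moreover have perms: "turn c p r q = - turn c p q r" "turn c q p r = - turn c p q r" "turn c q r p = turn c p q r"
    "turn c r p q = turn c p q r" "turn c r q p = - turn c p q r"
    by (simp_all add: turn_def algebra_simps)
  ultimately have "(i, j, k) \<in> {(p,q,r), (p,r,q), (q,p,r), (q,r,p), (r,p,q), (r,q,p)}"
    using assms(2) by auto
  then show ?thesis
    using assms(3) perms by auto
qed

lemma collinear_iff_turn:
  fixes c :: "nat \<Rightarrow> complex"
  shows "collinear (c ` {i, j, k}) \<longleftrightarrow> turn c i j k = 0"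
proof -
  have "collinear (c ` {i, j, k}) \<longleftrightarrow> collinear {c j, c i, c k}" by (simp add: insert_commute)
  also have "\<dots> \<longleftrightarrow> collinear {0, c j - c i, c k - c i}" by (rule collinear_3) (simp add: NO_MATCH_def)
  also have "\<dots> \<longleftrightarrow> c j - c i = 0 \<or> c k - c i = 0 \<or> (\<exists>s. c k - c i = s *\<^sub>R (c j - c i))"
    by (rule collinear_lemma)
  also have "\<dots> \<longleftrightarrow> turn c i j k = 0"
  proof
    assume "c j - c i = 0 \<or> c k - c i = 0 \<or> (\<exists>s. c k - c i = s *\<^sub>R (c j - c i))"
    then consider "c j = c i" | "c k = c i" | s where "c k = c i + s *\<^sub>R (c j - c i)"
      by (metis add.commute diff_add_cancel right_minus_eq)
    then show "turn c i j k = 0"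
      by cases (simp_all add: turn_def)
  next
    assume 0: "turn c i j k = 0"
    define u1 u2 v1 v2 where "u1 = Re (c j) - Re (c i)" and "u2 = Im (c j) - Im (c i)"
      and "v1 = Re (c k) - Re (c i)" and "v2 = Im (c k) - Im (c i)"
    have uv: "u1 * v2 = v1 * u2" using 0 by (simp add: turn_def u1_def u2_def v1_def v2_def)
    have "u1 = 0 \<and> u2 = 0 \<or> (\<exists>s. v1 = s * u1 \<and> v2 = s * u2)"
    proof (cases "u1 = 0")
      case True
      then show ?thesis using uv by (cases "u2 = 0") (auto intro!: exI[of _ "v2 / u2"])
    next
      case False
      then show ?thesis using uv by (auto intro!: exI[of _ "v1 / u1"] simp: field_simps)
    qed
    then show "c j - c i = 0 \<or> c k - c i = 0 \<or> (\<exists>s. c k - c i = s *\<^sub>R (c j - c i))"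
      by (auto simp: complex_eq_iff u1_def u2_def v1_def v2_def)
  qed
  finally show ?thesis .
qed

lemma mem_collinear_triples:
  "T \<in> collinear_triples n z t \<longleftrightarrow>
    (\<exists>i j k. T = {i, j, k} \<and> {i, j, k} \<subseteq> {1..n} \<and> distinct [i, j, k] \<and> turn (\<lambda>j. z j t) i j k = 0)"
proof
  assume "T \<in> collinear_triples n z t"
  then have T: "T \<subseteq> {1..n}" "card T = 3" "collinear ((\<lambda>i. z i t) ` T)" by (auto simp: collinear_triples_def)
  from T(2) obtain i j k where ijk: "T = {i, j, k}" "i \<noteq> j" "j \<noteq> k" "i \<noteq> k" unfolding card_3_iff by blast
  have "turn (\<lambda>j. z j t) i j k = 0" using T(3) unfolding ijk(1) by (simp only: collinear_iff_turn)
  then have "T = {i, j, k} \<and> {i, j, k} \<subseteq> {1..n} \<and> distinct [i, j, k] \<and> turn (\<lambda>j. z j t) i j k = 0"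
    using T(1) ijk by simp
  then show "\<exists>i j k. T = {i, j, k} \<and> {i, j, k} \<subseteq> {1..n} \<and> distinct [i, j, k] \<and> turn (\<lambda>j. z j t) i j k = 0"
    by (intro exI)
next
  assume "\<exists>i j k. T = {i, j, k} \<and> {i, j, k} \<subseteq> {1..n} \<and> distinct [i, j, k] \<and> turn (\<lambda>j. z j t) i j k = 0"
  then obtain i j k where T: "T = {i, j, k}" "{i, j, k} \<subseteq> {1..n}" "distinct [i, j, k]" "turn (\<lambda>j. z j t) i j k = 0"
    by blast
  have "card T = 3" using T(3) unfolding T(1) by simp
  moreover have "collinear ((\<lambda>i. z i t) ` T)" unfolding T(1) collinear_iff_turn by (rule T(4))
  ultimately show "T \<in> collinear_triples n z t"
    unfolding collinear_triples_def using T(1,2) by simp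
qed

lemma noncritical_iff_generic:
  "t \<in> {0..1} \<Longrightarrow> t \<notin> critical_moments n z \<longleftrightarrow> generic n (\<lambda>j. z j t)"
proof -
  assume t: "t \<in> {0..1}"
  have "t \<in> critical_moments n z \<longleftrightarrow> (\<exists>T. T \<in> collinear_triples n z t)"
    using t by (auto simp: critical_moments_def)
  also have "\<dots> \<longleftrightarrow> \<not> generic n (\<lambda>j. z j t)"
    unfolding mem_collinear_triples generic_def by metis
  finally show ?thesis by simp
qed

section \<open>Charts given by linear functionals\<close>

definition shear :: "real \<Rightarrow> complex \<Rightarrow> real" where
  "shear s w = Re w + s * Im w"

text \<open>A shear preserves signed areas, so no orientation changes, while points with equal real
  parts can be separated. Positions in a chart count from 0, indices of strands from 1;
  \<open>\<pi>\<close> translates between them.\<close>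

definition chart_coords :: "real \<Rightarrow> (nat \<Rightarrow> nat) \<Rightarrow> (nat \<Rightarrow> complex) \<Rightarrow> nat \<Rightarrow> complex" where
  "chart_coords s \<pi> c = (\<lambda>p. Complex (shear s (c (\<pi> p))) (Im (c (\<pi> p))))"

definition in_chart :: "nat \<Rightarrow> real \<Rightarrow> (nat \<Rightarrow> nat) \<Rightarrow> (nat \<Rightarrow> complex) \<Rightarrow> bool" where
  "in_chart n s \<pi> c \<longleftrightarrow> bij_betw \<pi> {..<n} {1..n} \<and> incr n (chart_coords s \<pi> c)"

lemma turn_chart_coords: "turn (chart_coords s \<pi> c) p q r = turn c (\<pi> p) (\<pi> q) (\<pi> r)"
  by (simp add: turn_def chart_coords_def shear_def algebra_simps)

lemma in_chart_less: "in_chart n s \<pi> c \<Longrightarrow> p < q \<Longrightarrow> q < n \<Longrightarrow> shear s (c (\<pi> p)) < shear s (c (\<pi> q))"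
  by (auto simp: in_chart_def incr_def chart_coords_def)

lemma in_chart_sorted_triple:
  assumes "in_chart n s \<pi> c" "{i, j, k} \<subseteq> {1..n}" "distinct [i, j, k]"
  obtains p q r where "p < q" "q < r" "r < n" "{i, j, k} = {\<pi> p, \<pi> q, \<pi> r}"
proof -
  have bij: "bij_betw \<pi> {..<n} {1..n}" using assms(1) by (simp add: in_chart_def)
  then have "{i, j, k} \<subseteq> \<pi> ` {..<n}" using assms(2) by (simp add: bij_betw_imp_surj_on)
  then obtain a b d where abd: "a < n" "b < n" "d < n" "i = \<pi> a" "j = \<pi> b" "k = \<pi> d"
    by auto
  have ne: "a \<noteq> b" "b \<noteq> d" "a \<noteq> d" using abd assms(3) by auto
  then consider "a < b" "b < d" | "a < d" "d < b" | "b < a" "a < d" | "b < d" "d < a" | "d < a" "a < b" | "d < b" "b < a"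
    by linarith
  then show ?thesis
  proof cases
    case 1 then show ?thesis using that[of a b d] abd by auto
  next
    case 2 then show ?thesis using that[of a d b] abd by auto
  next
    case 3 then show ?thesis using that[of b a d] abd by auto
  next
    case 4 then show ?thesis using that[of b d a] abd by auto
  next
    case 5 then show ?thesis using that[of d a b] abd by auto
  next
    case 6 then show ?thesis using that[of d b a] abd by auto
  qed
qed

lemma shear_between: "between (u, v) w \<Longrightarrow> min (shear s u) (shear s v) \<le> shear s w \<and> shear s w \<le> max (shear s u) (shear s v)"
proof -
  assume "between (u, v) w"
  then obtain x where x: "0 \<le> x" "x \<le> 1" "w = (1 - x) *\<^sub>R u + x *\<^sub>R v"
    by (auto simp: between_def closed_segment_def)
  then have w: "shear s w = (1 - x) * shear s u + x * shear s v" unfolding x(3) shear_def by (simp add: algebra_simps)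
  let ?m = "min (shear s u) (shear s v)" and ?M = "max (shear s u) (shear s v)"
  have "(1 - x) * ?m + x * ?m \<le> shear s w" "shear s w \<le> (1 - x) * ?M + x * ?M"
    unfolding w using x by (intro add_mono mult_left_mono; simp)+
  then show ?thesis by (simp add: algebra_simps)
qed

text \<open>On the common line the functional is strictly monotone, so the point with the middle
  value lies in the middle; \<open>x\<close> is its affine coordinate on the segment.\<close>

lemma collinear_between:
  assumes "turn c i j k = 0" "shear s (c i) < shear s (c j)" "shear s (c j) < shear s (c k)"
  shows "between (c i, c k) (c j)"
proof -
  define x where "x = (shear s (c j) - shear s (c i)) / (shear s (c k) - shear s (c i))"
  have x: "0 \<le> x" "x \<le> 1" using assms by (auto simp: x_def)
  have d: "shear s (c k) - shear s (c i) \<noteq> 0" using assms by auto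
  have xx: "x * (shear s (c k) - shear s (c i)) = shear s (c j) - shear s (c i)" using d by (simp add: x_def)
  have im: "(shear s (c k) - shear s (c i)) * (Im (c j) - Im (c i)) = (shear s (c j) - shear s (c i)) * (Im (c k) - Im (c i))"
    using assms(1) by (simp add: turn_def shear_def algebra_simps)
  have "(shear s (c k) - shear s (c i)) * (Im (c j) - Im (c i)) = (shear s (c k) - shear s (c i)) * (x * (Im (c k) - Im (c i)))"
    unfolding im xx[symmetric] by simp
  then have Im: "Im (c j) = Im (c i) + x * (Im (c k) - Im (c i))" using d by simp
  then have "Re (c j) = Re (c i) + x * (Re (c k) - Re (c i))"
    using xx unfolding shear_def by algebra
  then have "c j = (1 - x) *\<^sub>R c i + x *\<^sub>R c k" using Im by (simp add: complex_eq_iff algebra_simps)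
  then show ?thesis using x by (auto simp: between_def closed_segment_def)
qed

text \<open>Betweenness on the common line is the order of the values of the functional, and reading
  the line backwards gives the same \<open>rev_triple\<close>. Hence the order fixed by a chart
  determines the letter, including its middle index.\<close>

lemma moment_index_in_chart:
  assumes ch: "in_chart n s \<pi> (\<lambda>j. z j t)" and pqr: "p < q" "q < r" "r < n"
    and triples: "collinear_triples n z t = {{\<pi> p, \<pi> q, \<pi> r}}"
  shows "moment_index n z t = rev_triple (\<pi> p) (\<pi> q) (\<pi> r)"
  unfolding moment_index_def
proof (rule the_equality)
  let ?f = "\<lambda>i. shear s (z i t)"
  have lt: "?f (\<pi> p) < ?f (\<pi> q)" "?f (\<pi> q) < ?f (\<pi> r)" using in_chart_less[OF ch] pqr by auto
  then have ne: "distinct [\<pi> p, \<pi> q, \<pi> r]" by auto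
  have "{\<pi> p, \<pi> q, \<pi> r} \<in> collinear_triples n z t" using triples by simp
  then obtain i j k where e: "{\<pi> p, \<pi> q, \<pi> r} = {i, j, k}" "distinct [i, j, k]" "turn (\<lambda>j. z j t) i j k = 0"
    unfolding mem_collinear_triples by (elim exE conjE)
  have 0: "turn (\<lambda>j. z j t) (\<pi> p) (\<pi> q) (\<pi> r) = 0"
    by (rule turn_perm_zero[OF e])
  show "\<exists>i j k. {i, j, k} \<in> collinear_triples n z t \<and> between (z i t, z k t) (z j t) \<and>
     rev_triple (\<pi> p) (\<pi> q) (\<pi> r) = rev_triple i j k"
    using triples collinear_between[OF 0 lt] by (intro exI[of _ "\<pi> p"] exI[of _ "\<pi> q"] exI[of _ "\<pi> r"]) simp
  fix g assume "\<exists>i j k. {i, j, k} \<in> collinear_triples n z t \<and> between (z i t, z k t) (z j t) \<and> g = rev_triple i j k"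
  then obtain i j k where ijk: "{i, j, k} = {\<pi> p, \<pi> q, \<pi> r}" and b: "between (z i t, z k t) (z j t)" 
    and g: "g = rev_triple i j k" unfolding triples by (elim exE conjE singletonE)
  have "card {i, j, k} = 3" unfolding ijk using ne by simp
  then have d: "i \<noteq> j" "j \<noteq> k" "i \<noteq> k" by (auto simp: card_insert_if split: if_splits)
  have "i \<in> {\<pi> p, \<pi> q, \<pi> r}" "j \<in> {\<pi> p, \<pi> q, \<pi> r}" "k \<in> {\<pi> p, \<pi> q, \<pi> r}" using ijk by auto
  then have "i = \<pi> p \<and> j = \<pi> q \<and> k = \<pi> r \<or> i = \<pi> r \<and> j = \<pi> q \<and> k = \<pi> p"
    using d shear_between[OF b, of s] lt by (auto simp: min_def max_def split: if_splits)
  then show "g = rev_triple (\<pi> p) (\<pi> q) (\<pi> r)" by (auto simp: g rev_triple_def)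
qed

section \<open>Regular paths and their words\<close>

definition sign_change :: "nat \<Rightarrow> strands \<Rightarrow> real \<Rightarrow> bool" where
  "sign_change n z t \<longleftrightarrow> (\<forall>i j k. {i, j, k} \<subseteq> {1..n} \<longrightarrow> distinct [i, j, k] \<longrightarrow> turn (\<lambda>j. z j t) i j k = 0 \<longrightarrow>
     (\<exists>\<delta>>0. \<forall>u v. 0 \<le> u \<longrightarrow> t - \<delta> < u \<longrightarrow> u < t \<longrightarrow> t < v \<longrightarrow> v < t + \<delta> \<longrightarrow> v \<le> 1 \<longrightarrow>
        turn (\<lambda>j. z j u) i j k * turn (\<lambda>j. z j v) i j k < 0))"

text \<open>Only continuity is asked for, so that a concatenation of two braids that is not smooth
  at the junction still qualifies. The sign change excludes tangential collinearities, across which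
  the potential stays the same although a letter is read.\<close>

definition regular_path :: "nat \<Rightarrow> strands \<Rightarrow> bool" where
  "regular_path n z \<longleftrightarrow> (\<forall>j\<in>{1..n}. continuous_on {0..1} (z j)) \<and>
     generic n (\<lambda>j. z j 0) \<and> generic n (\<lambda>j. z j 1) \<and> finite (critical_moments n z) \<and>
     (\<forall>t\<in>critical_moments n z. (\<exists>!T. T \<in> collinear_triples n z t) \<and> sign_change n z t)"

lemma collinear_triplesI:
  assumes "{i, j, k} \<subseteq> {1..n}" "distinct [i, j, k]" "turn (\<lambda>j. z j t) i j k = 0"
  shows "{i, j, k} \<in> collinear_triples n z t"
  unfolding mem_collinear_triples using assms by (intro exI[of _ i] exI[of _ j] exI[of _ k]) simp

lemma regular_path_triple:
  assumes "regular_path n z" "t \<in> critical_moments n z"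
  obtains T where "collinear_triples n z t = {T}"
proof -
  have uniq: "\<exists>!T. T \<in> collinear_triples n z t"
    using assms(1)[unfolded regular_path_def] assms(2) by blast
  have "collinear_triples n z t = {THE T. T \<in> collinear_triples n z t}"
    using theI'[OF uniq] the1_equality[OF uniq] by blast
  then show thesis by (rule that)
qed

definition path_word :: "nat \<Rightarrow> (triple_index \<Rightarrow> 'g::group_add) \<Rightarrow> strands \<Rightarrow> real \<Rightarrow> real \<Rightarrow> 'g" where
  "path_word n \<alpha> z a b =
     sum_list (map (\<lambda>t. \<alpha> (moment_index n z t)) (sorted_list_of_set (critical_moments n z \<inter> {a..b})))"

definition chart_pot :: "nat \<Rightarrow> (triple_index \<Rightarrow> 'g::group_add) \<Rightarrow> real \<Rightarrow> (nat \<Rightarrow> nat) \<Rightarrow> (nat \<Rightarrow> complex) \<Rightarrow> 'g" where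
  "chart_pot n \<alpha> s \<pi> c = pot (\<lambda>p q r. \<alpha> (rev_triple (\<pi> p) (\<pi> q) (\<pi> r))) n (chart_coords s \<pi> c)"

lemma path_word_split:
  assumes "finite (critical_moments n z)" "a \<le> b" "b \<le> c" "b \<notin> critical_moments n z"
  shows "path_word n \<alpha> z a c = path_word n \<alpha> z a b + path_word n \<alpha> z b c"
proof -
  have "critical_moments n z \<inter> {a..c} = (critical_moments n z \<inter> {a..b}) \<union> (critical_moments n z \<inter> {b..c})"
    using assms by auto
  moreover have "sorted_list_of_set ((critical_moments n z \<inter> {a..b}) \<union> (critical_moments n z \<inter> {b..c})) =
     sorted_list_of_set (critical_moments n z \<inter> {a..b}) @ sorted_list_of_set (critical_moments n z \<inter> {b..c})"
  proof (rule sorted_list_of_set_append)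
    fix x y assume "x \<in> critical_moments n z \<inter> {a..b}" "y \<in> critical_moments n z \<inter> {b..c}"
    moreover from this have "x \<noteq> b" using assms by auto
    ultimately show "x < y" by auto
  qed (use assms in auto)
  ultimately show ?thesis by (simp add: path_word_def)
qed

text \<open>The relations of \<open>G3'\<close> for letters in an arbitrary additive group. Keeping
  the target abstract allows the potential to be built in a type of class \<open>group_add\<close>,
  whereas \<open>G3'\<close> is a record with a carrier.\<close>

locale triple_rep =
  fixes n :: nat and \<alpha> :: "triple_index \<Rightarrow> 'g::group_add"
  assumes rep_invol: "{i, j, k} \<subseteq> {1..n} \<Longrightarrow> distinct [i, j, k] \<Longrightarrow> \<alpha> (rev_triple i j k) + \<alpha> (rev_triple i j k) = 0"
    and rep_comm: "{i, j, k, p, q, r} \<subseteq> {1..n} \<Longrightarrow> distinct [i, j, k] \<Longrightarrow> distinct [p, q, r] \<Longrightarrow>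
      card ({i, j, k} \<inter> {p, q, r}) \<le> 1 \<Longrightarrow>
      \<alpha> (rev_triple i j k) + \<alpha> (rev_triple p q r) = \<alpha> (rev_triple p q r) + \<alpha> (rev_triple i j k)"
    and rep_tetra: "{i, j, k, l} \<subseteq> {1..n} \<Longrightarrow> distinct [i, j, k, l] \<Longrightarrow>
      \<alpha> (rev_triple i j k) + \<alpha> (rev_triple i j l) + \<alpha> (rev_triple i k l) + \<alpha> (rev_triple j k l) =
      \<alpha> (rev_triple j k l) + \<alpha> (rev_triple i k l) + \<alpha> (rev_triple i j l) + \<alpha> (rev_triple i j k)"
begin

lemma tetrahedral_chart:
  assumes "bij_betw \<pi> {..<n} {1..n}"
  shows "tetrahedral (\<lambda>p q r. \<alpha> (rev_triple (\<pi> p) (\<pi> q) (\<pi> r))) n"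
proof -
  have inj: "\<pi> x = \<pi> y \<longleftrightarrow> x = y" if "x < n" "y < n" for x y
    using assms that by (auto simp: bij_betw_def dest: inj_onD)
  have mem: "\<pi> x \<in> {1..n}" if "x < n" for x
    using bij_betwE[OF assms] that by blast
  have tri: "{\<pi> i, \<pi> j, \<pi> k} \<subseteq> {1..n}" "distinct [\<pi> i, \<pi> j, \<pi> k]" if "i < j" "j < k" "k < n" for i j k
    using mem[of i] mem[of j] mem[of k] inj that by auto
  show ?thesis
  proof (unfold_locales, goal_cases)
    case (1 i j k)
    then show ?case by (intro rep_invol tri)
  next
    case (2 i j k p q r)
    have "inj_on \<pi> ({i, j, k} \<union> {p, q, r})"
      by (rule inj_on_subset[OF bij_betw_imp_inj_on[OF assms]]) (use 2 in auto)
    then have "\<pi> ` ({i, j, k} \<inter> {p, q, r}) = \<pi> ` {i, j, k} \<inter> \<pi> ` {p, q, r}"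
      by (rule inj_on_image_Int) auto
    then have "{\<pi> i, \<pi> j, \<pi> k} \<inter> {\<pi> p, \<pi> q, \<pi> r} = \<pi> ` ({i, j, k} \<inter> {p, q, r})" by simp
    moreover have "card (\<pi> ` ({i, j, k} \<inter> {p, q, r})) \<le> card ({i, j, k} \<inter> {p, q, r})" 
      by (rule card_image_le) simp
    ultimately have "card ({\<pi> i, \<pi> j, \<pi> k} \<inter> {\<pi> p, \<pi> q, \<pi> r}) \<le> 1" using 2(7) by simp
    moreover have "{\<pi> i, \<pi> j, \<pi> k, \<pi> p, \<pi> q, \<pi> r} \<subseteq> {1..n}" 
      using tri(1)[OF 2(1-3)] tri(1)[OF 2(4-6)] by simp
    ultimately show ?case by (intro rep_comm tri(2) 2)
  next
    case (3 i j k l)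
    show ?case
      by (rule rep_tetra) (use mem[of i] mem[of j] mem[of k] mem[of l] inj 3 in auto)
  qed
qed

text \<open>The signs of all areas are constant along a path of generic configurations, and the
  potential depends on nothing else. In between the path may leave the chart; only its two ends have
  to be sorted by \<open>\<pi>\<close>.\<close>

lemma chart_pot_constant:
  fixes z :: strands
  assumes cont: "\<And>j. j \<in> {1..n} \<Longrightarrow> continuous_on {a..b} (z j)" and "a \<le> b"
    and gen: "\<And>t. t \<in> {a..b} \<Longrightarrow> generic n (\<lambda>j. z j t)"
    and ch: "in_chart n s \<pi> (\<lambda>j. z j a)" "in_chart n s \<pi> (\<lambda>j. z j b)"
  shows "chart_pot n \<alpha> s \<pi> (\<lambda>j. z j a) = chart_pot n \<alpha> s \<pi> (\<lambda>j. z j b)"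
proof -
  have bij: "bij_betw \<pi> {..<n} {1..n}" using ch by (simp add: in_chart_def)
  interpret tetrahedral "\<lambda>p q r. \<alpha> (rev_triple (\<pi> p) (\<pi> q) (\<pi> r))" n by (rule tetrahedral_chart[OF bij])
  show ?thesis
    unfolding chart_pot_def
  proof (rule pot_cong)
    fix p q r assume pqr: "p < q" "q < r" "r < n"
    have "\<pi> x \<in> {1..n}" if "x < n" for x
      using bij_betwE[OF bij] that by blast
    then have m: "{\<pi> p, \<pi> q, \<pi> r} \<subseteq> {1..n}" using pqr by auto
    have d: "distinct [\<pi> p, \<pi> q, \<pi> r]" using bij pqr by (auto simp: bij_betw_def dest: inj_onD)
    let ?f = "\<lambda>t. turn (\<lambda>j. z j t) (\<pi> p) (\<pi> q) (\<pi> r)"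
    have nz: "?f t \<noteq> 0" if "t \<in> {a..b}" for t using gen[OF that] m d unfolding generic_def by blast
    have "sgn (?f a) = sgn (?f b)"
      by (rule sgn_eq_of_nonzero_on_interval[OF _ _ \<open>a \<le> b\<close>]) (use m nz in \<open>auto intro!: continuous_on_turn cont\<close>)
    then show "turn (chart_coords s \<pi> (\<lambda>j. z j a)) p q r \<noteq> 0 \<and>
       sgn (turn (chart_coords s \<pi> (\<lambda>j. z j a)) p q r) = sgn (turn (chart_coords s \<pi> (\<lambda>j. z j b)) p q r)"
      using nz[of a] \<open>a \<le> b\<close> by (simp add: turn_chart_coords)
  qed (use ch in \<open>auto simp: in_chart_def\<close>)
qed

text \<open>This is \<open>pot_crossing\<close> with the configuration at the critical moment as the
  wall. The letter is an involution, so both directions of the sign change multiply the potential by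
  it in the same way.\<close>

lemma chart_pot_across:
  assumes reg: "regular_path n z" and "0 \<le> u" "u < t" "t < v" "v \<le> 1"
    and t: "t \<in> critical_moments n z" and only: "critical_moments n z \<inter> {u..v} = {t}"
    and ch: "\<And>x. x \<in> {u..v} \<Longrightarrow> in_chart n s \<pi> (\<lambda>j. z j x)"
    and chg: "\<And>i j k. {i, j, k} \<subseteq> {1..n} \<Longrightarrow> distinct [i, j, k] \<Longrightarrow> turn (\<lambda>j. z j t) i j k = 0 \<Longrightarrow> 
        turn (\<lambda>j. z j u) i j k * turn (\<lambda>j. z j v) i j k < 0"
  shows "chart_pot n \<alpha> s \<pi> (\<lambda>j. z j v) = chart_pot n \<alpha> s \<pi> (\<lambda>j. z j u) + \<alpha> (moment_index n z t)"
proof -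
  have tin: "t \<in> {u..v}" "u \<in> {u..v}" "v \<in> {u..v}" using assms by auto
  have bij: "bij_betw \<pi> {..<n} {1..n}" using ch[OF tin(1)] by (simp add: in_chart_def)
  interpret tetrahedral "\<lambda>p q r. \<alpha> (rev_triple (\<pi> p) (\<pi> q) (\<pi> r))" n by (rule tetrahedral_chart[OF bij])
  have mem: "\<pi> x \<in> {1..n}" if "x < n" for x
    using bij_betwE[OF bij] that by blast
  have inj: "\<pi> x = \<pi> y \<longleftrightarrow> x = y" if "x < n" "y < n" for x y
    using bij that by (auto simp: bij_betw_def dest: inj_onD)
  have cont: "continuous_on {0..1} (z j)" if "j \<in> {1..n}" for j
    using reg that by (simp add: regular_path_def)
  obtain T where T: "collinear_triples n z t = {T}"
    by (rule regular_path_triple[OF reg t])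
  then have "T \<in> collinear_triples n z t" by simp
  then obtain i j k where ijk: "T = {i, j, k}" "{i, j, k} \<subseteq> {1..n}" "distinct [i, j, k]" "turn (\<lambda>j. z j t) i j k = 0"
    unfolding mem_collinear_triples by (elim exE conjE)
  obtain p q r where pqr: "p < q" "q < r" "r < n" and e: "{i, j, k} = {\<pi> p, \<pi> q, \<pi> r}"
    by (rule in_chart_sorted_triple[OF ch[OF tin(1)] ijk(2,3)])
  have mi: "moment_index n z t = rev_triple (\<pi> p) (\<pi> q) (\<pi> r)"
    by (rule moment_index_in_chart[of n s \<pi> z t, OF ch[OF tin(1)] pqr]) (use T ijk(1) e in simp)
  have tri: "{\<pi> a, \<pi> b, \<pi> c} \<subseteq> {1..n}" "distinct [\<pi> a, \<pi> b, \<pi> c]" if "a < b" "b < c" "c < n" for a b c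
    using mem[of a] mem[of b] mem[of c] inj that by auto
  let ?f = "\<lambda>a b c t. turn (\<lambda>j. z j t) (\<pi> a) (\<pi> b) (\<pi> c)"
  have 0: "?f p q r t = 0" by (rule turn_perm_zero[OF e[symmetric] ijk(3,4)])
  have nz: "?f a b c x \<noteq> 0" if abc: "a < b" "b < c" "c < n" and ne: "(a, b, c) \<noteq> (p, q, r)" and x: "x \<in> {u..v}" for a b c x
  proof (cases "x = t")
    case True
    show ?thesis
    proof
      assume "?f a b c x = 0"
      then have "{\<pi> a, \<pi> b, \<pi> c} \<in> collinear_triples n z t"
        unfolding True by (rule collinear_triplesI[OF tri[OF abc]])
      then have img: "\<pi> ` {a, b, c} = \<pi> ` {p, q, r}" using T ijk(1) e by simp
      have "{a, b, c} \<subseteq> {..<n}" "{p, q, r} \<subseteq> {..<n}" using abc pqr by auto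
      from iffD1[OF inj_on_image_eq_iff[OF bij_betw_imp_inj_on[OF bij] this] img]
      have "{a, b, c} = {p, q, r}" .
      then have "sorted_list_of_set {a, b, c} = sorted_list_of_set {p, q, r}" by simp
      then show False using abc pqr ne by auto
    qed
  next
    case False
    then have "x \<notin> critical_moments n z" "x \<in> {0..1}" using only x assms by auto
    then show ?thesis using noncritical_iff_generic tri[OF abc] unfolding generic_def by blast
  qed
  have sg: "sgn (?f a b c u) = sgn (?f a b c t)" "sgn (?f a b c v) = sgn (?f a b c t)"
    if abc: "a < b" "b < c" "c < n" and ne: "(a, b, c) \<noteq> (p, q, r)" for a b c
  proof -
    have cn: "continuous_on {x..y} (?f a b c)" if "{x..y} \<subseteq> {0..1}" for x y
      using tri(1)[OF abc] by (intro continuous_on_turn continuous_on_subset[OF cont that]) auto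
    show "sgn (?f a b c u) = sgn (?f a b c t)"
      by (rule sgn_eq_of_nonzero_on_interval[OF cn]) (use assms in \<open>auto intro!: nz[OF abc ne]\<close>)
    have "sgn (?f a b c t) = sgn (?f a b c v)"
      by (rule sgn_eq_of_nonzero_on_interval[OF cn]) (use assms in \<open>auto intro!: nz[OF abc ne]\<close>)
    then show "sgn (?f a b c v) = sgn (?f a b c t)" ..
  qed
  have inc: "incr n (chart_coords s \<pi> (\<lambda>j. z j x))" if "x \<in> {u..v}" for x
    using ch[OF that] by (simp add: in_chart_def)
  have prod: "?f p q r u * ?f p q r v < 0" by (rule chg[OF tri[OF pqr] 0])
  show ?thesis
  proof (cases "?f p q r u < 0")
    case True
    then have "?f p q r v > 0" using prod by (auto simp: mult_less_0_iff)
    then show ?thesis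
      unfolding chart_pot_def mi
      by (intro pot_crossing[where ?c0.0 = "chart_coords s \<pi> (\<lambda>j. z j t)"])
         (use True pqr 0 inc tin sg nz in \<open>auto simp: turn_chart_coords\<close>)
  next
    case False
    then have "?f p q r u > 0" "?f p q r v < 0" using prod by (auto simp: mult_less_0_iff)
    then have 1: "chart_pot n \<alpha> s \<pi> (\<lambda>j. z j u) = chart_pot n \<alpha> s \<pi> (\<lambda>j. z j v) + \<alpha> (moment_index n z t)"
      unfolding chart_pot_def mi
      by (intro pot_crossing[where ?c0.0 = "chart_coords s \<pi> (\<lambda>j. z j t)"])
         (use pqr 0 inc tin sg nz in \<open>auto simp: turn_chart_coords\<close>)
    have "\<alpha> (moment_index n z t) + \<alpha> (moment_index n z t) = 0"
      unfolding mi by (rule rep_invol[OF tri[OF pqr]])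
    then show ?thesis using 1 by (simp add: add.assoc)
  qed
qed

end

lemma sign_change_uniform:
  assumes "sign_change n z t"
  shows "\<exists>\<delta>>0. \<forall>i j k u v. {i, j, k} \<subseteq> {1..n} \<longrightarrow> distinct [i, j, k] \<longrightarrow> turn (\<lambda>j. z j t) i j k = 0 \<longrightarrow>
     0 \<le> u \<longrightarrow> t - \<delta> < u \<longrightarrow> u < t \<longrightarrow> t < v \<longrightarrow> v < t + \<delta> \<longrightarrow> v \<le> 1 \<longrightarrow>
        turn (\<lambda>j. z j u) i j k * turn (\<lambda>j. z j v) i j k < 0"
proof -
  define Q where "Q i j k \<delta> \<longleftrightarrow> (\<forall>u v. 0 \<le> u \<longrightarrow> t - \<delta> < u \<longrightarrow> u < t \<longrightarrow> t < v \<longrightarrow> v < t + \<delta> \<longrightarrow> v \<le> 1 \<longrightarrow>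
        turn (\<lambda>j. z j u) i j k * turn (\<lambda>j. z j v) i j k < 0)" for i j k \<delta>
  define C where "C i j k \<longleftrightarrow> {i, j, k} \<subseteq> {1..n} \<and> distinct [i, j, k] \<and> turn (\<lambda>j. z j t) i j k = 0" for i j k
  have ex: "\<exists>\<delta>>0. C i j k \<longrightarrow> Q i j k \<delta>" for i j k
  proof (cases "C i j k")
    case True
    note c = True[unfolded C_def, THEN conjunct1] True[unfolded C_def, THEN conjunct2, THEN conjunct1]
      True[unfolded C_def, THEN conjunct2, THEN conjunct2]
    have "\<exists>\<delta>>0. Q i j k \<delta>"
      unfolding Q_def by (rule assms[unfolded sign_change_def, rule_format, OF c])
    then show ?thesis by blast
  qed (auto intro: exI[of _ 1])
  have mono: "Q i j k e" if "Q i j k d" "e \<le> d" for i j k d e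
    unfolding Q_def
  proof (intro allI impI)
    fix u v assume uv: "0 \<le> u" "t - e < u" "u < t" "t < v" "v < t + e" "v \<le> 1"
    show "turn (\<lambda>j. z j u) i j k * turn (\<lambda>j. z j v) i j k < 0"
      by (rule that(1)[unfolded Q_def, rule_format]) (use uv that(2) in auto)
  qed
  have "\<exists>\<delta>>0. \<forall>x\<in>{1..n} \<times> {1..n} \<times> {1..n}. C (fst x) (fst (snd x)) (snd (snd x)) \<longrightarrow> Q (fst x) (fst (snd x)) (snd (snd x)) \<delta>"
  proof (rule finite_uniform_positive)
    show "\<exists>\<delta>>0. C (fst x) (fst (snd x)) (snd (snd x)) \<longrightarrow> Q (fst x) (fst (snd x)) (snd (snd x)) \<delta>" for x :: "nat \<times> nat \<times> nat"
      by (rule ex)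
  qed (use mono in auto)
  then obtain \<delta> where d: "\<delta> > 0" "\<forall>x\<in>{1..n} \<times> {1..n} \<times> {1..n}. C (fst x) (fst (snd x)) (snd (snd x)) \<longrightarrow> Q (fst x) (fst (snd x)) (snd (snd x)) \<delta>"
    by blast
  show ?thesis
  proof (intro exI[of _ \<delta>] conjI d(1) allI impI)
    fix i j k u v assume *: "{i, j, k} \<subseteq> {1..n}" "distinct [i, j, k]" "turn (\<lambda>j. z j t) i j k = 0"
     and uv: "0 \<le> u" "t - \<delta> < u" "u < t" "t < v" "v < t + \<delta>" "v \<le> 1"
    have "C i j k" unfolding C_def by (intro conjI *)
    then have "Q i j k \<delta>" using d(2)[rule_format, of "(i, j, k)"] *(1) by simp
    then show "turn (\<lambda>j. z j u) i j k * turn (\<lambda>j. z j v) i j k < 0"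
      using uv by (simp only: Q_def simp_thms)
  qed
qed

text \<open>Each critical moment changes the potential by the letter read there, so the word
  telescopes. The induction is on the number of critical moments and cuts off the last one, hence
  the right end \<open>b\<close> is generalised.\<close>

lemma (in triple_rep) path_word_in_chart:
  assumes reg: "regular_path n z" and "0 \<le> a" "a \<le> b" "b \<le> 1"
    and ab: "a \<notin> critical_moments n z" "b \<notin> critical_moments n z"
    and ch: "\<And>x. x \<in> {a..b} \<Longrightarrow> in_chart n s \<pi> (\<lambda>j. z j x)"
  shows "path_word n \<alpha> z a b = - chart_pot n \<alpha> s \<pi> (\<lambda>j. z j a) + chart_pot n \<alpha> s \<pi> (\<lambda>j. z j b)"
  using assms(3-4) ab(2) ch
proof (induction "card (critical_moments n z \<inter> {a..b})" arbitrary: b rule: less_induct)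
  case less
  let ?C = "critical_moments n z" and ?P = "\<lambda>x. chart_pot n \<alpha> s \<pi> (\<lambda>j. z j x)"
  have fin: "finite ?C" and cont: "\<And>j. j \<in> {1..n} \<Longrightarrow> continuous_on {0..1} (z j)"
    using reg by (auto simp: regular_path_def)
  have const: "?P x = ?P y" if "?C \<inter> {x..y} = {}" "a \<le> x" "x \<le> y" "y \<le> b" for x y
  proof (rule chart_pot_constant)
    show "continuous_on {x..y} (z j)" if "j \<in> {1..n}" for j
      using continuous_on_subset[OF cont[OF that]] \<open>a \<le> x\<close> \<open>y \<le> b\<close> \<open>0 \<le> a\<close> less.prems by auto
    fix t assume "t \<in> {x..y}"
    then have "t \<notin> ?C" "t \<in> {0..1}" using that \<open>0 \<le> a\<close> less.prems by auto
    then show "generic n (\<lambda>j. z j t)" using noncritical_iff_generic by blast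
  qed (use that less.prems in auto)
  show ?case
  proof (cases "?C \<inter> {a..b} = {}")
    case True
    then show ?thesis using const[of a b] less.prems by (simp add: path_word_def)
  next
    case False
    define t where "t = Max (?C \<inter> {a..b})"
    have t: "t \<in> ?C" "t \<in> {a..b}" and tmax: "\<And>x. x \<in> ?C \<Longrightarrow> x \<in> {a..b} \<Longrightarrow> x \<le> t"
      using Max_in[OF _ False] Max_ge[of "?C \<inter> {a..b}"] fin by (auto simp: t_def)
    have t': "a < t" "t < b" using t ab less.prems by (auto simp: order.strict_iff_order)
    have sc: "sign_change n z t" using reg t unfolding regular_path_def by blast
    obtain \<delta> where \<delta>0: "\<delta> > 0" and \<delta>1: "\<forall>i j k u v. {i, j, k} \<subseteq> {1..n} \<longrightarrow> distinct [i, j, k] \<longrightarrow> turn (\<lambda>j. z j t) i j k = 0 \<longrightarrow>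
       0 \<le> u \<longrightarrow> t - \<delta> < u \<longrightarrow> u < t \<longrightarrow> t < v \<longrightarrow> v < t + \<delta> \<longrightarrow> v \<le> 1 \<longrightarrow>
        turn (\<lambda>j. z j u) i j k * turn (\<lambda>j. z j v) i j k < 0"
      using sign_change_uniform[OF sc] by (elim exE conjE)
    note \<delta> = \<delta>0 \<delta>1[rule_format]
    obtain d where d: "d > 0" "\<And>x. x \<in> ?C \<Longrightarrow> x \<noteq> t \<Longrightarrow> d \<le> dist t x"
      using finite_set_avoid[OF fin, of t] by auto
    \<comment> \<open>Half of the minimum makes all inequalities strict: [u, v] lies inside (a, b),
      within the radius of the sign change, and contains no other critical moment.\<close>
    define e where "e = Min {\<delta>, d, t - a, b - t} / 2"
    have "e > 0" "e < \<delta>" "e < d" "e < t - a" "e < b - t"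
      using \<delta>(1) d(1) t' by (auto simp: e_def min_def)
    define u v where "u = t - e" and "v = t + e"
    have uv: "a < u" "u < t" "t < v" "v < b" "t - \<delta> < u" "v < t + \<delta>"
      using \<open>e > 0\<close> \<open>e < \<delta>\<close> \<open>e < t - a\<close> \<open>e < b - t\<close> by (auto simp: u_def v_def)
    have near: "x = t" if "x \<in> ?C" "x \<in> {u..v}" for x
    proof (rule ccontr)
      assume "x \<noteq> t"
      then have "d \<le> \<bar>t - x\<bar>" using d(2)[OF that(1)] by (simp add: dist_real_def)
      then show False using that(2) \<open>e < d\<close> by (auto simp: u_def v_def)
    qed
    have "t \<in> {u..v}" using uv by simp
    then have Cuv: "?C \<inter> {u..v} = {t}" using near t(1) by blast
    have "x \<notin> ?C" if "x \<in> {v..b}" for x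
      using tmax[of x] that uv t' by auto
    then have Cvb: "?C \<inter> {v..b} = {}" by blast
    have unC: "u \<notin> ?C" "v \<notin> ?C" using near[of u] near[of v] uv by auto
    have "t \<notin> {a..u}" "{a..u} \<subseteq> {a..b}" using uv by auto
    then have "?C \<inter> {a..u} \<subset> ?C \<inter> {a..b}" using t by blast
    then have "card (?C \<inter> {a..u}) < card (?C \<inter> {a..b})" using fin by (intro psubset_card_mono) auto
    then have IH: "path_word n \<alpha> z a u = - ?P a + ?P u"
      using less.hyps[of u] uv less.prems unC by auto
    have "?P v = ?P u + \<alpha> (moment_index n z t)"
      by (rule chart_pot_across[OF reg _ _ _ _ t(1) Cuv _ \<delta>(2)]) (use uv \<open>0 \<le> a\<close> less.prems in auto)
    moreover have "?P v = ?P b" using const[OF Cvb] uv by auto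
    moreover have "path_word n \<alpha> z u v = \<alpha> (moment_index n z t)" by (simp add: path_word_def Cuv)
    moreover have "path_word n \<alpha> z v b = 0" by (simp add: path_word_def Cvb)
    moreover have "path_word n \<alpha> z a b = path_word n \<alpha> z a u + (path_word n \<alpha> z u v + path_word n \<alpha> z v b)"
      using path_word_split[OF fin, of a u b \<alpha>] path_word_split[OF fin, of u v b \<alpha>] uv unC by simp
    ultimately show ?thesis using IH by (simp add: add.assoc)
  qed
qed

section \<open>Transverse polynomial paths are regular\<close>

lemma simple_root_sign_change:
  fixes p :: "real poly"
  assumes "poly p t = 0" "poly (pderiv p) t \<noteq> 0"
  shows "\<exists>\<delta>>0. \<forall>u v. t - \<delta> < u \<longrightarrow> u < t \<longrightarrow> t < v \<longrightarrow> v < t + \<delta> \<longrightarrow> poly p u * poly p v < 0"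
proof -
  have D: "DERIV (poly p) t :> poly (pderiv p) t" by (rule poly_DERIV)
  consider "poly (pderiv p) t > 0" | "poly (pderiv p) t < 0" using assms(2) by linarith
  then show ?thesis
  proof cases
    case 1
    obtain d1 where d1: "d1 > 0" "\<And>h. 0 < h \<Longrightarrow> h < d1 \<Longrightarrow> poly p t < poly p (t + h)"
      using DERIV_pos_inc_right[OF D 1] by blast
    obtain d2 where d2: "d2 > 0" "\<And>h. 0 < h \<Longrightarrow> h < d2 \<Longrightarrow> poly p (t - h) < poly p t"
      using DERIV_pos_inc_left[OF D 1] by blast
    show ?thesis
    proof (intro exI[of _ "min d1 d2"] conjI allI impI)
      fix u v assume "t - min d1 d2 < u" "u < t" "t < v" "v < t + min d1 d2"
      then have "poly p u < 0" "0 < poly p v" using d1(2)[of "v - t"] d2(2)[of "t - u"] assms(1) by auto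
      then show "poly p u * poly p v < 0" by (rule mult_neg_pos)
    qed (use d1 d2 in auto)
  next
    case 2
    obtain d1 where d1: "d1 > 0" "\<And>h. 0 < h \<Longrightarrow> h < d1 \<Longrightarrow> poly p (t + h) < poly p t"
      using DERIV_neg_dec_right[OF D 2] by blast
    obtain d2 where d2: "d2 > 0" "\<And>h. 0 < h \<Longrightarrow> h < d2 \<Longrightarrow> poly p t < poly p (t - h)"
      using DERIV_neg_dec_left[OF D 2] by blast
    show ?thesis
    proof (intro exI[of _ "min d1 d2"] conjI allI impI)
      fix u v assume "t - min d1 d2 < u" "u < t" "t < v" "v < t + min d1 d2"
      then have "0 < poly p u" "poly p v < 0" using d1(2)[of "v - t"] d2(2)[of "t - u"] assms(1) by auto
      then show "poly p u * poly p v < 0" by (rule mult_pos_neg)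
    qed (use d1 d2 in auto)
  qed
qed

lemma critical_moments_iff:
  "t \<in> critical_moments n z \<longleftrightarrow> t \<in> {0..1} \<and> \<not> generic n (\<lambda>j. z j t)"
proof (cases "t \<in> {0..1}")
  case True
  then show ?thesis using noncritical_iff_generic[OF True, of n z] by blast
qed (auto simp: critical_moments_def)

lemma transverseD:
  assumes "transverse J X Y" "t \<in> {0..1}" "{i, j, k} \<subseteq> J" "distinct [i, j, k]" "poly (turn_poly X Y i j k) t = 0"
  shows "poly (pderiv (turn_poly X Y i j k)) t \<noteq> 0"
    and "{p, q, r} \<subseteq> J \<Longrightarrow> distinct [p, q, r] \<Longrightarrow> poly (turn_poly X Y p q r) t = 0 \<Longrightarrow> {p, q, r} = {i, j, k}"
proof -
  note 1 = assms(1)[unfolded transverse_def, rule_format, OF assms(2-5)]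
  show "poly (pderiv (turn_poly X Y i j k)) t \<noteq> 0" by (rule 1[THEN conjunct1])
  show "{p, q, r} \<subseteq> J \<Longrightarrow> distinct [p, q, r] \<Longrightarrow> poly (turn_poly X Y p q r) t = 0 \<Longrightarrow> {p, q, r} = {i, j, k}"
    by (rule 1[THEN conjunct2, rule_format])
qed

lemma transverse_imp_unique_triple:
  assumes "transverse {1..n} X Y" "t \<in> critical_moments n (poly_strands X Y)"
  shows "\<exists>!T. T \<in> collinear_triples n (poly_strands X Y) t"
proof -
  let ?z = "poly_strands X Y"
  have t: "t \<in> {0..1}" and "collinear_triples n ?z t \<noteq> {}" using assms(2) by (auto simp: critical_moments_def)
  then obtain T where T: "T \<in> collinear_triples n ?z t" by blast
  moreover have "S = T" if S: "S \<in> collinear_triples n ?z t" for S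
  proof -
    from T obtain i j k where T': "T = {i, j, k}" "{i, j, k} \<subseteq> {1..n}" "distinct [i, j, k]" "poly (turn_poly X Y i j k) t = 0"
      unfolding mem_collinear_triples turn_poly_strands by (elim exE conjE)
    from S obtain p q r where S': "S = {p, q, r}" "{p, q, r} \<subseteq> {1..n}" "distinct [p, q, r]" "poly (turn_poly X Y p q r) t = 0"
      unfolding mem_collinear_triples turn_poly_strands by (elim exE conjE)
    show ?thesis unfolding S'(1) T'(1) by (rule transverseD(2)[OF assms(1) t T'(2-4) S'(2-4)])
  qed
  ultimately show ?thesis by (rule ex1I)
qed

lemma transverse_imp_finite_critical:
  assumes "transverse {1..n} X Y"
  shows "finite (critical_moments n (poly_strands X Y))"
proof (rule finite_subset[OF _ transverse_finite[OF _ assms]])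
  show "critical_moments n (poly_strands X Y) \<subseteq>
    {t \<in> {0..1}. \<exists>i j k. {i, j, k} \<subseteq> {1..n} \<and> distinct [i, j, k] \<and> poly (turn_poly X Y i j k) t = 0}"
  proof
    fix t assume "t \<in> critical_moments n (poly_strands X Y)"
    then show "t \<in> {t \<in> {0..1}. \<exists>i j k. {i, j, k} \<subseteq> {1..n} \<and> distinct [i, j, k] \<and> poly (turn_poly X Y i j k) t = 0}"
      unfolding critical_moments_iff generic_def turn_poly_strands not_all not_imp not_not mem_Collect_eq .
  qed
qed simp

lemma transverse_imp_regular:
  assumes tr: "transverse {1..n} X Y" and ends: "generic n (\<lambda>j. poly_strands X Y j 0)" "generic n (\<lambda>j. poly_strands X Y j 1)"
  shows "regular_path n (poly_strands X Y)"
  unfolding regular_path_def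
proof (intro conjI ballI ends transverse_imp_finite_critical[OF tr] transverse_imp_unique_triple[OF tr])
  show "continuous_on {0..1} (poly_strands X Y j)" for j
    unfolding poly_strands_def by (intro continuous_on_Complex continuous_intros)
  fix t assume t: "t \<in> critical_moments n (poly_strands X Y)"
  then have t': "t \<in> {0..1}" by (simp add: critical_moments_def)
  show "sign_change n (poly_strands X Y) t"
    unfolding sign_change_def turn_poly_strands
  proof (intro allI impI)
    fix i j k assume *: "{i, j, k} \<subseteq> {1..n}" "distinct [i, j, k]" "poly (turn_poly X Y i j k) t = 0"
    show "\<exists>\<delta>>0. \<forall>u v. 0 \<le> u \<longrightarrow> t - \<delta> < u \<longrightarrow> u < t \<longrightarrow> t < v \<longrightarrow> v < t + \<delta> \<longrightarrow> v \<le> 1 \<longrightarrow>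
        poly (turn_poly X Y i j k) u * poly (turn_poly X Y i j k) v < 0"
      using simple_root_sign_change[OF *(3) transverseD(1)[OF tr t' *]] by blast
  qed
qed

section \<open>Homotopy invariance\<close>

definition near :: "nat \<Rightarrow> real \<Rightarrow> (nat \<Rightarrow> complex) \<Rightarrow> (nat \<Rightarrow> complex) \<Rightarrow> bool" where
  "near n \<epsilon> w c \<longleftrightarrow> (\<forall>j\<in>{1..n}. dist (w j) (c j) < \<epsilon>)"

lemma near_mono: "near n d w c \<Longrightarrow> d \<le> e \<Longrightarrow> near n e w c"
  by (force simp: near_def)

lemma near_trans: "near n d u v \<Longrightarrow> near n e v w \<Longrightarrow> near n (d + e) u w"
  unfolding near_def by (meson dist_triangle_less_add dist_commute_lessI)

lemma shear_dist: "\<bar>shear s w - shear s c\<bar> \<le> (1 + \<bar>s\<bar>) * dist w c"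
proof -
  have "\<bar>shear s w - shear s c\<bar> \<le> \<bar>Re (w - c)\<bar> + \<bar>s\<bar> * \<bar>Im (w - c)\<bar>"
    unfolding shear_def abs_mult[symmetric] by (simp add: algebra_simps)
  also have "\<dots> \<le> cmod (w - c) + \<bar>s\<bar> * cmod (w - c)"
    by (intro add_mono mult_left_mono abs_Re_le_cmod abs_Im_le_cmod) auto
  finally show ?thesis by (simp add: dist_norm algebra_simps)
qed

lemma in_chart_iff:
  "in_chart n s \<pi> c \<longleftrightarrow> bij_betw \<pi> {..<n} {1..n} \<and> (\<forall>p q. p < q \<longrightarrow> q < n \<longrightarrow> shear s (c (\<pi> p)) < shear s (c (\<pi> q)))"
  by (simp add: in_chart_def incr_def chart_coords_def)

lemma in_chart_open:
  assumes "in_chart n s \<pi> c"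
  shows "\<exists>\<epsilon>>0. \<forall>w. near n \<epsilon> w c \<longrightarrow> in_chart n s \<pi> w"
proof -
  have mem: "\<pi> p \<in> {1..n}" if "p < n" for p
    using assms that bij_betwE unfolding in_chart_def by blast
  have "\<exists>\<epsilon>>0. \<forall>x\<in>{..<n} \<times> {..<n}. fst x < snd x \<longrightarrow> 2 * \<epsilon> \<le> shear s (c (\<pi> (snd x))) - shear s (c (\<pi> (fst x)))"
  proof (rule finite_uniform_positive)
    fix x assume "x \<in> {..<n} \<times> {..<n}"
    then have "fst x < snd x \<longrightarrow> shear s (c (\<pi> (fst x))) < shear s (c (\<pi> (snd x)))"
      using assms in_chart_less by auto
    then show "\<exists>\<epsilon>>0. fst x < snd x \<longrightarrow> 2 * \<epsilon> \<le> shear s (c (\<pi> (snd x))) - shear s (c (\<pi> (fst x)))"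
      by (intro exI[of _ "if fst x < snd x then (shear s (c (\<pi> (snd x))) - shear s (c (\<pi> (fst x)))) / 2 else 1"]) auto
  qed auto
  then obtain e where e: "e > 0" "\<And>p q. p < q \<Longrightarrow> q < n \<Longrightarrow> 2 * e \<le> shear s (c (\<pi> q)) - shear s (c (\<pi> p))"
    by force
  have pos: "1 + \<bar>s\<bar> > 0" by simp
  show ?thesis
  proof (intro exI[of _ "e / (1 + \<bar>s\<bar>)"] conjI allI impI)
    show "e / (1 + \<bar>s\<bar>) > 0" using e(1) pos by simp
    fix w assume w: "near n (e / (1 + \<bar>s\<bar>)) w c"
    have "\<bar>shear s (w (\<pi> p)) - shear s (c (\<pi> p))\<bar> < e" if "p < n" for p
    proof -
      have "dist (w (\<pi> p)) (c (\<pi> p)) < e / (1 + \<bar>s\<bar>)" using w mem[OF that] by (auto simp: near_def)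
      then have "(1 + \<bar>s\<bar>) * dist (w (\<pi> p)) (c (\<pi> p)) < e" using pos by (simp add: field_simps)
      then show ?thesis using shear_dist[of s "w (\<pi> p)" "c (\<pi> p)"] by linarith
    qed
    note b = this
    have "shear s (w (\<pi> p)) < shear s (w (\<pi> q))" if "p < q" "q < n" for p q
      using b[of p] b[of q] e(2)[OF that] that by linarith
    then show "in_chart n s \<pi> w" using assms by (simp add: in_chart_iff)
  qed
qed

text \<open>Only finitely many values of \<open>s\<close> give two distinct points the same value of
  the functional. Any other \<open>s\<close> separates the points, and sorting by it yields
  \<open>\<pi>\<close>.\<close>

lemma exists_chart:
  assumes "inj_on c {1..n}"
  shows "\<exists>s \<pi>. in_chart n s \<pi> c"
proof -
  \<comment> \<open>Pairs with equal imaginary parts contribute the default value 0 of a division by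
    zero. They impose no condition on \<open>s\<close>, since their real parts differ.\<close>
  define B where "B = (\<lambda>(i, j). - (Re (c i) - Re (c j)) / (Im (c i) - Im (c j))) ` ({1..n} \<times> {1..n})"
  have "finite B" by (simp add: B_def)
  then obtain s where s: "s \<notin> B" using ex_new_if_finite infinite_UNIV_char_0 by blast
  define f where "f i = shear s (c i)" for i
  have inj: "inj_on f {1..n}"
  proof (rule inj_onI)
    fix i j assume ij: "i \<in> {1..n}" "j \<in> {1..n}" "f i = f j"
    have e: "Re (c i) - Re (c j) = - s * (Im (c i) - Im (c j))" using ij(3) by (simp add: f_def shear_def algebra_simps)
    have "Im (c i) = Im (c j)"
    proof (rule ccontr)
      assume "Im (c i) \<noteq> Im (c j)"
      then have "s = - (Re (c i) - Re (c j)) / (Im (c i) - Im (c j))" unfolding e by (simp add: field_simps)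
      then show False using s ij by (auto simp: B_def)
    qed
    then have "c i = c j" using e by (simp add: complex_eq_iff)
    then show "i = j" using assms ij by (auto dest: inj_onD)
  qed
  define xs where "xs = sort_key f [1..<Suc n]"
  have xs: "distinct xs" "set xs = {1..n}" "length xs = n" "sorted (map f xs)"
    by (auto simp: xs_def)
  have "bij_betw (\<lambda>p. xs ! p) {..<n} {1..n}" using bij_betw_nth[OF xs(1)] xs by auto
  moreover have "f (xs ! p) < f (xs ! q)" if "p < q" "q < n" for p q
  proof -
    have "f (xs ! p) \<le> f (xs ! q)" using sorted_nth_mono[OF xs(4), of p q] that xs(3) by simp
    moreover have "xs ! p \<noteq> xs ! q" using that xs nth_eq_iff_index_eq[OF xs(1), of p q] by simp
    then have "f (xs ! p) \<noteq> f (xs ! q)" using inj that xs by (metis inj_onD less_trans nth_mem)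
    ultimately show ?thesis by simp
  qed
  ultimately show ?thesis unfolding in_chart_iff f_def by blast
qed

lemma strands_near:
  fixes z :: strands
  assumes "\<And>j. j \<in> {1..n} \<Longrightarrow> continuous_on {0..1} (z j)" "x \<in> {0..1}" "\<epsilon> > 0"
  shows "\<exists>d>0. \<forall>t\<in>{0..1}. \<bar>t - x\<bar> < d \<longrightarrow> near n \<epsilon> (\<lambda>j. z j t) (\<lambda>j. z j x)"
proof -
  have "\<exists>d>0. \<forall>j\<in>{1..n}. \<forall>t\<in>{0..1}. \<bar>t - x\<bar> < d \<longrightarrow> dist (z j t) (z j x) < \<epsilon>"
  proof (rule finite_uniform_positive)
    fix j assume "j \<in> {1..n}"
    then show "\<exists>d>0. \<forall>t\<in>{0..1}. \<bar>t - x\<bar> < d \<longrightarrow> dist (z j t) (z j x) < \<epsilon>"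
      using assms unfolding continuous_on_iff dist_real_def by blast
  qed auto
  then show ?thesis unfolding near_def by blast
qed

text \<open>A Lebesgue number for the covering of a path by open conditions, with one radius for
  both time and space. Having such a radius passes to the union of adjacent intervals and holds on
  short intervals around each time, so \<open>Bolzano\<close> gives it on the whole unit
  interval.\<close>

lemma uniform_tube:
  fixes z :: strands and \<V> :: "((nat \<Rightarrow> complex) \<Rightarrow> bool) set"
  assumes cont: "\<And>j. j \<in> {1..n} \<Longrightarrow> continuous_on {0..1} (z j)"
    and V: "\<And>t. t \<in> {0..1} \<Longrightarrow> \<exists>V\<in>\<V>. \<exists>\<epsilon>>0. \<forall>w. near n \<epsilon> w (\<lambda>j. z j t) \<longrightarrow> V w"
  shows "\<exists>r>0. \<forall>t\<in>{0..1}. \<exists>V\<in>\<V>. \<forall>t'\<in>{0..1}. \<bar>t' - t\<bar> < r \<longrightarrow> (\<forall>w. near n r w (\<lambda>j. z j t') \<longrightarrow> V w)"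
proof -
  define G where "G r t \<longleftrightarrow> (\<exists>V\<in>\<V>. \<forall>t'\<in>{0..1}. \<bar>t' - t\<bar> < r \<longrightarrow> (\<forall>w. near n r w (\<lambda>j. z j t') \<longrightarrow> V w))" for r t
  have mono: "G r' t" if "G r t" "r' \<le> r" for r r' t
    unfolding G_def using that(1)[unfolded G_def] near_mono[OF _ that(2)] that(2) by (meson less_le_trans)
  have "\<exists>r>0. \<forall>t\<in>{0..1::real}. G r t"
  proof (rule Bolzano[where P = "\<lambda>a b. \<exists>r>0. \<forall>t\<in>{a..b}. G r t"])
    fix a b c :: real
    assume "\<exists>r>0. \<forall>t\<in>{a..b}. G r t" "\<exists>r>0. \<forall>t\<in>{b..c}. G r t"
    then obtain r r' where "r > 0" "\<forall>t\<in>{a..b}. G r t" "r' > 0" "\<forall>t\<in>{b..c}. G r' t" by blast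
    then have "min r r' > 0" "\<forall>t\<in>{a..c}. G (min r r') t"
      using mono by (auto simp: not_le) (metis atLeastAtMost_iff linear min.cobounded1 min.cobounded2)
    then show "\<exists>r>0. \<forall>t\<in>{a..c}. G r t" by blast
  next
    fix x :: real assume x: "0 \<le> x" "x \<le> 1"
    then obtain V \<epsilon> where "V \<in> \<V>" "\<epsilon> > 0" and w: "\<And>w. near n \<epsilon> w (\<lambda>j. z j x) \<Longrightarrow> V w"
      using V[of x] by auto
    obtain d where d: "d > 0" "\<And>t. t \<in> {0..1} \<Longrightarrow> \<bar>t - x\<bar> < d \<Longrightarrow> near n (\<epsilon> / 2) (\<lambda>j. z j t) (\<lambda>j. z j x)"
      using strands_near[of n z x "\<epsilon> / 2"] cont x \<open>\<epsilon> > 0\<close> by auto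
    \<comment> \<open>A time within r of a time within d/2 of \<open>x\<close> is within
      \<open>d\<close> of \<open>x\<close>; a configuration within r of that stage is then within r
      + \<epsilon>/2 \<le> \<epsilon> of the stage at \<open>x\<close>.\<close>
    define r where "r = min (d / 2) (\<epsilon> / 2)"
    have r: "r > 0" "r \<le> d / 2" "r \<le> \<epsilon> / 2" using d(1) \<open>\<epsilon> > 0\<close> by (auto simp: r_def)
    have G1: "G r t" if "\<bar>t - x\<bar> < d / 2" for t
      unfolding G_def
    proof (intro bexI[OF _ \<open>V \<in> \<V>\<close>] ballI impI allI)
      fix t' u assume t': "t' \<in> {0..1}" "\<bar>t' - t\<bar> < r" "near n r u (\<lambda>j. z j t')"
      have "\<bar>t' - x\<bar> < d" using t'(2) that r(2) by linarith
      then have "near n (r + \<epsilon> / 2) u (\<lambda>j. z j x)" by (rule near_trans[OF t'(3) d(2)[OF t'(1)]])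
      then show "V u" using w near_mono r(3) by force
    qed
    have "\<forall>t\<in>{a..b}. G r t" if "a \<le> x \<and> x \<le> b \<and> b - a < d / 2" for a b
    proof (intro ballI G1)
      fix t assume "t \<in> {a..b}"
      then show "\<bar>t - x\<bar> < d / 2" using that unfolding atLeastAtMost_iff by linarith
    qed
    then show "\<exists>d>0. \<forall>a b. a \<le> x \<and> x \<le> b \<and> b - a < d \<longrightarrow> (\<exists>r>0. \<forall>t\<in>{a..b}. G r t)"
      using half_gt_zero[OF d(1)] r(1) by blast
  qed simp
  then show ?thesis by (simp add: G_def)
qed

section \<open>Words of nearby and of homotopic paths\<close>

context triple_rep begin

text \<open>The path that jumps from \<open>c'\<close> to \<open>c\<close> is constant at the
  indices that matter, so \<open>chart_pot_constant\<close> applies to it.\<close>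

lemma chart_pot_cong:
  assumes "in_chart n s \<pi> c" "generic n c" "\<And>j. j \<in> {1..n} \<Longrightarrow> c' j = c j"
  shows "chart_pot n \<alpha> s \<pi> c' = chart_pot n \<alpha> s \<pi> c"
proof -
  have bij: "bij_betw \<pi> {..<n} {1..n}" using assms(1) by (simp add: in_chart_def)
  have mem: "\<pi> x \<in> {1..n}" if "x < n" for x
    using bij_betwE[OF bij] that by blast
  have "c' (\<pi> x) = c (\<pi> x)" if "x < n" for x using assms(3) mem that by blast
  then have ch': "in_chart n s \<pi> c'" using assms(1) by (auto simp: in_chart_iff)
  have "generic n c'" unfolding generic_def
  proof (intro allI impI)
    fix i j k assume *: "{i, j, k} \<subseteq> {1..n}" "distinct [i, j, k]"
    have "turn c' i j k = turn c i j k" using *(1) assms(3) by (simp add: turn_def)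
    then show "turn c' i j k \<noteq> 0" using assms(2)[unfolded generic_def, rule_format, OF *] by simp
  qed
  define z where "z = (\<lambda>j (t::real). if t \<le> 0 then c' j else c j)"
  have const: "continuous_on {0..1} (z j)" if "j \<in> {1..n}" for j
  proof -
    have "z j = (\<lambda>t. c j)" using assms(3)[OF that] by (auto simp: z_def)
    then show ?thesis by simp
  qed
  have "chart_pot n \<alpha> s \<pi> (\<lambda>j. z j 0) = chart_pot n \<alpha> s \<pi> (\<lambda>j. z j 1)"
  proof (rule chart_pot_constant)
    show "generic n (\<lambda>j. z j t)" for t
      using \<open>generic n c'\<close> assms(2) by (cases "t \<le> 0") (simp_all add: z_def)
  qed (use const ch' assms(1) in \<open>auto simp: z_def\<close>)
  then show ?thesis by (simp add: z_def)
qed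

lemma regular_approximation:
  fixes z :: strands
  assumes "\<And>j. j \<in> {1..n} \<Longrightarrow> continuous_on {0..1} (z j)" "\<And>t. t \<in> {0..1} \<Longrightarrow> inj_on (\<lambda>j. z j t) {1..n}"
    and ends: "generic n (\<lambda>j. z j 0)" "generic n (\<lambda>j. z j 1)" and "\<epsilon> > 0"
  shows "\<exists>w. regular_path n w \<and> (\<forall>j\<in>{1..n}. w j 0 = z j 0 \<and> w j 1 = z j 1) \<and> (\<forall>t\<in>{0..1}. near n \<epsilon> (\<lambda>j. w j t) (\<lambda>j. z j t))"
proof -
  obtain X Y where tr: "transverse {1..n} X Y"
    and e: "\<And>j. j \<in> {1..n} \<Longrightarrow> poly_strands X Y j 0 = z j 0 \<and> poly_strands X Y j 1 = z j 1"
    and d: "\<And>j t. j \<in> {1..n} \<Longrightarrow> t \<in> {0..1} \<Longrightarrow> dist (poly_strands X Y j t) (z j t) < \<epsilon>"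
    by (rule transverse_approximation[of n z \<epsilon>]) (use assms in auto)
  have "generic n (\<lambda>j. poly_strands X Y j 0)" "generic n (\<lambda>j. poly_strands X Y j 1)"
    using ends e unfolding generic_def turn_def by simp_all
  then have "regular_path n (poly_strands X Y)" by (rule transverse_imp_regular[OF tr])
  then show ?thesis using e d by (intro exI[of _ "poly_strands X Y"]) (auto simp: near_def)
qed

text \<open>A chart is convex, so the segment from \<open>c\<close> to \<open>c'\<close> stays in
  both charts, and so does a regular path in a thin tube around it. In each chart the difference of
  potentials is the word of that path, and the word does not depend on the chart.\<close>

lemma chart_pot_overlap:
  assumes ch: "in_chart n s \<pi> c" "in_chart n s \<pi> c'" "in_chart n s' \<pi>' c" "in_chart n s' \<pi>' c'"
    and gen: "generic n c" "generic n c'"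
  shows "- chart_pot n \<alpha> s \<pi> c + chart_pot n \<alpha> s \<pi> c' = - chart_pot n \<alpha> s' \<pi>' c + chart_pot n \<alpha> s' \<pi>' c'"
proof -
  define z where "z = (\<lambda>j t. (1 - t) *\<^sub>R c j + t *\<^sub>R c' j)"
  have z01: "z j 0 = c j" "z j 1 = c' j" for j by (auto simp: z_def)
  have cont: "continuous_on {0..1} (z j)" for j unfolding z_def by (intro continuous_intros)
  have conv: "in_chart n s \<pi> (\<lambda>j. z j t)" if "in_chart n s \<pi> c" "in_chart n s \<pi> c'" "t \<in> {0..1}" for s \<pi> t
    unfolding in_chart_iff
  proof (intro conjI allI impI)
    fix p q assume pq: "p < q" "q < n"
    have sh: "shear s (z j t) = (1 - t) * shear s (c j) + t * shear s (c' j)" for j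
      by (simp add: z_def shear_def algebra_simps)
    have "(1 - t) * shear s (c (\<pi> p)) + t * shear s (c' (\<pi> p)) < (1 - t) * shear s (c (\<pi> q)) + t * shear s (c' (\<pi> q))"
    proof (cases "t = 0")
      case True
      then show ?thesis using in_chart_less[OF that(1) pq] by simp
    next
      case False
      then show ?thesis using that(3) in_chart_less[OF that(1) pq] in_chart_less[OF that(2) pq]
        by (intro add_le_less_mono mult_left_mono mult_strict_left_mono) auto
    qed
    then show "shear s (z (\<pi> p) t) < shear s (z (\<pi> q) t)" by (simp only: sh)
  qed (use that in \<open>simp add: in_chart_def\<close>)
  have inj: "inj_on (\<lambda>j. z j t) {1..n}" if "t \<in> {0..1}" for t
  proof (rule inj_onI)
    fix i j assume ij: "i \<in> {1..n}" "j \<in> {1..n}" "z i t = z j t"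
    have bij: "bij_betw \<pi> {..<n} {1..n}" using ch by (simp add: in_chart_def)
    then obtain p q where pq: "p < n" "q < n" "i = \<pi> p" "j = \<pi> q"
      using ij(1,2) unfolding bij_betw_imp_surj_on[OF bij, symmetric] by auto
    have "\<not> p < q" "\<not> q < p" using in_chart_less[OF conv[OF ch(1,2) that]] ij(3) pq by force+
    then show "i = j" using pq by simp
  qed
  have tube: "\<exists>r>0. \<forall>t\<in>{0..1}. \<forall>w. near n r w (\<lambda>j. z j t) \<longrightarrow> in_chart n s \<pi> w"
    if "in_chart n s \<pi> c" "in_chart n s \<pi> c'" for s \<pi>
  proof -
    have "\<exists>r>0. \<forall>t\<in>{0..1}. \<exists>V\<in>{in_chart n s \<pi>}. \<forall>t'\<in>{0..1}. \<bar>t' - t\<bar> < r \<longrightarrow> (\<forall>w. near n r w (\<lambda>j. z j t') \<longrightarrow> V w)"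
      by (rule uniform_tube[OF cont]) (use conv[OF that] in_chart_open in blast)
    then obtain r where "r > 0" "\<forall>t\<in>{0..1}. \<forall>t'\<in>{0..1}. \<bar>t' - t\<bar> < r \<longrightarrow> (\<forall>w. near n r w (\<lambda>j. z j t') \<longrightarrow> in_chart n s \<pi> w)"
      by auto
    then show ?thesis by (metis abs_zero cancel_comm_monoid_add_class.diff_cancel)
  qed
  obtain r where r: "r > 0" "\<And>t w. t \<in> {0..1} \<Longrightarrow> near n r w (\<lambda>j. z j t) \<Longrightarrow> in_chart n s \<pi> w"
    using tube[OF ch(1,2)] by blast
  obtain r' where r': "r' > 0" "\<And>t w. t \<in> {0..1} \<Longrightarrow> near n r' w (\<lambda>j. z j t) \<Longrightarrow> in_chart n s' \<pi>' w"
    using tube[OF ch(3,4)] by blast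
  obtain w where w: "regular_path n w" "\<forall>j\<in>{1..n}. w j 0 = z j 0 \<and> w j 1 = z j 1"
     "\<forall>t\<in>{0..1}. near n (min r r') (\<lambda>j. w j t) (\<lambda>j. z j t)"
    using regular_approximation[of z "min r r'"] cont inj gen r(1) r'(1) by (auto simp: z01)
  have w_ch: "in_chart n s \<pi> (\<lambda>j. w j t)" "in_chart n s' \<pi>' (\<lambda>j. w j t)" if "t \<in> {0..1}" for t
    using w(3) that r(2)[OF that] r'(2)[OF that] near_mono by (meson min.cobounded1 min.cobounded2)+
  have nc: "0 \<notin> critical_moments n w" "1 \<notin> critical_moments n w"
    using w(1) by (auto simp: critical_moments_iff regular_path_def)
  have "path_word n \<alpha> w 0 1 = - chart_pot n \<alpha> s \<pi> (\<lambda>j. w j 0) + chart_pot n \<alpha> s \<pi> (\<lambda>j. w j 1)"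
       "path_word n \<alpha> w 0 1 = - chart_pot n \<alpha> s' \<pi>' (\<lambda>j. w j 0) + chart_pot n \<alpha> s' \<pi>' (\<lambda>j. w j 1)"
    by (rule path_word_in_chart[OF w(1) _ _ _ nc]; simp add: w_ch)+
  moreover have "chart_pot n \<alpha> s \<pi> (\<lambda>j. w j 0) = chart_pot n \<alpha> s \<pi> c" "chart_pot n \<alpha> s \<pi> (\<lambda>j. w j 1) = chart_pot n \<alpha> s \<pi> c'"
    "chart_pot n \<alpha> s' \<pi>' (\<lambda>j. w j 0) = chart_pot n \<alpha> s' \<pi>' c" "chart_pot n \<alpha> s' \<pi>' (\<lambda>j. w j 1) = chart_pot n \<alpha> s' \<pi>' c'"
    by (rule chart_pot_cong; use ch gen w(2) z01 in simp)+
  ultimately show ?thesis by simp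
qed

lemma path_word_singleton: "a \<notin> critical_moments n z \<Longrightarrow> path_word n \<alpha> z a a = 0"
proof -
  assume "a \<notin> critical_moments n z"
  then have "critical_moments n z \<inter> {a..a} = {}" by auto
  then show ?thesis by (simp add: path_word_def)
qed

text \<open>A ladder between the two paths: over each short time interval one chart contains both,
  the rungs are differences of potentials, and \<open>chart_pot_overlap\<close> lets consecutive
  charts share a rung. No path has to be constructed for a rung.\<close>

lemma close_paths_same_word:
  fixes z :: strands
  assumes cont: "\<And>j. j \<in> {1..n} \<Longrightarrow> continuous_on {0..1} (z j)" and inj: "\<And>t. t \<in> {0..1} \<Longrightarrow> inj_on (\<lambda>j. z j t) {1..n}"
  shows "\<exists>\<epsilon>>0. \<forall>v w. regular_path n v \<longrightarrow> regular_path n w \<longrightarrow>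
    (\<forall>t\<in>{0..1}. near n \<epsilon> (\<lambda>j. v j t) (\<lambda>j. z j t)) \<longrightarrow> (\<forall>t\<in>{0..1}. near n \<epsilon> (\<lambda>j. w j t) (\<lambda>j. z j t)) \<longrightarrow>
    (\<forall>j\<in>{1..n}. v j 0 = w j 0 \<and> v j 1 = w j 1) \<longrightarrow> path_word n \<alpha> v 0 1 = path_word n \<alpha> w 0 1"
proof -
  define \<V> where "\<V> = {in_chart n s \<pi> | s \<pi>. True}"
  have "\<exists>r>0. \<forall>t\<in>{0..1}. \<exists>V\<in>\<V>. \<forall>t'\<in>{0..1}. \<bar>t' - t\<bar> < r \<longrightarrow> (\<forall>w. near n r w (\<lambda>j. z j t') \<longrightarrow> V w)"
  proof (rule uniform_tube[OF cont])
    fix t :: real assume "t \<in> {0..1}"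
    from exists_chart[OF inj[OF this]]
    obtain s \<pi> where ch: "in_chart n s \<pi> (\<lambda>j. z j t)" by (elim exE)
    have "in_chart n s \<pi> \<in> \<V>" unfolding \<V>_def by (intro CollectI exI conjI) (rule HOL.refl TrueI)+
    then show "\<exists>V\<in>\<V>. \<exists>\<epsilon>>0. \<forall>w. near n \<epsilon> w (\<lambda>j. z j t) \<longrightarrow> V w"
      by (rule bexI[where P = "\<lambda>V. \<exists>\<epsilon>>0. \<forall>w. near n \<epsilon> w (\<lambda>j. z j t) \<longrightarrow> V w", OF in_chart_open[OF ch]])
  qed
  then obtain r where r: "r > 0" and "\<forall>t\<in>{0..1}. \<exists>V\<in>\<V>. \<forall>t'\<in>{0..1}. \<bar>t' - t\<bar> < r \<longrightarrow> (\<forall>w. near n r w (\<lambda>j. z j t') \<longrightarrow> V w)"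
    by blast
  moreover define ok where "ok t V \<longleftrightarrow> (\<forall>t'\<in>{0..1}. \<bar>t' - t\<bar> < r \<longrightarrow> (\<forall>w. near n r w (\<lambda>j. z j t') \<longrightarrow> V w))" for t V
  ultimately have "\<forall>t\<in>{0..1}. \<exists>V\<in>\<V>. ok t V" by blast
  then have "\<forall>t\<in>{0..1}. \<exists>s \<pi>. ok t (in_chart n s \<pi>)" unfolding \<V>_def by blast
  then obtain s \<pi> where "\<forall>t\<in>{0..1}. ok t (in_chart n (s t) (\<pi> t))" by metis
  then have sp: "in_chart n (s t) (\<pi> t) w" if "t \<in> {0..1}" "t' \<in> {0..1}" "\<bar>t' - t\<bar> < r" "near n r w (\<lambda>j. z j t')" for t t' w
    using that unfolding ok_def by blast
  \<comment> \<open>With 1/N below the radius, the chart chosen at k/N is valid up to both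
    neighbouring grid points, hence at the nodes k and k + 1.\<close>
  obtain N :: nat where N: "N > 0" "inverse (real N) < r"
    using reals_Archimedean[OF r] by (metis zero_less_Suc)
  have N1: "1 / real N < r" using N by (simp add: field_simps)
  show ?thesis
  proof (intro exI[of _ r] conjI r allI impI)
    fix v w assume reg: "regular_path n v" "regular_path n w"
      and nr: "\<forall>t\<in>{0..1}. near n r (\<lambda>j. v j t) (\<lambda>j. z j t)" "\<forall>t\<in>{0..1}. near n r (\<lambda>j. w j t) (\<lambda>j. z j t)"
      and ends: "\<forall>j\<in>{1..n}. v j 0 = w j 0 \<and> v j 1 = w j 1"
    let ?C = "critical_moments n v \<union> critical_moments n w"
    have fin: "finite (critical_moments n v)" "finite (critical_moments n w)" using reg by (auto simp: regular_path_def)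
    have nc01: "0 \<notin> ?C" "1 \<notin> ?C" using reg by (auto simp: regular_path_def critical_moments_iff)
    \<comment> \<open>The grid points themselves may be critical; an open interval before each of
      them contains a time that is critical for neither path.\<close>
    have "\<exists>x. x \<in> {real k / N - 1 / N<..<real k / N} \<and> x \<notin> ?C" for k
    proof -
      have "infinite {real k / N - 1 / N<..<real k / N}" using N(1) by (simp add: infinite_Ioo)
      then have "\<not> {real k / N - 1 / N<..<real k / N} \<subseteq> ?C" using fin by (metis finite_UnI finite_subset)
      then show ?thesis by blast
    qed
    then obtain x where x: "\<And>k. x k \<in> {real k / N - 1 / N<..<real k / N} \<and> x k \<notin> ?C" by metis
    define \<tau> where "\<tau> k = (if k = 0 then 0 else if k = N then 1 else x k)" for k
    have \<tau>_nc: "\<tau> k \<notin> ?C" for k using nc01 x by (simp add: \<tau>_def)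
    have \<tau>_lo: "real k / N - 1 / N \<le> \<tau> k" if "k \<le> N" for k
      using x[of k] N(1) that by (auto simp: \<tau>_def field_simps)
    have \<tau>_hi: "\<tau> k \<le> real k / N" if "k \<le> N" for k
      using x[of k] N(1) that by (auto simp: \<tau>_def field_simps)
    have \<tau>_hi': "\<tau> k < real k / N \<or> k = 0 \<or> k = N" for k using x[of k] by (auto simp: \<tau>_def)
    have \<tau>01: "\<tau> k \<in> {0..1}" if "k \<le> N" for k
    proof (cases "k = 0 \<or> k = N")
      case False
      then have "1 / N \<le> real k / N" "real k / N \<le> 1" using that N(1) by (auto simp: field_simps)
      then show ?thesis using \<tau>_lo[OF that] \<tau>_hi[OF that] by simp
    qed (auto simp: \<tau>_def)
    have step: "real (Suc k) / N = real k / N + 1 / N" for k by (simp add: add_divide_distrib)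
    have kN: "real k / N \<in> {0..1}" if "k \<le> N" for k using that N(1) by (auto simp: field_simps)
    define P where "P k u = chart_pot n \<alpha> (s (real k / N)) (\<pi> (real k / N)) u" for k u
    have chart: "in_chart n (s (real k / N)) (\<pi> (real k / N)) (\<lambda>j. v j t)" "in_chart n (s (real k / N)) (\<pi> (real k / N)) (\<lambda>j. w j t)"
      if "k \<le> N" "t \<in> {0..1}" "real k / N - 1 / N \<le> t" "t \<le> real k / N + 1 / N" for k t
    proof -
      have "\<bar>t - real k / N\<bar> < r" using that N1 by linarith
      then show "in_chart n (s (real k / N)) (\<pi> (real k / N)) (\<lambda>j. v j t)" "in_chart n (s (real k / N)) (\<pi> (real k / N)) (\<lambda>j. w j t)"
        using sp[OF kN[OF that(1)] that(2)] nr that(2) by blast+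
    qed
    have gen: "generic n (\<lambda>j. v j (\<tau> k))" "generic n (\<lambda>j. w j (\<tau> k))" if "k \<le> N" for k
      using \<tau>_nc[of k] \<tau>01[OF that] by (auto simp: critical_moments_iff)
    have chart\<tau>: "in_chart n (s (real k / N)) (\<pi> (real k / N)) (\<lambda>j. v j (\<tau> k))" "in_chart n (s (real k / N)) (\<pi> (real k / N)) (\<lambda>j. w j (\<tau> k))" if "k \<le> N" for k
      by (rule chart; use that \<tau>01[OF that] \<tau>_lo[OF that] \<tau>_hi[OF that] N(1) in \<open>simp add: field_simps\<close>)+
    \<comment> \<open>The word of \<open>v\<close> up to the node, followed by the rung from
      \<open>v\<close> to \<open>w\<close>, is the word of \<open>w\<close>. At the two end nodes
      the paths agree and the rung is trivial.\<close>
    have main: "path_word n \<alpha> v 0 (\<tau> k) + (- P k (\<lambda>j. v j (\<tau> k)) + P k (\<lambda>j. w j (\<tau> k))) = path_word n \<alpha> w 0 (\<tau> k)"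
      if "k \<le> N" for k
      using that
    proof (induction k)
      case 0
      have "P 0 (\<lambda>j. w j 0) = P 0 (\<lambda>j. v j 0)"
        unfolding P_def by (rule chart_pot_cong) (use chart\<tau>[of 0] gen[of 0] ends in \<open>simp_all add: \<tau>_def\<close>)
      then show ?case using nc01 by (simp add: \<tau>_def path_word_singleton)
    next
      case (Suc k)
      let ?v = "\<lambda>k j. v j (\<tau> k)" and ?w = "\<lambda>k j. w j (\<tau> k)"
      have k: "k \<le> N" using Suc.prems by simp
      have le: "\<tau> k \<le> \<tau> (Suc k)" using \<tau>_hi[OF k] \<tau>_lo[OF Suc.prems] step[of k] by linarith
      have rng: "t \<in> {0..1}" "real k / N - 1 / N \<le> t" "t \<le> real k / N + 1 / N" if "t \<in> {\<tau> k..\<tau> (Suc k)}" for t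
        using that \<tau>01[OF k] \<tau>01[OF Suc.prems] \<tau>_lo[OF k] \<tau>_hi[OF Suc.prems] step[of k] by auto
      have pv: "path_word n \<alpha> v (\<tau> k) (\<tau> (Suc k)) = - P k (?v k) + P k (?v (Suc k))"
        unfolding P_def by (rule path_word_in_chart[OF reg(1) _ le]) (use \<tau>01[OF k] \<tau>01[OF Suc.prems] \<tau>_nc chart[OF k rng] in auto)
      have pw: "path_word n \<alpha> w (\<tau> k) (\<tau> (Suc k)) = - P k (?w k) + P k (?w (Suc k))"
        unfolding P_def by (rule path_word_in_chart[OF reg(2) _ le]) (use \<tau>01[OF k] \<tau>01[OF Suc.prems] \<tau>_nc chart[OF k rng] in auto)
      have m: "\<tau> (Suc k) \<in> {\<tau> k..\<tau> (Suc k)}" using le by simp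
      have ov: "- P (Suc k) (?v (Suc k)) + P (Suc k) (?w (Suc k)) = - P k (?v (Suc k)) + P k (?w (Suc k))"
        unfolding P_def by (rule chart_pot_overlap; rule chart\<tau> chart gen; use Suc.prems k rng[OF m] in simp)
      have sv: "path_word n \<alpha> v 0 (\<tau> (Suc k)) = path_word n \<alpha> v 0 (\<tau> k) + path_word n \<alpha> v (\<tau> k) (\<tau> (Suc k))"
        by (rule path_word_split[OF fin(1) _ le]) (use \<tau>01[OF k] \<tau>_nc in auto)
      have sw: "path_word n \<alpha> w 0 (\<tau> (Suc k)) = path_word n \<alpha> w 0 (\<tau> k) + path_word n \<alpha> w (\<tau> k) (\<tau> (Suc k))"
        by (rule path_word_split[OF fin(2) _ le]) (use \<tau>01[OF k] \<tau>_nc in auto)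
      have "path_word n \<alpha> v 0 (\<tau> (Suc k)) + (- P (Suc k) (?v (Suc k)) + P (Suc k) (?w (Suc k)))
         = path_word n \<alpha> v 0 (\<tau> k) + (- P k (?v k) + P k (?w (Suc k)))"
        unfolding ov sv pv by (simp add: add.assoc)
      also have "\<dots> = (path_word n \<alpha> v 0 (\<tau> k) + (- P k (?v k) + P k (?w k))) + (- P k (?w k) + P k (?w (Suc k)))"
        by (simp add: add.assoc)
      also have "\<dots> = path_word n \<alpha> w 0 (\<tau> (Suc k))"
        unfolding Suc.IH[OF k] sw pw ..
      finally show ?case .
    qed
    have "P N (\<lambda>j. w j 1) = P N (\<lambda>j. v j 1)"
      unfolding P_def by (rule chart_pot_cong) (use chart\<tau>[of N] gen[of N] ends N(1) in \<open>simp_all add: \<tau>_def\<close>)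
    then show "path_word n \<alpha> v 0 1 = path_word n \<alpha> w 0 1"
      using main[of N] N(1) by (simp add: \<tau>_def)
  qed
qed

text \<open>The intermediate stages of the homotopy need not be regular. Each is replaced by regular
  paths close to it with the same ends, which all have one common word; neighbouring stages share
  such an approximation, so the word is locally constant in the homotopy parameter and thus
  constant.\<close>

theorem path_word_homotopy:
  fixes H :: "real \<Rightarrow> strands"
  assumes cont: "\<And>j. j \<in> {1..n} \<Longrightarrow> continuous_on ({0..1} \<times> {0..1}) (\<lambda>(s, t). H s j t)"
    and inj: "\<And>s t. s \<in> {0..1} \<Longrightarrow> t \<in> {0..1} \<Longrightarrow> inj_on (\<lambda>j. H s j t) {1..n}"
    and ends: "\<And>s j. s \<in> {0..1} \<Longrightarrow> j \<in> {1..n} \<Longrightarrow> H s j 0 = e0 j \<and> H s j 1 = e1 j"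
    and gen: "generic n e0" "generic n e1"
    and vw: "regular_path n v" "regular_path n w"
      "\<And>j t. j \<in> {1..n} \<Longrightarrow> t \<in> {0..1} \<Longrightarrow> H 0 j t = v j t \<and> H 1 j t = w j t"
  shows "path_word n \<alpha> v 0 1 = path_word n \<alpha> w 0 1"
proof -
  have contH: "continuous_on {0..1} (H s j)" if "s \<in> {0..1}" "j \<in> {1..n}" for s j
  proof -
    have c: "continuous_on {0..1} (\<lambda>t::real. (s, t))"
      by (intro continuous_on_Pair continuous_on_const continuous_on_id)
    have i: "(\<lambda>t. (s, t)) ` {0..1} \<subseteq> {0..1} \<times> {0..1}" using that by auto
    show ?thesis using continuous_on_compose2[OF cont[OF that(2)] c i] by simp
  qed
  have genH: "generic n (\<lambda>j. H s j 0)" "generic n (\<lambda>j. H s j 1)" if "s \<in> {0..1}" for s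
    using gen ends[OF that] unfolding generic_def turn_def by simp_all
  \<comment> \<open>The ends are prescribed exactly, since \<open>close_paths_same_word\<close>
    compares only paths with common ends.\<close>
  define good where "good s \<epsilon> p \<longleftrightarrow> regular_path n p \<and> (\<forall>j\<in>{1..n}. p j 0 = e0 j \<and> p j 1 = e1 j) \<and>
     (\<forall>t\<in>{0..1}. near n \<epsilon> (\<lambda>j. p j t) (\<lambda>j. H s j t))" for s \<epsilon> p
  have ex_good: "\<exists>p. good s \<epsilon> p" if s: "s \<in> {0..1}" "\<epsilon> > 0" for s \<epsilon>
  proof -
    have "\<exists>w. regular_path n w \<and> (\<forall>j\<in>{1..n}. w j 0 = H s j 0 \<and> w j 1 = H s j 1) \<and> (\<forall>t\<in>{0..1}. near n \<epsilon> (\<lambda>j. w j t) (\<lambda>j. H s j t))"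
      by (rule regular_approximation[OF contH[OF s(1)] inj[OF s(1)] genH[OF s(1)] s(2)])
    then obtain w where w: "regular_path n w" "\<forall>j\<in>{1..n}. w j 0 = H s j 0 \<and> w j 1 = H s j 1"
      "\<forall>t\<in>{0..1}. near n \<epsilon> (\<lambda>j. w j t) (\<lambda>j. H s j t)"
      by (elim exE conjE)
    have "good s \<epsilon> w" unfolding good_def using w ends[OF s(1)] by simp
    then show ?thesis by blast
  qed
  define ok where "ok s \<epsilon> \<longleftrightarrow> \<epsilon> > 0 \<and> (\<forall>p q. good s \<epsilon> p \<longrightarrow> good s \<epsilon> q \<longrightarrow> path_word n \<alpha> p 0 1 = path_word n \<alpha> q 0 1)" for s \<epsilon>
  have "\<exists>\<epsilon>. ok s \<epsilon>" if s: "s \<in> {0..1}" for s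
  proof -
    have "\<exists>\<epsilon>>0. \<forall>v w. regular_path n v \<longrightarrow> regular_path n w \<longrightarrow>
      (\<forall>t\<in>{0..1}. near n \<epsilon> (\<lambda>j. v j t) (\<lambda>j. H s j t)) \<longrightarrow> (\<forall>t\<in>{0..1}. near n \<epsilon> (\<lambda>j. w j t) (\<lambda>j. H s j t)) \<longrightarrow>
      (\<forall>j\<in>{1..n}. v j 0 = w j 0 \<and> v j 1 = w j 1) \<longrightarrow> path_word n \<alpha> v 0 1 = path_word n \<alpha> w 0 1"
      by (rule close_paths_same_word[OF contH[OF s] inj[OF s]])
    then obtain \<epsilon> where "\<epsilon> > 0" and \<epsilon>: "\<forall>v w. regular_path n v \<longrightarrow> regular_path n w \<longrightarrow>
      (\<forall>t\<in>{0..1}. near n \<epsilon> (\<lambda>j. v j t) (\<lambda>j. H s j t)) \<longrightarrow> (\<forall>t\<in>{0..1}. near n \<epsilon> (\<lambda>j. w j t) (\<lambda>j. H s j t)) \<longrightarrow>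
      (\<forall>j\<in>{1..n}. v j 0 = w j 0 \<and> v j 1 = w j 1) \<longrightarrow> path_word n \<alpha> v 0 1 = path_word n \<alpha> w 0 1"
      by (elim exE conjE)
    have "path_word n \<alpha> p 0 1 = path_word n \<alpha> q 0 1" if "good s \<epsilon> p" "good s \<epsilon> q" for p q
      using that unfolding good_def by (intro \<epsilon>[rule_format]) simp_all
    then have "ok s \<epsilon>" using \<open>\<epsilon> > 0\<close> unfolding ok_def by blast
    then show ?thesis by blast
  qed
  then obtain \<epsilon> where "\<And>s. s \<in> {0..1} \<Longrightarrow> ok s (\<epsilon> s)" by metis
  then have \<epsilon>: "\<And>s. s \<in> {0..1} \<Longrightarrow> \<epsilon> s > 0"
    "\<And>s p q. s \<in> {0..1} \<Longrightarrow> good s (\<epsilon> s) p \<Longrightarrow> good s (\<epsilon> s) q \<Longrightarrow> path_word n \<alpha> p 0 1 = path_word n \<alpha> q 0 1"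
    unfolding ok_def by blast+
  have "\<exists>p. good s (\<epsilon> s) p" if "s \<in> {0..1}" for s using ex_good[OF that \<epsilon>(1)[OF that]] .
  then obtain p where p: "\<And>s. s \<in> {0..1} \<Longrightarrow> good s (\<epsilon> s) (p s)" by metis
  have good_mono: "good s e q" if "good s d q" "d \<le> e" for s d e q
    using that near_mono unfolding good_def by blast
  define g where "g s = path_word n \<alpha> (p s) 0 1" for s
  have "g 0 = g 1"
  proof (rule connected_local_const[of "{0..1::real}"])
    show "\<forall>a\<in>{0..1}. eventually (\<lambda>b. g a = g b) (at a within {0..1})"
    proof
      fix a :: real assume a: "a \<in> {0..1}"
      have "\<exists>d>0. \<forall>j\<in>{1..n}. \<forall>s\<in>{0..1}. \<forall>t\<in>{0..1}. \<bar>s - a\<bar> < d \<longrightarrow> dist (H s j t) (H a j t) < \<epsilon> a / 2"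
      proof (rule finite_uniform_positive)
        fix j assume j: "j \<in> {1..n}"
        have "uniformly_continuous_on ({0..1} \<times> {0..1}) (\<lambda>(s, t). H s j t)"
          by (intro compact_uniformly_continuous cont[OF j] compact_Times) auto
        then obtain d where d: "d > 0" "\<And>x y. x \<in> {0..1} \<times> {0..1} \<Longrightarrow> y \<in> {0..1} \<times> {0..1} \<Longrightarrow> dist y x < d \<Longrightarrow>
           dist (case y of (s, t) \<Rightarrow> H s j t) (case x of (s, t) \<Rightarrow> H s j t) < \<epsilon> a / 2"
          using \<epsilon>(1)[OF a] unfolding uniformly_continuous_on_def by (metis half_gt_zero)
        have "dist (H s j t) (H a j t) < \<epsilon> a / 2" if "s \<in> {0..1}" "t \<in> {0..1}" "\<bar>s - a\<bar> < d" for s t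
          using d(2)[of "(a, t)" "(s, t)"] a that by (simp add: dist_Pair_Pair dist_real_def)
        then show "\<exists>d>0. \<forall>s\<in>{0..1}. \<forall>t\<in>{0..1}. \<bar>s - a\<bar> < d \<longrightarrow> dist (H s j t) (H a j t) < \<epsilon> a / 2"
          using d(1) by blast
      qed auto
      then obtain d where d: "d > 0" "\<And>s t. s \<in> {0..1} \<Longrightarrow> t \<in> {0..1} \<Longrightarrow> \<bar>s - a\<bar> < d \<Longrightarrow> near n (\<epsilon> a / 2) (\<lambda>j. H s j t) (\<lambda>j. H a j t)"
        unfolding near_def by blast
      have "g a = g s" if s: "s \<in> {0..1}" "dist s a < d" for s
      proof -
        \<comment> \<open>The path \<open>q\<close> is within half the radius of stage
          \<open>s\<close>, which is within the other half of stage \<open>a\<close>; so it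
          approximates both stages well enough.\<close>
        obtain q where q: "good s (min (\<epsilon> s) (\<epsilon> a / 2)) q" using ex_good[OF s(1)] \<epsilon>(1)[OF s(1)] \<epsilon>(1)[OF a] by fastforce
        have "good s (\<epsilon> s) q" by (rule good_mono[OF q]) simp
        then have "path_word n \<alpha> q 0 1 = g s" unfolding g_def using \<epsilon>(2)[OF s(1)] p[OF s(1)] by blast
        moreover have "near n (\<epsilon> a) (\<lambda>j. q j t) (\<lambda>j. H a j t)" if t: "t \<in> {0..1}" for t
        proof -
          have "near n (\<epsilon> a / 2) (\<lambda>j. q j t) (\<lambda>j. H s j t)"
            by (rule near_mono[of n "min (\<epsilon> s) (\<epsilon> a / 2)"]) (use q t in \<open>simp_all add: good_def\<close>)
          moreover have "near n (\<epsilon> a / 2) (\<lambda>j. H s j t) (\<lambda>j. H a j t)"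
            using d(2)[OF s(1) t] s(2) by (simp add: dist_real_def)
          ultimately have "near n (\<epsilon> a / 2 + \<epsilon> a / 2) (\<lambda>j. q j t) (\<lambda>j. H a j t)" by (rule near_trans)
          then show ?thesis by simp
        qed
        then have "good a (\<epsilon> a) q" using q unfolding good_def by blast
        then have "path_word n \<alpha> q 0 1 = g a" unfolding g_def using \<epsilon>(2)[OF a] p[OF a] by blast
        ultimately show ?thesis by simp
      qed
      then show "eventually (\<lambda>b. g a = g b) (at a within {0..1})"
        unfolding eventually_at using d(1) by blast
    qed
  qed auto
  moreover have "good 0 (\<epsilon> 0) v"
  proof -
    have "near n (\<epsilon> 0) (\<lambda>j. v j t) (\<lambda>j. H 0 j t)" if "t \<in> {0..1}" for t
      using vw(3) that \<epsilon>(1)[of 0] by (simp add: near_def)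
    moreover have "v j 0 = e0 j \<and> v j 1 = e1 j" if "j \<in> {1..n}" for j
      using vw(3)[OF that, of 0] vw(3)[OF that, of 1] ends[of 0 j] that by simp
    ultimately show ?thesis using vw(1) by (simp add: good_def)
  qed
  moreover have "good 1 (\<epsilon> 1) w"
  proof -
    have "near n (\<epsilon> 1) (\<lambda>j. w j t) (\<lambda>j. H 1 j t)" if "t \<in> {0..1}" for t
      using vw(3) that \<epsilon>(1)[of 1] by (simp add: near_def)
    moreover have "w j 0 = e0 j \<and> w j 1 = e1 j" if "j \<in> {1..n}" for j
      using vw(3)[OF that, of 0] vw(3)[OF that, of 1] ends[of 1 j] that by simp
    ultimately show ?thesis using vw(2) by (simp add: good_def)
  qed
  ultimately show ?thesis using \<epsilon>(2)[of 0 v "p 0"] \<epsilon>(2)[of 1 w "p 1"] p[of 0] p[of 1] by (simp add: g_def)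
qed

end

section \<open>Stability of simple zeros\<close>

lemma real_mvt_on_unit:
  fixes g :: "real \<Rightarrow> real"
  assumes "\<And>t. t \<in> {0..1} \<Longrightarrow> (g has_real_derivative g' t) (at t within {0..1})" "0 \<le> a" "a < b" "b \<le> 1"
  shows "\<exists>\<xi>\<in>{a<..<b}. g b - g a = g' \<xi> * (b - a)"
proof (rule mvt_simple[OF \<open>a < b\<close>])
  fix x assume "a \<le> x" "x \<le> b"
  then have "(g has_real_derivative g' x) (at x within {a..b})"
    using assms by (intro has_field_derivative_subset[OF assms(1)]) auto
  then show "(g has_derivative (*) (g' x)) (at x within {a..b})"
    by (simp add: has_field_derivative_def)
qed

lemma finite_family_positive_nearby:
  fixes h :: "'x \<Rightarrow> real \<Rightarrow> real"
  assumes "finite A" "\<And>x. x \<in> A \<Longrightarrow> continuous_on {0..1} (h x)" "t0 \<in> {0..1}" "\<And>x. x \<in> A \<Longrightarrow> h x t0 > 0"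
  shows "\<exists>d>0. \<exists>c>0. \<forall>x\<in>A. \<forall>t\<in>{0..1}. \<bar>t - t0\<bar> < d \<longrightarrow> c \<le> h x t"
proof -
  have "\<exists>c>0. \<forall>x\<in>A. \<forall>t\<in>{0..1}. \<bar>t - t0\<bar> < c \<longrightarrow> c \<le> h x t"
  proof (rule finite_uniform_positive[OF assms(1)])
    fix x assume x: "x \<in> A"
    then have "h x t0 / 2 > 0" using assms(4) by simp
    then obtain d where d: "d > 0" "\<And>t. t \<in> {0..1} \<Longrightarrow> \<bar>t - t0\<bar> < d \<Longrightarrow> \<bar>h x t - h x t0\<bar> < h x t0 / 2"
      using assms(2)[OF x] assms(3) unfolding continuous_on_iff dist_real_def by blast
    have "min d (h x t0 / 2) \<le> h x t" if "t \<in> {0..1}" "\<bar>t - t0\<bar> < min d (h x t0 / 2)" for t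
    proof -
      have "\<bar>h x t - h x t0\<bar> < h x t0 / 2" using d(2)[OF that(1)] that(2) by simp
      then have "h x t0 / 2 \<le> h x t" by linarith
      then show ?thesis by simp
    qed
    then show "\<exists>c>0. \<forall>t\<in>{0..1}. \<bar>t - t0\<bar> < c \<longrightarrow> c \<le> h x t"
      using d(1) \<open>h x t0 / 2 > 0\<close> by (intro exI[of _ "min d (h x t0 / 2)"]) auto
  next
    fix x d e assume "\<forall>t\<in>{0..1}. \<bar>t - t0\<bar> < d \<longrightarrow> d \<le> h x t" "0 < e" "e \<le> (d::real)"
    then show "\<forall>t\<in>{0..1}. \<bar>t - t0\<bar> < e \<longrightarrow> e \<le> h x t" by force
  qed
  then show ?thesis by blast
qed

lemma compact_nonzero_bounded_below:
  fixes f :: "real \<Rightarrow> real"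
  assumes "compact K" "continuous_on K f" "\<And>t. t \<in> K \<Longrightarrow> f t \<noteq> 0"
  shows "\<exists>c>0. \<forall>t\<in>K. c \<le> \<bar>f t\<bar>"
proof (cases "K = {}")
  case False
  have "continuous_on K (\<lambda>t. \<bar>f t\<bar>)" using assms(2) by (intro continuous_intros)
  then obtain t0 where "t0 \<in> K" "\<forall>t\<in>K. \<bar>f t0\<bar> \<le> \<bar>f t\<bar>"
    using continuous_attains_inf[OF assms(1) False, of "\<lambda>t. \<bar>f t\<bar>"] by blast
  then show ?thesis using assms(3)[of t0] by (intro exI[of _ "\<bar>f t0\<bar>"]) auto
qed (auto intro: exI[of _ 1])

text \<open>In a small window around a zero, the vanishing function has a derivative bounded away
  from 0 and the other functions are themselves bounded away from 0; outside the windows all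
  functions are. A perturbation below these bounds has exactly one zero in each window, by the
  intermediate and the mean value theorem, and none elsewhere.\<close>

lemma simple_zeros_stable:
  fixes F F' :: "'x \<Rightarrow> real \<Rightarrow> real" and \<T> :: "'x set"
  defines "Z \<equiv> {t \<in> {0..1}. \<exists>x\<in>\<T>. F x t = 0}"
  assumes fin: "finite \<T>" "finite Z"
    and der: "\<And>x t. x \<in> \<T> \<Longrightarrow> t \<in> {0..1} \<Longrightarrow> (F x has_real_derivative F' x t) (at t within {0..1})"
    and cont': "\<And>x. x \<in> \<T> \<Longrightarrow> continuous_on {0..1} (F' x)"
    and ends: "\<And>x. x \<in> \<T> \<Longrightarrow> F x 0 \<noteq> 0 \<and> F x 1 \<noteq> 0"
    and simple: "\<And>x t. x \<in> \<T> \<Longrightarrow> t \<in> {0..1} \<Longrightarrow> F x t = 0 \<Longrightarrow> F' x t \<noteq> 0"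
    and unique: "\<And>x y t. x \<in> \<T> \<Longrightarrow> y \<in> \<T> \<Longrightarrow> t \<in> {0..1} \<Longrightarrow> F x t = 0 \<Longrightarrow> F y t = 0 \<Longrightarrow> x = y"
  shows "\<exists>c>0. \<forall>G G'. (\<forall>x\<in>\<T>. \<forall>t\<in>{0..1}. (G x has_real_derivative G' x t) (at t within {0..1}) \<and>
      \<bar>G x t - F x t\<bar> < c \<and> \<bar>G' x t - F' x t\<bar> < c) \<longrightarrow>
      finite {t \<in> {0..1}. \<exists>x\<in>\<T>. G x t = 0} \<and> card {t \<in> {0..1}. \<exists>x\<in>\<T>. G x t = 0} = card Z"
proof -
  have contF: "continuous_on {0..1} (F x)" if "x \<in> \<T>" for x
    using der[OF that] by (intro DERIV_continuous_on)
  have "\<exists>x0\<in>\<T>. F x0 t0 = 0" if "t0 \<in> Z" for t0 using that by (auto simp: Z_def)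
  then obtain x0 where x0: "\<And>t0. t0 \<in> Z \<Longrightarrow> x0 t0 \<in> \<T> \<and> F (x0 t0) t0 = 0" by metis
  define \<sigma> where "\<sigma> t0 = sgn (F' (x0 t0) t0)" for t0
  \<comment> \<open>One family for both kinds of lower bound in a window: the signed derivative of
    the function that vanishes at \<open>t0\<close>, and the absolute values of the others.\<close>
  define h where "h t0 x t = (if x = x0 t0 then \<sigma> t0 * F' x t else \<bar>F x t\<bar>)" for t0 x t
  have Z01: "0 < t0" "t0 < 1" if "t0 \<in> Z" for t0
  proof -
    have "t0 \<in> {0..1}" "t0 \<noteq> 0" "t0 \<noteq> 1" using that ends by (auto simp: Z_def)
    then show "0 < t0" "t0 < 1" by auto
  qed
  have \<sigma>: "\<bar>\<sigma> t0\<bar> = 1" if "t0 \<in> Z" for t0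
    using simple[of "x0 t0" t0] x0[OF that] Z01[OF that] by (auto simp: \<sigma>_def sgn_if)
  \<comment> \<open>The factor 2 makes the closed windows disjoint and puts their end points at
    distance at least \<open>d\<close> from all zeros, that is, into the set \<open>K\<close>
    below.\<close>
  define good where "good d t0 \<longleftrightarrow> d < t0 \<and> t0 + d < 1 \<and> (\<forall>s\<in>Z. s \<noteq> t0 \<longrightarrow> 2 * d < \<bar>s - t0\<bar>) \<and>
     (\<exists>c>0. \<forall>x\<in>\<T>. \<forall>t\<in>{t0-d..t0+d}. c \<le> h t0 x t)" for d t0
  have "\<exists>d>0. \<forall>t0\<in>Z. good d t0"
  proof (rule finite_uniform_positive[OF fin(2)])
    fix t0 assume t0: "t0 \<in> Z"
    have "\<exists>d>0. \<exists>c>0. \<forall>x\<in>\<T>. \<forall>t\<in>{0..1}. \<bar>t - t0\<bar> < d \<longrightarrow> c \<le> h t0 x t"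
    proof (rule finite_family_positive_nearby[OF fin(1)])
      fix x assume x: "x \<in> \<T>"
      show "continuous_on {0..1} (h t0 x)"
        using contF[OF x] cont'[OF x] unfolding h_def by (cases "x = x0 t0") (auto intro!: continuous_intros)
      show "h t0 x t0 > 0"
      proof (cases "x = x0 t0")
        case True
        then have "F' x t0 \<noteq> 0" using simple[OF x, of t0] x0[OF t0] Z01[OF t0] by auto
        then show ?thesis using True by (auto simp: h_def \<sigma>_def sgn_if)
      next
        case False
        then have "F x t0 \<noteq> 0" using unique[OF x, of "x0 t0" t0] x0[OF t0] Z01[OF t0] by auto
        then show ?thesis using False by (simp add: h_def)
      qed
    qed (use Z01[OF t0] in auto)
    then obtain d1 c where d1: "d1 > 0" "c > 0" "\<And>x t. x \<in> \<T> \<Longrightarrow> t \<in> {0..1} \<Longrightarrow> \<bar>t - t0\<bar> < d1 \<Longrightarrow> c \<le> h t0 x t"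
      by blast
    obtain d2 where d2: "d2 > 0" "\<And>s. s \<in> Z \<Longrightarrow> s \<noteq> t0 \<Longrightarrow> d2 \<le> \<bar>s - t0\<bar>"
      using finite_set_avoid[OF fin(2), of t0] by (auto simp: dist_real_def abs_minus_commute)
    define d where "d = Min {d1, d2, t0, 1 - t0} / 3"
    have d: "d > 0" "d < d1" "2 * d < d2" "d < t0" "d < 1 - t0"
      using d1(1) d2(1) Z01[OF t0] by (auto simp: d_def min_def)
    have "c \<le> h t0 x t" if "x \<in> \<T>" "t \<in> {t0-d..t0+d}" for x t
      using that d by (intro d1(3)) auto
    moreover have "2 * d < \<bar>s - t0\<bar>" if "s \<in> Z" "s \<noteq> t0" for s using d2(2)[OF that] d by linarith
    ultimately have "good d t0" unfolding good_def using d d1(2) by auto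
    then show "\<exists>d>0. good d t0" using d(1) by blast
  next
    fix t0 d e assume *: "good d t0" "0 < e" "e \<le> d"
    then have "{t0-e..t0+e} \<subseteq> {t0-d..t0+d}" by auto
    moreover have "2 * e < \<bar>s - t0\<bar>" if "s \<in> Z" "s \<noteq> t0" for s using * that by (force simp: good_def)
    ultimately show "good e t0" using * unfolding good_def by (auto 0 3)
  qed
  then obtain d where d: "d > 0" "\<And>t0. t0 \<in> Z \<Longrightarrow> good d t0" by blast
  have "\<exists>c>0. \<forall>t0\<in>Z. \<forall>x\<in>\<T>. \<forall>t\<in>{t0-d..t0+d}. c \<le> h t0 x t"
  proof (rule finite_uniform_positive[OF fin(2)])
    fix t0 a b :: real assume "\<forall>x\<in>\<T>. \<forall>t\<in>{t0-d..t0+d}. a \<le> h t0 x t" "b \<le> a"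
    then show "\<forall>x\<in>\<T>. \<forall>t\<in>{t0-d..t0+d}. b \<le> h t0 x t" by force
  qed (use d(2) in \<open>simp add: good_def\<close>)
  then obtain c1 where c1: "c1 > 0" "\<And>t0 x t. t0 \<in> Z \<Longrightarrow> x \<in> \<T> \<Longrightarrow> t \<in> {t0-d..t0+d} \<Longrightarrow> c1 \<le> h t0 x t"
    by blast
  \<comment> \<open>The complement of the open windows. Its compactness yields the lower bound
    \<open>c2\<close>, which excludes new zeros and also preserves the signs at the ends of each
    window.\<close>
  define K where "K = {0..1} \<inter> (\<Inter>s\<in>Z. {t. d \<le> \<bar>t - s\<bar>})"
  have "closed {t::real. d \<le> \<bar>t - s\<bar>}" for s
    by (intro closed_Collect_le continuous_intros)
  then have "compact K" unfolding K_def by (intro compact_Int_closed closed_INT) auto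
  have "\<exists>c>0. \<forall>x\<in>\<T>. \<forall>t\<in>K. c \<le> \<bar>F x t\<bar>"
  proof (rule finite_uniform_positive[OF fin(1)])
    fix x assume x: "x \<in> \<T>"
    show "\<exists>c>0. \<forall>t\<in>K. c \<le> \<bar>F x t\<bar>"
    proof (rule compact_nonzero_bounded_below[OF \<open>compact K\<close>])
      show "continuous_on K (F x)" by (rule continuous_on_subset[OF contF[OF x]]) (auto simp: K_def)
      fix t assume t: "t \<in> K"
      show "F x t \<noteq> 0"
      proof
        assume "F x t = 0"
        then have "t \<in> Z" using t x by (auto simp: Z_def K_def)
        then show False using t d(1) by (auto simp: K_def)
      qed
    qed
  qed force
  then obtain c2 where c2: "c2 > 0" "\<And>x t. x \<in> \<T> \<Longrightarrow> t \<in> K \<Longrightarrow> c2 \<le> \<bar>F x t\<bar>" by blast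
  show ?thesis
  proof (intro exI[of _ "min c1 c2"] conjI[of "min c1 c2 > 0"] allI impI)
    show "min c1 c2 > 0" using c1 c2 by simp
    fix G G'
    assume asm: "\<forall>x\<in>\<T>. \<forall>t\<in>{0..1}. (G x has_real_derivative G' x t) (at t within {0..1}) \<and>
      \<bar>G x t - F x t\<bar> < min c1 c2 \<and> \<bar>G' x t - F' x t\<bar> < min c1 c2"
    define N where "N = {t \<in> {0..1}. \<exists>x\<in>\<T>. G x t = 0}"
    have derG: "(G x has_real_derivative G' x t) (at t within {0..1})" and GF: "\<bar>G x t - F x t\<bar> < c1" "\<bar>G x t - F x t\<bar> < c2"
      and GF': "\<bar>G' x t - F' x t\<bar> < c1" if "x \<in> \<T>" "t \<in> {0..1}" for x t
      using asm that by auto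
    have contG: "continuous_on {0..1} (G x)" if "x \<in> \<T>" for x
      using derG[OF that] by (intro DERIV_continuous_on)
    have outer: "t \<notin> N" if "t \<in> K" for t
    proof
      assume "t \<in> N"
      then obtain x where x: "x \<in> \<T>" "G x t = 0" "t \<in> {0..1}" by (auto simp: N_def)
      then show False using GF(2)[OF x(1,3)] c2(2)[OF x(1) that] by auto
    qed
    have inner: "\<exists>\<tau>. N \<inter> {t0-d..t0+d} = {\<tau>}" if t0: "t0 \<in> Z" for t0
    proof -
      have g: "d < t0" "t0 + d < 1" and sep: "\<And>s. s \<in> Z \<Longrightarrow> s \<noteq> t0 \<Longrightarrow> 2 * d < \<bar>s - t0\<bar>"
        using d(2)[OF t0] by (auto simp: good_def)
      let ?x = "x0 t0"
      have x: "?x \<in> \<T>" "F ?x t0 = 0" using x0[OF t0] by auto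
      have s: "\<sigma> t0 = 1 \<or> \<sigma> t0 = -1" using \<sigma>[OF t0] by (auto simp: abs_if split: if_splits)
      have sub: "t \<in> {0..1}" if "t \<in> {t0-d..t0+d}" for t using that g by auto
      have other: "G y t \<noteq> 0" if "y \<in> \<T>" "y \<noteq> ?x" "t \<in> {t0-d..t0+d}" for y t
        using c1(2)[OF t0 that(1,3)] GF(1)[OF that(1) sub[OF that(3)]] that(2) by (auto simp: h_def)
      have G'pos: "\<sigma> t0 * G' ?x t > 0" if "t \<in> {t0-d..t0+d}" for t
        using c1(2)[OF t0 x(1) that] GF'[OF x(1) sub[OF that]] s by (auto simp: h_def)
      have F'pos: "\<sigma> t0 * F' ?x t > 0" if "t \<in> {t0-d..t0+d}" for t
        using c1(1) c1(2)[OF t0 x(1) that] by (auto simp: h_def)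
      have "d \<le> \<bar>t0 - d - s\<bar>" "d \<le> \<bar>t0 + d - s\<bar>" if "s \<in> Z" for s
        using sep[OF that] d(1) by (cases "s = t0"; linarith)+
      then have inK: "t0 - d \<in> K" "t0 + d \<in> K"
        unfolding K_def using g d(1) by auto
      have "\<exists>\<xi>\<in>{t0<..<t0+d}. F ?x (t0 + d) - F ?x t0 = F' ?x \<xi> * (t0 + d - t0)"
        by (rule real_mvt_on_unit) (use der[OF x(1)] g d(1) in auto)
      then obtain \<xi> where \<xi>: "\<xi> \<in> {t0<..<t0+d}" "F ?x (t0 + d) = F' ?x \<xi> * d" using x(2) by auto
      have "\<sigma> t0 * F ?x (t0 + d) > 0" unfolding \<xi>(2) using F'pos[of \<xi>] \<xi>(1) d(1) by (simp add: mult.assoc[symmetric])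
      then have Gr: "\<sigma> t0 * G ?x (t0 + d) > 0"
        using c2(2)[OF x(1) inK(2)] GF(2)[OF x(1) sub[of "t0 + d"]] d(1) s by (auto simp: abs_if split: if_splits)
      have "\<exists>\<xi>\<in>{t0-d<..<t0}. F ?x t0 - F ?x (t0 - d) = F' ?x \<xi> * (t0 - (t0 - d))"
        by (rule real_mvt_on_unit) (use der[OF x(1)] g d(1) in auto)
      then obtain \<xi>' where \<xi>': "\<xi>' \<in> {t0-d<..<t0}" "F ?x (t0 - d) = - (F' ?x \<xi>' * d)" using x(2) by auto
      have "\<sigma> t0 * F ?x (t0 - d) < 0" unfolding \<xi>'(2) using F'pos[of \<xi>'] \<xi>'(1) d(1) by (simp add: mult.assoc[symmetric])
      then have Gl: "\<sigma> t0 * G ?x (t0 - d) < 0"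
        using c2(2)[OF x(1) inK(1)] GF(2)[OF x(1) sub[of "t0 - d"]] d(1) s by (auto simp: abs_if split: if_splits)
      have cG: "continuous_on {t0-d..t0+d} (\<lambda>t. \<sigma> t0 * G ?x t)"
        by (intro continuous_intros continuous_on_subset[OF contG[OF x(1)]]) (use sub in blast)
      obtain \<tau> where \<tau>: "\<tau> \<in> {t0-d..t0+d}" "\<sigma> t0 * G ?x \<tau> = 0"
        using IVT'[of "\<lambda>t. \<sigma> t0 * G ?x t" "t0 - d" 0 "t0 + d"] cG Gl Gr d(1) by auto
      then have "G ?x \<tau> = 0" using s by auto
      then have "\<tau> \<in> N" using sub[OF \<tau>(1)] x(1) by (auto simp: N_def)
      have no_two: False if ab: "a \<in> {t0-d..t0+d}" "b \<in> {t0-d..t0+d}" "a < b" "G ?x a = 0" "G ?x b = 0" for a b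
      proof -
        have "\<exists>\<xi>\<in>{a<..<b}. G ?x b - G ?x a = G' ?x \<xi> * (b - a)"
          by (rule real_mvt_on_unit) (use derG[OF x(1)] sub[OF ab(1)] sub[OF ab(2)] ab(3) in auto)
        then obtain \<xi> where "\<xi> \<in> {a<..<b}" "G' ?x \<xi> = 0" using ab by auto
        then show False using G'pos[of \<xi>] ab by auto
      qed
      have "t = \<tau>" if t: "t \<in> N" "t \<in> {t0-d..t0+d}" for t
      proof -
        obtain y where "y \<in> \<T>" "G y t = 0" using t(1) by (auto simp: N_def)
        then have "G ?x t = 0" using other t(2) by metis
        then show ?thesis using no_two[of t \<tau>] no_two[of \<tau> t] t(2) \<tau>(1) \<open>G ?x \<tau> = 0\<close> by (meson linorder_neqE)
      qed
      then have "N \<inter> {t0-d..t0+d} = {\<tau>}" using \<open>\<tau> \<in> N\<close> \<tau>(1) by blast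
      then show ?thesis by blast
    qed
    then obtain r where r: "\<And>t0. t0 \<in> Z \<Longrightarrow> N \<inter> {t0-d..t0+d} = {r t0}" by metis
    have rI: "r t0 \<in> N" "r t0 \<in> {t0-d..t0+d}" if "t0 \<in> Z" for t0 using r[OF that] by blast+
    have "bij_betw r Z N"
    proof (rule bij_betw_imageI)
      show "inj_on r Z"
      proof (rule inj_onI, rule ccontr)
        fix a b assume ab: "a \<in> Z" "b \<in> Z" "r a = r b" "a \<noteq> b"
        then have "2 * d < \<bar>b - a\<bar>" using d(2)[OF ab(1)] by (auto simp: good_def)
        then show False using rI(2)[OF ab(1)] rI(2)[OF ab(2)] ab(3) by (auto simp: abs_if split: if_splits)
      qed
      show "r ` Z = N"
      proof
        show "r ` Z \<subseteq> N" using rI by auto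
        show "N \<subseteq> r ` Z"
        proof
          fix t assume t: "t \<in> N"
          then have "t \<notin> K" using outer by blast
          then obtain s where s: "s \<in> Z" "\<bar>t - s\<bar> < d" using t by (auto simp: K_def N_def not_le)
          then have "t \<in> {s-d..s+d}" by (auto simp: abs_if split: if_splits)
          then have "t = r s" using r[OF s(1)] t by blast
          then show "t \<in> r ` Z" using s(1) by blast
        qed
      qed
    qed
    then show "finite {t \<in> {0..1}. \<exists>x\<in>\<T>. G x t = 0} \<and> card {t \<in> {0..1}. \<exists>x\<in>\<T>. G x t = 0} = card Z"
      using bij_betw_finite bij_betw_same_card fin(2) unfolding N_def[symmetric] by metis
  qed
qed

section \<open>Smooth strands\<close>

lemma has_vector_derivative_Complex:
  assumes "(f has_real_derivative f') (at t within S)" "(g has_real_derivative g') (at t within S)"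
  shows "((\<lambda>t. Complex (f t) (g t)) has_vector_derivative Complex f' g') (at t within S)"
proof -
  have "((\<lambda>t. f t *\<^sub>R 1 + g t *\<^sub>R \<i>) has_vector_derivative (f t *\<^sub>R 0 + f' *\<^sub>R 1) + (g t *\<^sub>R 0 + g' *\<^sub>R \<i>)) (at t within S)"
    by (intro has_vector_derivative_add has_vector_derivative_scaleR assms has_vector_derivative_const)
  moreover have "Complex a b = a *\<^sub>R 1 + b *\<^sub>R \<i>" for a b by (simp add: complex_eq_iff)
  ultimately show ?thesis by simp
qed

lemma smooth_on_unit_poly: "smooth_on_unit (\<lambda>t. Complex (poly p t) (poly q t))"
  unfolding smooth_on_unit_def
proof (intro exI[of _ "\<lambda>m t. Complex (poly ((pderiv ^^ m) p) t) (poly ((pderiv ^^ m) q) t)"] conjI ballI allI)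
  fix m and t :: real
  have "(poly p has_real_derivative poly (pderiv p) t) (at t within {0..1})" for p
    using poly_DERIV[of p t] by (rule DERIV_subset) simp
  then show "((\<lambda>t. Complex (poly ((pderiv ^^ m) p) t) (poly ((pderiv ^^ m) q) t)) has_vector_derivative
      Complex (poly ((pderiv ^^ Suc m) p) t) (poly ((pderiv ^^ Suc m) q) t)) (at t within {0..1})"
    by (intro has_vector_derivative_Complex) simp_all
qed simp

lemma smooth_on_unit_add:
  assumes "smooth_on_unit f" "smooth_on_unit g"
  shows "smooth_on_unit (\<lambda>t. f t + g t)"
proof -
  obtain D E where "\<forall>t\<in>{0..1}. D 0 t = f t" "\<forall>t\<in>{0..1}. E 0 t = g t"
    "\<forall>m. \<forall>t\<in>{0..1}. (D m has_vector_derivative D (Suc m) t) (at t within {0..1})"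
    "\<forall>m. \<forall>t\<in>{0..1}. (E m has_vector_derivative E (Suc m) t) (at t within {0..1})"
    using assms unfolding smooth_on_unit_def by blast
  then show ?thesis
    unfolding smooth_on_unit_def
    by (intro exI[of _ "\<lambda>m t. D m t + E m t"]) (auto intro!: has_vector_derivative_add)
qed

lemma smooth_on_unit_scaleR:
  assumes "smooth_on_unit f"
  shows "smooth_on_unit (\<lambda>t. a *\<^sub>R f t)"
proof -
  obtain D where "\<forall>t\<in>{0..1}. D 0 t = f t"
    "\<forall>m. \<forall>t\<in>{0..1}. (D m has_vector_derivative D (Suc m) t) (at t within {0..1})"
    using assms unfolding smooth_on_unit_def by blast
  then show ?thesis
    unfolding smooth_on_unit_def
    by (intro exI[of _ "\<lambda>m t. a *\<^sub>R D m t"])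
      (auto intro!: bounded_linear.has_vector_derivative[OF bounded_linear_scaleR_right])
qed

abbreviation velocity :: "(real \<Rightarrow> complex) \<Rightarrow> real \<Rightarrow> complex" where
  "velocity f t \<equiv> vector_derivative f (at t within {0..1})"

lemma velocity_eqI: "t \<in> {0..1} \<Longrightarrow> (f has_vector_derivative f') (at t within {0..1}) \<Longrightarrow> velocity f t = f'"
  by (rule vector_derivative_within_closed_interval) auto

lemma smooth_on_unit_velocity:
  assumes "smooth_on_unit f"
  shows "t \<in> {0..1} \<Longrightarrow> (f has_vector_derivative velocity f t) (at t within {0..1})"
    and "continuous_on {0..1} f" and "continuous_on {0..1} (velocity f)"
proof -
  obtain D where D: "\<And>t. t \<in> {0..1} \<Longrightarrow> D 0 t = f t"
    "\<And>m t. t \<in> {0..1} \<Longrightarrow> (D m has_vector_derivative D (Suc m) t) (at t within {0..1})"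
    using assms unfolding smooth_on_unit_def by blast
  have f: "(f has_vector_derivative D 1 t) (at t within {0..1})" if "t \<in> {0..1}" for t
    using has_vector_derivative_transform[OF that _ D(2)[OF that, of 0], of f] D(1) by simp
  then show d: "t \<in> {0..1} \<Longrightarrow> (f has_vector_derivative velocity f t) (at t within {0..1})" for t
    using velocity_eqI by metis
  then show "continuous_on {0..1} f" by (rule continuous_on_vector_derivative)
  have "continuous_on {0..1} (D 1)" using D(2)[of _ 1] by (rule continuous_on_vector_derivative)
  moreover have "D 1 t = velocity f t" if "t \<in> {0..1}" for t
    using velocity_eqI[OF that f[OF that]] by simp
  ultimately show "continuous_on {0..1} (velocity f)" using continuous_on_cong[of "{0..1}" "{0..1}" "D 1" "velocity f"] by simp
qed

section \<open>The signed area as a bilinear form\<close>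

definition cross2 :: "complex \<Rightarrow> complex \<Rightarrow> real" where
  "cross2 u v = Re u * Im v - Re v * Im u"

text \<open>The derivative of \<open>turn\<close> at \<open>c\<close> in direction
  \<open>c'\<close>, by the product rule.\<close>

definition turn_rate :: "(nat \<Rightarrow> complex) \<Rightarrow> (nat \<Rightarrow> complex) \<Rightarrow> nat \<Rightarrow> nat \<Rightarrow> nat \<Rightarrow> real" where
  "turn_rate c c' i j k = cross2 (c' j - c' i) (c k - c i) + cross2 (c j - c i) (c' k - c' i)"

lemma turn_cross2: "turn c i j k = cross2 (c j - c i) (c k - c i)"
  by (simp add: turn_def cross2_def)

lemma cross2_le: "\<bar>cross2 u v\<bar> \<le> cmod u * cmod v"
proof -
  have "cross2 u v = Im (cnj u * v)" by (simp add: cross2_def)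
  then show ?thesis using abs_Im_le_cmod[of "cnj u * v"] by (simp add: norm_mult)
qed

lemma cross2_diff: "cross2 u' v' - cross2 u v = cross2 (u' - u) v' + cross2 u (v' - v)"
  by (simp add: cross2_def algebra_simps)

lemma cross2_close:
  assumes "cmod u \<le> A" "cmod v \<le> A" "cmod (u' - u) \<le> e" "cmod (v' - v) \<le> e"
  shows "\<bar>cross2 u' v' - cross2 u v\<bar> \<le> e * (2 * A + e)"
proof -
  have "cmod v' \<le> A + e" using norm_triangle_ineq[of v "v' - v"] assms by simp
  have "0 \<le> e" "0 \<le> A" using assms(1,3) norm_ge_zero order_trans by blast+
  have "\<bar>cross2 u' v' - cross2 u v\<bar> \<le> \<bar>cross2 (u' - u) v'\<bar> + \<bar>cross2 u (v' - v)\<bar>"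
    unfolding cross2_diff by (rule abs_triangle_ineq)
  also have "\<dots> \<le> cmod (u' - u) * cmod v' + cmod u * cmod (v' - v)" by (intro add_mono cross2_le)
  also have "\<dots> \<le> e * (A + e) + A * e"
    using assms \<open>cmod v' \<le> A + e\<close> \<open>0 \<le> e\<close> \<open>0 \<le> A\<close> by (intro add_mono mult_mono) auto
  finally show ?thesis by (simp add: algebra_simps)
qed

lemma turn_has_derivative:
  assumes "\<And>l. l \<in> {i, j, k} \<Longrightarrow> (z l has_vector_derivative z' l) (at t within S)"
  shows "((\<lambda>t. turn (\<lambda>l. z l t) i j k) has_real_derivative turn_rate (\<lambda>l. z l t) z' i j k) (at t within S)"
proof -
  have R: "((\<lambda>t. Re (z l t)) has_real_derivative Re (z' l)) (at t within S)"
    and I: "((\<lambda>t. Im (z l t)) has_real_derivative Im (z' l)) (at t within S)" if "l \<in> {i, j, k}" for l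
    unfolding has_real_derivative_iff_has_vector_derivative
    using bounded_linear.has_vector_derivative[OF bounded_linear_Re assms[OF that]]
      bounded_linear.has_vector_derivative[OF bounded_linear_Im assms[OF that]] by auto
  have "((\<lambda>t. (Re (z j t) - Re (z i t)) * (Im (z k t) - Im (z i t)) - (Re (z k t) - Re (z i t)) * (Im (z j t) - Im (z i t)))
    has_real_derivative
    ((Re (z' j) - Re (z' i)) * (Im (z k t) - Im (z i t)) + (Im (z' k) - Im (z' i)) * (Re (z j t) - Re (z i t)))
    - ((Re (z' k) - Re (z' i)) * (Im (z j t) - Im (z i t)) + (Im (z' j) - Im (z' i)) * (Re (z k t) - Re (z i t)))) (at t within S)"
    by (intro DERIV_diff DERIV_mult R I) simp_all
  then show ?thesis
    unfolding turn_def turn_rate_def cross2_def by (rule DERIV_cong) (simp add: algebra_simps)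
qed

text \<open>One ordered representative for each set of three indices. With it, uniqueness of the
  collinear set is equality of family indices, as \<open>simple_zeros_stable\<close>
  requires.\<close>

definition sorted_triples :: "nat \<Rightarrow> (nat \<times> nat \<times> nat) set" where
  "sorted_triples n = {(i, j, k). {i, j, k} \<subseteq> {1..n} \<and> i < j \<and> j < k}"

definition turn3 :: "strands \<Rightarrow> nat \<times> nat \<times> nat \<Rightarrow> real \<Rightarrow> real" where
  "turn3 z x t = (case x of (i, j, k) \<Rightarrow> turn (\<lambda>l. z l t) i j k)"

lemma finite_sorted_triples: "finite (sorted_triples n)"
  by (rule finite_subset[of _ "{1..n} \<times> {1..n} \<times> {1..n}"]) (auto simp: sorted_triples_def)

lemma critical_moments_sorted:
  "critical_moments n z = {t \<in> {0..1}. \<exists>x\<in>sorted_triples n. turn3 z x t = 0}"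
proof (rule Set.set_eqI)
  fix t
  have "\<not> generic n (\<lambda>l. z l t) \<longleftrightarrow> (\<exists>x\<in>sorted_triples n. turn3 z x t = 0)"
  proof
    assume "\<not> generic n (\<lambda>l. z l t)"
    then obtain i j k where ijk: "{i, j, k} \<subseteq> {1..n}" "distinct [i, j, k]" "turn (\<lambda>l. z l t) i j k = 0"
      unfolding generic_def not_all not_imp not_not by (elim exE conjE)
    obtain a b c where abc: "a < b" "b < c" "{a, b, c} = {i, j, k}"
    proof -
      have "i \<noteq> j" "j \<noteq> k" "i \<noteq> k" using ijk(2) by auto
      then consider "i < j" "j < k" | "i < k" "k < j" | "j < i" "i < k" | "j < k" "k < i" | "k < i" "i < j" | "k < j" "j < i"
        by linarith
      then show thesis
        by cases (rule that[of i j k] that[of i k j] that[of j i k] that[of j k i] that[of k i j] that[of k j i]; auto)+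
    qed
    have "turn (\<lambda>l. z l t) a b c = 0" by (rule turn_perm_zero[OF abc(3) ijk(2,3)])
    moreover have "(a, b, c) \<in> sorted_triples n" using abc ijk(1) unfolding sorted_triples_def abc(3)[symmetric] by simp
    ultimately show "\<exists>x\<in>sorted_triples n. turn3 z x t = 0" by (intro bexI[of _ "(a, b, c)"]) (simp_all add: turn3_def)
  next
    assume "\<exists>x\<in>sorted_triples n. turn3 z x t = 0"
    then obtain i j k where "{i, j, k} \<subseteq> {1..n}" "i < j" "j < k" "turn (\<lambda>l. z l t) i j k = 0"
      by (auto simp: sorted_triples_def turn3_def)
    moreover from this have "distinct [i, j, k]" by auto
    ultimately show "\<not> generic n (\<lambda>l. z l t)" unfolding generic_def by metis
  qed
  then show "t \<in> critical_moments n z \<longleftrightarrow> t \<in> {t \<in> {0..1}. \<exists>x\<in>sorted_triples n. turn3 z x t = 0}"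
    by (simp add: critical_moments_iff)
qed

section \<open>The base configuration is generic\<close>

lemma base_point_inj:
  assumes "i \<in> {1..n}" "j \<in> {1..n}" "base_point n i = base_point n j"
  shows "i = j"
proof -
  have "i mod n = j mod n"
    using assms complex_root_unity_eq[of n i j] by (auto simp: base_point_def)
  then show ?thesis using assms(1,2) by (cases "i = n"; cases "j = n") auto
qed

lemma norm_base_point: "cmod (base_point n j) = 1"
proof -
  have "base_point n j = exp (\<i> * of_real (2 * pi * real j / real n))"
    unfolding base_point_def by (simp add: field_simps)
  then show ?thesis by simp
qed

text \<open>A line meets a circle at most twice. The chords u and v from \<open>c i\<close> satisfy
  |u|^2 = -2 c_i.u and |v|^2 = -2 c_i.v; if they are parallel, this forces |u|^2 = u.v = |v|^2 and
  hence u = v.\<close>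

lemma turn_nonzero_on_circle:
  assumes "cmod (c i) = 1" "cmod (c j) = 1" "cmod (c k) = 1" "c i \<noteq> c j" "c j \<noteq> c k" "c i \<noteq> c k"
  shows "turn c i j k \<noteq> 0"
proof
  assume 0: "turn c i j k = 0"
  define x y where "x = Re (c i)" and "y = Im (c i)"
  define u1 u2 v1 v2 where "u1 = Re (c j) - x" and "u2 = Im (c j) - y" and "v1 = Re (c k) - x" and "v2 = Im (c k) - y"
  have n: "x\<^sup>2 + y\<^sup>2 = 1" "(x + u1)\<^sup>2 + (y + u2)\<^sup>2 = 1" "(x + v1)\<^sup>2 + (y + v2)\<^sup>2 = 1"
    using assms(1-3) by (auto simp: cmod_def x_def y_def u1_def u2_def v1_def v2_def)
  have t: "u1 * v2 = v1 * u2" using 0 by (simp add: turn_def x_def y_def u1_def u2_def v1_def v2_def)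
  have e1: "u1\<^sup>2 + u2\<^sup>2 = - 2 * (x * u1 + y * u2)" and e2: "v1\<^sup>2 + v2\<^sup>2 = - 2 * (x * v1 + y * v2)"
    using n by (simp_all add: power2_sum algebra_simps)
  have u: "u1 \<noteq> 0 \<or> u2 \<noteq> 0" and v: "v1 \<noteq> 0 \<or> v2 \<noteq> 0" and uv: "u1 \<noteq> v1 \<or> u2 \<noteq> v2"
    using assms(4-6) by (auto simp: complex_eq_iff x_def y_def u1_def u2_def v1_def v2_def)
  have a: "u1 * (v1\<^sup>2 + v2\<^sup>2) = v1 * (u1 * v1 + u2 * v2)" "u2 * (v1\<^sup>2 + v2\<^sup>2) = v2 * (u1 * v1 + u2 * v2)"
    using t by algebra+
  define p where "p = u1\<^sup>2 + u2\<^sup>2"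
  define q where "q = v1\<^sup>2 + v2\<^sup>2"
  define r where "r = u1 * v1 + u2 * v2"
  have pq: "p > 0" "q > 0" using u v by (auto simp: p_def q_def sum_power2_gt_zero_iff)
  have "p * q = r * q"
  proof -
    have "q * p = q * (- 2 * (x * u1 + y * u2))" using e1 by (simp add: p_def)
    also have "\<dots> = - 2 * (x * (u1 * q) + y * (u2 * q))" by (simp add: algebra_simps)
    also have "\<dots> = - 2 * (x * (v1 * r) + y * (v2 * r))" using a by (simp add: q_def r_def)
    also have "\<dots> = r * (- 2 * (x * v1 + y * v2))" by (simp add: algebra_simps)
    also have "\<dots> = r * q" using e2 by (simp add: q_def)
    finally show ?thesis by (simp add: mult.commute)
  qed
  then have "p = r" using pq by simp
  have "p * q = r * r" using t unfolding p_def q_def r_def by algebra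
  then have "q = r" using \<open>p = r\<close> pq by simp
  have "(u1 - v1)\<^sup>2 + (u2 - v2)\<^sup>2 = p + q - 2 * r" by (simp add: p_def q_def r_def power2_diff algebra_simps)
  then have "(u1 - v1)\<^sup>2 + (u2 - v2)\<^sup>2 = 0" using \<open>p = r\<close> \<open>q = r\<close> by simp
  then show False using uv by (simp add: sum_power2_eq_zero_iff)
qed

lemma generic_base_points: "generic n (base_point n)"
  unfolding generic_def
proof (intro allI impI)
  fix i j k assume "{i, j, k} \<subseteq> {1..n}" "distinct [i, j, k]"
  then show "turn (base_point n) i j k \<noteq> 0"
    using base_point_inj[of i n j] base_point_inj[of j n k] base_point_inj[of i n k]
    by (intro turn_nonzero_on_circle) (auto simp: norm_base_point)
qed

lemma generic_cong:
  assumes "generic n c" "\<And>j. j \<in> {1..n} \<Longrightarrow> c' j = c j"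
  shows "generic n c'"
  unfolding generic_def
proof (intro allI impI)
  fix i j k assume *: "{i, j, k} \<subseteq> {1..n}" "distinct [i, j, k]"
  have "turn c' i j k = turn c i j k" using *(1) assms(2) by (simp add: turn_def)
  then show "turn c' i j k \<noteq> 0" using assms(1)[unfolded generic_def, rule_format, OF *] by simp
qed

lemma pure_braidD:
  assumes "pure_braid n z"
  shows "j \<in> {1..n} \<Longrightarrow> smooth_on_unit (z j)" "j \<in> {1..n} \<Longrightarrow> z j 0 = base_point n j"
    "j \<in> {1..n} \<Longrightarrow> z j 1 = base_point n j" "t \<in> {0..1} \<Longrightarrow> inj_on (\<lambda>j. z j t) {1..n}"
    "j \<in> {1..n} \<Longrightarrow> continuous_on {0..1} (z j)" "generic n (\<lambda>j. z j 0)" "generic n (\<lambda>j. z j 1)"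
  using assms smooth_on_unit_velocity(2) generic_cong[OF generic_base_points[of n]] unfolding pure_braid_def by auto

section \<open>Good and stable braids\<close>

definition turn3_rate :: "strands \<Rightarrow> nat \<times> nat \<times> nat \<Rightarrow> real \<Rightarrow> real" where
  "turn3_rate z x t = (case x of (i, j, k) \<Rightarrow> turn_rate (\<lambda>l. z l t) (\<lambda>l. velocity (z l) t) i j k)"

lemma turn3_has_derivative:
  assumes "\<And>l. l \<in> {1..n} \<Longrightarrow> smooth_on_unit (z l)" "x \<in> sorted_triples n" "t \<in> {0..1}"
  shows "(turn3 z x has_real_derivative turn3_rate z x t) (at t within {0..1})"
proof -
  obtain i j k where x: "x = (i, j, k)" "{i, j, k} \<subseteq> {1..n}" using assms(2) by (auto simp: sorted_triples_def)
  have "((\<lambda>t. turn (\<lambda>l. z l t) i j k) has_real_derivative turn_rate (\<lambda>l. z l t) (\<lambda>l. velocity (z l) t) i j k) (at t within {0..1})"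
    by (rule turn_has_derivative) (use assms(1,3) x(2) smooth_on_unit_velocity(1) in blast)
  moreover have "turn3 z x = (\<lambda>t. turn (\<lambda>l. z l t) i j k)" by (simp add: x turn3_def fun_eq_iff)
  ultimately show ?thesis by (simp add: x turn3_rate_def)
qed

lemma turn3_rate_continuous:
  assumes "\<And>l. l \<in> {1..n} \<Longrightarrow> smooth_on_unit (z l)" "x \<in> sorted_triples n"
  shows "continuous_on {0..1} (turn3_rate z x)"
proof -
  obtain i j k where x: "x = (i, j, k)" "i \<in> {1..n}" "j \<in> {1..n}" "k \<in> {1..n}" using assms(2) by (auto simp: sorted_triples_def)
  have "turn3_rate z x = (\<lambda>t. turn_rate (\<lambda>l. z l t) (\<lambda>l. velocity (z l) t) i j k)" by (simp add: x turn3_rate_def fun_eq_iff)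
  then show ?thesis
    using smooth_on_unit_velocity(2,3)[OF assms(1)[OF x(2)]] smooth_on_unit_velocity(2,3)[OF assms(1)[OF x(3)]]
      smooth_on_unit_velocity(2,3)[OF assms(1)[OF x(4)]]
    by (simp add: turn_rate_def cross2_def) (intro continuous_intros)
qed

lemma strands_bounded:
  fixes z :: strands
  assumes "\<And>l. l \<in> {1..n} \<Longrightarrow> smooth_on_unit (z l)"
  shows "\<exists>M\<ge>0. \<forall>l\<in>{1..n}. \<forall>t\<in>{0..1}. cmod (z l t) \<le> M \<and> cmod (velocity (z l) t) \<le> M"
proof -
  have "bounded (\<Union>l\<in>{1..n}. z l ` {0..1} \<union> velocity (z l) ` {0..1})"
    using smooth_on_unit_velocity(2,3)[OF assms]
    by (intro bounded_UN finite_atLeastAtMost ballI) (auto intro!: compact_imp_bounded compact_continuous_image)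
  then obtain M where M: "\<forall>w\<in>(\<Union>l\<in>{1..n}. z l ` {0..1} \<union> velocity (z l) ` {0..1}). cmod w \<le> M"
    unfolding bounded_iff by (elim exE)
  show ?thesis
  proof (intro exI[of _ "max M 0"] conjI[of "0 \<le> max M 0"] ballI)
    fix l t assume lt: "l \<in> {1..n}" "t \<in> {0..1::real}"
    have "cmod (z l t) \<le> M"
      by (rule M[rule_format], rule UN_I[OF lt(1)], rule UnI1, rule imageI[OF lt(2)])
    moreover have "cmod (velocity (z l) t) \<le> M"
      by (rule M[rule_format], rule UN_I[OF lt(1)], rule UnI2, rule imageI[OF lt(2)])
    ultimately show "cmod (z l t) \<le> max M 0 \<and> cmod (velocity (z l) t) \<le> max M 0"
      by (intro conjI max.coboundedI1)
  qed simp
qed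

lemma sorted_triples_eqI:
  assumes "(i, j, k) \<in> sorted_triples n" "(p, q, r) \<in> sorted_triples n" "{p, q, r} = {i, j, k}"
  shows "(p, q, r) = (i, j, k)"
proof -
  have "sorted_list_of_set {p, q, r} = sorted_list_of_set {i, j, k}" using assms(3) by simp
  then show ?thesis using assms(1,2) by (auto simp: sorted_triples_def)
qed

text \<open>Differences of two strands are bounded by 2M with error 2\<epsilon>. For \<epsilon>
  \<le> 1 the quadratic term is absorbed and \<open>cross2\<close> changes by at most \<epsilon>(8M
  + 4); the rate is a sum of two such terms, which doubles the bound.\<close>

lemma C1_close_turn3:
  assumes M: "\<And>l t. l \<in> {1..n} \<Longrightarrow> t \<in> {0..1} \<Longrightarrow> cmod (z l t) \<le> M \<and> cmod (velocity (z l) t) \<le> M"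
    and close: "C1_close n \<epsilon> z w" and "0 < \<epsilon>" "\<epsilon> \<le> 1" "x \<in> sorted_triples n" "t \<in> {0..1}"
  shows "\<bar>turn3 w x t - turn3 z x t\<bar> \<le> \<epsilon> * (16 * M + 8)" "\<bar>turn3_rate w x t - turn3_rate z x t\<bar> \<le> \<epsilon> * (16 * M + 8)"
proof -
  obtain i j k where x: "x = (i, j, k)" "i \<in> {1..n}" "j \<in> {1..n}" "k \<in> {1..n}" using assms(5) by (auto simp: sorted_triples_def)
  have "M \<ge> 0" using M[OF x(2) assms(6)] norm_ge_zero order_trans by blast
  have bd: "cmod (z a t - z b t) \<le> 2 * M" "cmod (velocity (z a) t - velocity (z b) t) \<le> 2 * M"
    if "a \<in> {1..n}" "b \<in> {1..n}" for a b
    using M[OF that(1) assms(6)] M[OF that(2) assms(6)] norm_triangle_ineq4[of "z a t" "z b t"]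
      norm_triangle_ineq4[of "velocity (z a) t" "velocity (z b) t"] by auto
  have cl: "cmod ((w a t - w b t) - (z a t - z b t)) \<le> 2 * \<epsilon>"
    "cmod ((velocity (w a) t - velocity (w b) t) - (velocity (z a) t - velocity (z b) t)) \<le> 2 * \<epsilon>"
    if ab: "a \<in> {1..n}" "b \<in> {1..n}" for a b
  proof -
    have *: "cmod (w l t - z l t) \<le> \<epsilon>" "cmod (velocity (w l) t - velocity (z l) t) \<le> \<epsilon>" if "l \<in> {1..n}" for l
      using close that assms(6) unfolding C1_close_def by (auto simp: dist_norm norm_minus_commute less_imp_le)
    have "cmod ((w a t - z a t) - (w b t - z b t)) \<le> \<epsilon> + \<epsilon>"
      by (rule order_trans[OF norm_triangle_ineq4]) (intro add_mono * ab)
    then show "cmod ((w a t - w b t) - (z a t - z b t)) \<le> 2 * \<epsilon>" by (simp add: algebra_simps)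
    have "cmod ((velocity (w a) t - velocity (z a) t) - (velocity (w b) t - velocity (z b) t)) \<le> \<epsilon> + \<epsilon>"
      by (rule order_trans[OF norm_triangle_ineq4]) (intro add_mono * ab)
    then show "cmod ((velocity (w a) t - velocity (w b) t) - (velocity (z a) t - velocity (z b) t)) \<le> 2 * \<epsilon>"
      by (simp add: algebra_simps)
  qed
  have e: "2 * \<epsilon> * (2 * (2 * M) + 2 * \<epsilon>) \<le> \<epsilon> * (8 * M + 4)"
  proof -
    have "2 * \<epsilon> * (2 * (2 * M) + 2 * \<epsilon>) \<le> 2 * \<epsilon> * (2 * (2 * M) + 2 * 1)"
      using \<open>0 < \<epsilon>\<close> \<open>\<epsilon> \<le> 1\<close> by (intro mult_left_mono add_mono) auto
    then show ?thesis by (simp add: algebra_simps)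
  qed
  have e': "\<epsilon> * (8 * M + 4) + \<epsilon> * (8 * M + 4) = \<epsilon> * (16 * M + 8)" "0 \<le> \<epsilon> * (8 * M + 4)"
    using \<open>0 < \<epsilon>\<close> \<open>M \<ge> 0\<close> by (auto simp: algebra_simps)
  have "\<bar>turn3 w x t - turn3 z x t\<bar> \<le> 2 * \<epsilon> * (2 * (2 * M) + 2 * \<epsilon>)"
    unfolding turn3_def x(1) prod.case turn_cross2 by (intro cross2_close bd cl x)
  then show "\<bar>turn3 w x t - turn3 z x t\<bar> \<le> \<epsilon> * (16 * M + 8)" using e e' by linarith
  have "\<bar>cross2 (velocity (w j) t - velocity (w i) t) (w k t - w i t) - cross2 (velocity (z j) t - velocity (z i) t) (z k t - z i t)\<bar>
      \<le> 2 * \<epsilon> * (2 * (2 * M) + 2 * \<epsilon>)"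
    "\<bar>cross2 (w j t - w i t) (velocity (w k) t - velocity (w i) t) - cross2 (z j t - z i t) (velocity (z k) t - velocity (z i) t)\<bar>
      \<le> 2 * \<epsilon> * (2 * (2 * M) + 2 * \<epsilon>)"
    by (intro cross2_close bd cl x)+
  then show "\<bar>turn3_rate w x t - turn3_rate z x t\<bar> \<le> \<epsilon> * (16 * M + 8)"
    unfolding turn3_rate_def x(1) prod.case turn_rate_def using e e' by linarith
qed

text \<open>The critical moments are the zeros of the areas of the sorted triples, which are simple
  and never simultaneous. A C1-small change of the braid is a C1-small change of these areas, so
  \<open>simple_zeros_stable\<close> counts the critical moments of the perturbed braid.\<close>

theorem transverse_imp_good_stable:
  assumes tr: "transverse {1..n} X Y" and pb: "pure_braid n (poly_strands X Y)"
  shows "good_stable n (poly_strands X Y)"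
proof -
  let ?z = "poly_strands X Y"
  have sm: "\<And>l. l \<in> {1..n} \<Longrightarrow> smooth_on_unit (?z l)" using pure_braidD(1)[OF pb] .
  have fin: "finite (critical_moments n ?z)" by (rule transverse_imp_finite_critical[OF tr])
  have turn3_poly: "turn3 ?z (i, j, k) = poly (turn_poly X Y i j k)" for i j k
    by (simp add: turn3_def turn_poly_strands fun_eq_iff)
  have "\<exists>c>0. \<forall>G G'. (\<forall>x\<in>sorted_triples n. \<forall>t\<in>{0..1}. (G x has_real_derivative G' x t) (at t within {0..1}) \<and>
      \<bar>G x t - turn3 ?z x t\<bar> < c \<and> \<bar>G' x t - turn3_rate ?z x t\<bar> < c) \<longrightarrow>
      finite {t \<in> {0..1}. \<exists>x\<in>sorted_triples n. G x t = 0} \<and> card {t \<in> {0..1}. \<exists>x\<in>sorted_triples n. G x t = 0} =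
      card {t \<in> {0..1}. \<exists>x\<in>sorted_triples n. turn3 ?z x t = 0}"
  proof (rule simple_zeros_stable)
    show "finite {t \<in> {0..1}. \<exists>x\<in>sorted_triples n. turn3 ?z x t = 0}" using fin by (simp add: critical_moments_sorted)
    show "turn3 ?z x 0 \<noteq> 0 \<and> turn3 ?z x 1 \<noteq> 0" if "x \<in> sorted_triples n" for x
    proof -
      have "0 \<notin> critical_moments n ?z" "1 \<notin> critical_moments n ?z"
        using pure_braidD(6,7)[OF pb] by (simp_all add: critical_moments_iff)
      then show ?thesis using that unfolding critical_moments_sorted by auto
    qed
    fix x t assume x: "x \<in> sorted_triples n" and t: "t \<in> {0..1::real}" and 0: "turn3 ?z x t = 0"
    obtain i j k where ijk: "x = (i, j, k)" "{i, j, k} \<subseteq> {1..n}" "distinct [i, j, k]" using x by (auto simp: sorted_triples_def)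
    have p0: "poly (turn_poly X Y i j k) t = 0" using 0 by (simp add: ijk turn3_poly)
    show "turn3_rate ?z x t \<noteq> 0"
    proof -
      have "(turn3 ?z x has_real_derivative poly (pderiv (turn_poly X Y i j k)) t) (at t within {0..1})"
        unfolding ijk(1) turn3_poly using poly_DERIV by (rule DERIV_subset) simp
      note d1 = this[unfolded has_real_derivative_iff_has_vector_derivative]
      note d2 = turn3_has_derivative[OF sm x t, unfolded has_real_derivative_iff_has_vector_derivative]
      have "turn3_rate ?z x t = poly (pderiv (turn_poly X Y i j k)) t"
        using vector_derivative_within_closed_interval[OF zero_less_one t d1]
          vector_derivative_within_closed_interval[OF zero_less_one t d2] by simp
      then show ?thesis using transverseD(1)[OF tr t ijk(2,3) p0] by simp
    qed
    fix y assume y: "y \<in> sorted_triples n" and 1: "turn3 ?z y t = 0"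
    obtain p q r where pqr: "y = (p, q, r)" "{p, q, r} \<subseteq> {1..n}" "distinct [p, q, r]" using y by (auto simp: sorted_triples_def)
    have "{p, q, r} = {i, j, k}"
      by (rule transverseD(2)[OF tr t ijk(2,3) p0 pqr(2,3)]) (use 1 in \<open>simp add: pqr turn3_poly\<close>)
    then show "x = y" using sorted_triples_eqI[of i j k n p q r] x y ijk(1) pqr(1) by simp
  qed (use turn3_has_derivative[OF sm] turn3_rate_continuous[OF sm] finite_sorted_triples in auto)
  then obtain c where c: "c > 0" and stab: "\<forall>G G'. (\<forall>x\<in>sorted_triples n. \<forall>t\<in>{0..1}. (G x has_real_derivative G' x t) (at t within {0..1}) \<and>
      \<bar>G x t - turn3 ?z x t\<bar> < c \<and> \<bar>G' x t - turn3_rate ?z x t\<bar> < c) \<longrightarrow>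
      finite {t \<in> {0..1}. \<exists>x\<in>sorted_triples n. G x t = 0} \<and> card {t \<in> {0..1}. \<exists>x\<in>sorted_triples n. G x t = 0} =
      card {t \<in> {0..1}. \<exists>x\<in>sorted_triples n. turn3 ?z x t = 0}" by (elim exE conjE)
  have "\<exists>M\<ge>0. \<forall>l\<in>{1..n}. \<forall>t\<in>{0..1}. cmod (?z l t) \<le> M \<and> cmod (velocity (?z l) t) \<le> M"
    by (rule strands_bounded[OF sm])
  then obtain M where M0: "M \<ge> 0" and M1: "\<forall>l\<in>{1..n}. \<forall>t\<in>{0..1}. cmod (?z l t) \<le> M \<and> cmod (velocity (?z l) t) \<le> M"
    by (elim exE conjE)
  note M = M0 M1[rule_format]
  \<comment> \<open>The 9 exceeds the 8 of \<open>C1_close_turn3\<close> in order to obtain a strict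
    inequality.\<close>
  define \<epsilon> where "\<epsilon> = min 1 (c / (16 * M + 9))"
  have \<epsilon>: "0 < \<epsilon>" "\<epsilon> \<le> 1" using c M(1) by (auto simp: \<epsilon>_def)
  have "\<epsilon> * (16 * M + 8) < \<epsilon> * (16 * M + 9)" using \<epsilon>(1) by simp
  also have "\<dots> \<le> c / (16 * M + 9) * (16 * M + 9)" using M(1) by (intro mult_right_mono) (auto simp: \<epsilon>_def)
  also have "\<dots> = c" using M(1) by simp
  finally have \<epsilon>c: "\<epsilon> * (16 * M + 8) < c" .
  have "finite (critical_moments n w) \<and> card (critical_moments n w) = card (critical_moments n ?z)"
    if w: "pure_braid n w" "C1_close n \<epsilon> ?z w" for w
    unfolding critical_moments_sorted
  proof (rule stab[rule_format, of "turn3 w" "turn3_rate w"], intro conjI)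
    fix x t assume xt: "x \<in> sorted_triples n" "t \<in> {0..1::real}"
    show "(turn3 w x has_real_derivative turn3_rate w x t) (at t within {0..1})"
      by (rule turn3_has_derivative[OF pure_braidD(1)[OF w(1)] xt])
    show "\<bar>turn3 w x t - turn3 ?z x t\<bar> < c" "\<bar>turn3_rate w x t - turn3_rate ?z x t\<bar> < c"
      using C1_close_turn3[OF M(2) w(2) \<epsilon> xt] \<epsilon>c by auto
  qed
  then show ?thesis
    unfolding good_stable_def using pb fin transverse_imp_unique_triple[OF tr] \<epsilon>(1) by blast
qed

section \<open>Stability forces a change of sign\<close>

lemma turn_shift_first:
  "i \<noteq> j \<Longrightarrow> i \<noteq> k \<Longrightarrow> turn (c(i := c i + v)) i j k =
     turn c i j k + (Re v * (Im (c j) - Im (c k)) + Im v * (Re (c k) - Re (c j)))"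
  by (simp add: turn_def algebra_simps)

lemma zero_between_opposite_signs:
  fixes g :: "real \<Rightarrow> real"
  assumes "continuous_on {a..b} g" "a < b" "g a * g b < 0"
  shows "\<exists>x. a < x \<and> x < b \<and> g x = 0"
proof -
  have "\<exists>x\<ge>a. x \<le> b \<and> g x = 0"
    using IVT'[of g a 0 b] IVT2'[of g b 0 a] assms by (auto simp: mult_less_0_iff)
  then obtain x where x: "a \<le> x" "x \<le> b" "g x = 0" by blast
  then have "x \<noteq> a" "x \<noteq> b" using assms(3) by auto
  then show ?thesis using x by (intro exI[of _ x]) auto
qed

text \<open>If the area has the same sign on both sides of its zero, an arbitrarily C1-small push of
  strand \<open>i\<close> across the line through \<open>j\<close> and \<open>k\<close> raises the
  number of critical moments, against stability.\<close>

lemma good_stable_imp_sign_change: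
  assumes gs: "good_stable n z" and t0: "t0 \<in> critical_moments n z"
  shows "sign_change n z t0"
  unfolding sign_change_def
proof (intro allI impI)
  fix i j k assume ijk: "{i, j, k} \<subseteq> {1..n}" "distinct [i, j, k]" and f0: "turn (\<lambda>l. z l t0) i j k = 0"
  let ?C = "critical_moments n z"
  define f where "f t = turn (\<lambda>l. z l t) i j k" for t
  have pb: "pure_braid n z" and fin: "finite ?C" using gs by (auto simp: good_stable_def)
  note sm = pure_braidD(1)[OF pb] and cont = pure_braidD(5)[OF pb]
  obtain \<epsilon> where \<epsilon>: "\<epsilon> > 0" "\<And>w. pure_braid n w \<Longrightarrow> C1_close n \<epsilon> z w \<Longrightarrow>
       finite (critical_moments n w) \<and> card (critical_moments n w) = card ?C"
    using gs unfolding good_stable_def by blast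
  have mem: "i \<in> {1..n}" "j \<in> {1..n}" "k \<in> {1..n}" "i \<noteq> j" "j \<noteq> k" "i \<noteq> k" using ijk by auto
  have t01: "t0 \<in> {0..1}" using t0 by (simp add: critical_moments_iff)
  have C01: "0 \<notin> ?C" "1 \<notin> ?C" using pure_braidD(6,7)[OF pb] by (simp_all add: critical_moments_iff)
  have crit: "t \<in> critical_moments n w" if "t \<in> {0..1}" "turn (\<lambda>l. w l t) i j k = 0" for t w
    unfolding critical_moments_iff generic_def using ijk that by blast
  obtain d where d: "d > 0" "\<And>x. x \<in> ?C \<Longrightarrow> x \<noteq> t0 \<Longrightarrow> d \<le> \<bar>t0 - x\<bar>"
    using finite_set_avoid[OF fin, of t0] by (auto simp: dist_real_def)
  have fnz: "f t \<noteq> 0" if "t \<in> {0..1}" "t \<noteq> t0" "\<bar>t0 - t\<bar> < d" for t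
    using crit[OF that(1), of z] d(2)[of t] that by (auto simp: f_def)
  have "f u * f v < 0" if uv: "0 \<le> u" "t0 - d < u" "u < t0" "t0 < v" "v < t0 + d" "v \<le> 1" for u v
  proof (rule ccontr)
    assume "\<not> f u * f v < 0"
    have u01: "u \<in> {0..1}" "v \<in> {0..1}" using uv t01 by auto
    have "f u \<noteq> 0" "f v \<noteq> 0" using fnz[of u] fnz[of v] uv u01 by auto
    define \<sigma> where "\<sigma> = sgn (f u)"
    have \<sigma>: "\<sigma> = 1 \<or> \<sigma> = -1" using \<open>f u \<noteq> 0\<close> by (auto simp: \<sigma>_def sgn_if)
    have fu: "\<sigma> * f u > 0" and fv: "\<sigma> * f v > 0"
      using \<open>f u \<noteq> 0\<close> \<open>f v \<noteq> 0\<close> \<open>\<not> f u * f v < 0\<close> by (auto simp: \<sigma>_def sgn_if mult_less_0_iff)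
    \<comment> \<open>The perturbation keeps every other critical moment critical, and it replaces a zero of \<open>f\<close>
      without sign change by two zeros.\<close>
    define q where "q = bump_poly * (\<Prod>s\<in>?C - {t0}. [:- s, 1:])"
    have q: "poly q t = poly bump_poly t * (\<Prod>s\<in>?C - {t0}. t - s)" for t
      unfolding q_def poly_mult poly_prod by simp
    have "t0 \<noteq> 0" "t0 \<noteq> 1" using t0 C01 by auto
    then have "poly bump_poly t0 \<noteq> 0" unfolding poly_bump by simp
    then have q0: "poly q t0 \<noteq> 0" unfolding q using fin by simp
    have qC: "poly q s = 0" if "s \<in> ?C - {t0}" for s unfolding q using fin that by auto
    have q01: "poly q 0 = 0" "poly q 1 = 0" unfolding q by simp_all
    \<comment> \<open>The gradient of the area with respect to the position of strand
      \<open>i\<close> at time \<open>t0\<close>. A displacement by \<open>V\<close> changes the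
      area at time t by \<open>L t\<close>, and \<open>L t0\<close> is the squared length of
      \<open>V\<close>.\<close>
    define V where "V = Complex (Im (z j t0) - Im (z k t0)) (Re (z k t0) - Re (z j t0))"
    define L where "L t = Re V * (Im (z j t) - Im (z k t)) + Im V * (Re (z k t) - Re (z j t))" for t
    have "z j t0 \<noteq> z k t0" using pure_braidD(4)[OF pb t01] mem by (auto dest: inj_onD)
    then have "L t0 > 0" 
      by (auto simp: L_def V_def complex_eq_iff power2_eq_square[symmetric] sum_power2_gt_zero_iff)
    have "compact (poly q ` {0..1} \<union> poly (pderiv q) ` {0..1})"
      by (intro compact_Un compact_continuous_image continuous_intros) auto
    from compact_imp_bounded[OF this]
    obtain B0 where B0: "\<forall>x\<in>poly q ` {0..1} \<union> poly (pderiv q) ` {0..1}. norm x \<le> B0"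
      unfolding bounded_iff by (elim exE)
    have qB: "\<bar>poly q t\<bar> \<le> B0" "\<bar>poly (pderiv q) t\<bar> \<le> B0" if "t \<in> {0..1}" for t
      using B0[rule_format, OF UnI1[OF imageI[OF that]]] B0[rule_format, OF UnI2[OF imageI[OF that]]] by simp_all
    \<comment> \<open>A common bound for the displacement and its velocity per unit of \<eta>; the
      summands 1 keep it positive.\<close>
    define B where "B = (B0 + 1) * (cmod V + 1)"
    have "B0 \<ge> 0" using qB(1)[of 0] by simp
    then have "B > 0" unfolding B_def by (intro mult_pos_pos add_nonneg_pos) auto
    have Bq: "\<bar>poly q t\<bar> * cmod V \<le> B" "\<bar>poly (pderiv q) t\<bar> * cmod V \<le> B" if "t \<in> {0..1}" for t
      unfolding B_def using qB[OF that] \<open>B0 \<ge> 0\<close> by (intro mult_mono; simp)+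
    obtain s0 where s0: "s0 > 0" "\<And>t a b. t \<in> {0..1} \<Longrightarrow> a \<in> {1..n} \<Longrightarrow> b \<in> {1..n} \<Longrightarrow> a \<noteq> b \<Longrightarrow> s0 \<le> dist (z a t) (z b t)"
      by (rule strands_separated[of n z]) (use cont pure_braidD(4)[OF pb] in auto)
    define K where "K = \<bar>poly q u * L u\<bar> + \<bar>poly q v * L v\<bar> + 1"
    have "K > 0" by (simp add: K_def add_nonneg_pos)
    \<comment> \<open>Below these bounds, respectively, the perturbation is C1-close to
      \<open>z\<close>, the strands remain distinct, and the area keeps its sign at \<open>u\<close>
      and at \<open>v\<close>.\<close>
    define S where "S = {\<epsilon> / B, s0 / B, \<bar>f u\<bar> / K, \<bar>f v\<bar> / K}"
    define \<theta> where "\<theta> = Min S / 2"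
    have "\<forall>x\<in>S. x > 0" using \<epsilon>(1) s0(1) \<open>B > 0\<close> \<open>K > 0\<close> \<open>f u \<noteq> 0\<close> \<open>f v \<noteq> 0\<close> by (simp add: S_def)
    then have "\<theta> > 0" unfolding \<theta>_def by (simp add: S_def)
    have "2 * \<theta> \<le> x" if "x \<in> S" for x using Min_le[of S x] that by (simp add: \<theta>_def S_def)
    note le = this
    have less: "\<theta> * b < e" if "e / b \<in> S" "b > 0" for b e
    proof -
      have "\<theta> < e / b" using le[OF that(1)] \<open>\<theta> > 0\<close> by linarith
      then show ?thesis using \<open>b > 0\<close> by (simp add: pos_less_divide_eq)
    qed
    have \<theta>: "\<theta> * B < \<epsilon>" "\<theta> * B < s0" "\<theta> * K < \<bar>f u\<bar>" "\<theta> * K < \<bar>f v\<bar>"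
      by (rule less, simp add: S_def, fact)+
    \<comment> \<open>The sign makes the area at \<open>t0\<close>, which was 0, opposite to its
      sign \<sigma> at \<open>u\<close> and \<open>v\<close>.\<close>
    define \<eta> where "\<eta> = - \<sigma> * sgn (poly q t0) * \<theta>"
    have "\<bar>\<eta>\<bar> = \<theta>" using \<sigma> q0 \<open>\<theta> > 0\<close> by (auto simp: \<eta>_def abs_mult sgn_if)
    define w where "w = z(i := \<lambda>t. z i t + (\<eta> * poly q t) *\<^sub>R V)"
    have w_other: "w l = z l" if "l \<noteq> i" for l using that by (simp add: w_def)
    have wi: "w i t = z i t + (\<eta> * poly q t) *\<^sub>R V" for t by (simp add: w_def)
    have turn_w: "turn (\<lambda>l. w l t) i j k = f t + \<eta> * poly q t * L t" for t
    proof -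
      have eq: "(\<lambda>l. w l t) = (\<lambda>l. z l t)(i := z i t + (\<eta> * poly q t) *\<^sub>R V)" by (auto simp: w_def)
      show ?thesis
        unfolding eq f_def L_def turn_shift_first[OF mem(4,6), of "\<lambda>l. z l t" "(\<eta> * poly q t) *\<^sub>R V"]
        by (simp add: algebra_simps)
    qed
    have w_dist: "dist (z l t) (w l t) \<le> (if l = i then \<theta> * B else 0)" if "t \<in> {0..1}" for l t
    proof (cases "l = i")
      case True
      have "dist (z i t) (w i t) = \<theta> * (\<bar>poly q t\<bar> * cmod V)" using \<open>\<bar>\<eta>\<bar> = \<theta>\<close> by (simp add: wi dist_norm abs_mult)
      also have "\<dots> \<le> \<theta> * B" using Bq(1)[OF that] \<open>\<theta> > 0\<close> by (intro mult_left_mono) auto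
      finally show ?thesis using True by simp
    qed (simp add: w_other)
    have pq: "(\<lambda>t. (\<eta> * poly q t) *\<^sub>R V) = (\<lambda>t. Complex (poly (smult (\<eta> * Re V) q) t) (poly (smult (\<eta> * Im V) q) t))"
      by (simp add: fun_eq_iff complex_eq_iff)
    have w_smooth: "smooth_on_unit (w l)" if "l \<in> {1..n}" for l
    proof (cases "l = i")
      case True
      have "smooth_on_unit (\<lambda>t. (\<eta> * poly q t) *\<^sub>R V)" unfolding pq by (rule smooth_on_unit_poly)
      from smooth_on_unit_add[OF sm[OF mem(1)] this] show ?thesis using True by (simp add: w_def)
    next
      case False
      then show ?thesis using sm[OF that] w_other by metis
    qed
    have pbw: "pure_braid n w"
      unfolding pure_braid_def
    proof (intro conjI ballI)
      fix l assume l: "l \<in> {1..n}"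
      show "smooth_on_unit (w l)" by (rule w_smooth[OF l])
      show "w l 0 = base_point n l" "w l 1 = base_point n l"
        using pure_braidD(2,3)[OF pb l] q01 by (cases "l = i"; simp add: wi w_other)+
    next
      fix t :: real assume t: "t \<in> {0..1}"
      show "inj_on (\<lambda>l. w l t) {1..n}"
      proof (rule inj_onI, rule ccontr)
        fix a b assume ab: "a \<in> {1..n}" "b \<in> {1..n}" "w a t = w b t" "a \<noteq> b"
        have "s0 \<le> dist (z a t) (z b t)" using s0(2)[OF t ab(1,2,4)] .
        also have "\<dots> \<le> dist (z a t) (w a t) + dist (z b t) (w b t)"
          using dist_triangle2[of "z a t" "z b t" "w a t"] ab(3) by simp
        also have "\<dots> \<le> \<theta> * B" using w_dist[OF t, of a] w_dist[OF t, of b] ab(4) \<open>\<theta> > 0\<close> \<open>B > 0\<close> by (auto split: if_splits)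
        finally show False using \<theta>(2) by simp
      qed
    qed
    have close: "C1_close n \<epsilon> z w"
      unfolding C1_close_def
    proof (intro ballI conjI)
      fix l and t :: real assume l: "l \<in> {1..n}" and t: "t \<in> {0..1}"
      show "dist (z l t) (w l t) < \<epsilon>"
        using w_dist[OF t, of l] \<theta>(1) \<epsilon>(1) by (auto split: if_splits)
      show "dist (velocity (z l) t) (velocity (w l) t) < \<epsilon>"
      proof (cases "l = i")
        case True
        have "((\<lambda>t. (\<eta> * poly q t) *\<^sub>R V) has_vector_derivative (\<eta> * poly (pderiv q) t) *\<^sub>R V) (at t within {0..1})"
        proof -
          have "((\<lambda>t. \<eta> * poly q t) has_real_derivative \<eta> * poly (pderiv q) t) (at t within {0..1})"
            by (intro DERIV_cmult DERIV_subset[OF poly_DERIV]) simp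
          from has_vector_derivative_scaleR[OF this has_vector_derivative_const[of V]] show ?thesis by simp
        qed
        then have "((\<lambda>t. z i t + (\<eta> * poly q t) *\<^sub>R V) has_vector_derivative velocity (z i) t + (\<eta> * poly (pderiv q) t) *\<^sub>R V) (at t within {0..1})"
          by (intro has_vector_derivative_add smooth_on_unit_velocity(1)[OF sm] mem t)
        then have "velocity (w i) t = velocity (z i) t + (\<eta> * poly (pderiv q) t) *\<^sub>R V"
          unfolding w_def fun_upd_same by (rule velocity_eqI[OF t])
        then have "dist (velocity (z i) t) (velocity (w i) t) = \<theta> * (\<bar>poly (pderiv q) t\<bar> * cmod V)"
          using \<open>\<bar>\<eta>\<bar> = \<theta>\<close> by (simp add: dist_norm abs_mult)
        also have "\<dots> \<le> \<theta> * B" using Bq(2)[OF t] \<open>\<theta> > 0\<close> by (intro mult_left_mono) auto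
        finally show ?thesis using True \<theta>(1) by simp
      qed (simp add: w_other \<epsilon>(1))
    qed
    define g where "g t = turn (\<lambda>l. w l t) i j k" for t
    have gt0: "\<sigma> * g t0 < 0"
    proof -
      have "f t0 = 0" using f0 by (simp add: f_def)
      then have "\<sigma> * g t0 = - (\<sigma> * \<sigma>) * (sgn (poly q t0) * poly q t0) * (\<theta> * L t0)"
        by (simp add: g_def turn_w \<eta>_def)
      also have "\<dots> = - (\<bar>poly q t0\<bar> * (\<theta> * L t0))" using \<sigma> by (auto simp: abs_sgn)
      also have "\<dots> < 0" using q0 \<open>\<theta> > 0\<close> \<open>L t0 > 0\<close> by simp
      finally show ?thesis .
    qed
    have small: "\<bar>\<eta> * poly q x * L x\<bar> < \<bar>f x\<bar>" if "x = u \<or> x = v" for x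
    proof -
      have "\<bar>\<eta> * poly q x * L x\<bar> = \<theta> * \<bar>poly q x * L x\<bar>" using \<open>\<bar>\<eta>\<bar> = \<theta>\<close> by (simp add: abs_mult)
      also have "\<dots> \<le> \<theta> * K" using that \<open>\<theta> > 0\<close> by (intro mult_left_mono) (auto simp: K_def)
      also have "\<dots> < \<bar>f x\<bar>" using that \<theta>(3,4) by auto
      finally show ?thesis .
    qed
    have guv: "\<sigma> * g u > 0" "\<sigma> * g v > 0"
      using small[of u] small[of v] fu fv \<sigma> unfolding g_def turn_w by (auto simp: abs_if split: if_splits)
    have contg: "continuous_on {0..1} g"
      unfolding g_def using smooth_on_unit_velocity(2)[OF w_smooth] mem by (intro continuous_on_turn) auto
    have opp: "g u * g t0 < 0" "g t0 * g v < 0"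
      using guv gt0 \<sigma> by (auto simp: mult_less_0_iff)
    obtain a where a: "u < a" "a < t0" "g a = 0"
      using zero_between_opposite_signs[OF continuous_on_subset[OF contg], of u t0] opp uv t01 by auto
    obtain b where b: "t0 < b" "b < v" "g b = 0"
      using zero_between_opposite_signs[OF continuous_on_subset[OF contg], of t0 v] opp uv t01 by auto
    have "a \<in> critical_moments n w" by (rule crit) (use a(1,2) a(3)[unfolded g_def] uv t01 in auto)
    moreover have "b \<in> critical_moments n w" by (rule crit) (use b(1,2) b(3)[unfolded g_def] uv t01 in auto)
    moreover have "s \<in> critical_moments n w" if "s \<in> ?C - {t0}" for s
    proof -
      have "w l s = z l s" for l using qC[OF that] by (cases "l = i") (simp_all add: wi w_other)
      then show ?thesis using that by (simp add: critical_moments_iff)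
    qed
    ultimately have sub: "insert a (insert b (?C - {t0})) \<subseteq> critical_moments n w" by blast
    have "a \<notin> ?C" "b \<notin> ?C" using d(2)[of a] d(2)[of b] a b uv by auto
    then have "card (insert a (insert b (?C - {t0}))) = Suc (Suc (card (?C - {t0})))"
      using fin a(2) b(1) by simp
    also have "\<dots> = Suc (card ?C)" using card_Suc_Diff1[OF fin t0] by simp
    finally have "Suc (card ?C) \<le> card (critical_moments n w)"
      using card_mono[OF _ sub] \<epsilon>(2)[OF pbw close] by simp
    then show False using \<epsilon>(2)[OF pbw close] by simp
  qed
  then show "\<exists>\<delta>>0. \<forall>u v. 0 \<le> u \<longrightarrow> t0 - \<delta> < u \<longrightarrow> u < t0 \<longrightarrow> t0 < v \<longrightarrow> v < t0 + \<delta> \<longrightarrow> v \<le> 1 \<longrightarrow>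
      turn (\<lambda>l. z l u) i j k * turn (\<lambda>l. z l v) i j k < 0"
    using d(1) unfolding f_def by blast
qed

lemma good_stable_imp_regular:
  assumes "good_stable n z"
  shows "regular_path n z"
proof -
  have "pure_braid n z" using assms by (simp add: good_stable_def)
  then show ?thesis
    using assms good_stable_imp_sign_change[OF assms] pure_braidD(5-7)[of n z]
    unfolding regular_path_def good_stable_def by blast
qed

section \<open>Presented groups\<close>

lemma gwords_Nil [simp]: "[] \<in> gwords S"
  and gwords_Cons [simp]: "x # u \<in> gwords S \<longleftrightarrow> fst x \<in> S \<and> u \<in> gwords S"
  and gwords_append [simp]: "u @ v \<in> gwords S \<longleftrightarrow> u \<in> gwords S \<and> v \<in> gwords S"
  by (cases x; auto simp: gwords_def)+

lemma pos_word_in_gwords [simp]: "pos_word l \<in> gwords S \<longleftrightarrow> set l \<subseteq> S"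
  by (induction l) auto

lemma pres_eq_gwords: "pres_eq S R u v \<Longrightarrow> u \<in> gwords S \<and> v \<in> gwords S"
  by (induction rule: pres_eq.induct) auto

lemma pres_class_eqI: "pres_eq S R u v \<Longrightarrow> pres_class S R u = pres_class S R v"
  unfolding pres_class_def
  by (rule Collect_cong, rule iffI) (erule pres_eq.trans[OF pres_eq.sym], assumption, erule pres_eq.trans)

lemma mem_pres_class: "u \<in> gwords S \<Longrightarrow> u \<in> pres_class S R u"
  by (simp add: pres_class_def pres_eq.refl)

lemma pres_class_eq_iff: "u \<in> gwords S \<Longrightarrow> pres_class S R u = pres_class S R v \<longleftrightarrow> pres_eq S R u v"
proof
  assume "u \<in> gwords S" "pres_class S R u = pres_class S R v"
  then have "u \<in> pres_class S R v" using mem_pres_class by blast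
  then show "pres_eq S R u v" by (simp add: pres_class_def pres_eq.sym)
qed (rule pres_class_eqI)

lemma pres_group_mult:
  assumes "u \<in> gwords S" "v \<in> gwords S"
  shows "pres_class S R u \<otimes>\<^bsub>pres_group S R\<^esub> pres_class S R v = pres_class S R (u @ v)"
proof -
  have "(\<exists>x\<in>pres_class S R u. \<exists>y\<in>pres_class S R v. pres_eq S R (x @ y) w) \<longleftrightarrow> pres_eq S R (u @ v) w" for w
  proof
    assume "\<exists>x\<in>pres_class S R u. \<exists>y\<in>pres_class S R v. pres_eq S R (x @ y) w"
    then obtain x y where "pres_eq S R u x" "pres_eq S R v y" "pres_eq S R (x @ y) w" by (auto simp: pres_class_def)
    then show "pres_eq S R (u @ v) w" using pres_eq.trans[OF pres_eq.append] by blast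
  qed (use mem_pres_class assms in blast)
  then show ?thesis by (simp add: pres_group_def pres_class_def)
qed

definition inv_word :: "'g gword \<Rightarrow> 'g gword" where
  "inv_word u = rev (map (\<lambda>(s, b). (s, \<not> b)) u)"

lemma inv_word_Cons: "inv_word (x # u) = inv_word u @ [(fst x, \<not> snd x)]"
  by (cases x) (simp add: inv_word_def)

lemma inv_word_gwords [simp]: "inv_word u \<in> gwords S \<longleftrightarrow> u \<in> gwords S"
  by (induction u) (auto simp: inv_word_Cons, auto simp: inv_word_def)

lemma inv_word_left: "u \<in> gwords S \<Longrightarrow> pres_eq S R (inv_word u @ u) []"
proof (induction u)
  case (Cons x u)
  have x: "pres_eq S R [(fst x, \<not> snd x), x] []"
    using pres_eq.cancel[of "fst x" S R "\<not> snd x"] Cons.prems by simp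
  have "pres_eq S R (inv_word u @ ([(fst x, \<not> snd x), x] @ u)) (inv_word u @ ([] @ u))"
    using Cons.prems by (intro pres_eq.append x pres_eq.refl) auto
  then have "pres_eq S R (inv_word (x # u) @ x # u) (inv_word u @ u)" by (simp add: inv_word_Cons)
  then show ?case using Cons.IH Cons.prems by (elim pres_eq.trans) simp
qed (auto simp: inv_word_def intro: pres_eq.refl)

lemma pres_group_carrier: "X \<in> carrier (pres_group S R) \<longleftrightarrow> (\<exists>u\<in>gwords S. X = pres_class S R u)"
  by (auto simp: pres_group_def)

lemma pres_group_carrierI: "u \<in> gwords S \<Longrightarrow> pres_class S R u \<in> carrier (pres_group S R)"
  by (simp add: pres_group_def)

lemma pres_group_carrierE:
  assumes "X \<in> carrier (pres_group S R)"
  obtains u where "u \<in> gwords S" "X = pres_class S R u"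
  using assms unfolding pres_group_carrier by (elim bexE)

lemma pres_group_one: "\<one>\<^bsub>pres_group S R\<^esub> = pres_class S R []"
  by (simp add: pres_group_def)

lemma pres_group_is_group: "group (pres_group S R)"
proof (rule groupI)
  fix X Y assume X: "X \<in> carrier (pres_group S R)" and Y: "Y \<in> carrier (pres_group S R)"
  obtain u where u: "u \<in> gwords S" "X = pres_class S R u" by (rule pres_group_carrierE[OF X])
  obtain v where v: "v \<in> gwords S" "Y = pres_class S R v" by (rule pres_group_carrierE[OF Y])
  show "X \<otimes>\<^bsub>pres_group S R\<^esub> Y \<in> carrier (pres_group S R)"
    unfolding u(2) v(2) pres_group_mult[OF u(1) v(1)] by (rule pres_group_carrierI) (simp add: u v)
  fix Z assume Z: "Z \<in> carrier (pres_group S R)"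
  obtain w where w: "w \<in> gwords S" "Z = pres_class S R w" by (rule pres_group_carrierE[OF Z])
  show "X \<otimes>\<^bsub>pres_group S R\<^esub> Y \<otimes>\<^bsub>pres_group S R\<^esub> Z = X \<otimes>\<^bsub>pres_group S R\<^esub> (Y \<otimes>\<^bsub>pres_group S R\<^esub> Z)"
    unfolding u(2) v(2) w(2) using u(1) v(1) w(1) by (simp add: pres_group_mult)
next
  fix X assume "X \<in> carrier (pres_group S R)"
  then obtain u where u: "u \<in> gwords S" "X = pres_class S R u" by (rule pres_group_carrierE)
  show "\<one>\<^bsub>pres_group S R\<^esub> \<otimes>\<^bsub>pres_group S R\<^esub> X = X"
    using u by (simp add: pres_group_one pres_group_mult)
  have "pres_class S R (inv_word u) \<otimes>\<^bsub>pres_group S R\<^esub> X = \<one>\<^bsub>pres_group S R\<^esub>"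
    using u inv_word_left[of u S R] by (simp add: pres_group_one pres_group_mult pres_class_eqI)
  then show "\<exists>Y\<in>carrier (pres_group S R). Y \<otimes>\<^bsub>pres_group S R\<^esub> X = \<one>\<^bsub>pres_group S R\<^esub>"
    using u by (intro bexI[of _ "pres_class S R (inv_word u)"] pres_group_carrierI) simp_all
next
  show "\<one>\<^bsub>pres_group S R\<^esub> \<in> carrier (pres_group S R)"
    unfolding pres_group_one by (rule pres_group_carrierI) simp
qed

text \<open>A letter \<open>(s, False)\<close> is the inverse of the letter \<open>(s, True)\<close>, so two homomorphisms that
  agree on the generators agree everywhere.\<close>

lemma pres_group_hom_unique:
  assumes "group H" "h \<in> hom (pres_group S R) H" "h' \<in> hom (pres_group S R) H"
    and gen: "\<And>s. s \<in> S \<Longrightarrow> h (pres_class S R [(s, True)]) = h' (pres_class S R [(s, True)])"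
    and "u \<in> gwords S"
  shows "h (pres_class S R u) = h' (pres_class S R u)"
proof -
  let ?G = "pres_group S R"
  interpret hh: group_hom ?G H h using pres_group_is_group assms(1,2) by (simp add: group_hom_def group_hom_axioms_def)
  interpret hh': group_hom ?G H h' using pres_group_is_group assms(1,3) by (simp add: group_hom_def group_hom_axioms_def)
  have letter: "h (pres_class S R [(s, b)]) = h' (pres_class S R [(s, b)])" if s: "s \<in> S" for s b
  proof (cases b)
    case False
    have c: "pres_class S R [(s, True)] \<in> carrier ?G" "pres_class S R [(s, False)] \<in> carrier ?G"
      by (rule pres_group_carrierI, simp add: s)+
    have "pres_class S R [(s, False)] \<otimes>\<^bsub>?G\<^esub> pres_class S R [(s, True)] = \<one>\<^bsub>?G\<^esub>"
      using s pres_eq.cancel[OF s, of R False] by (simp add: pres_group_mult pres_group_one pres_class_eqI)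
    then have "pres_class S R [(s, False)] = inv\<^bsub>?G\<^esub> pres_class S R [(s, True)]"
      using group.inv_equality[OF pres_group_is_group _ c] by simp
    then show ?thesis using gen[OF s] c False by simp
  qed (use gen[OF s] in simp)
  show ?thesis
    using assms(5)
  proof (induction u)
    case Nil
    then show ?case using hh.hom_one hh'.hom_one by (simp add: pres_group_one)
  next
    case (Cons x u)
    have x: "[x] \<in> gwords S" "u \<in> gwords S" using Cons.prems by auto
    have c: "pres_class S R [x] \<in> carrier ?G" "pres_class S R u \<in> carrier ?G"
      by (rule pres_group_carrierI, fact x)+
    have "pres_class S R (x # u) = pres_class S R [x] \<otimes>\<^bsub>?G\<^esub> pres_class S R u"
      using x by (simp add: pres_group_mult del: gwords_Cons)
    then show ?case
      using Cons.IH[OF x(2)] letter[of "fst x" "snd x"] Cons.prems c by simp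
  qed
qed

section \<open>Evaluation of words and the universal property\<close>

definition word_value :: "('a, 'm) monoid_scheme \<Rightarrow> ('g \<Rightarrow> 'a) \<Rightarrow> 'g gword \<Rightarrow> 'a" where
  "word_value H \<phi> u = foldr (\<lambda>(s, b) x. (if b then \<phi> s else inv\<^bsub>H\<^esub> \<phi> s) \<otimes>\<^bsub>H\<^esub> x) u \<one>\<^bsub>H\<^esub>"

context group
begin

lemma word_value_closed:
  assumes "\<And>s. s \<in> S \<Longrightarrow> \<phi> s \<in> carrier G" "u \<in> gwords S"
  shows "word_value G \<phi> u \<in> carrier G"
  using assms(2) by (induction u) (use assms(1) in \<open>auto simp: word_value_def split: prod.split\<close>)

lemma word_value_append:
  assumes "\<And>s. s \<in> S \<Longrightarrow> \<phi> s \<in> carrier G" "u \<in> gwords S" "v \<in> gwords S"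
  shows "word_value G \<phi> (u @ v) = word_value G \<phi> u \<otimes> word_value G \<phi> v"
  using assms(2)
proof (induction u)
  case Nil
  then show ?case using word_value_closed[of S \<phi> v] assms by (simp add: word_value_def)
next
  case (Cons x u)
  obtain s b where x: "x = (s, b)" by (cases x)
  have "s \<in> S" "u \<in> gwords S" using Cons.prems x by auto
  moreover have step: "word_value G \<phi> (x # w) = (if b then \<phi> s else inv \<phi> s) \<otimes> word_value G \<phi> w" for w
    by (simp add: x word_value_def)
  ultimately show ?case
    using Cons.IH word_value_closed[of S \<phi> u] word_value_closed[of S \<phi> v] assms
    by (simp add: step m_assoc)
qed

lemma word_value_pres_eq:
  assumes "\<And>s. s \<in> S \<Longrightarrow> \<phi> s \<in> carrier G"
    and "\<And>u v. (u, v) \<in> R \<Longrightarrow> u \<in> gwords S \<Longrightarrow> v \<in> gwords S \<Longrightarrow> word_value G \<phi> u = word_value G \<phi> v"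
    and "pres_eq S R u v"
  shows "word_value G \<phi> u = word_value G \<phi> v"
  using assms(3)
proof (induction rule: pres_eq.induct)
  case (append u u' v v')
  note w = pres_eq_gwords[OF append(1)] pres_eq_gwords[OF append(2)]
  have "word_value G \<phi> (u @ v) = word_value G \<phi> u \<otimes> word_value G \<phi> v"
    by (rule word_value_append[OF assms(1) conjunct1[OF w(1)] conjunct1[OF w(2)]])
  moreover have "word_value G \<phi> (u' @ v') = word_value G \<phi> u' \<otimes> word_value G \<phi> v'"
    by (rule word_value_append[OF assms(1) conjunct2[OF w(1)] conjunct2[OF w(2)]])
  ultimately show ?case by (simp only: append.IH)
next
  case (cancel s b)
  then show ?case using assms(1)[OF cancel] by (cases b) (simp_all add: word_value_def)
next
  case (rel u v)
  then show ?case by (rule assms(2))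
qed simp_all

text \<open>A map of generators respecting the relations is constant on classes of words.
  Extensionality fixes the values outside the carrier, so that the homomorphism can be unique as a
  total function, as the description of \<open>phi\<close> demands.\<close>

lemma pres_group_universal:
  assumes "\<And>s. s \<in> S \<Longrightarrow> \<phi> s \<in> carrier G"
    and "\<And>u v. (u, v) \<in> R \<Longrightarrow> u \<in> gwords S \<Longrightarrow> v \<in> gwords S \<Longrightarrow> word_value G \<phi> u = word_value G \<phi> v"
  shows "\<exists>h. h \<in> hom (pres_group S R) G \<and> h \<in> extensional (carrier (pres_group S R)) \<and>
     (\<forall>s\<in>S. h (pres_class S R [(s, True)]) = \<phi> s)"
proof -
  define h where "h = restrict (\<lambda>X. word_value G \<phi> (SOME u. u \<in> gwords S \<and> X = pres_class S R u)) (carrier (pres_group S R))"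
  have h: "h (pres_class S R u) = word_value G \<phi> u" if "u \<in> gwords S" for u
  proof -
    define v where "v = (SOME v. v \<in> gwords S \<and> pres_class S R u = pres_class S R v)"
    have "v \<in> gwords S \<and> pres_class S R u = pres_class S R v"
      unfolding v_def by (rule someI[of _ u]) (use that in auto)
    then have "pres_eq S R u v" using pres_class_eq_iff[OF that] by blast
    from word_value_pres_eq[OF assms this] have "word_value G \<phi> u = word_value G \<phi> v" by simp
    moreover have "h (pres_class S R u) = word_value G \<phi> v"
      using pres_group_carrierI[OF that] by (simp add: h_def v_def)
    ultimately show ?thesis by simp
  qed
  have "h \<in> hom (pres_group S R) G"
  proof (rule homI)
    fix X assume "X \<in> carrier (pres_group S R)"
    then obtain u where "u \<in> gwords S" "X = pres_class S R u" by (rule pres_group_carrierE)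
    then show "h X \<in> carrier G" using h word_value_closed[OF assms(1)] by simp
  next
    fix X Y assume "X \<in> carrier (pres_group S R)" "Y \<in> carrier (pres_group S R)"
    then obtain u v where uv: "u \<in> gwords S" "v \<in> gwords S" and XY: "X = pres_class S R u" "Y = pres_class S R v"
      by (elim pres_group_carrierE)
    have "h (X \<otimes>\<^bsub>pres_group S R\<^esub> Y) = word_value G \<phi> (u @ v)" 
      unfolding XY pres_group_mult[OF uv] by (rule h) (use uv in simp)
    then show "h (X \<otimes>\<^bsub>pres_group S R\<^esub> Y) = h X \<otimes> h Y"
      unfolding XY h[OF uv(1)] h[OF uv(2)] by (simp add: word_value_append[OF assms(1) uv])
  qed
  moreover have "h (pres_class S R [(s, True)]) = \<phi> s" if "s \<in> S" for s
    using h[of "[(s, True)]"] that assms(1) by (simp add: word_value_def)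
  ultimately show ?thesis by (intro exI[of _ h]) (auto simp: h_def)
qed

end

section \<open>The homomorphism \<open>\<phi>\<close>\<close>

lemma a2_sym: "a2 P p q = a2 P q p"
  by (simp add: a2_def insert_commute)

lemma G2_group: "group (G2 P)"
  unfolding G2_def by (rule pres_group_is_group)

lemma G2_gensI: "p \<in> P \<Longrightarrow> q \<in> P \<Longrightarrow> p \<noteq> q \<Longrightarrow> {p, q} \<in> G2_gens P"
  unfolding G2_gens_def by blast

lemma a2_closed: "p \<in> P \<Longrightarrow> q \<in> P \<Longrightarrow> p \<noteq> q \<Longrightarrow> a2 P p q \<in> carrier (G2 P)"
  unfolding a2_def G2_def by (rule pres_group_carrierI) (simp add: G2_gensI)

lemma pos_word_class_mult:
  assumes "set k \<subseteq> S" "set l \<subseteq> S"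
  shows "pres_class S R (pos_word k) \<otimes>\<^bsub>pres_group S R\<^esub> pres_class S R (pos_word l) = pres_class S R (pos_word (k @ l))"
  using assms by (simp add: pres_group_mult)

lemma pres_rel_class:
  assumes "(u, v) \<in> R" "u \<in> gwords S" "v \<in> gwords S"
  shows "pres_class S R u = pres_class S R v"
  using assms by (intro pres_class_eqI pres_eq.rel)

lemma a2_square:
  assumes "p \<in> P" "q \<in> P" "p \<noteq> q"
  shows "a2 P p q \<otimes>\<^bsub>G2 P\<^esub> a2 P p q = \<one>\<^bsub>G2 P\<^esub>"
proof -
  have "(pos_word [{p, q}, {p, q}], []) \<in> G2_rels P" unfolding G2_rels_def using assms by blast
  from pres_rel_class[OF this, of "G2_gens P"] show ?thesis
    unfolding a2_def G2_def using G2_gensI[OF assms] by (simp add: pres_group_mult pres_group_one)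
qed

lemma a2_commute:
  assumes "{p, q, r, s} \<subseteq> P" "distinct [p, q, r, s]"
  shows "a2 P p q \<otimes>\<^bsub>G2 P\<^esub> a2 P r s = a2 P r s \<otimes>\<^bsub>G2 P\<^esub> a2 P p q"
proof -
  have "(pos_word [{p, q}, {r, s}], pos_word [{r, s}, {p, q}]) \<in> G2_rels P"
    unfolding G2_rels_def using assms by blast
  from pres_rel_class[OF this, of "G2_gens P"] show ?thesis
    unfolding a2_def G2_def using assms G2_gensI[of p P q] G2_gensI[of r P s] by (simp add: pres_group_mult)
qed

text \<open>Since (xyz)^2 = 1, the product xyz is its own inverse; as x, y, z are involutions, that
  inverse is zyx.\<close>

lemma a2_triangle:
  assumes "{p, q, r} \<subseteq> P" "distinct [p, q, r]"
  shows "a2 P p q \<otimes>\<^bsub>G2 P\<^esub> a2 P p r \<otimes>\<^bsub>G2 P\<^esub> a2 P q r = a2 P q r \<otimes>\<^bsub>G2 P\<^esub> a2 P p r \<otimes>\<^bsub>G2 P\<^esub> a2 P p q"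
proof -
  interpret G: group "G2 P" by (rule G2_group)
  let ?x = "a2 P p q" and ?y = "a2 P p r" and ?z = "a2 P q r"
  have c: "?x \<in> carrier (G2 P)" "?y \<in> carrier (G2 P)" "?z \<in> carrier (G2 P)"
    by (rule a2_closed; use assms in simp)+
  have sq: "?x \<otimes>\<^bsub>G2 P\<^esub> ?x = \<one>\<^bsub>G2 P\<^esub>" "?y \<otimes>\<^bsub>G2 P\<^esub> ?y = \<one>\<^bsub>G2 P\<^esub>" "?z \<otimes>\<^bsub>G2 P\<^esub> ?z = \<one>\<^bsub>G2 P\<^esub>"
    by (rule a2_square; use assms in simp)+
  have "(pos_word [{p, q}, {p, r}, {q, r}, {p, q}, {p, r}, {q, r}], []) \<in> G2_rels P"
    unfolding G2_rels_def using assms by blast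
  from pres_rel_class[OF this, of "G2_gens P"]
  have "?x \<otimes>\<^bsub>G2 P\<^esub> (?y \<otimes>\<^bsub>G2 P\<^esub> (?z \<otimes>\<^bsub>G2 P\<^esub> (?x \<otimes>\<^bsub>G2 P\<^esub> (?y \<otimes>\<^bsub>G2 P\<^esub> ?z)))) = \<one>\<^bsub>G2 P\<^esub>"
    unfolding a2_def G2_def using assms G2_gensI[of p P q] G2_gensI[of p P r] G2_gensI[of q P r]
    by (simp add: pres_group_mult pres_group_one)
  then have "(?x \<otimes>\<^bsub>G2 P\<^esub> ?y \<otimes>\<^bsub>G2 P\<^esub> ?z) \<otimes>\<^bsub>G2 P\<^esub> (?x \<otimes>\<^bsub>G2 P\<^esub> ?y \<otimes>\<^bsub>G2 P\<^esub> ?z) = \<one>\<^bsub>G2 P\<^esub>"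
    using c by (simp add: G.m_assoc)
  then have "inv\<^bsub>G2 P\<^esub> (?x \<otimes>\<^bsub>G2 P\<^esub> ?y \<otimes>\<^bsub>G2 P\<^esub> ?z) = ?x \<otimes>\<^bsub>G2 P\<^esub> ?y \<otimes>\<^bsub>G2 P\<^esub> ?z"
    using c by (intro G.inv_equality) simp_all
  moreover have "inv\<^bsub>G2 P\<^esub> ?x = ?x" "inv\<^bsub>G2 P\<^esub> ?y = ?y" "inv\<^bsub>G2 P\<^esub> ?z = ?z" 
    by (rule G.inv_equality; fact)+
  ultimately show ?thesis using c by (simp add: G.inv_mult_group G.m_assoc)
qed

text \<open>The product is sorted by vertices with the commutation rules, the blocks
  \<open>x1 x2 x3\<close> and \<open>l1 l2 l3\<close> are reversed by their own relations, and the
  result is interleaved again. The single letters \<open>j\<close> and \<open>k\<close> only have to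
  move.\<close>

lemma (in group) sorted_product_reversal:
  assumes A: "{x1, x2, x3} \<subseteq> carrier G" and L: "{l1, l2, l3} \<subseteq> carrier G" and jk: "j \<in> carrier G" "k \<in> carrier G"
    and ck: "\<And>x. x \<in> {x1, x2, x3, l1, l2, l3, j} \<Longrightarrow> x \<otimes> k = k \<otimes> x"
    and cj: "\<And>x. x \<in> {x1, x2, x3, l1, l2, l3} \<Longrightarrow> x \<otimes> j = j \<otimes> x"
    and cl: "\<And>a l. a \<in> {x1, x2, x3} \<Longrightarrow> l \<in> {l1, l2, l3} \<Longrightarrow> l \<otimes> a = a \<otimes> l"
    and ra: "x1 \<otimes> x2 \<otimes> x3 = x3 \<otimes> x2 \<otimes> x1" and rl: "l1 \<otimes> l2 \<otimes> l3 = l3 \<otimes> l2 \<otimes> l1"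
  shows "(x1 \<otimes> k) \<otimes> ((x2 \<otimes> l1) \<otimes> ((x3 \<otimes> l2) \<otimes> (j \<otimes> l3))) = (j \<otimes> l3) \<otimes> ((x3 \<otimes> l2) \<otimes> ((x2 \<otimes> l1) \<otimes> (x1 \<otimes> k)))"
proof -
  have c: "x1 \<in> carrier G" "x2 \<in> carrier G" "x3 \<in> carrier G" "l1 \<in> carrier G" "l2 \<in> carrier G" "l3 \<in> carrier G"
    using A L by auto
  have lcomm: "x \<otimes> (y \<otimes> z) = y \<otimes> (x \<otimes> z)" if "x \<otimes> y = y \<otimes> x" "x \<in> carrier G" "y \<in> carrier G" "z \<in> carrier G" for x y z
    using that by (simp add: m_assoc[symmetric])
  have mem: "x \<in> carrier G" if "x \<in> {x1, x2, x3, l1, l2, l3, j}" for x using that c jk by auto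
  have ck': "x \<otimes> (k \<otimes> z) = k \<otimes> (x \<otimes> z)" if "x \<in> {x1, x2, x3, l1, l2, l3, j}" "z \<in> carrier G" for x z
    by (rule lcomm[OF ck[OF that(1)] mem[OF that(1)] jk(2) that(2)])
  have cj': "x \<otimes> (j \<otimes> z) = j \<otimes> (x \<otimes> z)" if "x \<in> {x1, x2, x3, l1, l2, l3}" "z \<in> carrier G" for x z
    by (rule lcomm[OF cj[OF that(1)] mem jk(1) that(2)]) (use that in auto)
  have cl': "l \<otimes> (a \<otimes> z) = a \<otimes> (l \<otimes> z)" if "a \<in> {x1, x2, x3}" "l \<in> {l1, l2, l3}" "z \<in> carrier G" for a l z
    by (rule lcomm[OF cl[OF that(1,2)] mem mem that(3)]) (use that in auto)
  note rules = cl[of x1 l1] cl[of x1 l2] cl[of x1 l3] cl[of x2 l1] cl[of x2 l2] cl[of x2 l3] cl[of x3 l1] cl[of x3 l2] cl[of x3 l3]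
    cl'[of x1 l1] cl'[of x1 l2] cl'[of x1 l3] cl'[of x2 l1] cl'[of x2 l2] cl'[of x2 l3] cl'[of x3 l1] cl'[of x3 l2] cl'[of x3 l3]
  have "(x1 \<otimes> k) \<otimes> ((x2 \<otimes> l1) \<otimes> ((x3 \<otimes> l2) \<otimes> (j \<otimes> l3))) = k \<otimes> (j \<otimes> ((x1 \<otimes> x2 \<otimes> x3) \<otimes> (l1 \<otimes> l2 \<otimes> l3)))"
    using c jk by (simp add: m_assoc ck ck' cj cj' rules)
  also have "\<dots> = k \<otimes> (j \<otimes> ((x3 \<otimes> x2 \<otimes> x1) \<otimes> (l3 \<otimes> l2 \<otimes> l1)))" by (simp only: ra rl)
  also have "\<dots> = (j \<otimes> l3) \<otimes> ((x3 \<otimes> l2) \<otimes> ((x2 \<otimes> l1) \<otimes> (x1 \<otimes> k)))"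
    using c jk by (simp add: m_assoc ck ck' cj cj' rules)
  finally show ?thesis .
qed

definition phi_val :: "nat \<Rightarrow> nat \<Rightarrow> nat \<Rightarrow> nat \<Rightarrow> (nat \<times> nat) set gword set" where
  "phi_val n i j k = a2 (ordered_pairs n) (i, j) (i, k) \<otimes>\<^bsub>G2_pairs n\<^esub> a2 (ordered_pairs n) (k, j) (k, i)"

lemma ordered_pairs_iff [simp]: "(i, j) \<in> ordered_pairs n \<longleftrightarrow> i \<in> {1..n} \<and> j \<in> {1..n} \<and> i \<noteq> j"
  by (simp add: ordered_pairs_def)

lemma a2_pair_closed:
  "{i, j, k} \<subseteq> {1..n} \<Longrightarrow> distinct [i, j, k] \<Longrightarrow> a2 (ordered_pairs n) (i, j) (i, k) \<in> carrier (G2_pairs n)"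
  by (rule a2_closed) auto

lemma phi_val_closed:
  assumes "{i, j, k} \<subseteq> {1..n}" "distinct [i, j, k]"
  shows "phi_val n i j k \<in> carrier (G2_pairs n)"
proof -
  interpret G: group "G2_pairs n" by (rule G2_group)
  show ?thesis unfolding phi_val_def using assms by (intro G.m_closed a2_pair_closed) auto
qed

lemma a2_pairs_commute:
  assumes "{i, j, k, p, q, r} \<subseteq> {1..n}" "distinct [i, j, k]" "distinct [p, q, r]" 
    and "i \<noteq> p \<or> {j, k} \<inter> {q, r} = {}"
  shows "a2 (ordered_pairs n) (i, j) (i, k) \<otimes>\<^bsub>G2_pairs n\<^esub> a2 (ordered_pairs n) (p, q) (p, r)
       = a2 (ordered_pairs n) (p, q) (p, r) \<otimes>\<^bsub>G2_pairs n\<^esub> a2 (ordered_pairs n) (i, j) (i, k)"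
  by (rule a2_commute) (use assms in auto)

text \<open>The two letters sit at the different vertices i and k and hence commute. This makes the
  map well defined on triples up to reversal.\<close>

lemma phi_val_rev: "{i, j, k} \<subseteq> {1..n} \<Longrightarrow> distinct [i, j, k] \<Longrightarrow> phi_val n k j i = phi_val n i j k"
  unfolding phi_val_def by (rule a2_pairs_commute) auto

lemma (in group) four_commute:
  assumes "{x, y, u, v} \<subseteq> carrier G" "x \<otimes> u = u \<otimes> x" "x \<otimes> v = v \<otimes> x" "y \<otimes> u = u \<otimes> y" "y \<otimes> v = v \<otimes> y"
  shows "(x \<otimes> y) \<otimes> (u \<otimes> v) = (u \<otimes> v) \<otimes> (x \<otimes> y)"
proof -
  have c: "x \<in> carrier G" "y \<in> carrier G" "u \<in> carrier G" "v \<in> carrier G" using assms(1) by auto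
  have "(x \<otimes> y) \<otimes> (u \<otimes> v) = x \<otimes> ((y \<otimes> u) \<otimes> v)" using c by (simp add: m_assoc)
  also have "\<dots> = (x \<otimes> u) \<otimes> (y \<otimes> v)" unfolding assms(4) using c by (simp add: m_assoc)
  also have "\<dots> = u \<otimes> ((x \<otimes> v) \<otimes> y)" unfolding assms(2,5) using c by (simp add: m_assoc)
  also have "\<dots> = (u \<otimes> v) \<otimes> (x \<otimes> y)" unfolding assms(3) using c by (simp add: m_assoc)
  finally show ?thesis .
qed

lemma phi_val_square:
  assumes "{i, j, k} \<subseteq> {1..n}" "distinct [i, j, k]"
  shows "phi_val n i j k \<otimes>\<^bsub>G2_pairs n\<^esub> phi_val n i j k = \<one>\<^bsub>G2_pairs n\<^esub>"
proof -
  interpret G: group "G2_pairs n" by (rule G2_group)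
  let ?x = "a2 (ordered_pairs n) (i, j) (i, k)" and ?y = "a2 (ordered_pairs n) (k, j) (k, i)"
  have c: "?x \<in> carrier (G2_pairs n)" "?y \<in> carrier (G2_pairs n)" using assms by (intro a2_pair_closed; simp)+
  have sq: "?x \<otimes>\<^bsub>G2_pairs n\<^esub> ?x = \<one>\<^bsub>G2_pairs n\<^esub>" "?y \<otimes>\<^bsub>G2_pairs n\<^esub> ?y = \<one>\<^bsub>G2_pairs n\<^esub>"
    by (rule a2_square; use assms in auto)+
  have xy: "?x \<otimes>\<^bsub>G2_pairs n\<^esub> ?y = ?y \<otimes>\<^bsub>G2_pairs n\<^esub> ?x" by (rule a2_pairs_commute) (use assms in auto)
  have "(?x \<otimes>\<^bsub>G2_pairs n\<^esub> ?y) \<otimes>\<^bsub>G2_pairs n\<^esub> (?x \<otimes>\<^bsub>G2_pairs n\<^esub> ?y) = (?x \<otimes>\<^bsub>G2_pairs n\<^esub> ?y) \<otimes>\<^bsub>G2_pairs n\<^esub> (?y \<otimes>\<^bsub>G2_pairs n\<^esub> ?x)"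
    by (rule arg_cong[OF xy])
  also have "\<dots> = ?x \<otimes>\<^bsub>G2_pairs n\<^esub> ((?y \<otimes>\<^bsub>G2_pairs n\<^esub> ?y) \<otimes>\<^bsub>G2_pairs n\<^esub> ?x)" using c by (simp add: G.m_assoc)
  also have "\<dots> = \<one>\<^bsub>G2_pairs n\<^esub>" unfolding sq using c sq by simp
  finally show ?thesis unfolding phi_val_def .
qed

text \<open>Letters at different vertices commute in any case, as their four ordered pairs are
  distinct. At a common vertex the two triples share nothing else, so again the four pairs are
  distinct.\<close>

lemma phi_val_far:
  assumes "{i, j, k, p, q, r} \<subseteq> {1..n}" "distinct [i, j, k]" "distinct [p, q, r]" "card ({i, j, k} \<inter> {p, q, r}) \<le> 1"
  shows "phi_val n i j k \<otimes>\<^bsub>G2_pairs n\<^esub> phi_val n p q r = phi_val n p q r \<otimes>\<^bsub>G2_pairs n\<^esub> phi_val n i j k"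
proof -
  interpret G: group "G2_pairs n" by (rule G2_group)
  have at_most: "x = y" if "x \<in> {i, j, k}" "y \<in> {i, j, k}" "x \<in> {p, q, r}" "y \<in> {p, q, r}" for x y
  proof (rule ccontr)
    assume "x \<noteq> y"
    then have "card {x, y} = 2" by simp
    moreover have "card {x, y} \<le> card ({i, j, k} \<inter> {p, q, r})" by (rule card_mono) (use that in auto)
    ultimately show False using assms(4) by simp
  qed
  have disj: "x \<noteq> x' \<or> {y, z} \<inter> {y', z'} = {}"
    if "{x, y, z} = {i, j, k}" "{x', y', z'} = {p, q, r}" "distinct [x, y, z]" for x y z x' y' z'
  proof (rule disjCI, rule notI)
    assume "{y, z} \<inter> {y', z'} \<noteq> {}" and x: "x = x'"
    then obtain u where u: "u \<in> {y, z}" "u \<in> {y', z'}" by blast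
    have "x \<in> {i, j, k}" "u \<in> {i, j, k}" unfolding that(1)[symmetric] using u(1) by simp_all
    moreover have "x \<in> {p, q, r}" "u \<in> {p, q, r}" unfolding that(2)[symmetric] using u(2) x by simp_all
    ultimately have "x = u" by (rule at_most)
    then show False using u(1) that(3) by simp
  qed
  have comm: "a2 (ordered_pairs n) (x, y) (x, z) \<otimes>\<^bsub>G2_pairs n\<^esub> a2 (ordered_pairs n) (x', y') (x', z')
       = a2 (ordered_pairs n) (x', y') (x', z') \<otimes>\<^bsub>G2_pairs n\<^esub> a2 (ordered_pairs n) (x, y) (x, z)"
    if "{x, y, z} = {i, j, k}" "{x', y', z'} = {p, q, r}" "distinct [x, y, z]" "distinct [x', y', z']" for x y z x' y' z'
  proof (rule a2_pairs_commute[OF _ that(3,4) disj[OF that(1-3)]])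
    have "{x, y, z, x', y', z'} = {x, y, z} \<union> {x', y', z'}" by auto
    also have "\<dots> \<subseteq> {1..n}" unfolding that(1,2) using assms(1) by simp
    finally show "{x, y, z, x', y', z'} \<subseteq> {1..n}" .
  qed
  have kji: "{k, j, i} = {i, j, k}" "{r, q, p} = {p, q, r}" by auto
  have d: "distinct [k, j, i]" "distinct [r, q, p]" using assms(2,3) by auto
  have sub: "{i, j, k} \<subseteq> {1..n}" "{k, j, i} \<subseteq> {1..n}" "{p, q, r} \<subseteq> {1..n}" "{r, q, p} \<subseteq> {1..n}"
    using assms(1) by simp_all
  note cl = a2_pair_closed[OF sub(1) assms(2)] a2_pair_closed[OF sub(2) d(1)]
    a2_pair_closed[OF sub(3) assms(3)] a2_pair_closed[OF sub(4) d(2)]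
  have cl': "{a2 (ordered_pairs n) (i, j) (i, k), a2 (ordered_pairs n) (k, j) (k, i), a2 (ordered_pairs n) (p, q) (p, r),
       a2 (ordered_pairs n) (r, q) (r, p)} \<subseteq> carrier (G2_pairs n)"
    by (simp only: insert_subset cl simp_thms empty_subsetI)
  show ?thesis
    unfolding phi_val_def
    by (rule G.four_commute[OF cl' comm[OF HOL.refl HOL.refl assms(2,3)] comm[OF HOL.refl kji(2) assms(2) d(2)]
         comm[OF kji(1) HOL.refl d(1) assms(3)] comm[OF kji d]])
qed

text \<open>Of the eight letters, three sit at i, three at l, and one each at j and k, so only the
  triangle relations at i and l enter. The one at l has to be rewritten by \<open>a2_sym\<close>,
  because the second factor of \<open>phi_val\<close> lists its pairs the other way round.\<close>

lemma phi_val_tetra: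
  assumes "{i, j, k, l} \<subseteq> {1..n}" "distinct [i, j, k, l]"
  shows "phi_val n i j k \<otimes>\<^bsub>G2_pairs n\<^esub> (phi_val n i j l \<otimes>\<^bsub>G2_pairs n\<^esub> (phi_val n i k l \<otimes>\<^bsub>G2_pairs n\<^esub> phi_val n j k l)) =
    phi_val n j k l \<otimes>\<^bsub>G2_pairs n\<^esub> (phi_val n i k l \<otimes>\<^bsub>G2_pairs n\<^esub> (phi_val n i j l \<otimes>\<^bsub>G2_pairs n\<^esub> phi_val n i j k))"
proof -
  interpret G: group "G2_pairs n" by (rule G2_group)
  let ?a = "a2 (ordered_pairs n)"
  have m: "i \<in> {1..n}" "j \<in> {1..n}" "k \<in> {1..n}" "l \<in> {1..n}" 
    "i \<noteq> j" "i \<noteq> k" "i \<noteq> l" "j \<noteq> k" "j \<noteq> l" "k \<noteq> l" using assms by auto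
  note ne = m(5-10) m(5-10)[symmetric]
  have comm: "?a (x, y) (x, z) \<otimes>\<^bsub>G2_pairs n\<^esub> ?a (x', y') (x', z') = ?a (x', y') (x', z') \<otimes>\<^bsub>G2_pairs n\<^esub> ?a (x, y) (x, z)"
    if "{x, y, z, x', y', z'} \<subseteq> {1..n}" "distinct [x, y, z]" "distinct [x', y', z']" "x \<noteq> x'" for x y z x' y' z'
    by (rule a2_pairs_commute) (use that in auto)
  have tri: "?a (x, y) (x, z) \<otimes>\<^bsub>G2_pairs n\<^esub> ?a (x, y) (x, w) \<otimes>\<^bsub>G2_pairs n\<^esub> ?a (x, z) (x, w) =
      ?a (x, z) (x, w) \<otimes>\<^bsub>G2_pairs n\<^esub> ?a (x, y) (x, w) \<otimes>\<^bsub>G2_pairs n\<^esub> ?a (x, y) (x, z)"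
    if "{x, y, z, w} \<subseteq> {1..n}" "distinct [x, y, z, w]" for x y z w
    by (rule a2_triangle) (use that in auto)
  have rl: "?a (l, j) (l, i) \<otimes>\<^bsub>G2_pairs n\<^esub> ?a (l, k) (l, i) \<otimes>\<^bsub>G2_pairs n\<^esub> ?a (l, k) (l, j) =
     ?a (l, k) (l, j) \<otimes>\<^bsub>G2_pairs n\<^esub> ?a (l, k) (l, i) \<otimes>\<^bsub>G2_pairs n\<^esub> ?a (l, j) (l, i)"
    using tri[of l i j k] m ne by (simp add: a2_sym[of _ "(l, i)" "(l, j)"] a2_sym[of _ "(l, i)" "(l, k)"] a2_sym[of _ "(l, j)" "(l, k)"])
  show ?thesis
    unfolding phi_val_def
  proof (rule G.sorted_product_reversal)
    show "{?a (i, j) (i, k), ?a (i, j) (i, l), ?a (i, k) (i, l)} \<subseteq> carrier (G2_pairs n)"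
      "{?a (l, j) (l, i), ?a (l, k) (l, i), ?a (l, k) (l, j)} \<subseteq> carrier (G2_pairs n)"
      "?a (j, k) (j, l) \<in> carrier (G2_pairs n)" "?a (k, j) (k, i) \<in> carrier (G2_pairs n)"
      using m ne by (simp_all add: a2_pair_closed)
    show "?a (i, j) (i, k) \<otimes>\<^bsub>G2_pairs n\<^esub> ?a (i, j) (i, l) \<otimes>\<^bsub>G2_pairs n\<^esub> ?a (i, k) (i, l) =
      ?a (i, k) (i, l) \<otimes>\<^bsub>G2_pairs n\<^esub> ?a (i, j) (i, l) \<otimes>\<^bsub>G2_pairs n\<^esub> ?a (i, j) (i, k)"
      using tri[of i j k l] m ne by simp
    have c1: "\<forall>x\<in>{?a (i, j) (i, k), ?a (i, j) (i, l), ?a (i, k) (i, l), ?a (l, j) (l, i), ?a (l, k) (l, i), ?a (l, k) (l, j), ?a (j, k) (j, l)}. x \<otimes>\<^bsub>G2_pairs n\<^esub> ?a (k, j) (k, i) = ?a (k, j) (k, i) \<otimes>\<^bsub>G2_pairs n\<^esub> x"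
      unfolding ball_simps by (intro conjI TrueI comm) (simp_all only: m ne insert_subset empty_subsetI distinct.simps list.set insert_iff empty_iff simp_thms)
    have c2: "\<forall>x\<in>{?a (i, j) (i, k), ?a (i, j) (i, l), ?a (i, k) (i, l), ?a (l, j) (l, i), ?a (l, k) (l, i), ?a (l, k) (l, j)}. x \<otimes>\<^bsub>G2_pairs n\<^esub> ?a (j, k) (j, l) = ?a (j, k) (j, l) \<otimes>\<^bsub>G2_pairs n\<^esub> x"
      unfolding ball_simps by (intro conjI TrueI comm) (simp_all only: m ne insert_subset empty_subsetI distinct.simps list.set insert_iff empty_iff simp_thms)
    have c3: "\<forall>x\<in>{?a (i, j) (i, k), ?a (i, j) (i, l), ?a (i, k) (i, l)}. \<forall>y\<in>{?a (l, j) (l, i), ?a (l, k) (l, i), ?a (l, k) (l, j)}. y \<otimes>\<^bsub>G2_pairs n\<^esub> x = x \<otimes>\<^bsub>G2_pairs n\<^esub> y"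
      unfolding ball_simps by (intro conjI TrueI comm) (simp_all only: m ne insert_subset empty_subsetI distinct.simps list.set insert_iff empty_iff simp_thms)
    show "x \<otimes>\<^bsub>G2_pairs n\<^esub> ?a (k, j) (k, i) = ?a (k, j) (k, i) \<otimes>\<^bsub>G2_pairs n\<^esub> x" if "x \<in> {?a (i, j) (i, k), ?a (i, j) (i, l), ?a (i, k) (i, l), ?a (l, j) (l, i), ?a (l, k) (l, i), ?a (l, k) (l, j), ?a (j, k) (j, l)}" for x
      by (rule bspec[OF c1 that])
    show "x \<otimes>\<^bsub>G2_pairs n\<^esub> ?a (j, k) (j, l) = ?a (j, k) (j, l) \<otimes>\<^bsub>G2_pairs n\<^esub> x" if "x \<in> {?a (i, j) (i, k), ?a (i, j) (i, l), ?a (i, k) (i, l), ?a (l, j) (l, i), ?a (l, k) (l, i), ?a (l, k) (l, j)}" for x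
      by (rule bspec[OF c2 that])
    show "y \<otimes>\<^bsub>G2_pairs n\<^esub> x = x \<otimes>\<^bsub>G2_pairs n\<^esub> y" if "x \<in> {?a (i, j) (i, k), ?a (i, j) (i, l), ?a (i, k) (i, l)}" "y \<in> {?a (l, j) (l, i), ?a (l, k) (l, i), ?a (l, k) (l, j)}" for x y
      by (rule bspec[OF bspec[OF c3 that(1)] that(2)])
  qed (rule rl)
qed

lemma rev_triple_eqD: "rev_triple i j k = rev_triple p q r \<Longrightarrow> (p, q, r) = (i, j, k) \<or> (p, q, r) = (k, j, i)"
  unfolding rev_triple_def by (metis insertE insertI1 singletonD)

lemma G3'_gensI: "{i, j, k} \<subseteq> {1..n} \<Longrightarrow> distinct [i, j, k] \<Longrightarrow> rev_triple i j k \<in> G3'_gens n"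
  unfolding G3'_gens_def by blast

lemma G3'_gensE:
  assumes "g \<in> G3'_gens n"
  obtains i j k where "{i, j, k} \<subseteq> {1..n}" "distinct [i, j, k]" "g = rev_triple i j k"
  using assms unfolding G3'_gens_def by blast

definition phi_gen :: "nat \<Rightarrow> triple_index \<Rightarrow> (nat \<times> nat) set gword set" where
  "phi_gen n g = (THE x. \<exists>i j k. {i, j, k} \<subseteq> {1..n} \<and> distinct [i, j, k] \<and> g = rev_triple i j k \<and> x = phi_val n i j k)"

text \<open>A generator has just two readings as a triple, and \<open>phi_val_rev\<close> gives them
  the same image, so the description denotes.\<close>

lemma phi_gen:
  assumes "{i, j, k} \<subseteq> {1..n}" "distinct [i, j, k]"
  shows "phi_gen n (rev_triple i j k) = phi_val n i j k"
  unfolding phi_gen_def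
proof (rule the_equality)
  show "\<exists>p q r. {p, q, r} \<subseteq> {1..n} \<and> distinct [p, q, r] \<and> rev_triple i j k = rev_triple p q r \<and> phi_val n i j k = phi_val n p q r"
    using assms by (intro exI[of _ i] exI[of _ j] exI[of _ k]) simp
  fix x assume "\<exists>p q r. {p, q, r} \<subseteq> {1..n} \<and> distinct [p, q, r] \<and> rev_triple i j k = rev_triple p q r \<and> x = phi_val n p q r"
  then obtain p q r where "rev_triple i j k = rev_triple p q r" and x: "x = phi_val n p q r" by (elim exE conjE)
  then have "(p, q, r) = (i, j, k) \<or> (p, q, r) = (k, j, i)" by (intro rev_triple_eqD)
  then show "x = phi_val n i j k" using x phi_val_rev[OF assms] by auto
qed

lemma G3'_group: "group (G3' n)"
  unfolding G3'_def by (rule pres_group_is_group)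

lemma phi_exists: "\<exists>h. h \<in> hom (G3' n) (G2_pairs n) \<and> h \<in> extensional (carrier (G3' n)) \<and> phi_on_gens n h"
proof -
  interpret G: group "G2_pairs n" by (rule G2_group)
  have cl: "phi_gen n s \<in> carrier (G2_pairs n)" if s: "s \<in> G3'_gens n" for s
  proof -
    obtain i j k where ijk: "{i, j, k} \<subseteq> {1..n}" "distinct [i, j, k]" "s = rev_triple i j k" by (rule G3'_gensE[OF s])
    show ?thesis unfolding ijk(3) phi_gen[OF ijk(1,2)] by (rule phi_val_closed[OF ijk(1,2)])
  qed
  have rel: "word_value (G2_pairs n) (phi_gen n) u = word_value (G2_pairs n) (phi_gen n) v" if uv: "(u, v) \<in> G3'_rels n" for u v
    using uv[unfolded G3'_rels_def]
  proof (elim UnE CollectE exE conjE)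
    fix i j k assume e: "(u, v) = (pos_word [rev_triple i j k, rev_triple i j k], [])" and ijk: "{i, j, k} \<subseteq> {1..n}" "distinct [i, j, k]"
    show ?thesis
      using e phi_val_closed[OF ijk] phi_val_square[OF ijk] by (simp add: word_value_def phi_gen[OF ijk])
  next
    fix i j k p q r
    assume e: "(u, v) = (pos_word [rev_triple i j k, rev_triple p q r], pos_word [rev_triple p q r, rev_triple i j k])"
      and h: "{i, j, k, p, q, r} \<subseteq> {1..n}" "distinct [i, j, k]" "distinct [p, q, r]" "card ({i, j, k} \<inter> {p, q, r}) \<le> 1"
    have s: "{i, j, k} \<subseteq> {1..n}" "{p, q, r} \<subseteq> {1..n}" using h(1) by simp_all
    show ?thesis
      using e phi_val_closed[OF s(1) h(2)] phi_val_closed[OF s(2) h(3)] phi_val_far[OF h]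
      by (simp add: word_value_def phi_gen[OF s(1) h(2)] phi_gen[OF s(2) h(3)])
  next
    fix i j k l
    assume e: "(u, v) = (pos_word [rev_triple i j k, rev_triple i j l, rev_triple i k l, rev_triple j k l],
        pos_word [rev_triple j k l, rev_triple i k l, rev_triple i j l, rev_triple i j k])"
      and h: "{i, j, k, l} \<subseteq> {1..n}" "distinct [i, j, k, l]"
    have s: "{i, j, k} \<subseteq> {1..n}" "{i, j, l} \<subseteq> {1..n}" "{i, k, l} \<subseteq> {1..n}" "{j, k, l} \<subseteq> {1..n}"
      "distinct [i, j, k]" "distinct [i, j, l]" "distinct [i, k, l]" "distinct [j, k, l]" using h by simp_all
    show ?thesis
      using e phi_val_closed[OF s(1,5)] phi_val_closed[OF s(2,6)] phi_val_closed[OF s(3,7)] phi_val_closed[OF s(4,8)] phi_val_tetra[OF h]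
      by (simp add: word_value_def phi_gen[OF s(1,5)] phi_gen[OF s(2,6)] phi_gen[OF s(3,7)] phi_gen[OF s(4,8)])
  qed
  have "\<exists>h. h \<in> hom (pres_group (G3'_gens n) (G3'_rels n)) (G2_pairs n) \<and> h \<in> extensional (carrier (pres_group (G3'_gens n) (G3'_rels n))) \<and>
     (\<forall>s\<in>G3'_gens n. h (pres_class (G3'_gens n) (G3'_rels n) [(s, True)]) = phi_gen n s)"
    by (rule G.pres_group_universal[OF cl rel])
  then obtain h where h: "h \<in> hom (G3' n) (G2_pairs n)" "h \<in> extensional (carrier (G3' n))"
     "\<forall>s\<in>G3'_gens n. h (pres_class (G3'_gens n) (G3'_rels n) [(s, True)]) = phi_gen n s"
    unfolding G3'_def[symmetric] by (elim exE conjE)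
  have "phi_on_gens n h"
    unfolding phi_on_gens_def
  proof (intro allI impI, elim conjE)
    fix i j k assume ijk: "{i, j, k} \<subseteq> {1..n}" "distinct [i, j, k]"
    show "h (a' n i j k) = a2 (ordered_pairs n) (i, j) (i, k) \<otimes>\<^bsub>G2_pairs n\<^esub> a2 (ordered_pairs n) (k, j) (k, i)"
      using h(3)[rule_format, OF G3'_gensI[OF ijk]] by (simp add: a'_def phi_gen[OF ijk] phi_val_def)
  qed
  then show ?thesis using h(1,2) by blast
qed

text \<open>A homomorphism is determined on the carrier by the generators and off the carrier by
  extensionality; this is the uniqueness that the description in \<open>phi\<close> needs.\<close>

lemma phi_props: "phi n \<in> hom (G3' n) (G2_pairs n) \<and> phi n \<in> extensional (carrier (G3' n)) \<and> phi_on_gens n (phi n)"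
proof -
  obtain h where h: "h \<in> hom (G3' n) (G2_pairs n)" "h \<in> extensional (carrier (G3' n))" "phi_on_gens n h"
    using phi_exists[of n] by (elim exE conjE)
  have uniq: "h' = h" if h': "h' \<in> hom (G3' n) (G2_pairs n)" "h' \<in> extensional (carrier (G3' n))" "phi_on_gens n h'" for h'
  proof (rule extensionalityI[OF h'(2) h(2)])
    fix X assume "X \<in> carrier (G3' n)"
    then obtain u where u: "u \<in> gwords (G3'_gens n)" "X = pres_class (G3'_gens n) (G3'_rels n) u"
      unfolding G3'_def by (rule pres_group_carrierE)
    show "h' X = h X"
      unfolding u(2)
    proof (rule pres_group_hom_unique[OF G2_group _ _ _ u(1)])
      show "h' \<in> hom (pres_group (G3'_gens n) (G3'_rels n)) (G2_pairs n)" "h \<in> hom (pres_group (G3'_gens n) (G3'_rels n)) (G2_pairs n)"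
        using h(1) h'(1) by (simp_all add: G3'_def)
      fix s assume "s \<in> G3'_gens n"
      then obtain i j k where ijk: "{i, j, k} \<subseteq> {1..n}" "distinct [i, j, k]" "s = rev_triple i j k" by (rule G3'_gensE)
      have "h' (a' n i j k) = h (a' n i j k)"
        using h(3)[unfolded phi_on_gens_def, rule_format, OF conjI[OF ijk(1,2)]]
          h'(3)[unfolded phi_on_gens_def, rule_format, OF conjI[OF ijk(1,2)]] by simp
      then show "h' (pres_class (G3'_gens n) (G3'_rels n) [(s, True)]) = h (pres_class (G3'_gens n) (G3'_rels n) [(s, True)])"
        by (simp add: a'_def ijk(3))
    qed
  qed
  have "phi n = h" unfolding phi_def
    by (rule the_equality) (intro conjI h, elim conjE, rule uniq)
  then show ?thesis using h by simp
qed

section \<open>The regular representation of \<open>'G_n^3\<close>\<close>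

typedef 'a sym = "{f :: 'a \<Rightarrow> 'a. bij f}"
  morphisms sym_fun Abs_sym
  by (rule exI[of _ id]) simp

text \<open>Words act from the right, so the sum applies its left summand first.\<close>

instantiation sym :: (type) group_add
begin

definition zero_sym_def: "0 = Abs_sym id"
definition plus_sym_def: "p + q = Abs_sym (sym_fun q \<circ> sym_fun p)"
definition uminus_sym_def: "- p = Abs_sym (inv_into UNIV (sym_fun p))"
definition minus_sym_def: "p - q = p + (- q :: 'a sym)"

lemma bij_sym_fun: "bij (sym_fun p)"
  using sym_fun[of p] by simp

lemma sym_fun_zero: "sym_fun 0 = id"
  by (simp add: zero_sym_def Abs_sym_inverse)

lemma sym_fun_plus: "sym_fun (p + q) = sym_fun q \<circ> sym_fun p"
  by (simp add: plus_sym_def Abs_sym_inverse bij_comp bij_sym_fun)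

lemma sym_fun_uminus: "sym_fun (- p) = inv_into UNIV (sym_fun p)"
  by (simp add: uminus_sym_def Abs_sym_inverse bij_imp_bij_inv bij_sym_fun)

instance
proof
  fix a b c :: "'a sym"
  show "a + b + c = a + (b + c)" by (simp add: sym_fun_inject[symmetric] sym_fun_plus comp_assoc)
  show "0 + a = a" "a + 0 = a" by (simp_all add: sym_fun_inject[symmetric] sym_fun_plus sym_fun_zero)
  show "- a + a = 0"
    using bij_sym_fun[of a]
    by (simp add: sym_fun_inject[symmetric] sym_fun_plus sym_fun_zero sym_fun_uminus fun_eq_iff bij_is_surj surj_f_inv_f)
  show "a + - b = a - b" by (simp add: minus_sym_def)
qed

end

abbreviation G3'_class :: "nat \<Rightarrow> triple_index list \<Rightarrow> triple_index gword set" where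
  "G3'_class n l \<equiv> pres_class (G3'_gens n) (G3'_rels n) (pos_word l)"

lemma G3'_class_closed: "set l \<subseteq> G3'_gens n \<Longrightarrow> G3'_class n l \<in> carrier (G3' n)"
  unfolding G3'_def by (rule pres_group_carrierI) simp

lemma G3'_class_mult:
  "set k \<subseteq> G3'_gens n \<Longrightarrow> set l \<subseteq> G3'_gens n \<Longrightarrow> G3'_class n k \<otimes>\<^bsub>G3' n\<^esub> G3'_class n l = G3'_class n (k @ l)"
  unfolding G3'_def by (rule pos_word_class_mult)

lemma G3'_class_Nil: "G3'_class n [] = \<one>\<^bsub>G3' n\<^esub>"
  by (simp add: G3'_def pres_group_one)

text \<open>Permutations of a whole type form an instance of \<open>group_add\<close>, which
  \<open>G3'\<close> as a record cannot be. Multiplication is therefore extended by the identity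
  outside the carrier and for indices that are not generators.\<close>

definition right_mult :: "nat \<Rightarrow> triple_index \<Rightarrow> triple_index gword set sym" where
  "right_mult n g = Abs_sym (\<lambda>X. if X \<in> carrier (G3' n) \<and> g \<in> G3'_gens n then X \<otimes>\<^bsub>G3' n\<^esub> G3'_class n [g] else X)"

lemma G3'_class_rel:
  assumes "(pos_word k, pos_word l) \<in> G3'_rels n" "set k \<subseteq> G3'_gens n" "set l \<subseteq> G3'_gens n"
  shows "G3'_class n k = G3'_class n l"
  by (rule pres_rel_class[OF assms(1)]) (simp_all add: assms(2,3))

lemma G3'_class_square:
  assumes "g \<in> G3'_gens n"
  shows "G3'_class n [g, g] = G3'_class n []"
proof (rule G3'_class_rel)
  obtain i j k where ijk: "{i, j, k} \<subseteq> {1..n}" "distinct [i, j, k]" "g = rev_triple i j k" by (rule G3'_gensE[OF assms])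
  show "(pos_word [g, g], pos_word []) \<in> G3'_rels n"
    unfolding G3'_rels_def list.map(1) ijk(3) using ijk(1,2) by blast
qed (use assms in simp_all)

lemma sym_fun_right_mult:
  "sym_fun (right_mult n g) X = (if X \<in> carrier (G3' n) \<and> g \<in> G3'_gens n then X \<otimes>\<^bsub>G3' n\<^esub> G3'_class n [g] else X)"
proof -
  interpret G: group "G3' n" by (rule G3'_group)
  let ?f = "\<lambda>X. if X \<in> carrier (G3' n) \<and> g \<in> G3'_gens n then X \<otimes>\<^bsub>G3' n\<^esub> G3'_class n [g] else X"
  \<comment> \<open>The generators are involutions, so the map is its own inverse and hence
    bijective.\<close>
  have "?f (?f X) = X" for X
  proof (cases "X \<in> carrier (G3' n) \<and> g \<in> G3'_gens n")
    case True
    then have c: "G3'_class n [g] \<in> carrier (G3' n)" by (intro G3'_class_closed) simp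
    have "G3'_class n [g] \<otimes>\<^bsub>G3' n\<^esub> G3'_class n [g] = \<one>\<^bsub>G3' n\<^esub>"
      using True G3'_class_mult[of "[g]" n "[g]"] G3'_class_square[of g n] G3'_class_Nil[of n] by simp
    then have "X \<otimes>\<^bsub>G3' n\<^esub> G3'_class n [g] \<otimes>\<^bsub>G3' n\<^esub> G3'_class n [g] = X"
      using True c by (simp add: G.m_assoc)
    then show ?thesis using True c by simp
  next
    case False
    then show ?thesis by (simp only: if_False)
  qed
  then have "bij ?f" by (intro o_bij[of ?f]) (simp_all only: fun_eq_iff o_def id_def simp_thms)
  then show ?thesis unfolding right_mult_def by (simp add: Abs_sym_inverse)
qed

lemma sym_fun_word:
  assumes "set l \<subseteq> G3'_gens n" "X \<in> carrier (G3' n)"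
  shows "sym_fun (sum_list (map (right_mult n) l)) X = X \<otimes>\<^bsub>G3' n\<^esub> G3'_class n l"
  using assms
proof (induction l arbitrary: X)
  case Nil
  then show ?case using group.is_monoid[OF G3'_group[of n]] G3'_class_Nil[of n] by (simp add: sym_fun_zero monoid.r_one)
next
  case (Cons g l)
  interpret G: group "G3' n" by (rule G3'_group)
  have c: "G3'_class n [g] \<in> carrier (G3' n)" "G3'_class n l \<in> carrier (G3' n)"
    by (rule G3'_class_closed; use Cons.prems in simp)+
  have "sym_fun (sum_list (map (right_mult n) (g # l))) X = X \<otimes>\<^bsub>G3' n\<^esub> G3'_class n [g] \<otimes>\<^bsub>G3' n\<^esub> G3'_class n l"
    using Cons c by (simp add: sym_fun_plus sym_fun_right_mult)
  also have "\<dots> = X \<otimes>\<^bsub>G3' n\<^esub> G3'_class n (g # l)"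
    using Cons.prems c G3'_class_mult[of "[g]" n l] by (simp add: G.m_assoc)
  finally show ?case .
qed

lemma sym_fun_word_outside:
  "X \<notin> carrier (G3' n) \<Longrightarrow> sym_fun (sum_list (map (right_mult n) l)) X = X"
  by (induction l) (simp_all add: sym_fun_zero sym_fun_plus sym_fun_right_mult)

text \<open>Evaluation at the unit recovers the class of a word, so the representation is faithful.
  Conversely, words of one class act alike on the carrier, and every word acts trivially outside
  it.\<close>

lemma right_mult_eq_iff:
  assumes "set k \<subseteq> G3'_gens n" "set l \<subseteq> G3'_gens n"
  shows "sum_list (map (right_mult n) k) = sum_list (map (right_mult n) l) \<longleftrightarrow> G3'_class n k = G3'_class n l"
proof
  interpret G: group "G3' n" by (rule G3'_group)
  assume "sum_list (map (right_mult n) k) = sum_list (map (right_mult n) l)"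
  then have "\<one>\<^bsub>G3' n\<^esub> \<otimes>\<^bsub>G3' n\<^esub> G3'_class n k = \<one>\<^bsub>G3' n\<^esub> \<otimes>\<^bsub>G3' n\<^esub> G3'_class n l"
    using sym_fun_word[OF assms(1) G.one_closed] sym_fun_word[OF assms(2) G.one_closed] by simp
  then show "G3'_class n k = G3'_class n l"
    using G3'_class_closed[OF assms(1)] G3'_class_closed[OF assms(2)] by simp
next
  assume e: "G3'_class n k = G3'_class n l"
  have "sym_fun (sum_list (map (right_mult n) k)) X = sym_fun (sum_list (map (right_mult n) l)) X" for X
    by (cases "X \<in> carrier (G3' n)") (simp_all add: sym_fun_word assms sym_fun_word_outside e)
  then show "sum_list (map (right_mult n) k) = sum_list (map (right_mult n) l)"
    by (simp add: sym_fun_inject[symmetric] fun_eq_iff)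
qed

lemma triple_rep_right_mult: "triple_rep n (right_mult n)"
proof (unfold_locales, goal_cases)
  case (1 i j k)
  note g = G3'_gensI[OF 1]
  show ?case using right_mult_eq_iff[of "[rev_triple i j k, rev_triple i j k]" n "[]"] G3'_class_square[OF g] g by simp
next
  case (2 i j k p q r)
  have s: "{i, j, k} \<subseteq> {1..n}" "{p, q, r} \<subseteq> {1..n}" using 2(1) by simp_all
  note g = G3'_gensI[OF s(1) 2(2)] G3'_gensI[OF s(2) 2(3)]
  have "(pos_word [rev_triple i j k, rev_triple p q r], pos_word [rev_triple p q r, rev_triple i j k]) \<in> G3'_rels n"
    unfolding G3'_rels_def using 2 by blast
  then have "G3'_class n [rev_triple i j k, rev_triple p q r] = G3'_class n [rev_triple p q r, rev_triple i j k]"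
    by (rule G3'_class_rel) (use g in simp_all)
  then show ?case
    using right_mult_eq_iff[of "[rev_triple i j k, rev_triple p q r]" n "[rev_triple p q r, rev_triple i j k]"] g by simp
next
  case (3 i j k l)
  have s: "{i, j, k} \<subseteq> {1..n}" "{i, j, l} \<subseteq> {1..n}" "{i, k, l} \<subseteq> {1..n}" "{j, k, l} \<subseteq> {1..n}"
      "distinct [i, j, k]" "distinct [i, j, l]" "distinct [i, k, l]" "distinct [j, k, l]" using 3 by simp_all
  note g = G3'_gensI[OF s(1,5)] G3'_gensI[OF s(2,6)] G3'_gensI[OF s(3,7)] G3'_gensI[OF s(4,8)]
  let ?k = "[rev_triple i j k, rev_triple i j l, rev_triple i k l, rev_triple j k l]"
  let ?l = "[rev_triple j k l, rev_triple i k l, rev_triple i j l, rev_triple i j k]"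
  have "(pos_word ?k, pos_word ?l) \<in> G3'_rels n"
    unfolding G3'_rels_def by (rule UnI2) (use 3 in blast)
  then have "G3'_class n ?k = G3'_class n ?l" by (rule G3'_class_rel) (use g in simp_all)
  then show ?case using right_mult_eq_iff[of ?k n ?l] g by (simp add: add.assoc)
qed

lemma moment_index_in_gens:
  assumes reg: "regular_path n z" and t: "t \<in> critical_moments n z" and inj: "inj_on (\<lambda>j. z j t) {1..n}"
  shows "moment_index n z t \<in> G3'_gens n"
proof -
  obtain s \<pi> where ch: "in_chart n s \<pi> (\<lambda>j. z j t)" using exists_chart[OF inj] by (elim exE)
  obtain T where T: "collinear_triples n z t = {T}" by (rule regular_path_triple[OF reg t])
  then have "T \<in> collinear_triples n z t" by simp
  then obtain i j k where ijk: "T = {i, j, k}" "{i, j, k} \<subseteq> {1..n}" "distinct [i, j, k]"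
    unfolding mem_collinear_triples by (elim exE conjE)
  obtain p q r where pqr: "p < q" "q < r" "r < n" and e: "{i, j, k} = {\<pi> p, \<pi> q, \<pi> r}"
    by (rule in_chart_sorted_triple[OF ch ijk(2,3)])
  have mi: "moment_index n z t = rev_triple (\<pi> p) (\<pi> q) (\<pi> r)"
    by (rule moment_index_in_chart[of n s \<pi> z t, OF ch pqr]) (use T ijk(1) e in simp)
  have "inj_on \<pi> {..<n}" using ch by (simp add: in_chart_def bij_betw_def)
  then have "distinct [\<pi> p, \<pi> q, \<pi> r]" using pqr by (auto dest: inj_onD)
  then show ?thesis unfolding mi by (intro G3'_gensI) (use e ijk(2) in simp_all)
qed

lemma path_word_eq_imp_class_eq:
  assumes v: "regular_path n v" "\<And>t. t \<in> {0..1} \<Longrightarrow> inj_on (\<lambda>j. v j t) {1..n}"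
    and w: "regular_path n w" "\<And>t. t \<in> {0..1} \<Longrightarrow> inj_on (\<lambda>j. w j t) {1..n}"
    and eq: "path_word n (right_mult n) v 0 1 = path_word n (right_mult n) w 0 1"
  shows "read_off n v = read_off n w"
proof -
  have *: "path_word n (right_mult n) z 0 1 = sum_list (map (right_mult n) (map (moment_index n z) (sorted_list_of_set (critical_moments n z))))"
    "set (map (moment_index n z) (sorted_list_of_set (critical_moments n z))) \<subseteq> G3'_gens n"
    if z: "regular_path n z" "\<And>t. t \<in> {0..1} \<Longrightarrow> inj_on (\<lambda>j. z j t) {1..n}" for z
  proof -
    have sub: "critical_moments n z \<subseteq> {0..1}" by (auto simp: critical_moments_def)
    then have "critical_moments n z \<inter> {0..1} = critical_moments n z" by blast
    then show "path_word n (right_mult n) z 0 1 = sum_list (map (right_mult n) (map (moment_index n z) (sorted_list_of_set (critical_moments n z))))"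
      unfolding path_word_def by (simp add: o_def)
    have "moment_index n z t \<in> G3'_gens n" if "t \<in> critical_moments n z" for t
      using moment_index_in_gens[OF z(1) that z(2)] that sub by blast
    moreover have "finite (critical_moments n z)" using z(1) by (simp add: regular_path_def)
    ultimately show "set (map (moment_index n z) (sorted_list_of_set (critical_moments n z))) \<subseteq> G3'_gens n" by auto
  qed
  show ?thesis
    unfolding read_off_def
    using eq right_mult_eq_iff[OF *(2)[OF v] *(2)[OF w]] *(1)[OF v] *(1)[OF w] by simp
qed

section \<open>The pure braid group as a fundamental group\<close>

lemma continuous_on_configuration:
  fixes f :: "nat \<Rightarrow> 'a::topological_space \<Rightarrow> complex"
  assumes "\<And>j. j \<in> J \<Longrightarrow> continuous_on S (f j)"
  shows "continuous_on S (\<lambda>x j. if j \<in> J then f j x else 0)"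
proof (rule continuous_on_coordinatewise_then_product)
  show "continuous_on S (\<lambda>x. if j \<in> J then f j x else 0)" for j
    using assms[of j] by (cases "j \<in> J") simp_all
qed

text \<open>The space of n distinct labelled points, with the value 0 at all other indices. A
  configuration is thus a unique function, and the product topology on functions applies to
  it.\<close>

definition Conf :: "nat \<Rightarrow> (nat \<Rightarrow> complex) set" where
  "Conf n = {c. inj_on c {1..n} \<and> (\<forall>j. j \<notin> {1..n} \<longrightarrow> c j = 0)}"

definition cpath :: "nat \<Rightarrow> strands \<Rightarrow> real \<Rightarrow> nat \<Rightarrow> complex" where
  "cpath n z = (\<lambda>t j. if j \<in> {1..n} then z j t else 0)"

text \<open>In the product topology a homotopy of configurations is a family of homotopies of single
  strands. Values of \<open>H\<close> at indices outside {1..n} are arbitrary, hence the passage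
  through \<open>cpath\<close>.\<close>

lemma homotopic_strands_iff:
  fixes z w :: strands
  shows "homotopic_paths (Conf n) (cpath n z) (cpath n w) \<longleftrightarrow>
    (\<exists>H :: real \<Rightarrow> strands. (\<forall>j\<in>{1..n}. continuous_on ({0..1} \<times> {0..1}) (\<lambda>(s, t). H s j t)) \<and>
      (\<forall>s\<in>{0..1}. \<forall>t\<in>{0..1}. inj_on (\<lambda>j. H s j t) {1..n}) \<and>
      (\<forall>j\<in>{1..n}. \<forall>t\<in>{0..1}. H 0 j t = z j t \<and> H 1 j t = w j t) \<and>
      (\<forall>j\<in>{1..n}. \<forall>s\<in>{0..1}. H s j 0 = z j 0 \<and> H s j 1 = z j 1))" (is "?L \<longleftrightarrow> ?R")
proof
  assume ?L
  then obtain h where h: "continuous_on ({0..1} \<times> {0..1}) h" "h \<in> ({0..1} \<times> {0..1}) \<rightarrow> Conf n"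
    "\<forall>x\<in>{0..1}. h (0, x) = cpath n z x" "\<forall>x\<in>{0..1}. h (1, x) = cpath n w x"
    "\<forall>t\<in>{0..1::real}. pathstart (h \<circ> Pair t) = pathstart (cpath n z) \<and> pathfinish (h \<circ> Pair t) = pathfinish (cpath n z)"
    unfolding homotopic_paths by (elim exE conjE)
  show ?R
  proof (intro exI[of _ "\<lambda>s j t. h (s, t) j"] conjI ballI)
    fix j assume j: "j \<in> {1..n}"
    show "continuous_on ({0..1} \<times> {0..1}) (\<lambda>(s, t). h (s, t) j)"
      using continuous_on_product_then_coordinatewise[OF h(1), of j] by (simp add: split_def)
    fix t :: real assume t: "t \<in> {0..1}"
    show "h (0, t) j = z j t" "h (1, t) j = w j t" using h(3,4) t j by (simp_all add: cpath_def)
    have "h (t, 0) = cpath n z 0" "h (t, 1) = cpath n z 1"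
      using bspec[OF h(5) t] by (simp_all add: pathstart_def pathfinish_def)
    then show "h (t, 0) j = z j 0" "h (t, 1) j = z j 1" using j by (simp_all add: cpath_def)
  next
    fix s t :: real assume "s \<in> {0..1}" "t \<in> {0..1}"
    then have "h (s, t) \<in> Conf n" by (intro funcset_mem[OF h(2)]) simp
    then show "inj_on (\<lambda>j. h (s, t) j) {1..n}" by (simp add: Conf_def)
  qed
next
  assume ?R
  then obtain H :: "real \<Rightarrow> strands" where H0: "\<forall>j\<in>{1..n}. continuous_on ({0..1} \<times> {0..1}) (\<lambda>(s, t). H s j t)"
      "\<forall>s\<in>{0..1}. \<forall>t\<in>{0..1}. inj_on (\<lambda>j. H s j t) {1..n}"
      "\<forall>j\<in>{1..n}. \<forall>t\<in>{0..1}. H 0 j t = z j t \<and> H 1 j t = w j t"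
      "\<forall>j\<in>{1..n}. \<forall>s\<in>{0..1}. H s j 0 = z j 0 \<and> H s j 1 = z j 1"
    by (elim exE conjE)
  note H = H0[rule_format]
  show ?L
    unfolding homotopic_paths
  proof (intro exI[of _ "\<lambda>x j. if j \<in> {1..n} then H (fst x) j (snd x) else 0"] conjI ballI)
    show "continuous_on ({0..1} \<times> {0..1}) (\<lambda>x j. if j \<in> {1..n} then H (fst x) j (snd x) else 0)"
      using H(1) by (intro continuous_on_configuration) (simp add: split_def)
    show "(\<lambda>x j. if j \<in> {1..n} then H (fst x) j (snd x) else 0) \<in> {0..1} \<times> {0..1} \<rightarrow> Conf n"
    proof
      fix x :: "real \<times> real" assume "x \<in> {0..1} \<times> {0..1}"
      then have "inj_on (\<lambda>j. H (fst x) j (snd x)) {1..n}" by (intro H(2)) (simp_all add: mem_Times_iff)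
      then have "inj_on (\<lambda>j. if j \<in> {1..n} then H (fst x) j (snd x) else 0) {1..n}"
        by (rule inj_on_cong[THEN iffD1, rotated]) simp
      then show "(\<lambda>j. if j \<in> {1..n} then H (fst x) j (snd x) else 0) \<in> Conf n" by (simp add: Conf_def)
    qed
  qed (use H(3,4) in \<open>simp_all add: cpath_def pathstart_def pathfinish_def fun_eq_iff\<close>)
qed

text \<open>Along the straight-line homotopy each point moves by less than d/2, so no two points of
  distance at least d can meet.\<close>

lemma homotopic_strands_near:
  fixes z w :: strands
  assumes cont: "\<And>j. j \<in> {1..n} \<Longrightarrow> continuous_on {0..1} (z j)" "\<And>j. j \<in> {1..n} \<Longrightarrow> continuous_on {0..1} (w j)"
    and sep: "\<And>t j k. t \<in> {0..1} \<Longrightarrow> j \<in> {1..n} \<Longrightarrow> k \<in> {1..n} \<Longrightarrow> j \<noteq> k \<Longrightarrow> d \<le> dist (z j t) (z k t)"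
    and close: "\<And>j t. j \<in> {1..n} \<Longrightarrow> t \<in> {0..1} \<Longrightarrow> dist (w j t) (z j t) < d / 2"
    and ends: "\<And>j. j \<in> {1..n} \<Longrightarrow> w j 0 = z j 0 \<and> w j 1 = z j 1"
  shows "homotopic_paths (Conf n) (cpath n z) (cpath n w)" and "t \<in> {0..1} \<Longrightarrow> inj_on (\<lambda>j. w j t) {1..n}"
proof -
  define H where "H s j t = z j t + s *\<^sub>R (w j t - z j t)" for s j and t :: real
  have inj: "inj_on (\<lambda>j. H s j t) {1..n}" if s: "s \<in> {0..1}" and t: "t \<in> {0..1}" for s t
  proof (rule inj_onI, rule ccontr)
    fix j k assume jk: "j \<in> {1..n}" "k \<in> {1..n}" and e: "H s j t = H s k t" and "j \<noteq> k"
    have b: "cmod (s *\<^sub>R (w i t - z i t)) < d / 2" if i: "i \<in> {1..n}" for i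
    proof -
      have "cmod (s *\<^sub>R (w i t - z i t)) \<le> cmod (w i t - z i t)"
        using s by (simp add: mult_left_le_one_le)
      also have "\<dots> < d / 2" using close[OF i t] by (simp add: dist_norm)
      finally show ?thesis .
    qed
    have "z j t - z k t = s *\<^sub>R (w k t - z k t) - s *\<^sub>R (w j t - z j t)"
      using e by (simp add: H_def algebra_simps)
    then have "dist (z j t) (z k t) \<le> cmod (s *\<^sub>R (w k t - z k t)) + cmod (s *\<^sub>R (w j t - z j t))"
      unfolding dist_norm by (simp only: norm_triangle_ineq4)
    also have "\<dots> < d" using b[OF jk(1)] b[OF jk(2)] by simp
    finally show False using sep[OF t jk \<open>j \<noteq> k\<close>] by simp
  qed
  show "inj_on (\<lambda>j. w j t) {1..n}" if "t \<in> {0..1}" using inj[OF _ that, of 1] by (simp add: H_def)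
  have cs: "continuous_on ({0..1} \<times> {0..1}) (\<lambda>x. f (snd x))" if "continuous_on {0..1} f" for f :: "real \<Rightarrow> complex"
    by (rule continuous_on_compose2[OF that]) (auto intro: continuous_intros)
  show "homotopic_paths (Conf n) (cpath n z) (cpath n w)"
    unfolding homotopic_strands_iff
  proof (intro exI[of _ H] conjI ballI)
    show "continuous_on ({0..1} \<times> {0..1}) (\<lambda>(s, t). H s j t)" if "j \<in> {1..n}" for j
      unfolding H_def split_def by (intro continuous_intros cs cont that)
    show "inj_on (\<lambda>j. H s j t) {1..n}" if "s \<in> {0..1}" "t \<in> {0..1}" for s t by (rule inj[OF that])
  qed (use ends in \<open>simp_all add: H_def\<close>)
qed

lemma smooth_on_unit_polynomial_function:
  assumes "polynomial_function f"
  shows "smooth_on_unit f"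
proof -
  obtain p q where "f = (\<lambda>t. Complex (poly p t) (poly q t))" by (rule polynomial_function_poly_strand[OF assms])
  then show ?thesis by (simp add: smooth_on_unit_poly)
qed

text \<open>The compact set will be the parameter square of a homotopy; its minimal distance
  measures how coarsely the homotopy may be approximated.\<close>

lemma separated_on_compact:
  fixes h :: "nat \<Rightarrow> 'a::topological_space \<Rightarrow> complex"
  assumes "compact S" "S \<noteq> {}" "\<And>j. j \<in> {1..n} \<Longrightarrow> continuous_on S (h j)" "\<And>x. x \<in> S \<Longrightarrow> inj_on (\<lambda>j. h j x) {1..n}"
  obtains d where "d > 0" "\<And>x j k. x \<in> S \<Longrightarrow> j \<in> {1..n} \<Longrightarrow> k \<in> {1..n} \<Longrightarrow> j \<noteq> k \<Longrightarrow> d \<le> dist (h j x) (h k x)"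
proof -
  have "\<exists>d>0. \<forall>x\<in>{1..n} \<times> {1..n}. fst x \<noteq> snd x \<longrightarrow> (\<forall>t\<in>S. d \<le> dist (h (fst x) t) (h (snd x) t))"
  proof (rule finite_uniform_positive)
    fix x assume x: "x \<in> {1..n} \<times> {1..n}"
    have "continuous_on S (\<lambda>t. dist (h (fst x) t) (h (snd x) t))"
      using x by (intro continuous_intros assms) auto
    then obtain t0 where t0: "t0 \<in> S" "\<And>t. t \<in> S \<Longrightarrow> dist (h (fst x) t0) (h (snd x) t0) \<le> dist (h (fst x) t) (h (snd x) t)"
      using continuous_attains_inf[of S "\<lambda>t. dist (h (fst x) t) (h (snd x) t)"] assms(1,2) by auto
    show "\<exists>d>0. fst x \<noteq> snd x \<longrightarrow> (\<forall>t\<in>S. d \<le> dist (h (fst x) t) (h (snd x) t))"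
    proof (cases "fst x = snd x")
      case False
      then have "h (fst x) t0 \<noteq> h (snd x) t0"
        using assms(4)[OF t0(1)] x by (auto dest: inj_onD)
      then show ?thesis using t0 by (intro exI[of _ "dist (h (fst x) t0) (h (snd x) t0)"]) auto
    qed (auto intro: exI[of _ 1])
  qed force+
  then show ?thesis using that by force
qed

lemma isotopic_imp_homotopic:
  assumes z: "pure_braid n z" and "isotopic n z w"
  shows "homotopic_paths (Conf n) (cpath n z) (cpath n w)"
proof -
  obtain H :: "real \<Rightarrow> strands" where H: "\<forall>s\<in>{0..1}. pure_braid n (H s)"
     "\<forall>j\<in>{1..n}. continuous_on ({0..1} \<times> {0..1}) (\<lambda>(s, t). H s j t)"
     "\<forall>j\<in>{1..n}. \<forall>t\<in>{0..1}. H 0 j t = z j t \<and> H 1 j t = w j t"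
    using assms(2) unfolding isotopic_def by (elim exE conjE)
  show ?thesis
    unfolding homotopic_strands_iff
  proof (intro exI[of _ H] conjI H(2,3) ballI)
    show "inj_on (\<lambda>j. H s j t) {1..n}" if "s \<in> {0..1}" "t \<in> {0..1}" for s t
      by (rule pure_braidD(4)[OF bspec[OF H(1) that(1)] that(2)])
    show "H s j 0 = z j 0" "H s j 1 = z j 1" if "s \<in> {0..1}" "j \<in> {1..n}" for s j
      using pure_braidD(2,3)[OF bspec[OF H(1) that(1)] that(2)] pure_braidD(2,3)[OF z that(2)] by simp_all
  qed
qed

text \<open>The converse smooths a homotopy in \<open>t\<close>: a polynomial approximation of it in both
  variables is corrected by affine terms, first at the ends of the strands and then at the
  ends of the isotopy.\<close>

lemma homotopic_imp_isotopic:
  assumes z: "pure_braid n z" and w: "pure_braid n w"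
    and "homotopic_paths (Conf n) (cpath n z) (cpath n w)"
  shows "isotopic n z w"
proof -
  let ?Q = "{0..1} \<times> {0..1} :: (real \<times> real) set"
  obtain h :: "real \<Rightarrow> strands" where h: "\<forall>j\<in>{1..n}. continuous_on ?Q (\<lambda>(s, t). h s j t)"
      "\<forall>s\<in>{0..1}. \<forall>t\<in>{0..1}. inj_on (\<lambda>j. h s j t) {1..n}"
      "\<forall>j\<in>{1..n}. \<forall>t\<in>{0..1}. h 0 j t = z j t \<and> h 1 j t = w j t"
      "\<forall>j\<in>{1..n}. \<forall>s\<in>{0..1}. h s j 0 = z j 0 \<and> h s j 1 = z j 1"
    using assms(3) unfolding homotopic_strands_iff by (elim exE conjE)
  let ?b = "base_point n"
  have hc: "continuous_on ?Q (\<lambda>x. h (fst x) j (snd x))" if "j \<in> {1..n}" for j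
    using bspec[OF h(1) that] by (simp add: split_def)
  have cQ: "compact ?Q" by (intro compact_Times) simp_all
  obtain d where d: "d > 0" "\<And>x j k. x \<in> ?Q \<Longrightarrow> j \<in> {1..n} \<Longrightarrow> k \<in> {1..n} \<Longrightarrow> j \<noteq> k \<Longrightarrow>
      d \<le> dist (h (fst x) j (snd x)) (h (fst x) k (snd x))"
    by (rule separated_on_compact[of ?Q n "\<lambda>j x. h (fst x) j (snd x)", OF cQ _ hc])
      (use h(2) in \<open>auto simp: mem_Times_iff\<close>)
  \<comment> \<open>Each correction below adds at most the error already present: d/12 for the
    polynomials becomes d/6 for \<open>G\<close> and d/3 for \<open>H\<close>, which is below the
    d/2 that keeps points distinct.\<close>
  have "\<forall>j\<in>{1..n}. \<exists>g. polynomial_function g \<and> (\<forall>x\<in>?Q. cmod (h (fst x) j (snd x) - g x) < d / 12)"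
  proof
    fix j assume "j \<in> {1..n}"
    show "\<exists>g. polynomial_function g \<and> (\<forall>x\<in>?Q. cmod (h (fst x) j (snd x) - g x) < d / 12)"
      by (rule Stone_Weierstrass_polynomial_function[OF cQ hc[OF \<open>j \<in> {1..n}\<close>]]) (use d(1) in auto)
  qed
  then obtain g where g0: "\<forall>j\<in>{1..n}. polynomial_function (g j) \<and> (\<forall>x\<in>?Q. cmod (h (fst x) j (snd x) - g j x) < d / 12)"
    unfolding bchoice_iff by (elim exE)
  have g: "\<And>j. j \<in> {1..n} \<Longrightarrow> polynomial_function (g j)"
      "\<And>j x. j \<in> {1..n} \<Longrightarrow> x \<in> ?Q \<Longrightarrow> cmod (h (fst x) j (snd x) - g j x) < d / 12"
    by (rule conjunct1[OF bspec[OF g0]], assumption) (rule bspec[OF conjunct2[OF bspec[OF g0]]])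
  define G where "G s j t = g j (s, t) - (1 - t) *\<^sub>R (g j (s, 0) - ?b j) - t *\<^sub>R (g j (s, 1) - ?b j)" for s j t
  define H where "H s j t = G s j t + (1 - s) *\<^sub>R (z j t - G 0 j t) + s *\<^sub>R (w j t - G 1 j t)" for s j t
  have G_close: "cmod (h s j t - G s j t) < d / 6" if j: "j \<in> {1..n}" and s: "s \<in> {0..1}" and t: "t \<in> {0..1}" for s j t
  proof -
    let ?u = "h s j 0 - g j (s, 0)" and ?v = "h s j 1 - g j (s, 1)"
    have hb: "h s j 0 = ?b j" "h s j 1 = ?b j"
      using bspec[OF bspec[OF h(4) j] s] pure_braidD(2,3)[OF z j] by simp_all
    have b: "cmod (h s j t - g j (s, t)) < d / 12" "cmod ?u < d / 12" "cmod ?v < d / 12"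
      using g(2)[OF j, of "(s, t)"] g(2)[OF j, of "(s, 0)"] g(2)[OF j, of "(s, 1)"] s t by simp_all
    have "h s j t - G s j t = (h s j t - g j (s, t)) - ((1 - t) *\<^sub>R ?u + t *\<^sub>R ?v)"
      unfolding G_def hb by (simp add: algebra_simps)
    then have "cmod (h s j t - G s j t) \<le> cmod (h s j t - g j (s, t)) + cmod ((1 - t) *\<^sub>R ?u + t *\<^sub>R ?v)"
      by (simp only: norm_triangle_ineq4)
    moreover have "cmod ((1 - t) *\<^sub>R ?u + t *\<^sub>R ?v) \<le> (1 - t) * cmod ?u + t * cmod ?v"
      by (rule order_trans[OF norm_triangle_ineq]) (use t in simp)
    moreover have "(1 - t) * cmod ?u + t * cmod ?v \<le> d / 12"
      by (rule convex_bound_le) (use b t in simp_all)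
    ultimately show ?thesis using b(1) by simp
  qed
  have H_close: "cmod (H s j t - h s j t) < d / 2" if j: "j \<in> {1..n}" and s: "s \<in> {0..1}" and t: "t \<in> {0..1}" for s j t
  proof -
    let ?u = "z j t - G 0 j t" and ?v = "w j t - G 1 j t"
    have hb: "h 0 j t = z j t" "h 1 j t = w j t" using bspec[OF bspec[OF h(3) j] t] by simp_all
    have b: "cmod (G s j t - h s j t) < d / 6" "cmod ?u < d / 6" "cmod ?v < d / 6"
      using G_close[OF j s t] G_close[OF j _ t, of 0] G_close[OF j _ t, of 1] hb by (simp_all add: norm_minus_commute)
    have "H s j t - h s j t = (G s j t - h s j t) + ((1 - s) *\<^sub>R ?u + s *\<^sub>R ?v)"
      unfolding H_def by simp
    then have "cmod (H s j t - h s j t) \<le> cmod (G s j t - h s j t) + cmod ((1 - s) *\<^sub>R ?u + s *\<^sub>R ?v)"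
      by (simp only: norm_triangle_ineq)
    moreover have "cmod ((1 - s) *\<^sub>R ?u + s *\<^sub>R ?v) \<le> (1 - s) * cmod ?u + s * cmod ?v"
      by (rule order_trans[OF norm_triangle_ineq]) (use s in simp)
    moreover have "(1 - s) * cmod ?u + s * cmod ?v \<le> d / 6"
      by (rule convex_bound_le) (use b s in simp_all)
    ultimately show ?thesis using b(1) d(1) by simp
  qed
  have G_smooth: "smooth_on_unit (G s j)" if j: "j \<in> {1..n}" for s j
  proof (rule smooth_on_unit_polynomial_function)
    have "polynomial_function (\<lambda>t::real. (s, 0::real) + t *\<^sub>R (0, 1))"
      by (intro polynomial_function_add polynomial_function_const polynomial_function_mult polynomial_function_id)
    then have "polynomial_function (\<lambda>t::real. g j (s, t))"
      using polynomial_function_compose[OF _ g(1)[OF j]] by (simp add: o_def)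
    then show "polynomial_function (G s j)"
      unfolding G_def
      by (intro polynomial_function_diff polynomial_function_mult polynomial_function_const polynomial_function_id)
  qed
  have H_smooth: "smooth_on_unit (H s j)" if j: "j \<in> {1..n}" for s j
  proof -
    have e: "H s j = (\<lambda>t. G s j t + (1 - s) *\<^sub>R (z j t + (- 1) *\<^sub>R G 0 j t) + s *\<^sub>R (w j t + (- 1) *\<^sub>R G 1 j t))"
      by (simp add: H_def fun_eq_iff)
    show ?thesis
      unfolding e by (intro smooth_on_unit_add smooth_on_unit_scaleR G_smooth j pure_braidD(1)[OF z] pure_braidD(1)[OF w])
  qed
  show ?thesis
    unfolding isotopic_def
  proof (intro exI[of _ H] conjI ballI)
    fix s :: real assume s: "s \<in> {0..1}"
    show "pure_braid n (H s)"
      unfolding pure_braid_def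
    proof (intro conjI ballI)
      show "smooth_on_unit (H s j)" if "j \<in> {1..n}" for j by (rule H_smooth[OF that])
      show "H s j 0 = ?b j" "H s j 1 = ?b j" if "j \<in> {1..n}" for j
        using pure_braidD(2,3)[OF z that] pure_braidD(2,3)[OF w that] by (simp_all add: H_def G_def)
      fix t :: real assume t: "t \<in> {0..1}"
      show "inj_on (\<lambda>j. H s j t) {1..n}"
      proof (rule inj_onI, rule ccontr)
        fix j k assume jk: "j \<in> {1..n}" "k \<in> {1..n}" and e: "H s j t = H s k t" and "j \<noteq> k"
        have "dist (h s j t) (h s k t) \<le> dist (H s j t) (h s j t) + dist (H s k t) (h s k t)"
          using dist_triangle3[of "h s j t" "h s k t" "H s j t"] e by simp
        also have "\<dots> < d" using H_close[OF jk(1) s t] H_close[OF jk(2) s t] by (simp add: dist_norm)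
        finally show False using d(2)[of "(s, t)", OF _ jk \<open>j \<noteq> k\<close>] s t by simp
      qed
    qed
  next
    fix j assume j: "j \<in> {1..n}"
    have cs: "continuous_on ?Q (\<lambda>x. f (snd x))" if "continuous_on {0..1} f" for f :: "real \<Rightarrow> complex"
      by (rule continuous_on_compose2[OF that]) (auto intro: continuous_intros)
    have cg: "continuous_on ?Q (\<lambda>x. g j (fst x, u x))" if "continuous_on ?Q u" for u
      by (rule continuous_on_compose2[OF continuous_on_polymonial_function[OF g(1)[OF j], of UNIV]])
        (auto intro!: continuous_intros that)
    have c1: "continuous_on ?Q (\<lambda>x. G (fst x) j (snd x))"
      unfolding G_def by (intro continuous_intros cg)
    have c2: "continuous_on ?Q (\<lambda>x. G s j (snd x))" for s
      by (intro cs smooth_on_unit_velocity(2) G_smooth j)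
    show "continuous_on ?Q (\<lambda>(s, t). H s j t)"
      unfolding H_def split_def
      by (intro continuous_intros c1 c2 cs pure_braidD(5)[OF z j] pure_braidD(5)[OF w j])
    fix t :: real
    show "H 0 j t = z j t" "H 1 j t = w j t" by (simp_all add: H_def)
  qed
qed

lemma isotopic_iff_homotopic:
  assumes "pure_braid n z" "pure_braid n w"
  shows "isotopic n z w \<longleftrightarrow> homotopic_paths (Conf n) (cpath n z) (cpath n w)"
  using assms isotopic_imp_homotopic homotopic_imp_isotopic by blast

text \<open>The concatenation is approximated as a whole by a polynomial, which is then corrected at the
  middle by a multiple of \<open>t (1 - t)\<close>; its two halves are smooth and so is their concatenation.\<close>

lemma braid_approximation:
  fixes z w :: strands
  assumes cont: "\<And>j. j \<in> {1..n} \<Longrightarrow> continuous_on {0..1} (z j)" "\<And>j. j \<in> {1..n} \<Longrightarrow> continuous_on {0..1} (w j)"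
    and inj: "\<And>t. t \<in> {0..1} \<Longrightarrow> inj_on (\<lambda>j. z j t) {1..n}" "\<And>t. t \<in> {0..1} \<Longrightarrow> inj_on (\<lambda>j. w j t) {1..n}"
    and ends: "\<And>j. j \<in> {1..n} \<Longrightarrow> z j 0 = base_point n j \<and> z j 1 = base_point n j"
      "\<And>j. j \<in> {1..n} \<Longrightarrow> w j 0 = base_point n j \<and> w j 1 = base_point n j"
  obtains z' w' where "pure_braid n z'" "pure_braid n w'" "pure_braid n (braid_concat z' w')"
    "homotopic_paths (Conf n) (cpath n z) (cpath n z')" "homotopic_paths (Conf n) (cpath n w) (cpath n w')"
proof -
  let ?b = "base_point n"
  define r where "r = braid_concat z w"
  have r1: "r j (t / 2) = z j t" if "t \<in> {0..1}" for j t
    using that by (simp add: r_def braid_concat_def joinpaths_def)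
  \<comment> \<open>At t = 0 the join still reads the end of the first half, which is the base point
    as well.\<close>
  have r2: "r j (t / 2 + 1 / 2) = w j t" if "j \<in> {1..n}" "t \<in> {0..1}" for j t
    using that ends by (cases "t = 0") (simp_all add: r_def braid_concat_def joinpaths_def)
  have rc: "continuous_on {0..1} (r j)" if "j \<in> {1..n}" for j
    unfolding r_def braid_concat_def
    by (rule path_join_imp[unfolded path_def]) (use cont ends that in \<open>simp_all add: pathstart_def pathfinish_def\<close>)
  have re: "r j 0 = ?b j" "r j 1 = ?b j" "r j (1 / 2) = ?b j" if "j \<in> {1..n}" for j
    using r1[of 0 j] r1[of 1 j] r2[OF that, of 1] ends that by simp_all
  have ri: "inj_on (\<lambda>j. r j t) {1..n}" if t: "t \<in> {0..1}" for t
  proof (cases "t \<le> 1 / 2")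
    case True
    then show ?thesis using inj(1)[of "2 * t"] t by (simp add: r_def braid_concat_def joinpaths_def)
  next
    case False
    then show ?thesis using inj(2)[of "2 * t - 1"] t by (simp add: r_def braid_concat_def joinpaths_def)
  qed
  obtain d where d: "d > 0" "\<And>t j k. t \<in> {0..1} \<Longrightarrow> j \<in> {1..n} \<Longrightarrow> k \<in> {1..n} \<Longrightarrow> j \<noteq> k \<Longrightarrow> d \<le> dist (r j t) (r k t)"
    using strands_separated[of n r, OF rc ri] by blast
  have "\<forall>j\<in>{1..n}. \<exists>v. polynomial_function v \<and> v 0 = ?b j \<and> v 1 = ?b j \<and> v (1 / 2) = ?b j \<and> (\<forall>t\<in>{0..1}. dist (v t) (r j t) < d / 2)"
  proof
    fix j assume j: "j \<in> {1..n}"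
    have e4: "0 < d / 4" using d(1) by simp
    have "path (r j)" using rc[OF j] by (simp add: path_def)
    then obtain g where g: "polynomial_function g" "pathstart g = pathstart (r j)" "pathfinish g = pathfinish (r j)"
      "\<And>t. t \<in> {0..1} \<Longrightarrow> norm (g t - r j t) < d / 4"
      using path_approx_polynomial_function[OF _ e4] by blast
    define v where "v t = g t + (4 * t * (1 - t)) *\<^sub>R (?b j - g (1 / 2))" for t
    have "polynomial_function v"
      unfolding v_def
      by (intro polynomial_function_add polynomial_function_mult polynomial_function_diff polynomial_function_const polynomial_function_id g(1)
          polynomial_function_mult[where 'b = real, unfolded real_scaleR_def])
    moreover have "v 0 = ?b j" "v 1 = ?b j" "v (1 / 2) = ?b j"
      using g(2,3) re[OF j] by (simp_all add: v_def pathstart_def pathfinish_def)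
    moreover have "dist (v t) (r j t) < d / 2" if t: "t \<in> {0..1}" for t
    proof -
      have "0 \<le> (2 * t - 1)\<^sup>2" by (rule zero_le_power2)
      then have "4 * t * (1 - t) \<le> 1" by (simp add: power2_eq_square algebra_simps)
      moreover have "0 \<le> 4 * t * (1 - t)" using t by simp
      ultimately have "norm ((4 * t * (1 - t)) *\<^sub>R (?b j - g (1 / 2))) \<le> norm (?b j - g (1 / 2))"
        unfolding norm_scaleR by (intro mult_left_le_one_le) simp_all
      also have "\<dots> < d / 4" using g(4)[of "1 / 2"] re(3)[OF j] by (simp add: norm_minus_commute)
      finally have n: "norm ((4 * t * (1 - t)) *\<^sub>R (?b j - g (1 / 2))) < d / 4" .
      have e: "v t - r j t = (g t - r j t) + (4 * t * (1 - t)) *\<^sub>R (?b j - g (1 / 2))" by (simp add: v_def)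
      show ?thesis
        unfolding dist_norm e
        by (rule le_less_trans[OF norm_triangle_ineq]) (use n g(4)[OF t] in linarith)
    qed
    ultimately show "\<exists>v. polynomial_function v \<and> v 0 = ?b j \<and> v 1 = ?b j \<and> v (1 / 2) = ?b j \<and> (\<forall>t\<in>{0..1}. dist (v t) (r j t) < d / 2)"
      by (intro exI[of _ v] conjI ballI)
  qed
  then obtain v where v0: "\<forall>j\<in>{1..n}. polynomial_function (v j) \<and> v j 0 = ?b j \<and> v j 1 = ?b j \<and> v j (1 / 2) = ?b j \<and> (\<forall>t\<in>{0..1}. dist (v j t) (r j t) < d / 2)"
    unfolding bchoice_iff by (elim exE)
  note v = bspec[OF v0]
  have vs: "smooth_on_unit (v j)" if "j \<in> {1..n}" for j
    by (rule smooth_on_unit_polynomial_function) (use v[OF that] in simp)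
  have vi: "inj_on (\<lambda>j. v j t) {1..n}" if "t \<in> {0..1}" for t
    by (rule homotopic_strands_near(2)[of n r v d, OF rc smooth_on_unit_velocity(2)[OF vs] d(2) _ _ that]) (use v re in simp_all)
  have pv: "pure_braid n v"
    unfolding pure_braid_def using vs vi v by simp
  define z' where "z' j t = v j (t / 2)" for j t
  define w' where "w' j t = v j (t / 2 + 1 / 2)" for j t
  have half: "(\<lambda>t::real. t / 2) = (\<lambda>t. (1 / 2) *\<^sub>R t)" "(\<lambda>t::real. t / 2 + 1 / 2) = (\<lambda>t. (1 / 2) *\<^sub>R t + 1 / 2)"
    by (simp_all add: fun_eq_iff)
  have lin: "polynomial_function (\<lambda>t::real. t / 2)" "polynomial_function (\<lambda>t::real. t / 2 + 1 / 2)"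
    unfolding half by (intro polynomial_function_add polynomial_function_cmul polynomial_function_id polynomial_function_const)+
  have zs: "smooth_on_unit (z' j)" "smooth_on_unit (w' j)" if "j \<in> {1..n}" for j
  proof -
    have "z' j = v j \<circ> (\<lambda>t. t / 2)" "w' j = v j \<circ> (\<lambda>t. t / 2 + 1 / 2)" by (simp_all add: fun_eq_iff z'_def w'_def)
    then show "smooth_on_unit (z' j)" "smooth_on_unit (w' j)"
      using smooth_on_unit_polynomial_function polynomial_function_compose lin conjunct1[OF v[OF that]] by metis+
  qed
  have z01: "z' j 0 = ?b j" "z' j 1 = ?b j" "w' j 0 = ?b j" "w' j 1 = ?b j" if "j \<in> {1..n}" for j
    using v[OF that] by (simp_all add: z'_def w'_def)
  have hz: "homotopic_paths (Conf n) (cpath n z) (cpath n z')"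
  proof (rule homotopic_strands_near(1)[where d = d])
    fix j assume j: "j \<in> {1..n}"
    show "continuous_on {0..1} (z j)" by (rule cont(1)[OF j])
    show "continuous_on {0..1} (z' j)" by (rule smooth_on_unit_velocity(2)[OF zs(1)[OF j]])
    show "z' j 0 = z j 0 \<and> z' j 1 = z j 1" using z01(1,2)[OF j] ends(1)[OF j] by simp
    fix t :: real assume t: "t \<in> {0..1}"
    have t2: "t / 2 \<in> {0..1}" using t by simp
    show "dist (z' j t) (z j t) < d / 2"
      unfolding z'_def r1[OF t, of j, symmetric] using v[OF j] t2 by blast
    show "d \<le> dist (z j t) (z k t)" if "k \<in> {1..n}" "j \<noteq> k" for k
      unfolding r1[OF t, symmetric] by (rule d(2)[OF t2 j that])
  qed
  have hw: "homotopic_paths (Conf n) (cpath n w) (cpath n w')"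
  proof (rule homotopic_strands_near(1)[where d = d])
    fix j assume j: "j \<in> {1..n}"
    show "continuous_on {0..1} (w j)" by (rule cont(2)[OF j])
    show "continuous_on {0..1} (w' j)" by (rule smooth_on_unit_velocity(2)[OF zs(2)[OF j]])
    show "w' j 0 = w j 0 \<and> w' j 1 = w j 1" using z01(3,4)[OF j] ends(2)[OF j] by simp
    fix t :: real assume t: "t \<in> {0..1}"
    have t2: "t / 2 + 1 / 2 \<in> {0..1}" using t by simp
    show "dist (w' j t) (w j t) < d / 2"
      unfolding w'_def r2[OF j t, symmetric] using v[OF j] t2 by blast
    show "d \<le> dist (w j t) (w k t)" if "k \<in> {1..n}" "j \<noteq> k" for k
      unfolding r2[OF j t, symmetric] r2[OF that(1) t, symmetric] by (rule d(2)[OF t2 j that])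
  qed
  have "inj_on (\<lambda>j. z' j t) {1..n}" "inj_on (\<lambda>j. w' j t) {1..n}" if t: "t \<in> {0..1}" for t
    unfolding z'_def w'_def by (rule vi; use t in simp)+
  then have "pure_braid n z'" "pure_braid n w'"
    unfolding pure_braid_def using zs z01 by blast+
  moreover have "braid_concat z' w' = v"
  proof (intro ext)
    fix j and t :: real
    have e: "(2 * t - 1) / 2 + 1 / 2 = t" by (simp add: field_simps)
    show "braid_concat z' w' j t = v j t"
      unfolding braid_concat_def joinpaths_def z'_def w'_def e by simp
  qed
  ultimately show ?thesis using pv hz hw by (intro that) simp_all
qed

section \<open>Loops in the configuration space\<close>

definition base_conf :: "nat \<Rightarrow> nat \<Rightarrow> complex" where
  "base_conf n j = (if j \<in> {1..n} then base_point n j else 0)"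

definition conf_loop :: "nat \<Rightarrow> (real \<Rightarrow> nat \<Rightarrow> complex) \<Rightarrow> bool" where
  "conf_loop n p \<longleftrightarrow> path p \<and> path_image p \<subseteq> Conf n \<and> pathstart p = base_conf n \<and> pathfinish p = base_conf n"

text \<open>Elements of \<open>PB n\<close> are described by arbitrary continuous loops. The group
  laws then come from path homotopies, whose joins and reverses need not be smooth.\<close>

definition loop_class :: "nat \<Rightarrow> (real \<Rightarrow> nat \<Rightarrow> complex) \<Rightarrow> strands set" where
  "loop_class n p = {u. pure_braid n u \<and> homotopic_paths (Conf n) p (cpath n u)}"

lemma loop_class_eqI: "homotopic_paths (Conf n) p q \<Longrightarrow> loop_class n p = loop_class n q"
  unfolding loop_class_def using homotopic_paths_trans homotopic_paths_sym by blast

lemma conf_loop_join: "conf_loop n p \<Longrightarrow> conf_loop n q \<Longrightarrow> conf_loop n (p +++ q)"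
  unfolding conf_loop_def by (auto intro: path_join_imp dest: subsetD[OF path_image_join_subset])

lemma conf_loop_reverse: "conf_loop n p \<Longrightarrow> conf_loop n (reversepath p)"
  unfolding conf_loop_def by simp

lemma conf_loop_cpath:
  assumes "pure_braid n z"
  shows "conf_loop n (cpath n z)"
proof -
  have "path (cpath n z)"
    unfolding path_def cpath_def by (intro continuous_on_configuration pure_braidD(5)[OF assms])
  moreover have "cpath n z t \<in> Conf n" if "t \<in> {0..1}" for t
    using inj_on_cong[THEN iffD1, OF _ pure_braidD(4)[OF assms that], of "cpath n z t"] by (simp add: Conf_def cpath_def)
  ultimately show ?thesis
    using pure_braidD(2,3)[OF assms]
    by (auto simp: conf_loop_def path_image_def pathstart_def pathfinish_def cpath_def base_conf_def fun_eq_iff)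
qed

lemma pure_braid_const: "pure_braid n (\<lambda>j t. base_point n j)"
proof -
  have "smooth_on_unit (\<lambda>t. base_point n j)" for j
    by (intro smooth_on_unit_polynomial_function polynomial_function_const)
  moreover have "inj_on (base_point n) {1..n}" by (rule inj_onI) (rule base_point_inj)
  ultimately show ?thesis
    by (simp add: pure_braid_def)
qed

lemma cpath_const: "cpath n (\<lambda>j t. base_point n j) = (\<lambda>t. base_conf n)"
  by (simp add: cpath_def base_conf_def fun_eq_iff)

lemma conf_loop_const: "conf_loop n (\<lambda>t. base_conf n)"
  using conf_loop_cpath[OF pure_braid_const] by (simp add: cpath_const)

lemma braid_class_eq_loop_class: "pure_braid n z \<Longrightarrow> braid_class n z = loop_class n (cpath n z)"
  unfolding braid_class_def loop_class_def using isotopic_iff_homotopic by blast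

lemma cpath_braid_concat: "cpath n (braid_concat z w) = cpath n z +++ cpath n w"
  by (auto simp: cpath_def braid_concat_def joinpaths_def fun_eq_iff)

lemma homotopic_cpath:
  assumes "conf_loop n p"
  shows "homotopic_paths (Conf n) p (cpath n (\<lambda>j t. p t j))"
proof (rule homotopic_paths_eq)
  fix t :: real assume "t \<in> {0..1}"
  then have "p t \<in> Conf n" using assms by (auto simp: conf_loop_def path_image_def)
  then show "p t = cpath n (\<lambda>j t. p t j) t" by (auto simp: Conf_def cpath_def)
qed (use assms in \<open>simp_all add: conf_loop_def\<close>)

text \<open>Both braids are produced together because the product of \<open>PB\<close> asks for
  representatives whose concatenation is again smooth.\<close>

lemma conf_loop_approximation:
  assumes p: "conf_loop n p" and q: "conf_loop n q"
  obtains z w where "pure_braid n z" "pure_braid n w" "pure_braid n (braid_concat z w)"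
    "homotopic_paths (Conf n) p (cpath n z)" "homotopic_paths (Conf n) q (cpath n w)"
proof -
  have *: "continuous_on {0..1} (\<lambda>t. p t j)" "t \<in> {0..1} \<Longrightarrow> inj_on (\<lambda>j. p t j) {1..n}"
      "j \<in> {1..n} \<Longrightarrow> p 0 j = base_point n j \<and> p 1 j = base_point n j" if "conf_loop n p" for p j t
  proof -
    show "continuous_on {0..1} (\<lambda>t. p t j)"
      by (rule continuous_on_product_then_coordinatewise) (use that in \<open>simp add: conf_loop_def path_def\<close>)
    show "inj_on (\<lambda>j. p t j) {1..n}" if "t \<in> {0..1}"
    proof -
      have "p t \<in> Conf n" using \<open>conf_loop n p\<close> that by (auto simp: conf_loop_def path_image_def)
      then show ?thesis by (simp add: Conf_def)
    qed
    show "p 0 j = base_point n j \<and> p 1 j = base_point n j" if "j \<in> {1..n}"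
      using \<open>conf_loop n p\<close> that by (simp add: conf_loop_def pathstart_def pathfinish_def base_conf_def)
  qed
  show ?thesis
  proof (rule braid_approximation[of n "\<lambda>j t. p t j" "\<lambda>j t. q t j"])
    fix z w assume z: "pure_braid n z" "homotopic_paths (Conf n) (cpath n (\<lambda>j t. p t j)) (cpath n z)"
      and w: "pure_braid n w" "homotopic_paths (Conf n) (cpath n (\<lambda>j t. q t j)) (cpath n w)"
      and zw: "pure_braid n (braid_concat z w)"
    show thesis
      by (rule that[OF z(1) w(1) zw homotopic_paths_trans[OF homotopic_cpath[OF p] z(2)] homotopic_paths_trans[OF homotopic_cpath[OF q] w(2)]])
  next
    fix j assume j: "j \<in> {1..n}"
    show "continuous_on {0..1} (\<lambda>t. p t j)" "continuous_on {0..1} (\<lambda>t. q t j)" by (rule *(1)[OF p], rule *(1)[OF q])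
    show "p 0 j = base_point n j \<and> p 1 j = base_point n j" by (rule *(3)[OF p j])
    show "q 0 j = base_point n j \<and> q 1 j = base_point n j" by (rule *(3)[OF q j])
  next
    fix t :: real assume t: "t \<in> {0..1}"
    show "inj_on (\<lambda>j. p t j) {1..n}" by (rule *(2)[OF p t])
    show "inj_on (\<lambda>j. q t j) {1..n}" by (rule *(2)[OF q t])
  qed
qed

lemma PB_carrier: "carrier (PB n) = loop_class n ` {p. conf_loop n p}"
proof -
  have "carrier (PB n) = (\<lambda>z. loop_class n (cpath n z)) ` {z. pure_braid n z}"
    unfolding PB_def by (simp add: braid_class_eq_loop_class cong: image_cong_simp)
  also have "\<dots> = loop_class n ` {p. conf_loop n p}"
  proof (intro equalityI subsetI)
    fix X assume "X \<in> loop_class n ` {p. conf_loop n p}"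
    then obtain p where p: "conf_loop n p" "X = loop_class n p" by blast
    obtain z where "pure_braid n z" "homotopic_paths (Conf n) p (cpath n z)"
      by (rule conf_loop_approximation[OF p(1) p(1)])
    then show "X \<in> (\<lambda>z. loop_class n (cpath n z)) ` {z. pure_braid n z}"
      using loop_class_eqI p(2) by blast
  qed (use conf_loop_cpath in blast)
  finally show ?thesis .
qed

lemma PB_one: "\<one>\<^bsub>PB n\<^esub> = loop_class n (\<lambda>t. base_conf n)"
  by (simp add: PB_def braid_class_eq_loop_class[OF pure_braid_const] cpath_const)

text \<open>Joins respect homotopy, so all admissible pairs of representatives yield the same class,
  and \<open>conf_loop_approximation\<close> provides an admissible pair.\<close>

lemma PB_mult:
  assumes p: "conf_loop n p" and q: "conf_loop n q"
  shows "loop_class n p \<otimes>\<^bsub>PB n\<^esub> loop_class n q = loop_class n (p +++ q)"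
proof -
  have pq: "pathfinish p = pathstart q" using p q by (simp add: conf_loop_def)
  have eq: "braid_class n (braid_concat z w) = loop_class n (p +++ q)"
    if "z \<in> loop_class n p" "w \<in> loop_class n q" "pure_braid n (braid_concat z w)" for z w
    unfolding braid_class_eq_loop_class[OF that(3)] cpath_braid_concat
    by (rule loop_class_eqI[symmetric], rule homotopic_paths_join) (use that(1,2) pq in \<open>simp_all add: loop_class_def\<close>)
  obtain z w where "pure_braid n z" "pure_braid n w" "pure_braid n (braid_concat z w)"
    "homotopic_paths (Conf n) p (cpath n z)" "homotopic_paths (Conf n) q (cpath n w)"
    by (rule conf_loop_approximation[OF p q])
  then have zw: "z \<in> loop_class n p" "w \<in> loop_class n q" "pure_braid n (braid_concat z w)"
    by (simp_all add: loop_class_def)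
  have "loop_class n p \<otimes>\<^bsub>PB n\<^esub> loop_class n q = {v. \<exists>z\<in>loop_class n p. \<exists>w\<in>loop_class n q. pure_braid n (braid_concat z w) \<and>
      v \<in> braid_class n (braid_concat z w)}"
    by (simp add: PB_def)
  also have "\<dots> = loop_class n (p +++ q)"
    using eq zw by blast
  finally show ?thesis .
qed

text \<open>The unit and inverse laws are images of the same laws for the path \<open>linepath 0 1\<close> of the
  unit interval, because the library states them for normed spaces only.\<close>

lemma path_compose_linepath:
  "p \<circ> linepath 0 1 = p" "p \<circ> linepath c c = (\<lambda>t. p c)" for p :: "real \<Rightarrow> 'a::topological_space"
  by (simp_all add: fun_eq_iff linepath_def algebra_simps)

lemma homotopic_paths_const_left:
  fixes p :: "real \<Rightarrow> 'a::topological_space"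
  assumes "path p" "path_image p \<subseteq> S"
  shows "homotopic_paths S ((\<lambda>t. pathstart p) +++ p) p"
proof -
  have "homotopic_paths {0..1} (linepath 0 0 +++ linepath 0 1) (linepath 0 (1::real))"
    using homotopic_paths_lid[of "linepath 0 (1::real)" "{0..1}"] by (simp add: closed_segment_eq_real_ivl)
  then have "homotopic_paths S (p \<circ> (linepath 0 0 +++ linepath 0 1)) (p \<circ> linepath 0 1)"
    by (rule homotopic_paths_continuous_image) (use assms in \<open>auto simp: path_def path_image_def\<close>)
  then show ?thesis by (simp add: path_compose_join path_compose_linepath pathstart_def)
qed

lemma homotopic_paths_reverse_left:
  fixes p :: "real \<Rightarrow> 'a::topological_space"
  assumes "path p" "path_image p \<subseteq> S"
  shows "homotopic_paths S (reversepath p +++ p) (\<lambda>t. pathfinish p)"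
proof -
  have "homotopic_paths {0..1} (reversepath (linepath 0 1) +++ linepath 0 1) (linepath 1 (1::real))"
    using homotopic_paths_linv[of "linepath 0 (1::real)" "{0..1}"] by (simp add: closed_segment_eq_real_ivl del: reversepath_linepath)
  then have "homotopic_paths S (p \<circ> (reversepath (linepath 0 1) +++ linepath 0 1)) (p \<circ> linepath 1 1)"
    by (rule homotopic_paths_continuous_image) (use assms in \<open>auto simp: path_def path_image_def\<close>)
  then show ?thesis
    by (simp add: path_compose_join path_compose_reversepath path_compose_linepath pathfinish_def del: reversepath_linepath)
qed

lemma PB_group: "group (PB n)"
proof (rule groupI)
  fix X Y Z assume XY: "X \<in> carrier (PB n)" "Y \<in> carrier (PB n)"
  then obtain p q where pq: "conf_loop n p" "conf_loop n q" "X = loop_class n p" "Y = loop_class n q"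
    unfolding PB_carrier by blast
  show "X \<otimes>\<^bsub>PB n\<^esub> Y \<in> carrier (PB n)"
    using pq conf_loop_join[OF pq(1,2)] by (simp add: PB_mult PB_carrier)
  assume "Z \<in> carrier (PB n)"
  then obtain r where r: "conf_loop n r" "Z = loop_class n r" unfolding PB_carrier by blast
  have "loop_class n ((p +++ q) +++ r) = loop_class n (p +++ (q +++ r))"
    by (rule loop_class_eqI[symmetric], rule homotopic_paths_assoc) (use pq(1,2) r(1) in \<open>simp_all add: conf_loop_def\<close>)
  then show "X \<otimes>\<^bsub>PB n\<^esub> Y \<otimes>\<^bsub>PB n\<^esub> Z = X \<otimes>\<^bsub>PB n\<^esub> (Y \<otimes>\<^bsub>PB n\<^esub> Z)"
    using pq r by (simp add: PB_mult conf_loop_join)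
next
  show "\<one>\<^bsub>PB n\<^esub> \<in> carrier (PB n)" using conf_loop_const by (simp add: PB_carrier PB_one)
next
  fix X assume "X \<in> carrier (PB n)"
  then obtain p where p: "conf_loop n p" "X = loop_class n p" unfolding PB_carrier by blast
  then have p': "path p" "path_image p \<subseteq> Conf n" "pathstart p = base_conf n" "pathfinish p = base_conf n"
    by (simp_all add: conf_loop_def)
  show "\<one>\<^bsub>PB n\<^esub> \<otimes>\<^bsub>PB n\<^esub> X = X"
    unfolding PB_one p(2) PB_mult[OF conf_loop_const p(1)]
    using loop_class_eqI[OF homotopic_paths_const_left[OF p'(1,2)]] by (simp add: p'(3))
  have "loop_class n (reversepath p) \<otimes>\<^bsub>PB n\<^esub> X = \<one>\<^bsub>PB n\<^esub>"
    unfolding PB_one p(2) PB_mult[OF conf_loop_reverse[OF p(1)] p(1)]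
    using loop_class_eqI[OF homotopic_paths_reverse_left[OF p'(1,2)]] by (simp add: p'(4))
  then show "\<exists>Y\<in>carrier (PB n). Y \<otimes>\<^bsub>PB n\<^esub> X = \<one>\<^bsub>PB n\<^esub>"
    using conf_loop_reverse[OF p(1)] unfolding PB_carrier by blast
qed

section \<open>The map \<open>f\<close> and multiplicativity\<close>

text \<open>Homotopy invariance holds for the words in the right regular representation, and
  faithfulness of the latter pulls it back to \<open>G3'\<close>.\<close>

lemma read_off_homotopic:
  assumes v: "regular_path n v" "\<And>t. t \<in> {0..1} \<Longrightarrow> inj_on (\<lambda>j. v j t) {1..n}"
    and w: "regular_path n w" "\<And>t. t \<in> {0..1} \<Longrightarrow> inj_on (\<lambda>j. w j t) {1..n}"
    and "homotopic_paths (Conf n) (cpath n v) (cpath n w)"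
  shows "read_off n v = read_off n w"
proof -
  interpret triple_rep n "right_mult n" by (rule triple_rep_right_mult)
  obtain H :: "real \<Rightarrow> strands" where H0: "\<forall>j\<in>{1..n}. continuous_on ({0..1} \<times> {0..1}) (\<lambda>(s, t). H s j t)"
      "\<forall>s\<in>{0..1}. \<forall>t\<in>{0..1}. inj_on (\<lambda>j. H s j t) {1..n}"
      "\<forall>j\<in>{1..n}. \<forall>t\<in>{0..1}. H 0 j t = v j t \<and> H 1 j t = w j t"
      "\<forall>j\<in>{1..n}. \<forall>s\<in>{0..1}. H s j 0 = v j 0 \<and> H s j 1 = v j 1"
    using assms(5) unfolding homotopic_strands_iff by (elim exE conjE)
  note H = H0[rule_format]
  have eq: "path_word n (right_mult n) v 0 1 = path_word n (right_mult n) w 0 1"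
  proof (rule path_word_homotopy[where H = H and ?e0.0 = "\<lambda>j. v j 0" and ?e1.0 = "\<lambda>j. v j 1"])
    show "generic n (\<lambda>j. v j 0)" "generic n (\<lambda>j. v j 1)" using v(1) by (simp_all add: regular_path_def)
  qed (use H v(1) w(1) in blast)+
  show ?thesis
    by (rule path_word_eq_imp_class_eq)
      (rule eq | rule v(1) | rule w(1) | (rule v(2), assumption) | (rule w(2), assumption))+
qed

lemma good_stableD:
  assumes "good_stable n z"
  shows "pure_braid n z" "regular_path n z" "t \<in> {0..1} \<Longrightarrow> inj_on (\<lambda>j. z j t) {1..n}"
  using assms good_stable_imp_regular[OF assms] pure_braidD(4)[of n z t] by (simp_all add: good_stable_def)

text \<open>A transverse polynomial approximation within half the minimal distance of the strands is
  joined to the braid by a straight-line homotopy, so it stays in the class.\<close>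

lemma good_stable_representative:
  assumes "X \<in> carrier (PB n)"
  obtains z where "z \<in> X" "good_stable n z"
proof -
  obtain p where p: "conf_loop n p" "X = loop_class n p" using assms unfolding PB_carrier by blast
  obtain z where z: "pure_braid n z" "homotopic_paths (Conf n) p (cpath n z)"
    by (rule conf_loop_approximation[OF p(1) p(1)])
  note zD = pure_braidD[OF z(1)]
  obtain d where d: "d > 0" "\<And>t j k. t \<in> {0..1} \<Longrightarrow> j \<in> {1..n} \<Longrightarrow> k \<in> {1..n} \<Longrightarrow> j \<noteq> k \<Longrightarrow> d \<le> dist (z j t) (z k t)"
    using strands_separated[of n z, OF zD(5) zD(4)] by blast
  obtain X' Y' where tr: "transverse {1..n} X' Y'"
    and ends: "\<And>j. j \<in> {1..n} \<Longrightarrow> poly_strands X' Y' j 0 = z j 0 \<and> poly_strands X' Y' j 1 = z j 1"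
    and close: "\<And>j t. j \<in> {1..n} \<Longrightarrow> t \<in> {0..1} \<Longrightarrow> dist (poly_strands X' Y' j t) (z j t) < d / 2"
    by (rule transverse_approximation[of n z "d / 2", OF zD(5) zD(4) zD(6,7)]) (use d(1) in auto)
  have sm: "smooth_on_unit (poly_strands X' Y' j)" for j
    unfolding poly_strands_def by (rule smooth_on_unit_poly)
  note near = homotopic_strands_near[of n z "poly_strands X' Y'" d, OF zD(5) smooth_on_unit_velocity(2)[OF sm] d(2) close ends]
  have pb: "pure_braid n (poly_strands X' Y')"
    unfolding pure_braid_def using sm near(2) ends zD(2,3) by simp
  have "poly_strands X' Y' \<in> X"
    unfolding p(2) loop_class_def using pb homotopic_paths_trans[OF z(2) near(1)] by simp
  then show ?thesis using transverse_imp_good_stable[OF tr pb] by (rule that)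
qed

text \<open>Two good and stable members of a class are homotopic regular paths and hence give the
  same element, so the description in \<open>f_map\<close> denotes.\<close>

lemma f_map_loop_class:
  assumes z: "z \<in> loop_class n p" "good_stable n z"
  shows "f_map n (loop_class n p) = read_off n z"
  unfolding f_map_def
proof (rule the_equality)
  show "\<exists>w\<in>loop_class n p. good_stable n w \<and> read_off n z = read_off n w" using z by blast
  fix g assume "\<exists>w\<in>loop_class n p. good_stable n w \<and> g = read_off n w"
  then obtain w where w: "w \<in> loop_class n p" "good_stable n w" and g: "g = read_off n w" by blast
  have "homotopic_paths (Conf n) (cpath n w) (cpath n z)"
    using z(1) w(1) homotopic_paths_trans homotopic_paths_sym unfolding loop_class_def by blast
  then show "g = read_off n z"
    unfolding g by (intro read_off_homotopic good_stableD[OF w(2)] good_stableD[OF z(2)])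
qed

lemma f_map_braid_class:
  assumes "good_stable n z"
  shows "f_map n (braid_class n z) = read_off n z"
proof -
  note pb = good_stableD(1)[OF assms]
  have "z \<in> loop_class n (cpath n z)"
    using pb conf_loop_cpath[OF pb] by (simp add: loop_class_def conf_loop_def)
  then show ?thesis using f_map_loop_class assms braid_class_eq_loop_class[OF pb] by simp
qed

lemma moment_indices_in_gens:
  assumes "regular_path n z" "\<And>t. t \<in> {0..1} \<Longrightarrow> inj_on (\<lambda>j. z j t) {1..n}"
  shows "set (map (moment_index n z) (sorted_list_of_set (critical_moments n z))) \<subseteq> G3'_gens n"
proof -
  have "moment_index n z t \<in> G3'_gens n" if "t \<in> critical_moments n z" for t
    by (rule moment_index_in_gens[OF assms(1) that assms(2)]) (use that in \<open>simp add: critical_moments_def\<close>)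
  moreover have "finite (critical_moments n z)" using assms(1) by (simp add: regular_path_def)
  ultimately show ?thesis by auto
qed

lemma read_off_closed:
  assumes "regular_path n z" "\<And>t. t \<in> {0..1} \<Longrightarrow> inj_on (\<lambda>j. z j t) {1..n}"
  shows "read_off n z \<in> carrier (G3' n)"
  unfolding read_off_def by (rule G3'_class_closed[OF moment_indices_in_gens[OF assms]])

section \<open>Concatenation and multiplicativity\<close>

lemma collinear_triples_cong: "(\<lambda>j. c j x) = (\<lambda>j. z j t) \<Longrightarrow> collinear_triples n c x = collinear_triples n z t"
  unfolding collinear_triples_def by (simp add: fun_eq_iff)

lemma moment_index_cong:
  assumes "(\<lambda>j. c j x) = (\<lambda>j. z j t)"
  shows "moment_index n c x = moment_index n z t"
proof -
  have "c j x = z j t" for j using fun_cong[OF assms] .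
  then show ?thesis unfolding moment_index_def collinear_triples_cong[of c x z t, OF assms] by (simp only:)
qed

text \<open>The two halves of a concatenation are read at time 2x + b with b = 0 and b = -1. The
  strands are known to agree only for 2x + b inside (0, 1), so the radius is cut down to stay
  there.\<close>

lemma sign_change_rescale:
  fixes c z :: strands
  assumes sc: "sign_change n z t" and t: "0 < t" "t < 1"
    and c: "\<And>x. 0 < 2 * x + b \<Longrightarrow> 2 * x + b < 1 \<Longrightarrow> (\<lambda>j. c j x) = (\<lambda>j. z j (2 * x + b))"
  shows "sign_change n c ((t - b) / 2)"
  unfolding sign_change_def
proof (intro allI impI)
  have e: "2 * ((t - b) / 2) + b = t" by (simp add: field_simps)
  have ct: "(\<lambda>j. c j ((t - b) / 2)) = (\<lambda>j. z j t)" using c[of "(t - b) / 2", unfolded e] t by blast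
  fix i j k assume ijk: "{i, j, k} \<subseteq> {1..n}" "distinct [i, j, k]" "turn (\<lambda>j. c j ((t - b) / 2)) i j k = 0"
  have zt: "turn (\<lambda>j. z j t) i j k = 0" using ijk(3) unfolding ct .
  obtain \<delta> where \<delta>: "\<delta> > 0" and d: "\<forall>u v. 0 \<le> u \<longrightarrow> t - \<delta> < u \<longrightarrow> u < t \<longrightarrow> t < v \<longrightarrow> v < t + \<delta> \<longrightarrow> v \<le> 1 \<longrightarrow>
       turn (\<lambda>j. z j u) i j k * turn (\<lambda>j. z j v) i j k < 0"
    using sc[unfolded sign_change_def, rule_format, OF ijk(1,2) zt] by (elim exE conjE)
  show "\<exists>\<delta>>0. \<forall>u v. 0 \<le> u \<longrightarrow> (t - b) / 2 - \<delta> < u \<longrightarrow> u < (t - b) / 2 \<longrightarrow> (t - b) / 2 < v \<longrightarrow> v < (t - b) / 2 + \<delta> \<longrightarrow> v \<le> 1 \<longrightarrow>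
       turn (\<lambda>j. c j u) i j k * turn (\<lambda>j. c j v) i j k < 0"
  proof (intro exI[of _ "min (\<delta> / 2) (min (t / 2) ((1 - t) / 2))"] conjI allI impI)
    show "0 < min (\<delta> / 2) (min (t / 2) ((1 - t) / 2))" using \<delta> t by simp
    fix u v :: real
    assume *: "(t - b) / 2 - min (\<delta> / 2) (min (t / 2) ((1 - t) / 2)) < u" "u < (t - b) / 2" "(t - b) / 2 < v"
      "v < (t - b) / 2 + min (\<delta> / 2) (min (t / 2) ((1 - t) / 2))"
    have u: "0 < 2 * u + b" "t - \<delta> < 2 * u + b" "2 * u + b < t" and v: "t < 2 * v + b" "2 * v + b < t + \<delta>" "2 * v + b < 1"
      using * t by (auto simp: min_def field_simps split: if_splits)
    have "turn (\<lambda>j. z j (2 * u + b)) i j k * turn (\<lambda>j. z j (2 * v + b)) i j k < 0"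
      by (rule d[rule_format]) (use u v in simp_all)
    moreover have "(\<lambda>j. c j u) = (\<lambda>j. z j (2 * u + b))" "(\<lambda>j. c j v) = (\<lambda>j. z j (2 * v + b))"
      by (rule c; use u v t in simp)+
    ultimately show "turn (\<lambda>j. c j u) i j k * turn (\<lambda>j. c j v) i j k < 0" by simp
  qed
qed

lemma regular_path_critical_interior:
  assumes "regular_path n z" "t \<in> critical_moments n z"
  shows "0 < t" "t < 1"
proof -
  have t: "t \<in> {0..1}" "\<not> generic n (\<lambda>j. z j t)" using assms(2) unfolding critical_moments_iff by blast+
  have "t \<noteq> 0" "t \<noteq> 1" using assms(1) t(2) unfolding regular_path_def by metis+
  then show "0 < t" "t < 1" using t(1) by simp_all
qed

text \<open>The ends are generic, so nothing is critical at the junction. The critical moments of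
  both factors are carried over by increasing maps into separate halves, hence the two lists of
  letters are appended.\<close>

lemma read_off_braid_concat:
  assumes z: "regular_path n z" "\<And>t. t \<in> {0..1} \<Longrightarrow> inj_on (\<lambda>j. z j t) {1..n}"
    and w: "regular_path n w" "\<And>t. t \<in> {0..1} \<Longrightarrow> inj_on (\<lambda>j. w j t) {1..n}"
    and zw: "\<And>j. j \<in> {1..n} \<Longrightarrow> z j 1 = w j 0"
  defines "c \<equiv> braid_concat z w"
  shows "regular_path n c" and "t \<in> {0..1} \<Longrightarrow> inj_on (\<lambda>j. c j t) {1..n}"
    and "read_off n c = read_off n z \<otimes>\<^bsub>G3' n\<^esub> read_off n w"
proof -
  have cz: "(\<lambda>j. c j x) = (\<lambda>j. z j (2 * x))" if "x \<le> 1 / 2" for x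
    using that by (simp add: c_def braid_concat_def joinpaths_def)
  have cw: "(\<lambda>j. c j x) = (\<lambda>j. w j (2 * x - 1))" if "\<not> x \<le> 1 / 2" for x
    using that by (simp add: c_def braid_concat_def joinpaths_def)
  show "inj_on (\<lambda>j. c j t) {1..n}" if "t \<in> {0..1}" for t
  proof (cases "t \<le> 1 / 2")
    case True
    then show ?thesis unfolding cz[OF True] by (intro z(2)) (use that in simp)
  next
    case False
    then show ?thesis unfolding cw[OF False] by (intro w(2)) (use that in simp)
  qed
  let ?A = "critical_moments n z" and ?B = "critical_moments n w"
  let ?f = "\<lambda>t::real. t / 2" and ?g = "\<lambda>t::real. (t + 1) / 2"
  have fin: "finite ?A" "finite ?B" using z(1) w(1) by (simp_all add: regular_path_def)
  have int: "t \<in> ?A \<Longrightarrow> 0 < t \<and> t < 1" "t \<in> ?B \<Longrightarrow> 0 < t \<and> t < 1" for t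
    using regular_path_critical_interior[OF z(1)] regular_path_critical_interior[OF w(1)] by blast+
  have cA: "(\<lambda>j. c j (?f t)) = (\<lambda>j. z j t)" if "t \<in> ?A" for t
    using cz[of "?f t"] int(1)[OF that] by simp
  have cB: "(\<lambda>j. c j (?g t)) = (\<lambda>j. w j t)" if "t \<in> ?B" for t
  proof -
    have e: "2 * ?g t - 1 = t" by (simp add: field_simps)
    have "\<not> ?g t \<le> 1 / 2" using int(2)[OF that] by simp
    from cw[OF this] show ?thesis unfolding e .
  qed
  have mA: "moment_index n c (?f t) = moment_index n z t" if "t \<in> ?A" for t
    by (rule moment_index_cong[of c "?f t" z t]) (rule cA[OF that])
  have mB: "moment_index n c (?g t) = moment_index n w t" if "t \<in> ?B" for t
    by (rule moment_index_cong[of c "?g t" w t]) (rule cB[OF that])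
  have crit: "critical_moments n c = ?f ` ?A \<union> ?g ` ?B"
  proof (intro equalityI subsetI)
    fix x assume "x \<in> critical_moments n c"
    then have x: "x \<in> {0..1}" "\<not> generic n (\<lambda>j. c j x)" unfolding critical_moments_iff by blast+
    show "x \<in> ?f ` ?A \<union> ?g ` ?B"
    proof (cases "x \<le> 1 / 2")
      case True
      have "2 * x \<in> ?A" unfolding critical_moments_iff using x cz[OF True] True by simp
      then show ?thesis by (intro UnI1 image_eqI[of _ _ "2 * x"]) simp_all
    next
      case False
      have "2 * x - 1 \<in> ?B" unfolding critical_moments_iff using x cw[OF False] False by simp
      then show ?thesis by (intro UnI2 image_eqI[of _ _ "2 * x - 1"]) simp_all
    qed
  next
    fix x assume "x \<in> ?f ` ?A \<union> ?g ` ?B"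
    then show "x \<in> critical_moments n c"
    proof (elim UnE imageE)
      fix t assume t: "x = ?f t" "t \<in> ?A"
      then show ?thesis using cA[OF t(2)] int(1)[OF t(2)] unfolding critical_moments_iff t(1) by simp
    next
      fix t assume t: "x = ?g t" "t \<in> ?B"
      then show ?thesis using cB[OF t(2)] int(2)[OF t(2)] unfolding critical_moments_iff t(1) by simp
    qed
  qed
  have crit_ok: "(\<exists>!T. T \<in> collinear_triples n c x) \<and> sign_change n c x" if x: "x \<in> critical_moments n c" for x
    using x[unfolded crit]
  proof (elim UnE imageE)
    fix t assume t: "x = ?f t" "t \<in> ?A"
    have "sign_change n c ((t - 0) / 2)"
      by (rule sign_change_rescale[of n z t 0 c]) (use z(1) t(2) int(1)[OF t(2)] cz in \<open>simp_all add: regular_path_def\<close>)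
    moreover have "\<exists>!T. T \<in> collinear_triples n z t" using z(1) t(2) by (simp add: regular_path_def)
    ultimately show ?thesis unfolding t(1) collinear_triples_cong[of c "?f t" z t, OF cA[OF t(2)]] by simp
  next
    fix t assume t: "x = ?g t" "t \<in> ?B"
    have "sign_change n c ((t - (- 1)) / 2)"
      by (rule sign_change_rescale[of n w t "- 1" c]) (use w(1) t(2) int(2)[OF t(2)] cw in \<open>simp_all add: regular_path_def\<close>)
    moreover have "\<exists>!T. T \<in> collinear_triples n w t" using w(1) t(2) by (simp add: regular_path_def)
    ultimately show ?thesis unfolding t(1) collinear_triples_cong[of c "?g t" w t, OF cB[OF t(2)]] by simp
  qed
  show "regular_path n c"
    unfolding regular_path_def
  proof (intro conjI ballI)
    show "continuous_on {0..1} (c j)" if "j \<in> {1..n}" for j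
      unfolding c_def braid_concat_def
      by (rule path_join_imp[unfolded path_def])
        (use z(1) w(1) zw that in \<open>simp_all add: regular_path_def pathstart_def pathfinish_def\<close>)
    show "generic n (\<lambda>j. c j 0)" "generic n (\<lambda>j. c j 1)"
      using cz[of 0] cw[of 1] z(1) w(1) by (simp_all add: regular_path_def)
    show "finite (critical_moments n c)" unfolding crit using fin by simp
  qed (use crit_ok in \<open>auto\<close>)
  have sl: "sorted_list_of_set (h ` S) = map h (sorted_list_of_set S)" if "finite S" "strict_mono h" for h :: "real \<Rightarrow> real" and S
  proof -
    have "sorted (map h (sorted_list_of_set S))"
      unfolding sorted_map by (simp add: strict_mono_less_eq[OF that(2)])
    moreover have "distinct (map h (sorted_list_of_set S))"
      using strict_mono_imp_inj_on[OF that(2)] by (auto simp: distinct_map intro: inj_on_subset)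
    ultimately have "sorted_list_of_set (set (map h (sorted_list_of_set S))) = map h (sorted_list_of_set S)"
      by (rule sorted_list_of_set.idem_if_sorted_distinct)
    then show ?thesis using that(1) by simp
  qed
  have "sorted_list_of_set (critical_moments n c) = sorted_list_of_set (?f ` ?A) @ sorted_list_of_set (?g ` ?B)"
    unfolding crit by (rule sorted_list_of_set_append) (use fin int in force)+
  also have "\<dots> = map ?f (sorted_list_of_set ?A) @ map ?g (sorted_list_of_set ?B)"
    using fin by (simp add: sl strict_mono_def)
  finally have "map (moment_index n c) (sorted_list_of_set (critical_moments n c)) =
      map (moment_index n z) (sorted_list_of_set ?A) @ map (moment_index n w) (sorted_list_of_set ?B)"
    using mA mB fin by simp
  then show "read_off n c = read_off n z \<otimes>\<^bsub>G3' n\<^esub> read_off n w"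
    unfolding read_off_def
    using G3'_class_mult[OF moment_indices_in_gens[OF z] moment_indices_in_gens[OF w]] by (simp only:)
qed

lemma f_map_closed:
  assumes "X \<in> carrier (PB n)"
  shows "f_map n X \<in> carrier (G3' n)"
proof -
  obtain z where z: "z \<in> X" "good_stable n z" by (rule good_stable_representative[OF assms])
  obtain p where p: "X = loop_class n p" using assms unfolding PB_carrier by blast
  show ?thesis
    using f_map_loop_class z read_off_closed good_stableD(2,3)[OF z(2)] unfolding p by simp
qed

text \<open>A concatenation of good and stable representatives need not be smooth and so need not
  belong to the product class. It is still a regular path homotopic to a good and stable
  representative of that class, and \<open>read_off_homotopic\<close> compares the two.\<close>

lemma f_map_mult:
  assumes X: "X \<in> carrier (PB n)" and Y: "Y \<in> carrier (PB n)"
  shows "f_map n (X \<otimes>\<^bsub>PB n\<^esub> Y) = f_map n X \<otimes>\<^bsub>G3' n\<^esub> f_map n Y"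
proof -
  obtain p q where p: "conf_loop n p" "X = loop_class n p" and q: "conf_loop n q" "Y = loop_class n q"
    using X Y unfolding PB_carrier by blast
  have XY: "X \<otimes>\<^bsub>PB n\<^esub> Y = loop_class n (p +++ q)" unfolding p(2) q(2) by (rule PB_mult[OF p(1) q(1)])
  have "X \<otimes>\<^bsub>PB n\<^esub> Y \<in> carrier (PB n)" unfolding XY PB_carrier using conf_loop_join[OF p(1) q(1)] by blast
  then obtain u where u: "u \<in> loop_class n (p +++ q)" "good_stable n u"
    unfolding XY by (rule good_stable_representative)
  obtain z where z: "z \<in> X" "good_stable n z" by (rule good_stable_representative[OF X])
  obtain w where w: "w \<in> Y" "good_stable n w" by (rule good_stable_representative[OF Y])
  note zD = good_stableD[OF z(2)] and wD = good_stableD[OF w(2)]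
  have e: "z j 1 = w j 0" if "j \<in> {1..n}" for j
    using pure_braidD(3)[OF zD(1) that] pure_braidD(2)[OF wD(1) that] by simp
  note concat = read_off_braid_concat[OF zD(2,3) wD(2,3) e]
  have "homotopic_paths (Conf n) (p +++ q) (cpath n z +++ cpath n w)"
    by (rule homotopic_paths_join) (use p q z(1) w(1) in \<open>simp_all add: loop_class_def conf_loop_def\<close>)
  then have "homotopic_paths (Conf n) (cpath n u) (cpath n (braid_concat z w))"
    using u(1) homotopic_paths_trans homotopic_paths_sym unfolding loop_class_def cpath_braid_concat by blast
  then have "read_off n u = read_off n (braid_concat z w)"
    by (intro read_off_homotopic good_stableD[OF u(2)] concat(1,2))
  also have "\<dots> = read_off n z \<otimes>\<^bsub>G3' n\<^esub> read_off n w" by (rule concat(3))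
  finally have r: "read_off n u = read_off n z \<otimes>\<^bsub>G3' n\<^esub> read_off n w" .
  show ?thesis
    unfolding XY using r f_map_loop_class[OF u] f_map_loop_class[of z n p] f_map_loop_class[of w n q] z w
    by (simp add: p(2) q(2))
qed

theorem corollary1:
  fixes n :: nat
  assumes "n \<ge> 3"
  shows "(\<forall>X\<in>carrier (PB n). \<exists>z\<in>X. good_stable n z) \<and>
         (\<forall>z. good_stable n z \<longrightarrow> f_map n (braid_class n z) = read_off n z) \<and>
         phi n \<in> hom (G3' n) (G2_pairs n) \<and> phi_on_gens n (phi n) \<and>
         group_hom (PB n) (G2_pairs n) (Phi n)"
proof (intro conjI ballI allI impI)
  show "\<exists>z\<in>X. good_stable n z" if "X \<in> carrier (PB n)" for X
    using good_stable_representative[OF that] by blast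
  show "f_map n (braid_class n z) = read_off n z" if "good_stable n z" for z
    by (rule f_map_braid_class[OF that])
  show phi: "phi n \<in> hom (G3' n) (G2_pairs n)" and "phi_on_gens n (phi n)"
    using phi_props[of n] by simp_all
  have "Phi n \<in> hom (PB n) (G2_pairs n)"
    unfolding Phi_def
    by (rule homI) (simp_all add: f_map_closed f_map_mult hom_in_carrier[OF phi] hom_mult[OF phi])
  then show "group_hom (PB n) (G2_pairs n) (Phi n)"
    by (intro group_hom.intro group_hom_axioms.intro PB_group G2_group)
qed

end
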